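(* Let $N\ge1$ be an odd integer and $n\ge2$ an integer. Let $\boldsymbol{k}$ be a field whose characteristic does not divide $2nN$, and suppose that there is a primitive $4nN$-th root of unity in $\boldsymbol{k}$. (1) If $n$ is even, then the representation rings of $A_{Nn}$ and $\boldsymbol{k}[G_{Nn}]$ are isomorphic as rings with $\ast$-structure, and both of them are isomorphic to the commutative ring generated by $a,b,c,x_1,\dots,x_{n-1}$ subject to the commutativity relations and the relations $$a^2=b^2=c^N=1,\quad ax_i=x_i,\quad bx_i=x_{n-i}\quad(i=1,\dots,n-1),$$ $$x_ix_j=c^{\frac{1-(-1)^{ij}}2}(x_{|i-j|}+x_{i+j})\quad(i,j=1,\dots,n-1),$$ where the indices of $x$ on the right-hand side of the last relation are treated under the rules $x_0=1+a$, $x_n=b(1+a)$, $x_{n+i}=x_{n-i}$ $(i=1,\dots,n-1)$. The $\ast$-structure is given by $a^\ast=a$, $b^\ast=b$, $c^\ast=c^{-1}$, $x_i^\ast=c^{\frac{(-1)^i-1}2}x_i$ $(i=1,\dots,n-1)$. (2) If $n$ is odd, then the representation rings of $A_{Nn}$ and $\boldsymbol{k}[G_{Nn}]$ are isomorphic as rings with $\ast$-structure, and both of them are isomorphic to the commutative ring generated by $a,b,x_1,\dots,x_{n-1}$ subject to the commutativity relations and the relations $$a^2=b^{2N}=1,\quad ax_i=x_i\ (i=1,\dots,n-1),\quad bx_i=x_{n-i}\ (i=2,4,\dots,n-1),$$ $$x_ix_j=b^{1-(-1)^{ij}}(x_{|i-j|}+x_{i+j})\quad(i,j=1,\dots,n-1),$$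 where the indices of $x$ on the right-hand side of the last relation are treated under the rules $x_0=1+a$, $x_n=b(1+a)$, $x_{n+i}=x_{n-i}$ $(i=1,\dots,n-1)$. The $\ast$-structure is given by $a^\ast=a$, $b^\ast=b^{-1}$, $x_i^\ast=b^{(-1)^i-1}x_i$ $(i=1,\dots,n-1)$.
   Context: For $N\ge 1$, $n\ge 2$ and $\nu,\lambda=\pm1$, Suzuki's Hopf algebra $A_{Nn}^{\nu\lambda}$ is the $\boldsymbol{k}$-algebra generated by $x_{11},x_{12},x_{21},x_{22}$ with relations $x_{11}^2=x_{22}^2$, $x_{12}^2=x_{21}^2$, $x_{ij}x_{lm}=0$ whenever $i-j\not\equiv l-m\pmod 2$, $x_{11}^{2N}+\nu x_{12}^{2N}=1$, $\underbrace{x_{11}x_{22}x_{11}\cdots}_{n}=\underbrace{x_{22}x_{11}x_{22}\cdots}_{n}$, $\underbrace{x_{21}x_{12}x_{21}\cdots}_{n}=\lambda\underbrace{x_{12}x_{21}x_{12}\cdots}_{n}$ (alternating words of length $n$), with $\Delta(x_{ij})=x_{i1}\otimes x_{1j}+x_{i2}\otimes x_{2j}$, $\varepsilon(x_{ij})=\delta_{ij}$, $S(x_{ij})=x_{ji}^{2N-1}$. It has dimension $4nN$ and is semisimple here. For $N$ odd, $A_{Nn}:=A_{Nn}^{++}$ ($\nu=\lambda=1$) if $n$ is odd, and $A_{Nn}:=A_{Nn}^{+-}$ ($\nu=1,\lambda=-1$) if $n$ is even. The group $G_{Nn}$, of order $4nN$, is $$G_{Nn}=\langle h,t,w\mid t^2=h^{2N}=1,\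 w^n=h^N,\ tw=w^{-1}t,\ ht=th,\ hw=wh\rangle,$$ and $\boldsymbol{k}[G_{Nn}]$ is its group Hopf algebra. The representation ring $\mathrm{Rep}(A)$ of a finite-dimensional semisimple Hopf algebra $A$ is the Grothendieck group of the semiring of isomorphism classes $[V]$ of finite-dimensional left $A$-modules with $[V]+[W]=[V\oplus W]$ and $[V][W]=[V\otimes W]$, together with the ring anti-homomorphism $\ast:\mathrm{Rep}(A)\to\mathrm{Rep}(A)$, $[V]\mapsto[V^\ast]$, where $V^\ast$ is the dual module defined via the antipode. *)

theory Defs
  imports
    "HOL-Algebra.QuotRing"
    "HOL-Library.Poly_Mapping"
    "HOL-Library.Multiset"
    "HOL-Library.Product_Plus"
    "HOL-Number_Theory.Cong"
    "Jordan_Normal_Form.Matrix"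
begin

hide_const (open) Multiset.mult

section \<open>Maps induced on quotients\<close>

text \<open>
  The value at a class \<open>X\<close> of the map induced by \<open>f\<close>. Through \<^const>\<open>the_elem\<close> it is
  specified only if \<open>f\<close> is constant on \<open>X\<close>.
\<close>

definition induced :: "('a \<Rightarrow> 'b) \<Rightarrow> 'a set \<Rightarrow> 'b" where
  "induced f X = the_elem (f ` X)"

definition induced2 :: "('a \<Rightarrow> 'b \<Rightarrow> 'c) \<Rightarrow> 'a set \<Rightarrow> 'b set \<Rightarrow> 'c" where
  "induced2 f X Y = the_elem ((\<lambda>(x, y). f x y) ` (X \<times> Y))"


section \<open>Hopf algebras and tensor squares\<close>

text \<open>
  The scalars are the type \<open>'k\<close>. A tensor in \<open>A \<otimes> A\<close> is a class of formal linear
  combinations of pairs of elements of \<open>A\<close> modulo the bilinearity relations; the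
  comultiplication takes such classes as values.
\<close>

record (overloaded) ('k::zero, 'a) hopf_algebra = "('k, 'a) module" +
  comult :: "'a \<Rightarrow> ('a \<times> 'a \<Rightarrow>\<^sub>0 'k) set"
  counit :: "'a \<Rightarrow> 'k"
  antipode :: "'a \<Rightarrow> 'a"

abbreviation fscale :: "'k::comm_ring_1 \<Rightarrow> ('x \<Rightarrow>\<^sub>0 'k) \<Rightarrow> ('x \<Rightarrow>\<^sub>0 'k)" where
  "fscale c f \<equiv> Poly_Mapping.map ((*) c) f"

abbreviation ptensor :: "'a \<Rightarrow> 'b \<Rightarrow> ('a \<times> 'b \<Rightarrow>\<^sub>0 'k::comm_ring_1)" where
  "ptensor a b \<equiv> Poly_Mapping.single (a, b) 1"

inductive_set tensor_null ::
    "('k::comm_ring_1, 'a, 'm) module_scheme \<Rightarrow> ('a \<times> 'a \<Rightarrow>\<^sub>0 'k) set"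
  for A :: "('k, 'a, 'm) module_scheme" where
  zero: "0 \<in> tensor_null A"
| plus: "\<lbrakk>s \<in> tensor_null A; t \<in> tensor_null A\<rbrakk> \<Longrightarrow> s + t \<in> tensor_null A"
| scale: "t \<in> tensor_null A \<Longrightarrow> fscale c t \<in> tensor_null A"
| add_left: "\<lbrakk>a \<in> carrier A; a' \<in> carrier A; b \<in> carrier A\<rbrakk>
    \<Longrightarrow> ptensor (a \<oplus>\<^bsub>A\<^esub> a') b - ptensor a b - ptensor a' b \<in> tensor_null A"
| add_right: "\<lbrakk>a \<in> carrier A; b \<in> carrier A; b' \<in> carrier A\<rbrakk>
    \<Longrightarrow> ptensor a (b \<oplus>\<^bsub>A\<^esub> b') - ptensor a b - ptensor a b' \<in> tensor_null A"
| smult_left: "\<lbrakk>a \<in> carrier A; b \<in> carrier A\<rbrakk>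
    \<Longrightarrow> ptensor (c \<odot>\<^bsub>A\<^esub> a) b - fscale c (ptensor a b) \<in> tensor_null A"
| smult_right: "\<lbrakk>a \<in> carrier A; b \<in> carrier A\<rbrakk>
    \<Longrightarrow> ptensor a (c \<odot>\<^bsub>A\<^esub> b) - fscale c (ptensor a b) \<in> tensor_null A"

definition tensor_class ::
    "('k::comm_ring_1, 'a, 'm) module_scheme \<Rightarrow> ('a \<times> 'a \<Rightarrow>\<^sub>0 'k) \<Rightarrow> ('a \<times> 'a \<Rightarrow>\<^sub>0 'k) set" where
  "tensor_class A t =
     {s. Poly_Mapping.keys s \<subseteq> carrier A \<times> carrier A \<and> s - t \<in> tensor_null A}"


section \<open>Finite-dimensional modules\<close>

text \<open>
  A \<open>d\<close>-dimensional left module is taken on the space \<open>k^d\<close>: it is a pair \<open>(d, \<rho>)\<close>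
  with \<open>\<rho> a\<close> the matrix of the action of \<open>a\<close>. Every finite-dimensional module is isomorphic to
  one of these, so that the isomorphism classes form a set. Values of \<open>\<rho>\<close> outside the carrier
  are irrelevant, as they do not enter into \<open>module_iso\<close>.
\<close>

type_synonym ('k, 'a) matmod = "nat \<times> ('a \<Rightarrow> 'k mat)"

definition fd_modules :: "('k::field, 'a, 'm) module_scheme \<Rightarrow> ('k, 'a) matmod set" where
  "fd_modules A = {(d, \<rho>).
     (\<forall>a\<in>carrier A. \<rho> a \<in> carrier_mat d d) \<and>
     \<rho> \<one>\<^bsub>A\<^esub> = 1\<^sub>m d \<and>
     (\<forall>a\<in>carrier A. \<forall>b\<in>carrier A. \<rho> (a \<otimes>\<^bsub>A\<^esub> b) = \<rho> a * \<rho> b) \<and>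
     (\<forall>a\<in>carrier A. \<forall>b\<in>carrier A. \<rho> (a \<oplus>\<^bsub>A\<^esub> b) = \<rho> a + \<rho> b) \<and>
     (\<forall>c. \<forall>a\<in>carrier A. \<rho> (c \<odot>\<^bsub>A\<^esub> a) = c \<cdot>\<^sub>m \<rho> a)}"

definition module_iso ::
    "('k::field, 'a, 'm) module_scheme \<Rightarrow> (('k, 'a) matmod \<times> ('k, 'a) matmod) set" where
  "module_iso A = {((d, \<rho>), (e, \<sigma>)).
     (d, \<rho>) \<in> fd_modules A \<and> (e, \<sigma>) \<in> fd_modules A \<and>
     (\<exists>P\<in>carrier_mat e d. \<exists>Q\<in>carrier_mat d e.
        Q * P = 1\<^sub>m d \<and> P * Q = 1\<^sub>m e \<and> (\<forall>a\<in>carrier A. P * \<rho> a = \<sigma> a * P))}"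

abbreviation iso_class ::
    "('k::field, 'a, 'm) module_scheme \<Rightarrow> ('k, 'a) matmod \<Rightarrow> ('k, 'a) matmod set" where
  "iso_class A V \<equiv> module_iso A `` {V}"

fun module_sum :: "('k::field, 'a) matmod \<Rightarrow> ('k, 'a) matmod \<Rightarrow> ('k, 'a) matmod" where
  "module_sum (d, \<rho>) (e, \<sigma>) =
     (d + e, \<lambda>a. four_block_mat (\<rho> a) (0\<^sub>m d e) (0\<^sub>m e d) (\<sigma> a))"

text \<open>The standard basis vector with index \<open>i * e + j\<close> of \<open>k^(d * e)\<close> stands for
  the tensor product of the \<open>i\<close>-th of \<open>k^d\<close> and the \<open>j\<close>-th of \<open>k^e\<close>.\<close>

definition kronecker :: "'k::field mat \<Rightarrow> 'k mat \<Rightarrow> 'k mat" where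
  "kronecker P Q = mat (dim_row P * dim_row Q) (dim_col P * dim_col Q)
     (\<lambda>(i, j). P $$ (i div dim_row Q, j div dim_col Q) * Q $$ (i mod dim_row Q, j mod dim_col Q))"

text \<open>The action of the tensor \<open>\<Sum> c (a \<otimes> b)\<close> on a tensor product of modules is
  \<open>\<Sum> c (\<rho> a \<otimes> \<sigma> b)\<close>; it does not depend on the formal combination representing the tensor.\<close>

fun module_tensor ::
    "('k::field, 'a, 'm) hopf_algebra_scheme \<Rightarrow> ('k, 'a) matmod \<Rightarrow> ('k, 'a) matmod \<Rightarrow> ('k, 'a) matmod" where
  "module_tensor A (d, \<rho>) (e, \<sigma>) =
     (d * e, \<lambda>x. let t = (SOME t. t \<in> comult A x) in
        mat (d * e) (d * e) (\<lambda>ij. \<Sum>(a, b)\<in>Poly_Mapping.keys t.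
          Poly_Mapping.lookup t (a, b) * kronecker (\<rho> a) (\<sigma> b) $$ ij))"

definition trivial_module :: "('k::field, 'a, 'm) hopf_algebra_scheme \<Rightarrow> ('k, 'a) matmod" where
  "trivial_module A = (1, \<lambda>a. mat 1 1 (\<lambda>_. counit A a))"

definition zero_module :: "('k::field, 'a) matmod" where
  "zero_module = (0, \<lambda>a. 0\<^sub>m 0 0)"

fun dual_module :: "('k::field, 'a, 'm) hopf_algebra_scheme \<Rightarrow> ('k, 'a) matmod \<Rightarrow> ('k, 'a) matmod" where
  "dual_module A (d, \<rho>) = (d, \<lambda>a. transpose_mat (\<rho> (antipode A a)))"


section \<open>Representation rings\<close>

record 'a star_ring = "'a ring" +
  star :: "'a \<Rightarrow> 'a"

definition with_star :: "'a ring \<Rightarrow> ('a \<Rightarrow> 'a) \<Rightarrow> 'a star_ring" where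
  "with_star R s = ring.extend R (star_ring.fields s)"

definition star_ring_iso :: "'a star_ring \<Rightarrow> 'b star_ring \<Rightarrow> ('a \<Rightarrow> 'b) set" where
  "star_ring_iso R S = {f \<in> ring_iso R S. \<forall>x\<in>carrier R. f (star R x) = star S (f x)}"

definition is_star_ring_iso :: "'a star_ring \<Rightarrow> 'b star_ring \<Rightarrow> bool" (infix \<open>\<simeq>\<^sub>*\<close> 60) where
  "R \<simeq>\<^sub>* S \<longleftrightarrow> star_ring_iso R S \<noteq> {}"

definition module_semiring ::
    "('k::field, 'a, 'm) hopf_algebra_scheme \<Rightarrow> ('k, 'a) matmod set star_ring" where
  "module_semiring A = \<lparr>
     carrier = fd_modules A // module_iso A,
     mult = induced2 (\<lambda>V W. iso_class A (module_tensor A V W)),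
     one = iso_class A (trivial_module A),
     zero = iso_class A zero_module,
     add = induced2 (\<lambda>V W. iso_class A (module_sum V W)),
     star = induced (\<lambda>V. iso_class A (dual_module A V))\<rparr>"

text \<open>Grothendieck construction; the pair \<open>(a, b)\<close> stands for the formal difference
  \<open>a - b\<close>.\<close>

definition groth_rel :: "('a, 'm) ring_scheme \<Rightarrow> (('a \<times> 'a) \<times> ('a \<times> 'a)) set" where
  "groth_rel S = {((a, b), (c, d)).
     a \<in> carrier S \<and> b \<in> carrier S \<and> c \<in> carrier S \<and> d \<in> carrier S \<and>
     (\<exists>e\<in>carrier S. a \<oplus>\<^bsub>S\<^esub> d \<oplus>\<^bsub>S\<^esub> e = c \<oplus>\<^bsub>S\<^esub> b \<oplus>\<^bsub>S\<^esub> e)}"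

abbreviation groth_class :: "('a, 'm) ring_scheme \<Rightarrow> 'a \<times> 'a \<Rightarrow> ('a \<times> 'a) set" where
  "groth_class S p \<equiv> groth_rel S `` {p}"

definition grothendieck :: "'a star_ring \<Rightarrow> ('a \<times> 'a) set star_ring" where
  "grothendieck S = \<lparr>
     carrier = (carrier S \<times> carrier S) // groth_rel S,
     mult = induced2 (\<lambda>(a, b) (c, d). groth_class S
       ((a \<otimes>\<^bsub>S\<^esub> c) \<oplus>\<^bsub>S\<^esub> (b \<otimes>\<^bsub>S\<^esub> d), (a \<otimes>\<^bsub>S\<^esub> d) \<oplus>\<^bsub>S\<^esub> (b \<otimes>\<^bsub>S\<^esub> c))),
     one = groth_class S (\<one>\<^bsub>S\<^esub>, \<zero>\<^bsub>S\<^esub>),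
     zero = groth_class S (\<zero>\<^bsub>S\<^esub>, \<zero>\<^bsub>S\<^esub>),
     add = induced2 (\<lambda>(a, b) (c, d). groth_class S (a \<oplus>\<^bsub>S\<^esub> c, b \<oplus>\<^bsub>S\<^esub> d)),
     star = induced (\<lambda>(a, b). groth_class S (star S a, star S b))\<rparr>"

definition Rep ::
    "('k::field, 'a, 'm) hopf_algebra_scheme
     \<Rightarrow> (('k, 'a) matmod set \<times> ('k, 'a) matmod set) set star_ring" where
  "Rep A = grothendieck (module_semiring A)"


section \<open>Suzuki's Hopf algebras\<close>

text \<open>The free algebra over \<open>'k\<close> on \<open>'x\<close> is the monoid algebra
  \<open>'x free_monoid \<Rightarrow>\<^sub>0 'k\<close>, whose multiplication is the convolution product of
  \<^type>\<open>poly_mapping\<close>; its tensor square is the monoid algebra on pairs of words.\<close>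

datatype 'x free_monoid = Word (letters: "'x list")

instantiation free_monoid :: (type) monoid_add
begin

definition zero_free_monoid :: "'a free_monoid" where
  "zero_free_monoid = Word []"

definition plus_free_monoid :: "'a free_monoid \<Rightarrow> 'a free_monoid \<Rightarrow> 'a free_monoid" where
  "plus_free_monoid u v = Word (letters u @ letters v)"

instance
  by standard (simp_all add: zero_free_monoid_def plus_free_monoid_def)

end

abbreviation fconst :: "'k::comm_ring_1 \<Rightarrow> ('m::monoid_add \<Rightarrow>\<^sub>0 'k)" where
  "fconst c \<equiv> Poly_Mapping.single 0 c"

text \<open>The algebra homomorphism given by \<open>\<phi>\<close> on the generators, where \<open>\<iota>\<close> embeds
  the scalars into the target; the second version is the anti-homomorphism.\<close>

definition free_hom ::
    "('k::comm_ring_1 \<Rightarrow> 'b::ring_1) \<Rightarrow> ('x \<Rightarrow> 'b) \<Rightarrow> ('x free_monoid \<Rightarrow>\<^sub>0 'k) \<Rightarrow> 'b" where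
  "free_hom \<iota> \<phi> p = (\<Sum>w\<in>Poly_Mapping.keys p.
     \<iota> (Poly_Mapping.lookup p w) * prod_list (map \<phi> (letters w)))"

definition free_antihom ::
    "('k::comm_ring_1 \<Rightarrow> 'b::ring_1) \<Rightarrow> ('x \<Rightarrow> 'b) \<Rightarrow> ('x free_monoid \<Rightarrow>\<^sub>0 'k) \<Rightarrow> 'b" where
  "free_antihom \<iota> \<phi> p = (\<Sum>w\<in>Poly_Mapping.keys p.
     \<iota> (Poly_Mapping.lookup p w) * prod_list (map \<phi> (rev (letters w))))"

datatype idx = I1 | I2

fun idx_val :: "idx \<Rightarrow> int" where
  "idx_val I1 = 1"
| "idx_val I2 = 2"

type_synonym 'k free_alg = "(idx \<times> idx) free_monoid \<Rightarrow>\<^sub>0 'k"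

definition gen :: "idx \<Rightarrow> idx \<Rightarrow> 'k::comm_ring_1 free_alg" where
  "gen i j = Poly_Mapping.single (Word [(i, j)]) 1"

definition free_alg_ring :: "'k::comm_ring_1 free_alg ring" where
  "free_alg_ring = \<lparr>carrier = UNIV, mult = (*), one = 1, zero = 0, add = (+)\<rparr>"

text \<open>\<open>alternating n a b = a * b * a * \<dots>\<close> with \<open>n\<close> factors\<close>

definition alternating :: "nat \<Rightarrow> 'b::monoid_mult \<Rightarrow> 'b \<Rightarrow> 'b" where
  "alternating n a b = prod_list (map (\<lambda>i. if even i then a else b) [0..<n])"

text \<open>The parameter usually called \<open>\<lambda>\<close> is \<open>\<mu>\<close> here.\<close>

definition suzuki_relators :: "nat \<Rightarrow> nat \<Rightarrow> 'k::comm_ring_1 \<Rightarrow> 'k \<Rightarrow> 'k free_alg set" where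
  "suzuki_relators N n \<nu> \<mu> =
     {gen I1 I1 ^ 2 - gen I2 I2 ^ 2, gen I1 I2 ^ 2 - gen I2 I1 ^ 2} \<union>
     {gen i j * gen l m | i j l m. \<not> [idx_val i - idx_val j = idx_val l - idx_val m] (mod 2)} \<union>
     {gen I1 I1 ^ (2 * N) + fconst \<nu> * gen I1 I2 ^ (2 * N) - 1,
      alternating n (gen I1 I1) (gen I2 I2) - alternating n (gen I2 I2) (gen I1 I1),
      alternating n (gen I2 I1) (gen I1 I2) - fconst \<mu> * alternating n (gen I1 I2) (gen I2 I1)}"

definition suzuki_ideal :: "nat \<Rightarrow> nat \<Rightarrow> 'k::comm_ring_1 \<Rightarrow> 'k \<Rightarrow> 'k free_alg set" where
  "suzuki_ideal N n \<nu> \<mu> = Idl\<^bsub>free_alg_ring\<^esub> (suzuki_relators N n \<nu> \<mu>)"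

abbreviation suzuki_class ::
    "nat \<Rightarrow> nat \<Rightarrow> 'k::comm_ring_1 \<Rightarrow> 'k \<Rightarrow> 'k free_alg \<Rightarrow> 'k free_alg set" where
  "suzuki_class N n \<nu> \<mu> p \<equiv> suzuki_ideal N n \<nu> \<mu> +>\<^bsub>free_alg_ring\<^esub> p"

definition suzuki_algebra ::
    "nat \<Rightarrow> nat \<Rightarrow> 'k::comm_ring_1 \<Rightarrow> 'k \<Rightarrow> ('k, 'k free_alg set) module" where
  "suzuki_algebra N n \<nu> \<mu> =
     ring.extend (free_alg_ring Quot suzuki_ideal N n \<nu> \<mu>)
       (module.fields (\<lambda>c. induced (\<lambda>p. suzuki_class N n \<nu> \<mu> (fconst c * p))))"

definition free_comult :: "'k::comm_ring_1 free_alg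
    \<Rightarrow> ((idx \<times> idx) free_monoid \<times> (idx \<times> idx) free_monoid \<Rightarrow>\<^sub>0 'k)" where
  "free_comult = free_hom fconst
     (\<lambda>(i, j). ptensor (Word [(i, I1)]) (Word [(I1, j)]) + ptensor (Word [(i, I2)]) (Word [(I2, j)]))"

definition free_counit :: "'k::comm_ring_1 free_alg \<Rightarrow> 'k" where
  "free_counit = free_hom (\<lambda>c. c) (\<lambda>(i, j). if i = j then 1 else 0)"

text \<open>The formula for the antipode is used below only in the case \<open>\<nu> = 1\<close>.\<close>

definition free_antipode :: "nat \<Rightarrow> 'k::comm_ring_1 free_alg \<Rightarrow> 'k free_alg" where
  "free_antipode N = free_antihom fconst (\<lambda>(i, j). gen j i ^ (2 * N - 1))"

text \<open>The projection \<open>F \<otimes> F \<rightarrow> A \<otimes> A\<close> from the free algebra \<open>F\<close>, on representatives\<close>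

definition suzuki_project :: "nat \<Rightarrow> nat \<Rightarrow> 'k::comm_ring_1 \<Rightarrow> 'k
    \<Rightarrow> ((idx \<times> idx) free_monoid \<times> (idx \<times> idx) free_monoid \<Rightarrow>\<^sub>0 'k)
    \<Rightarrow> ('k free_alg set \<times> 'k free_alg set \<Rightarrow>\<^sub>0 'k)" where
  "suzuki_project N n \<nu> \<mu> t = (\<Sum>(u, v)\<in>Poly_Mapping.keys t.
     Poly_Mapping.single
       (suzuki_class N n \<nu> \<mu> (Poly_Mapping.single u 1), suzuki_class N n \<nu> \<mu> (Poly_Mapping.single v 1))
       (Poly_Mapping.lookup t (u, v)))"

definition suzuki ::
    "nat \<Rightarrow> nat \<Rightarrow> 'k::comm_ring_1 \<Rightarrow> 'k \<Rightarrow> ('k, 'k free_alg set) hopf_algebra" where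
  "suzuki N n \<nu> \<mu> =
     module.extend (suzuki_algebra N n \<nu> \<mu>)
       (hopf_algebra.fields
         (induced (\<lambda>p. tensor_class (suzuki_algebra N n \<nu> \<mu>)
            (suzuki_project N n \<nu> \<mu> (free_comult p))))
         (induced free_counit)
         (induced (\<lambda>p. suzuki_class N n \<nu> \<mu> (free_antipode N p))))"

definition A_Nn :: "nat \<Rightarrow> nat \<Rightarrow> ('k::field, 'k free_alg set) hopf_algebra" where
  "A_Nn N n = (if odd n then suzuki N n 1 1 else suzuki N n 1 (- 1))"


section \<open>The group \<open>G_Nn\<close> and its group Hopf algebra\<close>

text \<open>The letter \<open>(x, True)\<close> is the generator \<open>x\<close>, and \<open>(x, False)\<close> its
  formal inverse.\<close>

inductive_set pres_rel :: "(('x \<times> bool) list \<times> ('x \<times> bool) list) set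
    \<Rightarrow> (('x \<times> bool) list \<times> ('x \<times> bool) list) set"
  for E :: "(('x \<times> bool) list \<times> ('x \<times> bool) list) set" where
  refl: "(u, u) \<in> pres_rel E"
| sym: "(u, v) \<in> pres_rel E \<Longrightarrow> (v, u) \<in> pres_rel E"
| trans: "\<lbrakk>(u, v) \<in> pres_rel E; (v, w) \<in> pres_rel E\<rbrakk> \<Longrightarrow> (u, w) \<in> pres_rel E"
| cancel: "(u @ [(x, s), (x, \<not> s)] @ v, u @ v) \<in> pres_rel E"
| relation: "(l, r) \<in> E \<Longrightarrow> (u @ l @ v, u @ r @ v) \<in> pres_rel E"

definition presented_group ::
    "(('x \<times> bool) list \<times> ('x \<times> bool) list) set \<Rightarrow> ('x \<times> bool) list set monoid" where
  "presented_group E = \<lparr>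
     carrier = UNIV // pres_rel E,
     mult = induced2 (\<lambda>u v. pres_rel E `` {u @ v}),
     one = pres_rel E `` {[]}\<rparr>"

datatype ggen = GH | GT | GW

definition G_Nn :: "nat \<Rightarrow> nat \<Rightarrow> (ggen \<times> bool) list set monoid" where
  "G_Nn N n = presented_group (let h = (GH, True); t = (GT, True); w = (GW, True); w' = (GW, False) in
     {([t, t], []),
      (replicate (2 * N) h, []),
      (replicate n w, replicate N h),
      ([t, w], [w', t]),
      ([h, t], [t, h]),
      ([h, w], [w, h])})"

definition group_algebra :: "('g, 'm) monoid_scheme \<Rightarrow> ('k::comm_ring_1, 'g \<Rightarrow>\<^sub>0 'k) module" where
  "group_algebra G = \<lparr>
     carrier = {f. Poly_Mapping.keys f \<subseteq> carrier G},
     mult = (\<lambda>f f'. \<Sum>g\<in>Poly_Mapping.keys f. \<Sum>g'\<in>Poly_Mapping.keys f'.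
       Poly_Mapping.single (g \<otimes>\<^bsub>G\<^esub> g') (Poly_Mapping.lookup f g * Poly_Mapping.lookup f' g')),
     one = Poly_Mapping.single \<one>\<^bsub>G\<^esub> 1,
     zero = 0,
     add = (+),
     smult = fscale\<rparr>"

definition group_hopf_algebra ::
    "('g, 'm) monoid_scheme \<Rightarrow> ('k::comm_ring_1, 'g \<Rightarrow>\<^sub>0 'k) hopf_algebra" where
  "group_hopf_algebra G =
     module.extend (group_algebra G)
       (hopf_algebra.fields
         (\<lambda>f. tensor_class (group_algebra G) (\<Sum>g\<in>Poly_Mapping.keys f.
            fscale (Poly_Mapping.lookup f g) (ptensor (Poly_Mapping.single g 1) (Poly_Mapping.single g 1))))
         (\<lambda>f. \<Sum>g\<in>Poly_Mapping.keys f. Poly_Mapping.lookup f g)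
         (\<lambda>f. \<Sum>g\<in>Poly_Mapping.keys f. Poly_Mapping.single (inv\<^bsub>G\<^esub> g) (Poly_Mapping.lookup f g)))"


section \<open>The presented commutative rings\<close>

text \<open>Integral polynomials in the variables \<open>'v\<close>; a monomial is a multiset of variables.\<close>

type_synonym 'v zpoly = "'v multiset \<Rightarrow>\<^sub>0 int"

definition zpoly_ring :: "'v set \<Rightarrow> 'v zpoly ring" where
  "zpoly_ring V = \<lparr>
     carrier = {p. \<forall>m\<in>Poly_Mapping.keys p. set_mset m \<subseteq> V},
     mult = (*), one = 1, zero = 0, add = (+)\<rparr>"

definition presented_cring :: "'v set \<Rightarrow> 'v zpoly set \<Rightarrow> 'v zpoly set ring" where
  "presented_cring V E = zpoly_ring V Quot (Idl\<^bsub>zpoly_ring V\<^esub> E)"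

definition presented_elem :: "'v set \<Rightarrow> 'v zpoly set \<Rightarrow> 'v zpoly \<Rightarrow> 'v zpoly set" where
  "presented_elem V E p = (Idl\<^bsub>zpoly_ring V\<^esub> E) +>\<^bsub>zpoly_ring V\<^esub> p"

datatype rvar = VA | VB | VC | VX nat

definition pvar :: "rvar \<Rightarrow> rvar zpoly" where
  "pvar v = Poly_Mapping.single {#v#} 1"

text \<open>The element \<open>x_k\<close> for \<open>0 \<le> k < 2 * n\<close>, by the index rules
  \<open>x_0 = 1 + a\<close>, \<open>x_n = b * (1 + a)\<close> and \<open>x_(n+i) = x_(n-i)\<close>\<close>

definition xpoly :: "nat \<Rightarrow> nat \<Rightarrow> rvar zpoly" where
  "xpoly n k =
     (if k = 0 then 1 + pvar VA
      else if k < n then pvar (VX k)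
      else if k = n then pvar VB * (1 + pvar VA)
      else pvar (VX (2 * n - k)))"

definition vars_even :: "nat \<Rightarrow> rvar set" where
  "vars_even n = {VA, VB, VC} \<union> VX ` {1..n - 1}"

definition rels_even :: "nat \<Rightarrow> nat \<Rightarrow> rvar zpoly set" where
  "rels_even N n =
     {pvar VA ^ 2 - 1, pvar VB ^ 2 - 1, pvar VC ^ N - 1} \<union>
     {pvar VA * xpoly n i - xpoly n i | i. i \<in> {1..n - 1}} \<union>
     {pvar VB * xpoly n i - xpoly n (n - i) | i. i \<in> {1..n - 1}} \<union>
     {xpoly n i * xpoly n j
        - pvar VC ^ nat ((1 - (-1) ^ (i * j)) div 2) * (xpoly n (nat \<bar>int i - int j\<bar>) + xpoly n (i + j))
      | i j. i \<in> {1..n - 1} \<and> j \<in> {1..n - 1}}"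

definition R_even :: "nat \<Rightarrow> nat \<Rightarrow> rvar zpoly set ring" where
  "R_even N n = presented_cring (vars_even n) (rels_even N n)"

text \<open>A ring homomorphism is determined by its values on the generators, so at most one
  map on the carrier satisfies this (\<open>R_even\<close> is commutative, hence no order reversal).\<close>

definition is_star_even :: "nat \<Rightarrow> nat \<Rightarrow> (rvar zpoly set \<Rightarrow> rvar zpoly set) \<Rightarrow> bool" where
  "is_star_even N n s \<longleftrightarrow>
     (let R = R_even N n;
          a = presented_elem (vars_even n) (rels_even N n) (pvar VA);
          b = presented_elem (vars_even n) (rels_even N n) (pvar VB);
          c = presented_elem (vars_even n) (rels_even N n) (pvar VC);
          x = (\<lambda>i. presented_elem (vars_even n) (rels_even N n) (pvar (VX i)))
      in s \<in> Ring.ring_hom R R \<and> s a = a \<and> s b = b \<and> s c = inv\<^bsub>R\<^esub> c \<and>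
         (\<forall>i\<in>{1..n - 1}. s (x i) = (c [^]\<^bsub>R\<^esub> (((-1) ^ i - 1) div 2 :: int)) \<otimes>\<^bsub>R\<^esub> x i))"

definition vars_odd :: "nat \<Rightarrow> rvar set" where
  "vars_odd n = {VA, VB} \<union> VX ` {1..n - 1}"

definition rels_odd :: "nat \<Rightarrow> nat \<Rightarrow> rvar zpoly set" where
  "rels_odd N n =
     {pvar VA ^ 2 - 1, pvar VB ^ (2 * N) - 1} \<union>
     {pvar VA * xpoly n i - xpoly n i | i. i \<in> {1..n - 1}} \<union>
     {pvar VB * xpoly n i - xpoly n (n - i) | i. i \<in> {1..n - 1} \<and> even i} \<union>
     {xpoly n i * xpoly n j
        - pvar VB ^ nat (1 - (-1) ^ (i * j)) * (xpoly n (nat \<bar>int i - int j\<bar>) + xpoly n (i + j))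
      | i j. i \<in> {1..n - 1} \<and> j \<in> {1..n - 1}}"

definition R_odd :: "nat \<Rightarrow> nat \<Rightarrow> rvar zpoly set ring" where
  "R_odd N n = presented_cring (vars_odd n) (rels_odd N n)"

definition is_star_odd :: "nat \<Rightarrow> nat \<Rightarrow> (rvar zpoly set \<Rightarrow> rvar zpoly set) \<Rightarrow> bool" where
  "is_star_odd N n s \<longleftrightarrow>
     (let R = R_odd N n;
          a = presented_elem (vars_odd n) (rels_odd N n) (pvar VA);
          b = presented_elem (vars_odd n) (rels_odd N n) (pvar VB);
          x = (\<lambda>i. presented_elem (vars_odd n) (rels_odd N n) (pvar (VX i)))
      in s \<in> Ring.ring_hom R R \<and> s a = a \<and> s b = inv\<^bsub>R\<^esub> b \<and>
         (\<forall>i\<in>{1..n - 1}. s (x i) = (b [^]\<^bsub>R\<^esub> ((-1) ^ i - 1 :: int)) \<otimes>\<^bsub>R\<^esub> x i))"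

definition primitive_root_of_unity :: "nat \<Rightarrow> 'k::field \<Rightarrow> bool" where
  "primitive_root_of_unity m z \<longleftrightarrow> z ^ m = 1 \<and> (\<forall>k. 0 < k \<and> k < m \<longrightarrow> z ^ k \<noteq> 1)"

end

theory Submission
  imports Defs "Jordan_Normal_Form.Char_Poly" "HOL-Library.Function_Algebras" Complex_Main
begin

text \<open>For odd \<open>N\<close> both Hopf algebras are generated, as algebras, by elements \<open>z\<close>, \<open>t\<close>, \<open>w\<close> with \<open>z\<close> central,
  \<open>z\<^sup>N = t\<^sup>2 = w\<^sup>2\<^sup>n = 1\<close> and \<open>wtw = t\<close>: in the group algebra \<open>z = h\<^sup>2\<close>, and in Suzuki's algebra \<open>z\<close> and \<open>t\<close> are
  the powers \<open>X\<^sup>2\<close> and \<open>X\<^sup>N\<close> of \<open>X = x\<^sub>1\<^sub>1 + x\<^sub>1\<^sub>2\<close>. Hence a module is given by three matrices, and it is determined up to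
  isomorphism by the multiplicities of the one-dimensional \<open>Chi u e d\<close> and the two-dimensional \<open>Psi u j\<close>.
  The comultiplications differ, but tensor products and duals of irreducible modules have the same
  multiplicities in both cases. So both representation rings are the ring with these fusion rules. The presented
  ring is spanned by the images of the irreducible classes, and these are linearly independent because
  the ring has enough homomorphisms to the complex numbers.\<close>

text \<open>The dihedral group comes from \<open>Y = x22 + x21\<close>: since
  \<open>Y^2 = X^2\<close>, the quotient \<open>V = Y X^-1\<close> satisfies
  \<open>V X V = X\<close>. The relations between alternating words fix \<open>V^n\<close> in terms
  of the central involution \<open>P = x11^(2N) - x12^(2N)\<close>, and multiplying \<open>V\<close>
  by \<open>P\<close> for odd \<open>n\<close> gives a \<open>w\<close> with \<open>w^n = P\<close>
  for both parities of \<open>n\<close>. As \<open>N\<close> is odd, \<open>X\<close> is recovered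
  from \<open>X^2\<close> and \<open>X^N\<close>, and each generator from \<open>X\<close>,
  \<open>Y\<close> and the projections \<open>(1 + P) / 2\<close>, \<open>(1 - P) / 2\<close>. The
  obstacle is that \<open>X\<close> is not group-like: its coproduct is
  \<open>x11 \<otimes> X + x12 \<otimes> Y\<close>. Where \<open>P\<close> is -1 on the first
  factor, \<open>X\<close> and \<open>Y\<close> are exchanged on the second. A linear bijection of
  the second factor that exchanges them repairs this, except on characters with
  \<open>Y = -X\<close>; there a sign change on the first factor helps. Noncommutative identities
  are proved in arbitrary ring types. Matrices of positive size and quotients of free algebras are
  embedded in rings of additive maps to make use of them.\<close>

abbreviation "sgl == Poly_Mapping.single"
abbreviation "kys == Poly_Mapping.keys"
abbreviation "lkp == Poly_Mapping.lookup"
abbreviation "trm == transpose_mat"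
abbreviation "kro == kronecker"
abbreviation "fdms == fd_modules"
abbreviation "mten == module_tensor"
abbreviation "dmod == dual_module"
abbreviation "tmod == trivial_module"
abbreviation "msum == module_sum"
abbreviation "alte == alternating"
abbreviation "pelm == presented_elem"
abbreviation "sqm d == carrier_mat d d"
abbreviation "idm == one_mat"
abbreviation "zm == zero_mat"
notation smult_mat (infixl "\<cdot>" 70)
notation pow_mat (infixr "^m" 75)

section \<open>Linear extension to formal combinations\<close>

lemma poly_mapping_sum_single: "(\<Sum>x\<in>kys t. sgl x (lkp t x)) = t"
	by (rule poly_mapping_eqI)
		 (auto simp: lookup_sum lookup_single when_def in_keys_iff if_distrib cong: if_cong)

lemma pm_induct [case_names zero single add]:
	assumes "P 0" "!!x c. P (sgl x c)"
		and add: "!!s t. P s ==> P t ==> P (s + t)"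
	shows "P (t :: 'm \<Rightarrow>\<^sub>0 'b::comm_monoid_add)"
proof -
	have "P (\<Sum>x\<in>S. sgl x (lkp t x))" if "finite S" for S
		using that by induction (auto intro: assms)
	from this[OF finite_keys[of t]] show ?thesis
		by (simp add: poly_mapping_sum_single)
qed

text \<open>One extension operator for all later uses: homomorphisms out of free algebras,
  evaluation of integral polynomials, and entries of the matrix by which a formal combination acts.
  \<open>io\<close> embeds the scalars into a possibly noncommutative target.\<close>

definition lin :: "('k::zero => 'b::semiring_0) => ('m => 'b) => ('m \<Rightarrow>\<^sub>0 'k) => 'b" where
	"lin io M t = (\<Sum>x\<in>kys t. io (lkp t x) * M x)"

locale additive_scalars =
	fixes io :: "'k::comm_ring_1 => 'b::ring_1"
	assumes io_add: "io (c + d) = io c + io d"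
begin

lemma io_0: "io 0 = 0"
	using io_add[of 0 0] by simp

lemma lin_superset:
	assumes "finite S" "kys t \<subseteq> S"
	shows "lin io M t = (\<Sum>x\<in>S. io (lkp t x) * M x)"
	unfolding lin_def using assms
	by (intro sum.mono_neutral_left) (auto simp: in_keys_iff io_0)

lemma lin_0 [simp]: "lin io M 0 = 0"
	by (simp add: lin_def)

lemma lin_single [simp]: "lin io M (sgl x c) = io c * M x"
	by (simp add: lin_superset[of "{x}"] io_0)

lemma lin_add: "lin io M (s + t) = lin io M s + lin io M t"
proof -
	let ?S = "kys s \<union> kys t"
	have "lin io M (s + t) = (\<Sum>x\<in>?S. io (lkp (s + t) x) * M x)"
		by (rule lin_superset) (auto dest: keys_add[THEN subsetD])
	thus ?thesis
		by (simp add: lin_superset[of ?S] lookup_add io_add distrib_right sum.distrib)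
qed

lemma lin_uminus: "lin io M (- t) = - lin io M t"
	using lin_add[of M t "- t"] by (simp add: minus_unique)

lemma lin_diff: "lin io M (s - t) = lin io M s - lin io M t"
	using lin_add[of M s "- t"] by (simp add: lin_uminus)

lemma lin_sum: "lin io M (sum f S) = (\<Sum>x\<in>S. lin io M (f x))"
	by (induction S rule: infinite_finite_induct) (auto simp: lin_add)

end

locale scalars = additive_scalars +
	assumes io_mult: "io (c * d) = io c * io d"
		and io_1: "io 1 = 1"
begin

text \<open>Biadditivity reduces the claim to two monomials. There the scalar of the second has to
  pass the image of the first, which is why \<open>M\<close> must take values commuting with the
  scalars.\<close>

lemma lin_mult:
	fixes M :: "'m::monoid_add => 'b"
	assumes "!!x y. M (x + y) = M x * M y" "!!c x. M x * io c = io c * M x"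
	shows "lin io M (s * t) = lin io M s * lin io M t"
proof (induction s rule: pm_induct)
	case (single x c)
	show ?case
	proof (induction t rule: pm_induct)
		case (single y d)
		have "M x * (io d * M y) = io d * (M x * M y)"
			by (simp add: assms(2) mult.assoc[symmetric])
		thus ?case
			by (simp add: mult_single io_mult assms(1) mult.assoc)
	qed (simp_all add: lin_add distrib_left)
qed (simp_all add: lin_add distrib_right)

lemma lin_mult_anti:
	fixes M :: "'m::monoid_add => 'b"
	assumes "!!x y. M (x + y) = M y * M x" "!!c x. M x * io c = io c * M x"
	shows "lin io M (s * t) = lin io M t * lin io M s"
proof (induction s rule: pm_induct)
	case (single x c)
	show ?case
	proof (induction t rule: pm_induct)
		case (single y d)
		have "io d * M y * (io c * M x) = io d * (M y * io c) * M x"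
			by (simp add: mult.assoc)
		also have "... = io (d * c) * (M y * M x)"
			by (simp add: assms(2) io_mult mult.assoc)
		also have "d * c = c * d" by (rule mult.commute)
		finally have "io d * M y * (io c * M x) = io c * (io d * (M y * M x))"
			by (simp add: io_mult mult.assoc)
		thus ?case
			by (simp add: mult_single io_mult assms(1) mult.assoc)
	qed (simp_all add: lin_add distrib_left distrib_right)
qed (simp_all add: lin_add distrib_left distrib_right)

lemma lin_one:
	assumes "M 0 = 1"
	shows "lin io M 1 = 1"
	using assms io_1 by (metis lin_single mult_1 single_one)

end

lemma letters_plus [simp]: "letters (u + v) = letters u @ letters v"
	by (simp add: plus_free_monoid_def)

lemma letters_zero [simp]: "letters 0 = []"
	by (simp add: zero_free_monoid_def)

lemma free_hom_lin: "free_hom io ph = lin io (%w. prod_list (map ph (letters w)))"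
	by (rule ext) (simp add: free_hom_def lin_def)

lemma free_antihom_lin: "free_antihom io ph = lin io (%w. prod_list (map ph (rev (letters w))))"
	by (rule ext) (simp add: free_antihom_def lin_def)

lemma prod_list_commute:
	assumes "!!x. x : set xs ==> x * c = c * (x :: 'b::monoid_mult)"
	shows "prod_list xs * c = c * prod_list xs"
	using assms by (induction xs) (auto simp: mult.assoc, metis mult.assoc)

context scalars
begin

context
	fixes ph :: "'x => 'b"
	assumes central: "!!c x. ph x * io c = io c * ph x"
begin

lemma free_hom_mult: "free_hom io ph (p * q) = free_hom io ph p * free_hom io ph q"
	unfolding free_hom_lin by (rule lin_mult) (auto intro!: prod_list_commute simp: central)

lemma free_antihom_mult: "free_antihom io ph (p * q) = free_antihom io ph q * free_antihom io ph p"
	unfolding free_antihom_lin by (rule lin_mult_anti) (auto intro!: prod_list_commute simp: central)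

end

lemma free_hom_1 [simp]: "free_hom io ph 1 = 1"
	and free_antihom_1 [simp]: "free_antihom io ph 1 = 1"
	by (simp_all add: free_hom_lin free_antihom_lin lin_one)

lemma free_hom_const [simp]: "free_hom io ph (fconst c) = io c"
	and free_antihom_const [simp]: "free_antihom io ph (fconst c) = io c"
	by (simp_all add: free_hom_lin free_antihom_lin)

lemma free_hom_gen [simp]: "free_hom io ph (gen i j) = ph (i, j)"
	and free_antihom_gen [simp]: "free_antihom io ph (gen i j) = ph (i, j)"
	by (simp_all add: free_hom_lin free_antihom_lin gen_def io_1)

lemma free_hom_add: "free_hom io ph (p + q) = free_hom io ph p + free_hom io ph q"
	and free_antihom_add: "free_antihom io ph (p + q) = free_antihom io ph p + free_antihom io ph q"
	and free_hom_diff: "free_hom io ph (p - q) = free_hom io ph p - free_hom io ph q"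
	and free_antihom_diff: "free_antihom io ph (p - q) = free_antihom io ph p - free_antihom io ph q"
	and free_hom_0 [simp]: "free_hom io ph 0 = 0"
	and free_antihom_0 [simp]: "free_antihom io ph 0 = 0"
	by (simp_all add: free_hom_lin free_antihom_lin lin_add lin_diff)

end

text \<open>A monomial is built from the left by multiplication with single generators, the empty
  word carrying the coefficient. This reduces equivariance of a matrix under the whole algebra to
  its four generators.\<close>

lemma gen_induct [case_names const gen add mult]:
	assumes const: "!!c. P (fconst c)" and gen: "!!i j. P (gen i j)"
		and add: "!!p q. P p ==> P q ==> P (p + q)" and mult: "!!p q. P p ==> P q ==> P (p * q)"
	shows "P (p :: 'k::comm_ring_1 free_alg)"
proof (induction p rule: pm_induct)
	case zero
	show ?case using const[of 0] by simp
next
	case (single w c)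
	have "P (sgl (Word xs) c)" for xs
	proof (induction xs)
		case Nil
		show ?case using const[of c] by (simp add: zero_free_monoid_def)
	next
		case (Cons x xs)
		have "gen (fst x) (snd x) * sgl (Word xs) c = sgl (Word (x # xs)) c"
			by (simp add: gen_def mult_single plus_free_monoid_def)
		thus ?case using mult[OF gen Cons.IH] by metis
	qed
	thus ?case by (metis free_monoid.exhaust)
qed (rule add)


section \<open>Square matrices as operators\<close>

text \<open>A ring type that receives the matrix rings of all positive sizes and, later, quotients
  of free algebras. Consequences of defining relations are thus derived once, in an arbitrary ring
  type and without dimension conditions.\<close>

typedef (overloaded) 'v endo = "{f :: 'v::ab_group_add => 'v. \<forall>u v. f (u + v) = f u + f v}"
	by (rule exI[of _ "%_. 0"]) simp

setup_lifting type_definition_endo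

instantiation endo :: ("{ab_group_add, zero_neq_one}") ring_1
begin

lift_definition zero_endo :: "'a endo" is "%_. 0" by simp
lift_definition one_endo :: "'a endo" is "%u. u" by simp
lift_definition plus_endo :: "'a endo => 'a endo => 'a endo" is "%f g u. f u + g u" by (simp add: algebra_simps)
lift_definition minus_endo :: "'a endo => 'a endo => 'a endo" is "%f g u. f u - g u" by (simp add: algebra_simps)
lift_definition uminus_endo :: "'a endo => 'a endo" is "%f u. - f u" by (simp add: algebra_simps)
lift_definition times_endo :: "'a endo => 'a endo => 'a endo" is "%f g u. f (g u)" by simp

instance
proof
	\<comment> \<open>The class \<open>ring_1\<close> demands \<open>0 ~= 1\<close>. The sort
	  constraint gives the underlying group two different elements, so the zero map and the identity
	  differ.\<close>
	show "(0 :: 'a endo) ~= 1"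
		by transfer (metis zero_neq_one)
qed (transfer, simp add: algebra_simps)+

end

type_synonym 'k op = "(nat => 'k) endo"

lift_definition op_scalar :: "'k::comm_ring_1 => 'k op" is "%c u i. c * u i"
	by (simp add: fun_eq_iff algebra_simps)

interpretation op_scalar: scalars op_scalar
proof
	show "op_scalar (c + d) = op_scalar c + op_scalar d" for c d :: 'a
		by transfer (simp add: fun_eq_iff distrib_right)
	show "op_scalar (c * d) = op_scalar c * op_scalar d" for c d :: 'a
		by transfer (simp add: mult.assoc)
	show "op_scalar 1 = (1 :: 'a op)"
		by transfer simp
qed

text \<open>A matrix of size \<open>d > 0\<close> acts on sequences block by block, so that it is the identity matrix
  of size \<open>d\<close>, and not just an idempotent, which becomes the unit of the ring of operators.\<close>

lift_definition opr :: "nat => 'k::comm_ring_1 mat => 'k op" is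
	"%d M u i. \<Sum>j<d. M $$ (i mod d, j) * u (d * (i div d) + j)"
	by (simp add: fun_eq_iff algebra_simps sum.distrib)

lemma op_eqI: "(!!u i. Rep_endo a u i = Rep_endo (b :: 'k::comm_ring_1 op) u i) ==> a = b"
	by (metis Rep_endo_inject ext)

lemmas op_rep = zero_endo.rep_eq one_endo.rep_eq plus_endo.rep_eq times_endo.rep_eq op_scalar.rep_eq opr.rep_eq

lemma opr_zero [simp]: "d > 0 ==> opr d (zm d d) = 0"
	by (rule op_eqI) (simp add: op_rep)

lemma opr_one [simp]:
	assumes "d > 0"
	shows "opr d (idm d) = 1"
proof (rule op_eqI)
	fix u :: "nat => 'a" and i :: nat
	have "(\<Sum>j<d. idm d $$ (i mod d, j) * u (d * (i div d) + j)) =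
			(\<Sum>j<d. if j = i mod d then u (d * (i div d) + j) else 0)"
		using assms by (intro sum.cong) auto
	also have "... = u i" using assms by simp
	finally show "Rep_endo (opr d (idm d)) u i = Rep_endo 1 u i"
		by (simp add: op_rep)
qed

lemma opr_add:
	assumes "d > 0" "A : sqm d" "B : sqm d"
	shows "opr d (A + B) = opr d A + opr d B"
	using assms by (intro op_eqI) (auto simp: op_rep distrib_right sum.distrib[symmetric] intro!: sum.cong)

lemma opr_smult:
	assumes "d > 0" "A : sqm d"
	shows "opr d (c \<cdot> A) = op_scalar c * opr d A"
	using assms by (intro op_eqI) (auto simp: op_rep sum_distrib_left mult.assoc intro!: sum.cong)

lemma opr_mult:
	assumes d: "d > 0" and A: "A : sqm d" and B: "B : sqm d"
	shows "opr d (A * B) = opr d A * opr d B"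
proof (rule op_eqI)
	fix u :: "nat => 'a" and i
	have "(\<Sum>j<d. (A * B) $$ (i mod d, j) * u (d * (i div d) + j)) =
			(\<Sum>j<d. \<Sum>l<d. A $$ (i mod d, l) * (B $$ (l, j) * u (d * (i div d) + j)))"
		using d A B by (intro sum.cong)
			(auto simp: scalar_prod_def sum_distrib_right mult.assoc atLeast0LessThan intro!: sum.cong)
	also have "... = (\<Sum>l<d. \<Sum>j<d. A $$ (i mod d, l) * (B $$ (l, j) * u (d * (i div d) + j)))"
		by (rule sum.swap)
	also have "... = (\<Sum>l<d. A $$ (i mod d, l) * (\<Sum>j<d. B $$ ((d * (i div d) + l) mod d, j) *
			u (d * ((d * (i div d) + l) div d) + j)))"
		using d by (intro sum.cong) (auto simp: sum_distrib_left)
	finally show "Rep_endo (opr d (A * B)) u i = Rep_endo (opr d A * opr d B) u i"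
		by (simp add: op_rep)
qed

text \<open>Applied to the indicator sequence of \<open>j\<close>, the operator returns column
  \<open>j\<close> of its matrix in the first block.\<close>

lemma opr_inj:
	assumes "opr d A = opr d B" "A : sqm d" "B : sqm d"
	shows "A = B"
proof (rule eq_matI)
	fix i j assume "i < dim_row B" "j < dim_col B"
	hence ij: "i < d" "j < d" using assms(3) by auto
	have "Rep_endo (opr d A) (%l. if l = j then 1 else 0) i = Rep_endo (opr d B) (%l. if l = j then 1 else 0) i"
		by (simp add: assms(1))
	thus "A $$ (i, j) = B $$ (i, j)" using ij by (simp add: op_rep if_distrib cong: if_cong)
qed (use assms in auto)

lemma opr_scalar_commute: "opr d A * op_scalar c = op_scalar c * opr d A"
	by (intro op_eqI) (auto simp: op_rep sum_distrib_left mult.left_commute intro!: sum.cong)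

lemma opr_pow: "d > 0 ==> A : sqm d ==> opr d (A ^m k) = opr d A ^ k"
	by (induction k) (simp_all add: opr_mult power_commutes carrier_matD)

section \<open>Matrix algebra\<close>

lemma mma:
	"dim_col A = dim_row B ==> dim_col B = dim_row C ==> (A * B) * C = A * (B * (C :: 'a::semiring_0 mat))"
	by (rule assoc_mult_mat[of A "dim_row A" "dim_row B" B "dim_row C" C "dim_col C"]) auto

text \<open>Products are normalised to the right by \<open>mma\<close>, so a relation
  \<open>A * B = D\<close> has to be usable inside \<open>A * (B * C)\<close>; this is its rewriting
  form.\<close>

lemma mms:
	"A * B = D ==> dim_col A = dim_row B ==> dim_col B = dim_row C ==> A * (B * C) = D * (C :: 'a::semiring_0 mat)"
	using mma by metis

lemma mat_one_mult: "dim_row A = d ==> idm d * A = (A :: 'a::semiring_1 mat)"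
	and mat_mult_one: "dim_col A = d ==> A * idm d = (A :: 'a::semiring_1 mat)"
	by (auto simp: left_mult_one_mat[of _ _ "dim_col A"] right_mult_one_mat[of _ "dim_row A"])

lemma mat_zero_mult: "dim_row A = c ==> zm r c * A = zm r (dim_col (A :: 'a::semiring_0 mat))"
	and mat_mult_zero: "dim_col A = r ==> A * zm r c = zm (dim_row (A :: 'a::semiring_0 mat)) c"
	by (auto simp: left_mult_zero_mat[of _ _ "dim_col A"] right_mult_zero_mat[of _ "dim_row A"])

lemma mat_mult_add:
	"dim_col A = dim_row B ==> dim_row B = dim_row C ==> dim_col B = dim_col C ==>
		A * (B + C) = A * B + A * (C :: 'a::semiring_0 mat)"
	by (rule mult_add_distrib_mat[of A "dim_row A" "dim_row B" B "dim_col B" C]) auto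

lemma mat_add_mult:
	"dim_col B = dim_row A ==> dim_row B = dim_row C ==> dim_col B = dim_col C ==>
		(B + C) * A = B * A + C * (A :: 'a::semiring_0 mat)"
	by (rule add_mult_distrib_mat[of B "dim_row B" "dim_col B" C A "dim_col A"]) auto

lemma mat_mult_minus:
	"dim_col A = dim_row B ==> dim_row B = dim_row C ==> dim_col B = dim_col C ==>
		A * (B - C) = A * B - A * (C :: 'a::ring mat)"
	by (rule mult_minus_distrib_mat[of A "dim_row A" "dim_row B" B "dim_col B" C]) auto

lemma mat_minus_mult:
	"dim_col B = dim_row A ==> dim_row B = dim_row C ==> dim_col B = dim_col C ==>
		(B - C) * A = B * A - C * (A :: 'a::ring mat)"
	by (rule minus_mult_distrib_mat[of B "dim_row B" "dim_col B" C A "dim_col A"]) auto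

lemma mmsm: "dim_col A = dim_row B ==> A * (c \<cdot> B) = c \<cdot> (A * (B :: 'a::comm_semiring_0 mat))"
	by (rule mult_smult_distrib[of A "dim_row A" "dim_row B" B "dim_col B"]) auto

lemma msm: "dim_col A = dim_row B ==> (c \<cdot> A) * B = c \<cdot> (A * (B :: 'a::comm_semiring_0 mat))"
	by (rule mult_smult_assoc_mat[of A "dim_row A" "dim_row B" B "dim_col B"]) auto

lemma mat_minus_zero: "dim_row A = r ==> dim_col A = c ==> A - zm r c = (A :: 'a::group_add mat)"
	by auto

lemma mat_add_zero: "dim_row A = r ==> dim_col A = c ==> A + zm r c = (A :: 'a::monoid_add mat)"
	and mat_zero_add: "dim_row A = r ==> dim_col A = c ==> zm r c + A = (A :: 'a::monoid_add mat)"
	by auto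

lemma mat_add_assoc:
	"dim_row A = dim_row B ==> dim_col A = dim_col B ==> dim_row B = dim_row C ==> dim_col B = dim_col C ==>
		A + B + C = A + (B + (C :: 'a::ring mat))"
	by (rule assoc_add_mat[of A "dim_row A" "dim_col A"]) auto

lemma mat_minus_self: "A - A = zm (dim_row A) (dim_col (A :: 'a::group_add mat))"
	by auto

lemmas mrs = mma mat_one_mult mat_mult_one mat_zero_mult mat_mult_zero
	mat_mult_add mat_add_mult mat_mult_minus mat_minus_mult mmsm msm
	mat_minus_zero mat_add_zero mat_zero_add

lemma pow_intw:
	assumes "P * A = B * P" "A : sqm d" "B : sqm e" "P : carrier_mat e d"
	shows "P * (A ^m k) = B ^m k * (P :: 'a::comm_ring_1 mat)"
proof (induction k)
	case (Suc k)
	have "P * (A ^m k * A) = (P * A ^m k) * A"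
		using assms by (simp add: mma)
	also have "... = B ^m k * (P * A)"
		using assms by (simp add: Suc.IH mma)
	also have "... = (B ^m k * B) * P"
		using assms by (simp add: mma)
	finally show ?case by simp
qed (use assms in "simp add: mrs")

subsection \<open>Inclusions and projections of a direct sum\<close>

definition inl_mat :: "nat => nat => 'a::{zero,one} mat" where
	"inl_mat d e = mat (d + e) d (%(i, j). if i = j then 1 else 0)"

definition inr_mat :: "nat => nat => 'a::{zero,one} mat" where
	"inr_mat d e = mat (d + e) e (%(i, j). if i = d + j then 1 else 0)"

definition prl_mat :: "nat => nat => 'a::{zero,one} mat" where
	"prl_mat d e = mat d (d + e) (%(i, j). if i = j then 1 else 0)"

definition prr_mat :: "nat => nat => 'a::{zero,one} mat" where
	"prr_mat d e = mat e (d + e) (%(i, j). if j = d + i then 1 else 0)"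

lemmas sum_mat_defs = inl_mat_def inr_mat_def prl_mat_def prr_mat_def

lemma sum_mat_dim [simp]:
	"dim_row (inl_mat d e) = d + e" "dim_col (inl_mat d e) = d"
	"dim_row (inr_mat d e) = d + e" "dim_col (inr_mat d e) = e"
	"dim_row (prl_mat d e) = d" "dim_col (prl_mat d e) = d + e"
	"dim_row (prr_mat d e) = e" "dim_col (prr_mat d e) = d + e"
	by (simp_all add: sum_mat_defs)

lemma sum_mat_carrier [simp]:
	"inl_mat d e : carrier_mat (d + e) d" "inr_mat d e : carrier_mat (d + e) e"
	"prl_mat d e : carrier_mat d (d + e)" "prr_mat d e : carrier_mat e (d + e)"
	by auto

lemma if_mult_distrib: "(if b then x else y) * z = (if b then x * z else y * (z :: 'a::semiring_0))"
	"z * (if b then x else y) = (if b then z * x else z * y)"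
	by auto

lemma smat_simps [simp]:
	"prl_mat d e * inl_mat d e = (idm d :: 'a::comm_ring_1 mat)"
	"prr_mat d e * inr_mat d e = (idm e :: 'a::comm_ring_1 mat)"
	"prl_mat d e * inr_mat d e = (zm d e :: 'a::comm_ring_1 mat)"
	"prr_mat d e * inl_mat d e = (zm e d :: 'a::comm_ring_1 mat)"
	"inl_mat d e * prl_mat d e + inr_mat d e * prr_mat d e = (idm (d + e) :: 'a::comm_ring_1 mat)"
proof -
	show "prl_mat d e * inl_mat d e = (idm d :: 'a mat)"
		by (rule eq_matI) (auto simp: sum_mat_defs scalar_prod_def if_mult_distrib cong: if_cong)
	show "prr_mat d e * inr_mat d e = (idm e :: 'a mat)"
		by (rule eq_matI) (auto simp: sum_mat_defs scalar_prod_def if_mult_distrib cong: if_cong)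
	show "prl_mat d e * inr_mat d e = (zm d e :: 'a mat)"
		by (rule eq_matI) (auto simp: sum_mat_defs scalar_prod_def if_mult_distrib cong: if_cong)
	show "prr_mat d e * inl_mat d e = (zm e d :: 'a mat)"
		by (rule eq_matI) (auto simp: sum_mat_defs scalar_prod_def if_mult_distrib cong: if_cong)
	show "inl_mat d e * prl_mat d e + inr_mat d e * prr_mat d e = (idm (d + e) :: 'a mat)"
	proof (rule eq_matI)
		fix i j assume "i < dim_row (idm (d + e) :: 'a mat)" "j < dim_col (idm (d + e) :: 'a mat)"
		hence ij: "i < d + e" "j < d + e" by auto
		have 1: "(inl_mat d e * prl_mat d e :: 'a mat) $$ (i, j) = (if i = j & i < d then 1 else 0)"
			using ij by (auto simp: sum_mat_defs scalar_prod_def if_mult_distrib cong: if_cong)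
		have "(inr_mat d e * prr_mat d e :: 'a mat) $$ (i, j) =
				(\<Sum>k = 0..<e. (if i = d + k then 1 else 0) * (if j = d + k then 1 else 0))"
			using ij by (simp add: sum_mat_defs scalar_prod_def)
		\<comment> \<open>The condition \<open>i = d + k\<close> becomes \<open>k = i - d\<close>, so that
		  the sum has a single index to evaluate; the guard \<open>d \<le> i\<close> compensates for
		  truncated subtraction.\<close>
		also have "... = (\<Sum>k = 0..<e. if k = i - d then if i = j & d \<le> i then 1 else 0 else 0)"
			by (intro sum.cong) auto
		finally have "(inr_mat d e * prr_mat d e :: 'a mat) $$ (i, j) = (if i = j & d \<le> i then 1 else 0)"
			using ij by auto
		with 1 show "(inl_mat d e * prl_mat d e + inr_mat d e * prr_mat d e :: 'a mat) $$ (i, j) = idm (d + e) $$ (i, j)"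
			using ij by (auto simp del: index_mult_mat(1))
	qed auto
qed

abbreviation diag_block :: "'a::zero mat => 'a mat => 'a mat" where
	"diag_block A B == four_block_mat A (zm (dim_row A) (dim_col B)) (zm (dim_row B) (dim_col A)) B"

text \<open>Writing the block matrix with inclusions and projections reduces later statements on
  direct sums to the five relations \<open>smat_simps\<close>.\<close>

lemma diag_block_eq:
	assumes "A : sqm d" "B : sqm e"
	shows "four_block_mat A (zm d e) (zm e d) B =
		inl_mat d e * (A * prl_mat d e) + inr_mat d e * (B * (prr_mat d e :: 'a::comm_ring_1 mat))"
proof (rule eq_matI)
	fix i j
	assume "i < dim_row (inl_mat d e * (A * prl_mat d e) + inr_mat d e * (B * (prr_mat d e :: 'a mat)))"
		"j < dim_col (inl_mat d e * (A * prl_mat d e) + inr_mat d e * (B * (prr_mat d e :: 'a mat)))"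
	hence ij: "i < d + e" "j < d + e" by auto
	have A: "(A * prl_mat d e) $$ (k, j) = (if j < d then A $$ (k, j) else 0)" if "k < d" for k
		using that assms ij by (auto simp: sum_mat_defs scalar_prod_def if_mult_distrib cong: if_cong)
	have "(B * prr_mat d e) $$ (k, j) = (\<Sum>l = 0..<e. if j = d + l then B $$ (k, l) else 0)" if "k < e" for k
		using that assms ij by (auto simp: sum_mat_defs scalar_prod_def if_mult_distrib cong: if_cong)
	also have "... k = (\<Sum>l = 0..<e. if l = j - d then if d \<le> j then B $$ (k, l) else 0 else 0)" for k
		by (intro sum.cong) auto
	finally have B: "(B * prr_mat d e) $$ (k, j) = (if d \<le> j then B $$ (k, j - d) else 0)" if "k < e" for k
		using that ij by (auto split: if_splits)
	have "(inl_mat d e * (A * prl_mat d e)) $$ (i, j) = (\<Sum>k = 0..<d. if i = k then (A * prl_mat d e) $$ (k, j) else 0)"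
		using ij assms by (auto simp: inl_mat_def scalar_prod_def if_mult_distrib cong: if_cong intro!: sum.cong)
	also have "... = (if i < d & j < d then A $$ (i, j) else 0)"
		using A by simp
	finally have 1: "(inl_mat d e * (A * prl_mat d e)) $$ (i, j) = ..." .
	have "(inr_mat d e * (B * prr_mat d e)) $$ (i, j) = (\<Sum>k = 0..<e. if i = d + k then (B * prr_mat d e) $$ (k, j) else 0)"
		using ij assms by (auto simp: inr_mat_def scalar_prod_def if_mult_distrib cong: if_cong intro!: sum.cong)
	also have "... = (\<Sum>k = 0..<e. if k = i - d then if d \<le> i then (B * prr_mat d e) $$ (k, j) else 0 else 0)"
		by (intro sum.cong) auto
	also have "... = (if d \<le> i & d \<le> j then B $$ (i - d, j - d) else 0)"
		using B ij by auto
	finally have 2: "(inr_mat d e * (B * prr_mat d e)) $$ (i, j) = ..." .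
	show "four_block_mat A (zm d e) (zm e d) B $$ (i, j) =
			(inl_mat d e * (A * prl_mat d e) + inr_mat d e * (B * prr_mat d e)) $$ (i, j)"
		using 1 2 ij assms by (subst index_add_mat) (auto simp del: index_mult_mat(1))
qed (use assms in auto)

lemma diag_block_simps:
	fixes A B :: "'a::comm_ring_1 mat"
	assumes "A : sqm d" "B : sqm e"
	defines "D == four_block_mat A (zm d e) (zm e d) B"
	shows "inl_mat d e * A = D * inl_mat d e" "inr_mat d e * B = D * inr_mat d e"
		"prl_mat d e * D = A * prl_mat d e" "prr_mat d e * D = B * prr_mat d e"
	unfolding D_def diag_block_eq[OF assms(1,2)] using assms(1,2)
	by (simp_all add: mrs mms[OF smat_simps(1)] mms[OF smat_simps(2)]
			mms[OF smat_simps(3)] mms[OF smat_simps(4)])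

subsection \<open>Complements of split subspaces\<close>

text \<open>If \<open>v\<close> has the nonzero entry \<open>v\<^sub>i\<close>, then \<open>R = 1 - v e\<^sub>i\<^sup>T / v\<^sub>i\<close> and
  \<open>1 - v ph\<close> are projections with the same kernel, and dropping the \<open>i\<close>-th coordinate is
  invertible on the image of \<open>R\<close>.\<close>

lemma line_complement:
	fixes v ph :: "'a::field mat"
	assumes v: "v : carrier_mat d 1" and ph: "ph : carrier_mat 1 d" and one: "ph * v = idm 1"
	obtains P Q where "0 < d" "P : carrier_mat d (d - 1)" "Q : carrier_mat (d - 1) d"
		"Q * P = idm (d - 1)" "v * ph + P * Q = idm d"
proof -
	have [simp]: "dim_row v = d" "dim_col v = 1" "dim_row ph = 1" "dim_col ph = d"
		using v ph by auto
	have "\<exists>i<d. v $$ (i, 0) ~= 0"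
	proof (rule ccontr)
		assume "\<not> (\<exists>i<d. v $$ (i, 0) ~= 0)"
		hence "(ph * v) $$ (0, 0) = 0" by (auto simp: scalar_prod_def intro!: sum.neutral)
		thus False by (simp add: one)
	qed
	then obtain i where i: "i < d" "v $$ (i, 0) ~= 0" by blast
	\<comment> \<open>\<open>s\<close> enumerates the coordinates other than \<open>i\<close>;
	  \<open>S\<close> and \<open>S'\<close> insert and delete them. The factor in \<open>e'\<close> is
	  chosen to make \<open>e' * v\<close> the identity.\<close>
	define s where "s j = (if j < i then j else Suc j)" for j
	define S :: "'a mat" where "S = mat d (d - 1) (%(r, j). if r = s j then 1 else 0)"
	define S' :: "'a mat" where "S' = mat (d - 1) d (%(j, r). if r = s j then 1 else 0)"
	define e :: "'a mat" where "e = mat d 1 (%(r, j). if r = i then 1 else 0)"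
	define e' :: "'a mat" where "e' = mat 1 d (%(j, r). if r = i then inverse (v $$ (i, 0)) else 0)"
	have [simp]: "dim_row S = d" "dim_col S = d - 1" "dim_row S' = d - 1" "dim_col S' = d"
		"dim_row e = d" "dim_col e = 1" "dim_row e' = 1" "dim_col e' = d"
		by (auto simp: S_def S'_def e_def e'_def)
	have s_inj: "s j = s k \<longleftrightarrow> j = k" for j k by (auto simp: s_def split: if_splits)
	have s_less: "s j < d" if "j < d - 1" for j using that by (auto simp: s_def)
	have 1: "S' * S = idm (d - 1)"
		by (rule eq_matI) (auto simp: S_def S'_def scalar_prod_def if_mult_distrib s_inj s_less cong: if_cong)
	have e'S: "e' * S = zm 1 (d - 1)"
		by (rule eq_matI) (auto simp: S_def e'_def scalar_prod_def if_mult_distrib s_def cong: if_cong intro!: sum.neutral)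
	have e'v: "e' * v = idm 1"
		by (rule eq_matI) (use i in "auto simp: e'_def scalar_prod_def if_mult_distrib cong: if_cong")
	have SS': "S * S' = idm d - v $$ (i, 0) \<cdot> (e * e')"
	proof (rule eq_matI)
		fix r c assume "r < dim_row (idm d - v $$ (i, 0) \<cdot> (e * e'))" "c < dim_col (idm d - v $$ (i, 0) \<cdot> (e * e'))"
		hence rc: "r < d" "c < d" by auto
		have "(S * S') $$ (r, c) = (\<Sum>j = 0..<d - 1. (if r = s j then 1 else 0) * (if c = s j then 1 else 0))"
			using rc by (simp add: S_def S'_def scalar_prod_def)
		also have "... = (\<Sum>j = 0..<d - 1. if j = (if r < i then r else r - 1) then if r = c & r ~= i then 1 else 0 else 0)"
			by (intro sum.cong) (auto simp: s_def)
		also have "... = (if r = c & r ~= i then 1 else 0)"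
			using rc i by auto
		finally show "(S * S') $$ (r, c) = (idm d - v $$ (i, 0) \<cdot> (e * e')) $$ (r, c)"
			using rc i by (auto simp: e_def e'_def scalar_prod_def)
	qed auto
	define R where "R = idm d - v * e'"
	define B where "B = idm d - v * ph"
	have [simp]: "dim_row R = d" "dim_col R = d" "dim_row B = d" "dim_col B = d"
		by (simp_all add: R_def B_def)
	have "e' * R = zm 1 d"
		by (simp add: R_def mrs mms[OF e'v] mat_minus_self)
	hence SR: "S * (S' * R) = R"
		by (subst mms[OF SS']) (auto simp: mrs)
	have Rv: "R * v = zm d 1"
		by (simp add: R_def mrs e'v mat_minus_self)
	have RB: "R * B = R"
		by (simp add: B_def mrs mms[OF Rv])
	have "ph * R = ph - e'"
		by (simp add: R_def mrs mms[OF one])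
	hence "B * R = R - v * (ph - e')"
		by (simp add: B_def mrs)
	hence BR: "v * ph + B * R = idm d"
		by (intro eq_matI) (auto simp: R_def mrs)
	show ?thesis
	\<comment> \<open>\<open>R\<close> and \<open>B\<close> both kill \<open>v\<close>, whence
	  \<open>R * B = R\<close> and \<open>B * R = B\<close>. So one composite is
	  \<open>S' * R * S = S' * S\<close>, the identity, and the other is
	  \<open>B * S * S' * R = B * R\<close>, which is \<open>B\<close>.\<close>
	proof (rule that[of "B * S" "S' * R"])
		show "0 < d" using i by simp
		have "R * S = S"
			by (simp add: R_def mrs e'S)
		thus "S' * R * (B * S) = idm (d - 1)"
			by (simp add: mrs mms[OF RB] 1)
		show "v * ph + B * S * (S' * R) = idm d"
			by (simp add: mrs SR BR)
	qed auto
qed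

text \<open>Induction on \<open>m\<close>: a complement of the first \<open>m\<close> columns
  contains the last column, and \<open>line_complement\<close> splits it off there. The bound
  \<open>m \<le> d\<close> comes along because each splitting yields a positive dimension.\<close>

lemma split_complement:
	fixes P Q :: "'a::field mat"
	assumes "P : carrier_mat d m" "Q : carrier_mat m d" "Q * P = idm m"
	shows "m \<le> d & (\<exists>P' Q'. P' : carrier_mat d (d - m) & Q' : carrier_mat (d - m) d &
		Q' * P' = idm (d - m) & P * Q + P' * Q' = idm d)"
	using assms
proof (induction m arbitrary: P Q)
	case 0
	have "P * Q = zm d d"
		using 0 by (intro eq_matI) (auto simp: scalar_prod_def)
	hence "idm d : sqm d & idm d * idm d = (idm d :: 'a mat) & P * Q + idm d * idm d = idm d"
		by auto
	thus ?case by (intro conjI exI[of _ "idm d"]) auto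
next
	case (Suc m)
	have [simp]: "dim_row P = d" "dim_col P = m + 1" "dim_row Q = m + 1" "dim_col Q = d"
		using Suc.prems by auto
	have QP: "Q * P = idm (m + 1)" using Suc.prems by simp
	let ?P = "P * inl_mat m 1" and ?Q = "prl_mat m 1 * Q"
	define v where "v = P * inr_mat m 1"
	define ph where "ph = prr_mat m 1 * Q"
	have [simp]: "dim_row v = d" "dim_col v = 1" "dim_row ph = 1" "dim_col ph = d"
		by (simp_all add: v_def ph_def)
	have "?Q * ?P = idm m"
		by (simp add: mrs mms[OF QP])
	moreover have "?P : carrier_mat d m" "?Q : carrier_mat m d"
		by (rule carrier_matI; simp)+
	ultimately obtain P1 Q1 where md: "m \<le> d" and
		PQ1: "P1 : carrier_mat d (d - m)" "Q1 : carrier_mat (d - m) d" "Q1 * P1 = idm (d - m)"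
		"?P * ?Q + P1 * Q1 = idm d"
		using Suc.IH by blast
	have [simp]: "dim_row P1 = d" "dim_col P1 = d - m" "dim_row Q1 = d - m" "dim_col Q1 = d"
		using PQ1 by auto
	have "P1 * Q1 = (?P * ?Q + P1 * Q1) - ?P * ?Q"
		by (intro eq_matI) (auto simp del: index_mult_mat(1))
	hence eq: "P1 * Q1 = idm d - ?P * ?Q"
		by (simp only: PQ1(4))
	have P1v: "P1 * (Q1 * v) = v"
		by (simp add: mms[OF eq]) (simp add: v_def mrs mms[OF QP])
	have phv: "ph * v = idm 1"
		by (simp add: ph_def v_def mrs mms[OF QP])
	have phP1: "ph * (P1 * Q1) = ph"
	proof -
		have 0: "ph * ?P = zm 1 m"
			by (simp add: ph_def mrs mms[OF QP] del: One_nat_def)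
		have "ph * (P1 * Q1) = ph - ph * (?P * ?Q)"
			by (simp add: eq mat_mult_minus mat_mult_one)
		also have "ph * (?P * ?Q) = zm 1 d"
			by (subst mms[OF 0]) (simp_all add: mat_zero_mult)
		finally show ?thesis by (simp add: mat_minus_zero)
	qed
	have 1: "Q1 * v : carrier_mat (d - m) 1" and 2: "ph * P1 : carrier_mat 1 (d - m)"
		by (rule carrier_matI; simp)+
	\<comment> \<open>The last column \<open>v\<close> lies in the image of \<open>P1\<close>, so its
	  coordinates \<open>Q1 * v\<close> still pair to 1 with the restriction of
	  \<open>ph\<close>.\<close>
	have 3: "(ph * P1) * (Q1 * v) = idm 1"
		by (simp add: mrs P1v phv)
	obtain P2 Q2 where PQ2: "0 < d - m" "P2 : carrier_mat (d - m) (d - m - 1)" "Q2 : carrier_mat (d - m - 1) (d - m)"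
		"Q2 * P2 = idm (d - m - 1)" "(Q1 * v) * (ph * P1) + P2 * Q2 = idm (d - m)"
		by (rule line_complement[OF 1 2 3])
	have [simp]: "dim_row P2 = d - m" "dim_col P2 = d - m - 1" "dim_row Q2 = d - m - 1" "dim_col Q2 = d - m"
		using PQ2 by auto
	have PQ: "P * Q = ?P * ?Q + v * ph"
	proof -
		have "P * Q = P * ((inl_mat m 1 * prl_mat m 1 + inr_mat m 1 * prr_mat m 1) * Q)"
			by (simp only: smat_simps) (simp add: mrs)
		also have "... = ?P * ?Q + v * ph"
			by (simp add: v_def ph_def mrs del: smat_simps(5))
		finally show ?thesis .
	qed
	have "P1 * (Q1 * (v * (ph * (P1 * Q1)))) = v * ph"
		using P1v by (simp add: phP1 mma[symmetric])
	hence "v * ph + P1 * (P2 * (Q2 * Q1)) = P1 * (((Q1 * v) * (ph * P1) + P2 * Q2) * Q1)"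
		by (simp add: mrs)
	also have "... = P1 * Q1"
		by (simp only: PQ2) (simp add: mrs)
	finally have fin: "v * ph + P1 * (P2 * (Q2 * Q1)) = P1 * Q1" .
	have "P * Q + (P1 * P2) * (Q2 * Q1) = ?P * ?Q + (v * ph + P1 * (P2 * (Q2 * Q1)))"
		unfolding PQ mma[of P1 P2 "Q2 * Q1", simplified] by (rule mat_add_assoc) simp_all
	also have "... = idm d"
		by (simp only: fin PQ1)
	finally have "P * Q + (P1 * P2) * (Q2 * Q1) = idm d" .
	moreover have "(Q2 * Q1) * (P1 * P2) = idm (d - Suc m)"
		using PQ2(4) by (simp add: mrs mms[OF PQ1(3)])
	moreover have "P1 * P2 : carrier_mat d (d - Suc m)" "Q2 * Q1 : carrier_mat (d - Suc m) d"
		by auto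
	ultimately show ?case using PQ2(1) by auto
qed

lemma inverse_mat_dim:
	fixes P Q :: "'a::field mat"
	assumes "P : carrier_mat e d" "Q : carrier_mat d e" "Q * P = idm d" "P * Q = idm e"
	shows "d = e"
	using split_complement[OF assms(1,2,3)] split_complement[OF assms(2,1,4)] by auto

section \<open>Spectral projections\<close>

text \<open>Entrywise, because a sum of matrices over an index set has no neutral element
  independent of the size.\<close>

definition lin_mat :: "nat => nat => 'i set => ('i => 'k) => ('i => 'k mat) => 'k::comm_ring_1 mat" where
	"lin_mat r c S f M = mat r c (%ij. \<Sum>a\<in>S. f a * M a $$ ij)"

lemma lin_mat_dim [simp]: "dim_row (lin_mat r c S f M) = r" "dim_col (lin_mat r c S f M) = c"
	by (simp_all add: lin_mat_def)

lemma lin_mat_cong: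
	"(!!a. a : S ==> M a = M' a) ==> lin_mat r c S f M = lin_mat r c S f M'"
	by (auto simp: lin_mat_def intro!: cong_mat sum.cong)

lemma mult_lin_mat:
	assumes B: "dim_col B = r" and M: "!!a. a : S ==> M a : carrier_mat r c"
	shows "B * lin_mat r c S f M = lin_mat (dim_row B) c S f (%a. B * M a)"
proof (rule eq_matI)
	have M': "dim_row (M a) = r" "dim_col (M a) = c" if "a : S" for a
		using M[OF that] by auto
	fix i j assume "i < dim_row (lin_mat (dim_row B) c S f (%a. B * M a))" "j < dim_col (lin_mat (dim_row B) c S f (%a. B * M a))"
	hence ij: "i < dim_row B" "j < c" by auto
	have "(B * lin_mat r c S f M) $$ (i, j) = (\<Sum>l = 0..<r. \<Sum>a\<in>S. f a * (B $$ (i, l) * M a $$ (l, j)))"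
		using ij B by (simp add: lin_mat_def scalar_prod_def sum_distrib_left mult.left_commute)
	also have "... = (\<Sum>a\<in>S. \<Sum>l = 0..<r. f a * (B $$ (i, l) * M a $$ (l, j)))"
		by (rule sum.swap)
	also have "... = (\<Sum>a\<in>S. f a * (B * M a) $$ (i, j))"
		using ij B M' by (intro sum.cong) (auto simp: scalar_prod_def sum_distrib_left)
	finally show "(B * lin_mat r c S f M) $$ (i, j) = lin_mat (dim_row B) c S f (%a. B * M a) $$ (i, j)"
		using ij by (simp add: lin_mat_def)
qed (use B in auto)

lemma lin_mat_mult:
	assumes B: "dim_row B = c" and M: "!!a. a : S ==> M a : carrier_mat r c"
	shows "lin_mat r c S f M * B = lin_mat r (dim_col B) S f (%a. M a * B)"
proof (rule eq_matI)
	have M': "dim_row (M a) = r" "dim_col (M a) = c" if "a : S" for a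
		using M[OF that] by auto
	fix i j assume "i < dim_row (lin_mat r (dim_col B) S f (%a. M a * B))" "j < dim_col (lin_mat r (dim_col B) S f (%a. M a * B))"
	hence ij: "i < r" "j < dim_col B" by auto
	have "(lin_mat r c S f M * B) $$ (i, j) = (\<Sum>l = 0..<c. \<Sum>a\<in>S. f a * (M a $$ (i, l) * B $$ (l, j)))"
		using ij B by (simp add: lin_mat_def scalar_prod_def sum_distrib_right mult.assoc)
	also have "... = (\<Sum>a\<in>S. \<Sum>l = 0..<c. f a * (M a $$ (i, l) * B $$ (l, j)))"
		by (rule sum.swap)
	also have "... = (\<Sum>a\<in>S. f a * (M a * B) $$ (i, j))"
		using ij B M' by (intro sum.cong) (auto simp: scalar_prod_def sum_distrib_left)
	finally show "(lin_mat r c S f M * B) $$ (i, j) = lin_mat r (dim_col B) S f (%a. M a * B) $$ (i, j)"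
		using ij by (simp add: lin_mat_def)
qed (use B in auto)

section \<open>Eigenprojections of a matrix whose order divides \<open>m\<close>\<close>

locale root_of_unity =
	fixes z :: "'k::field" and m :: nat
	assumes m_pos: "m > 0" and m_nz: "of_nat m ~= (0 :: 'k)" and prim: "primitive_root_of_unity m z"
begin

lemma z_pow_m [simp]: "z ^ m = 1"
	using prim by (simp add: primitive_root_of_unity_def)

lemma z_nz [simp]: "z ~= 0"
	using z_pow_m m_pos by (metis power_0_left zero_neq_one less_numeral_extra(3))

lemma z_pow_mod: "z ^ (k mod m) = z ^ k"
proof -
	have "z ^ k = z ^ (m * (k div m) + k mod m)" by simp
	also have "... = z ^ (k mod m)" by (simp only: power_add power_mult z_pow_m) simp
	finally show ?thesis by simp
qed

lemma z_pow_eq_1: "z ^ k = 1 \<longleftrightarrow> k mod m = 0"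
proof
	assume "z ^ k = 1"
	hence "z ^ (k mod m) = 1" by (simp add: z_pow_mod)
	moreover have "k mod m < m" using m_pos by simp
	ultimately show "k mod m = 0"
		using prim unfolding primitive_root_of_unity_def by (metis neq0_conv)
next
	assume "k mod m = 0"
	thus "z ^ k = 1" using z_pow_mod[of k] by simp
qed

lemma z_pow_eq: "z ^ i = z ^ j \<longleftrightarrow> i mod m = j mod m"
proof (induction i j rule: linorder_wlog)
	case (le i j)
	have "z ^ i = z ^ j \<longleftrightarrow> z ^ (j - i) = 1"
		using le by (metis le_add_diff_inverse mult_cancel_left1 power_add power_not_zero z_nz)
	also have "... \<longleftrightarrow> i mod m = j mod m"
		using le by (metis mod_eq_dvd_iff_nat mod_0_imp_dvd dvd_imp_mod_0 z_pow_eq_1)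
	finally show ?case .
qed auto

text \<open>Orthogonality of characters: a geometric series in \<open>z^i / z^j\<close>, which
  vanishes unless the ratio is 1.\<close>

lemma root_sum:
	"(\<Sum>a<m. inverse z ^ (j * a) * z ^ (i * a)) = (if i mod m = j mod m then of_nat m else 0)"
proof -
	let ?w = "z ^ i * inverse (z ^ j)"
	have w: "?w ^ m = 1"
		by (metis (no_types) mult.commute power_mult power_mult_distrib power_one power_inverse z_pow_m inverse_1 mult_1)
	have 1: "?w = 1 \<longleftrightarrow> i mod m = j mod m"
		by (metis z_pow_eq divide_inverse power_not_zero right_inverse_eq z_nz)
	have "(\<Sum>a<m. inverse z ^ (j * a) * z ^ (i * a)) = (\<Sum>a<m. ?w ^ a)"
		by (simp add: power_mult power_mult_distrib power_inverse mult.commute[of "inverse _"])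
	also have "... = (if i mod m = j mod m then of_nat m else 0)"
	proof (cases "?w = 1")
		case True
		thus ?thesis using 1 by simp
	next
		case False
		thus ?thesis using 1 w geometric_sum[OF False, of m] by simp
	qed
	finally show ?thesis .
qed

text \<open>A discrete Fourier transform of the powers of \<open>M\<close>: the projection onto the
  eigenspace of \<open>z ^ j\<close> when \<open>M ^m m\<close> is the identity. Being a polynomial
  in \<open>M\<close>, it is compatible with intertwiners.\<close>

definition proj :: "nat => nat => 'k mat => 'k mat" where
	"proj d j M = lin_mat d d {..<m} (%a. inverse z ^ (j * a) / of_nat m) (%a. M ^m a)"

lemma proj_dim [simp]: "dim_row (proj d j M) = d" "dim_col (proj d j M) = d"
	by (simp_all add: proj_def)

lemma root_sum': "(\<Sum>a<m. inverse z ^ (j * a) / of_nat m * z ^ (i * a)) = (if i mod m = j mod m then 1 else 0)"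
proof -
	have "(\<Sum>a<m. inverse z ^ (j * a) / of_nat m * z ^ (i * a)) = (\<Sum>a<m. inverse z ^ (j * a) * z ^ (i * a)) / of_nat m"
		by (simp add: sum_divide_distrib)
	thus ?thesis using m_nz by (simp add: root_sum)
qed

lemma root_sum'_mult:
	"(\<Sum>a<m. inverse z ^ (j * a) / of_nat m * (z ^ (i * a) * x)) = (if i mod m = j mod m then x else 0)"
	by (simp only: mult.assoc[symmetric] sum_distrib_right[symmetric] root_sum') simp

lemma proj_mult_eigen:
	assumes "M : sqm d" "dim_row B = d" "M * B = z ^ i \<cdot> B"
	shows "proj d j M * B = (if i mod m = j mod m then B else zm d (dim_col B))"
proof -
	have pow: "M ^m a * B = z ^ (i * a) \<cdot> B" for a
	proof (induction a)
		case (Suc a)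
		have "M ^m Suc a * B = z ^ i \<cdot> (M ^m a * B)"
			using assms by (simp add: mrs)
		thus ?case by (auto simp: Suc.IH power_add mult.assoc)
	qed (use assms in "auto simp: mrs")
	have "proj d j M * B = lin_mat d (dim_col B) {..<m} (%a. inverse z ^ (j * a) / of_nat m) (%a. z ^ (i * a) \<cdot> B)"
		unfolding proj_def using assms by (subst lin_mat_mult) (auto simp: pow)
	also have "... = (if i mod m = j mod m then B else zm d (dim_col B))"
		using assms(2) by (intro eq_matI) (auto simp: lin_mat_def root_sum'_mult simp del: times_divide_eq_left split: if_splits)
	finally show ?thesis .
qed

lemma eigen_mult_proj:
	assumes "M : sqm d" "dim_col B = d" "B * M = z ^ i \<cdot> B"
	shows "B * proj d j M = (if i mod m = j mod m then B else zm (dim_row B) d)"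
proof -
	have pow: "B * M ^m a = z ^ (i * a) \<cdot> B" for a
	proof (induction a)
		case (Suc a)
		have "B * M ^m Suc a = z ^ (i * a) \<cdot> (B * M)"
			using assms Suc.IH by (simp add: mrs mma[symmetric])
		thus ?case by (auto simp: assms(3) power_add)
	qed (use assms in "auto simp: mrs")
	have "B * proj d j M = lin_mat (dim_row B) d {..<m} (%a. inverse z ^ (j * a) / of_nat m) (%a. z ^ (i * a) \<cdot> B)"
		unfolding proj_def using assms by (subst mult_lin_mat) (auto simp: pow)
	also have "... = (if i mod m = j mod m then B else zm (dim_row B) d)"
		using assms(2) by (intro eq_matI) (auto simp: lin_mat_def root_sum'_mult simp del: times_divide_eq_left split: if_splits)
	finally show ?thesis .
qed

lemma sum_shift_period:
	assumes "g m = g 0"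
	shows "(\<Sum>a<m. g (Suc a)) = (\<Sum>a<m. (g a :: 'k))"
	using sum.lessThan_Suc_shift[of g m] sum.lessThan_Suc[of g m] assms by simp

text \<open>Multiplication by \<open>M\<close> shifts the summation index, and the summand is
  periodic because the orders of \<open>M\<close> and \<open>z\<close> divide
  \<open>m\<close>.\<close>

lemma proj_eigen_aux:
	assumes "M : sqm d" "M ^m m = idm d"
	shows "lin_mat d d {..<m} (%a. inverse z ^ (j * a) / of_nat m) (%a. M ^m Suc a) = z ^ j \<cdot> proj d j M"
proof (rule eq_matI)
	fix i l assume "i < dim_row (z ^ j \<cdot> proj d j M)" "l < dim_col (z ^ j \<cdot> proj d j M)"
	hence il: "i < d" "l < d" by auto
	define g where "g a = inverse z ^ (j * a) / of_nat m * (M ^m a) $$ (i, l)" for a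
	have "inverse z ^ (j * m) = 1"
		by (metis mult.commute power_mult power_inverse z_pow_m inverse_1 power_one)
	hence "g m = g 0" using assms by (simp add: g_def)
	have "(\<Sum>a<m. inverse z ^ (j * a) / of_nat m * (M ^m Suc a) $$ (i, l)) = (\<Sum>a<m. z ^ j * g (Suc a))"
		by (intro sum.cong) (auto simp: g_def power_add power_inverse field_simps simp del: pow_mat.simps)
	also have "... = z ^ j * (\<Sum>a<m. g a)"
		unfolding sum_distrib_left[symmetric] using sum_shift_period[OF \<open>g m = g 0\<close>] by simp
	finally show "lin_mat d d {..<m} (%a. inverse z ^ (j * a) / of_nat m) (%a. M ^m Suc a) $$ (i, l) =
			(z ^ j \<cdot> proj d j M) $$ (i, l)"
		using il by (simp add: lin_mat_def proj_def g_def del: pow_mat.simps)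
qed auto

lemma mult_proj:
	assumes "M : sqm d" "M ^m m = idm d"
	shows "M * proj d j M = z ^ j \<cdot> proj d j M"
proof -
	have "M * M ^m a = M ^m a * M" for a
		using pow_intw[of M M M] assms by simp
	hence "M * proj d j M = lin_mat d d {..<m} (%a. inverse z ^ (j * a) / of_nat m) (%a. M ^m Suc a)"
		unfolding proj_def using assms by (subst mult_lin_mat) auto
	thus ?thesis by (simp only: proj_eigen_aux[OF assms])
qed

lemma proj_mult:
	assumes "M : sqm d" "M ^m m = idm d"
	shows "proj d j M * M = z ^ j \<cdot> proj d j M"
proof -
	have "proj d j M * M = lin_mat d d {..<m} (%a. inverse z ^ (j * a) / of_nat m) (%a. M ^m Suc a)"
		unfolding proj_def using assms by (subst lin_mat_mult) auto
	thus ?thesis by (simp only: proj_eigen_aux[OF assms])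
qed

lemma proj_intertwine:
	assumes "P * A = B * P" "A : sqm d" "B : sqm e" "P : carrier_mat e d"
	shows "P * proj d j A = proj e j B * P"
	unfolding proj_def using assms
	by (subst mult_lin_mat, simp, simp, subst lin_mat_mult, simp, simp)
		 (simp add: pow_intw[OF assms])

text \<open>The projections add up to the identity: summing over \<open>j\<close> first,
  orthogonality leaves only the power \<open>a = 0\<close>.\<close>

lemma proj_complete:
	assumes "M : sqm d" "dim_row B = d" "i < d" "l < dim_col B"
	shows "B $$ (i, l) = (\<Sum>j<m. (proj d j M * B) $$ (i, l))"
proof -
	have "(proj d j M * B) $$ (i, l) = (\<Sum>a<m. inverse z ^ (j * a) / of_nat m * (M ^m a * B) $$ (i, l))" for j
		unfolding proj_def using assms by (subst lin_mat_mult) (auto simp: lin_mat_def)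
	hence "(\<Sum>j<m. (proj d j M * B) $$ (i, l)) =
			(\<Sum>j<m. \<Sum>a<m. inverse z ^ (j * a) / of_nat m * (M ^m a * B) $$ (i, l))"
		by simp
	also have "... = (\<Sum>a<m. \<Sum>j<m. inverse z ^ (a * j) / of_nat m * z ^ (0 * j) * (M ^m a * B) $$ (i, l))"
		by (subst sum.swap) (simp add: mult.commute)
	also have "... = (\<Sum>a<m. (if 0 mod m = a mod m then 1 else 0) * (M ^m a * B) $$ (i, l))"
		by (simp only: sum_distrib_right[symmetric] root_sum')
	also have "... = (\<Sum>a<m. if a = 0 then B $$ (i, l) else 0)"
		using assms by (intro sum.cong) (auto simp: mrs)
	also have "... = B $$ (i, l)" using m_pos by simp
	finally show ?thesis by simp
qed

lemma proj_exhaust: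
	assumes "M : sqm d" "B : carrier_mat d e" "B ~= zm d e"
	obtains j where "j < m" "proj d j M * B ~= zm d e"
proof -
	have False if "!!j. j < m ==> proj d j M * B = zm d e"
	proof -
		have "B $$ (i, l) = 0" if "i < d" "l < e" for i l
			using proj_complete[of M d B i l] assms that \<open>!!j. j < m ==> proj d j M * B = zm d e\<close> by auto
		hence "B = zm d e" using assms by (intro eq_matI) auto
		thus False using assms by simp
	qed
	thus ?thesis using that by blast
qed

end

definition diagm :: "nat => (nat => 'a) => 'a::zero mat" where
	"diagm d f = mat d d (%(i, j). if i = j then f i else 0)"

lemma diagm_dim [simp]: "dim_row (diagm d f) = d" "dim_col (diagm d f) = d"
	by (simp_all add: diagm_def)

lemma diagm_carrier [simp]: "diagm d f : sqm d"
	by auto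

lemma diagm_mult: "diagm d f * diagm d g = diagm d (%i. f i * (g i :: 'a::comm_ring_1))"
	by (rule eq_matI) (auto simp: diagm_def scalar_prod_def if_mult_distrib cong: if_cong)

lemma diagm_one: "diagm d (%_. 1) = idm d"
	by (rule eq_matI) (auto simp: diagm_def)

lemma diagm_cong: "(!!i. i < d ==> f i = g i) ==> diagm d f = diagm d g"
	by (rule eq_matI) (auto simp: diagm_def)

lemma diagm_pow: "diagm d f ^m k = diagm d (%i. f i ^ k :: 'a::comm_ring_1)"
	by (induction k) (simp_all add: diagm_one diagm_mult mult.commute)

lemma diagm_smult: "c \<cdot> diagm d f = diagm d (%i. c * f i :: 'a::comm_ring_1)"
	by (rule eq_matI) (auto simp: diagm_def)

lemma (in root_of_unity) proj_diagm:
	"proj d j (diagm d (%i. z ^ f i)) = diagm d (%i. if f i mod m = j mod m then 1 else 0)"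
proof (rule eq_matI)
	fix i l assume "i < dim_row (diagm d (%i. if f i mod m = j mod m then 1 else 0 :: 'k))"
		"l < dim_col (diagm d (%i. if f i mod m = j mod m then 1 else 0 :: 'k))"
	hence "i < d" "l < d" by auto
	thus "proj d j (diagm d (%i. z ^ f i)) $$ (i, l) = diagm d (%i. if f i mod m = j mod m then 1 else 0) $$ (i, l)"
		using root_sum'[of j "f i"]
		by (cases "i = l") (simp_all add: proj_def diagm_pow lin_mat_def, simp_all add: diagm_def power_mult)
qed auto

subsection \<open>Characteristic polynomials\<close>

lemma char_poly_diag_block:
	fixes A B :: "'a::field mat"
	assumes "A : sqm d" "B : sqm e"
	shows "char_poly (four_block_mat A (zm d e) (zm e d) B) = char_poly A * char_poly B"
proof -
	have "char_poly_matrix (four_block_mat A (zm d e) (zm e d) B) =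
			four_block_mat (char_poly_matrix A) (zm d e) (zm e d) (char_poly_matrix B)"
		unfolding char_poly_matrix_def using assms by (intro eq_matI) auto
	thus ?thesis
		unfolding char_poly_def using assms by (simp add: det_four_block_mat_lower_left_zero[of _ d _ e])
qed

lemma char_poly_diagm: "char_poly (diagm d f) = (\<Prod>i<d. [:- f i, 1 :: 'a::field:])"
proof -
	have "char_poly (diagm d f) = (\<Prod>a\<leftarrow>diag_mat (diagm d f). [:- a, 1:])"
		by (rule char_poly_upper_triangular) (auto simp: diagm_def)
	also have "... = (\<Prod>i\<leftarrow>[0..<d]. [:- f i, 1:])"
		by (simp add: diag_mat_def o_def) (rule arg_cong[of _ _ prod_list], auto simp: diagm_def)
	finally show ?thesis by (simp add: prod.list_conv_set_nth atLeast0LessThan)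
qed

section \<open>Representations of the product of a cyclic and a dihedral group\<close>

text \<open>A tuple \<open>(d, Z, T, W)\<close> of matrices of size \<open>d\<close> is a representation of
  \<open>\<langle>z, t, w | z\<^sup>N = t\<^sup>2 = w\<^sup>2\<^sup>n = 1, wtw = t, zt = tz, zw = wz\<rangle>\<close>.
  For odd \<open>N\<close>, both algebras in question are generated by such elements \<open>z\<close>, \<open>t\<close>, \<open>w\<close>.\<close>

type_synonym 'k trip = "nat \<times> 'k mat \<times> 'k mat \<times> 'k mat"

abbreviation tdim :: "'k trip => nat" where "tdim X == fst X"
abbreviation tZ :: "'k trip => 'k mat" where "tZ X == fst (snd X)"
abbreviation tT :: "'k trip => 'k mat" where "tT X == fst (snd (snd X))"
abbreviation tW :: "'k trip => 'k mat" where "tW X == snd (snd (snd X))"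

definition tcarrier :: "'k trip set" where
	"tcarrier = {X. tZ X : carrier_mat (tdim X) (tdim X) & tT X : carrier_mat (tdim X) (tdim X) &
		 tW X : carrier_mat (tdim X) (tdim X)}"

lemma tcarrierD:
	assumes "X : tcarrier"
	shows "tZ X : carrier_mat (tdim X) (tdim X)" "tT X : carrier_mat (tdim X) (tdim X)"
		"tW X : carrier_mat (tdim X) (tdim X)"
		"dim_row (tZ X) = tdim X" "dim_col (tZ X) = tdim X" "dim_row (tT X) = tdim X"
		"dim_col (tT X) = tdim X" "dim_row (tW X) = tdim X" "dim_col (tW X) = tdim X"
	using assms by (auto simp: tcarrier_def)

definition intertw :: "'k::field trip => 'k trip => 'k mat => bool" where
	"intertw X Y P \<longleftrightarrow> P : carrier_mat (tdim Y) (tdim X) &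
		 P * tZ X = tZ Y * P & P * tT X = tT Y * P & P * tW X = tW Y * P"

lemma intertwD:
	assumes "intertw X Y P"
	shows "P * tZ X = tZ Y * P" "P * tT X = tT Y * P" "P * tW X = tW Y * P"
		"P : carrier_mat (tdim Y) (tdim X)" "dim_row P = tdim Y" "dim_col P = tdim X"
	using assms by (auto simp: intertw_def)

definition tiso :: "'k::field trip => 'k trip => bool" where
	"tiso X Y \<longleftrightarrow> (\<exists>P Q. intertw X Y P & Q : carrier_mat (tdim X) (tdim Y) &
		 Q * P = idm (tdim X) & P * Q = idm (tdim Y))"

definition tsum :: "'k::field trip => 'k trip => 'k trip" where
	"tsum X Y = (let d = tdim X; e = tdim Y; B = (%A C. four_block_mat A (zm d e) (zm e d) C) in
		 (d + e, B (tZ X) (tZ Y), B (tT X) (tT Y), B (tW X) (tW Y)))"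

lemma tsum_carrier [simp]: "X : tcarrier ==> Y : tcarrier ==> tsum X Y : tcarrier"
	by (auto simp: tcarrier_def tsum_def Let_def)

lemma tdim_tsum [simp]: "tdim (tsum X Y) = tdim X + tdim Y"
	by (simp add: tsum_def Let_def)

lemma intertw_one: "X : tcarrier ==> intertw X X (idm (tdim X))"
	by (auto simp: intertw_def tcarrierD mrs)

lemma intertw_mult:
	assumes "intertw X Y P" "intertw Y U Q" "X : tcarrier" "Y : tcarrier" "U : tcarrier"
	shows "intertw X U (Q * P)"
	using assms intertwD[OF assms(1)] intertwD[OF assms(2)]
	by (auto simp: intertw_def tcarrierD mma mms[OF intertwD(1)]
			mms[OF intertwD(2)] mms[OF intertwD(3)])

lemma intertw_inverse:
	assumes "intertw X Y P" "Q : carrier_mat (tdim X) (tdim Y)" "Q * P = idm (tdim X)"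
		"P * Q = idm (tdim Y)" "X : tcarrier" "Y : tcarrier"
	shows "intertw Y X Q"
proof -
	note D = intertwD[OF assms(1)] tcarrierD[OF assms(5)] tcarrierD[OF assms(6)]
	have [simp]: "dim_row Q = tdim X" "dim_col Q = tdim Y" using assms(2) by auto
	have "Q * B = A * Q" if "P * A = B * P" "A : carrier_mat (tdim X) (tdim X)" "B : carrier_mat (tdim Y) (tdim Y)" for A B
	proof -
		have [simp]: "dim_row A = tdim X" "dim_col A = tdim X" "dim_row B = tdim Y" "dim_col B = tdim Y"
			using that by auto
		have "Q * B = Q * (B * (P * Q))" by (simp add: assms mrs)
		also have "... = Q * ((B * P) * Q)" by (simp add: D mma)
		also have "... = Q * (P * (A * Q))" by (simp add: that(1)[symmetric] D mma)
		also have "... = A * Q" by (subst mms[OF assms(3)]) (simp_all add: D mrs)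
		finally show ?thesis .
	qed
	thus ?thesis using D assms by (auto simp: intertw_def)
qed

lemma tisoI:
	"intertw X Y P ==> Q : carrier_mat (tdim X) (tdim Y) ==> Q * P = idm (tdim X) ==> P * Q = idm (tdim Y) ==> tiso X Y"
	unfolding tiso_def by blast

lemma tiso_refl: "X : tcarrier ==> tiso X X"
	by (rule tisoI[OF intertw_one, of X "idm (tdim X)"]) auto

lemma tiso_sym:
	assumes "tiso X Y" "X : tcarrier" "Y : tcarrier"
	shows "tiso Y X"
proof -
	from assms obtain P Q where PQ: "intertw X Y P" "Q : carrier_mat (tdim X) (tdim Y)"
		"Q * P = idm (tdim X)" "P * Q = idm (tdim Y)"
		by (auto simp: tiso_def)
	show ?thesis
		by (rule tisoI[OF intertw_inverse[OF PQ assms(2,3)] _ PQ(4,3)]) (use PQ in "simp add: intertwD")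
qed

lemma tiso_trans:
	assumes "tiso X Y" "tiso Y U" "X : tcarrier" "Y : tcarrier" "U : tcarrier"
	shows "tiso X U"
proof -
	from assms obtain P Q P' Q' where PQ: "intertw X Y P" "Q : carrier_mat (tdim X) (tdim Y)"
		"Q * P = idm (tdim X)" "P * Q = idm (tdim Y)"
		and PQ': "intertw Y U P'" "Q' : carrier_mat (tdim Y) (tdim U)"
		"Q' * P' = idm (tdim Y)" "P' * Q' = idm (tdim U)"
		by (auto simp: tiso_def)
	note D = intertwD(5,6)[OF PQ(1)] intertwD(5,6)[OF PQ'(1)] carrier_matD[OF PQ(2)] carrier_matD[OF PQ'(2)]
	show ?thesis
	proof (rule tisoI)
		show "intertw X U (P' * P)" using PQ PQ' assms intertw_mult by blast
		show "Q * Q' : carrier_mat (tdim X) (tdim U)" using PQ PQ' by auto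
		show "Q * Q' * (P' * P) = idm (tdim X)"
			by (simp add: D mrs mms[OF PQ'(3)] PQ)
		show "P' * P * (Q * Q') = idm (tdim U)"
			by (simp add: D mrs mms[OF PQ(4)] PQ')
	qed
qed

lemma intertw_sum_mat:
	assumes "X : tcarrier" "Y : tcarrier"
	shows "intertw X (tsum X Y) (inl_mat (tdim X) (tdim Y))" "intertw Y (tsum X Y) (inr_mat (tdim X) (tdim Y))"
		"intertw (tsum X Y) X (prl_mat (tdim X) (tdim Y))" "intertw (tsum X Y) Y (prr_mat (tdim X) (tdim Y))"
	using assms by (auto simp: intertw_def tsum_def Let_def tcarrierD diag_block_simps)

text \<open>The equivariant injections assemble to an equivariant bijection \<open>P\<close> from
  the direct sum, and the inverse of an equivariant bijection is equivariant.\<close>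

lemma tiso_tsumI:
	assumes "intertw X1 X P1" "intertw X2 X P2" "Q1 : carrier_mat (tdim X1) (tdim X)" "Q2 : carrier_mat (tdim X2) (tdim X)"
		and QP: "Q1 * P1 = idm (tdim X1)" "Q2 * P2 = idm (tdim X2)" "Q1 * P2 = zm (tdim X1) (tdim X2)"
			"Q2 * P1 = zm (tdim X2) (tdim X1)"
		and PQ: "P1 * Q1 + P2 * Q2 = idm (tdim X)"
		and X: "X : tcarrier" "X1 : tcarrier" "X2 : tcarrier"
	shows "tiso X (tsum X1 X2)"
proof -
	let ?d = "tdim X1" and ?e = "tdim X2"
	note D = intertwD[OF assms(1)] intertwD[OF assms(2)] carrier_matD[OF assms(3)] carrier_matD[OF assms(4)]
		tcarrierD[OF X(1)] tcarrierD[OF X(2)] tcarrierD[OF X(3)]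
	define P where "P = P1 * prl_mat ?d ?e + P2 * prr_mat ?d ?e"
	define Q where "Q = inl_mat ?d ?e * Q1 + inr_mat ?d ?e * Q2"
	have [simp]: "dim_row P = tdim X" "dim_col P = ?d + ?e" "dim_row Q = ?d + ?e" "dim_col Q = tdim X"
		by (simp_all add: P_def Q_def D)
	have i: "intertw (tsum X1 X2) X P"
	proof -
		have "P * B = A * P" if "P1 * B1 = A * P1" "P2 * B2 = A * P2" "prl_mat ?d ?e * B = B1 * prl_mat ?d ?e"
			"prr_mat ?d ?e * B = B2 * prr_mat ?d ?e" "A : carrier_mat (tdim X) (tdim X)" "B : carrier_mat (?d + ?e) (?d + ?e)"
			"B1 : carrier_mat ?d ?d" "B2 : carrier_mat ?e ?e" for A B B1 B2
		proof -
			note C = carrier_matD[OF that(5)] carrier_matD[OF that(6)] carrier_matD[OF that(7)] carrier_matD[OF that(8)]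
			have "P * B = P1 * (B1 * prl_mat ?d ?e) + P2 * (B2 * prr_mat ?d ?e)"
				by (simp add: P_def mrs D C that(3,4))
			also have "... = A * P"
				by (simp add: P_def mrs D C mms[OF that(1)] mms[OF that(2)])
			finally show ?thesis .
		qed
		note this[OF D(1) D(7) intertwD(1)[OF intertw_sum_mat(3)[OF X(2,3)]] intertwD(1)[OF intertw_sum_mat(4)[OF X(2,3)]]]
			this[OF D(2) D(8) intertwD(2)[OF intertw_sum_mat(3)[OF X(2,3)]] intertwD(2)[OF intertw_sum_mat(4)[OF X(2,3)]]]
			this[OF D(3) D(9) intertwD(3)[OF intertw_sum_mat(3)[OF X(2,3)]] intertwD(3)[OF intertw_sum_mat(4)[OF X(2,3)]]]
		thus ?thesis
			using tcarrierD[OF tsum_carrier[OF X(2,3)]] by (auto simp: intertw_def D)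
	qed
	have 1: "P * Q = idm (tdim X)"
		by (simp add: P_def Q_def D mrs mms[OF smat_simps(1)] mms[OF smat_simps(2)]
				mms[OF smat_simps(3)] mms[OF smat_simps(4)] PQ)
	have 2: "Q * P = idm (?d + ?e)"
		by (simp add: P_def Q_def D mrs mms[OF QP(1)] mms[OF QP(2)]
				mms[OF QP(3)] mms[OF QP(4)])
	have "tiso (tsum X1 X2) X"
		by (rule tisoI[OF i]) (use 1 2 in auto)
	thus ?thesis by (rule tiso_sym) (use X in auto)
qed

lemma tsum_cong:
	assumes "tiso X X'" "Y : tcarrier" "X : tcarrier" "X' : tcarrier"
	shows "tiso (tsum Y X) (tsum Y X')"
proof -
	from assms obtain P Q where PQ: "intertw X X' P" "Q : carrier_mat (tdim X) (tdim X')"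
		"Q * P = idm (tdim X)" "P * Q = idm (tdim X')"
		by (auto simp: tiso_def)
	note D = intertwD(5,6)[OF PQ(1)] carrier_matD[OF PQ(2)]
	note i = intertw_inverse[OF PQ assms(3,4)]
	let ?d = "tdim Y" and ?e = "tdim X"
	show ?thesis
	proof (rule tiso_tsumI)
		show "intertw Y (tsum Y X) (inl_mat ?d ?e)"
			using assms by (simp add: intertw_sum_mat)
		show "intertw X' (tsum Y X) (inr_mat ?d ?e * Q)"
			by (rule intertw_mult[OF i intertw_sum_mat(2)]) (use assms in auto)
		show "prl_mat ?d ?e : carrier_mat (tdim Y) (tdim (tsum Y X))" by simp
		show "P * prr_mat ?d ?e : carrier_mat (tdim X') (tdim (tsum Y X))"
			using PQ(1) by (intro carrier_matI) (auto simp: D)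
		show "prl_mat ?d ?e * inl_mat ?d ?e = (idm ?d :: 'a mat)" by simp
		show "P * prr_mat ?d ?e * (inr_mat ?d ?e * Q) = idm (tdim X')"
			by (simp add: mma D mms[OF smat_simps(2)] mat_one_mult PQ(4))
		show "prl_mat ?d ?e * (inr_mat ?d ?e * Q) = zm ?d (tdim X')"
			by (simp add: D mms[OF smat_simps(3)] mat_zero_mult)
		show "P * prr_mat ?d ?e * inl_mat ?d ?e = zm (tdim X') ?d"
			by (simp add: mma D mat_mult_zero)
		have "inr_mat ?d ?e * Q * (P * prr_mat ?d ?e) = inr_mat ?d ?e * prr_mat ?d ?e"
			by (simp add: mma D mms[OF PQ(3)] mat_one_mult)
		thus "inl_mat ?d ?e * prl_mat ?d ?e + inr_mat ?d ?e * Q * (P * prr_mat ?d ?e) = idm (tdim (tsum Y X))"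
			by simp
	qed (use assms in auto)
qed

text \<open>In \<open>Chi u e d\<close> the element \<open>z\<close> acts by \<open>om ^ u\<close>,
  \<open>t\<close> by 1 if \<open>e\<close> and else -1, \<open>w\<close> by -1 if \<open>d\<close>
  and else 1. In \<open>Psi u j\<close> the eigenvalues of \<open>w\<close> are
  \<open>ze ^ j\<close> and its inverse, and \<open>t\<close> exchanges the eigenvectors.\<close>

datatype irr = Chi nat bool bool | Psi nat nat

fun irr_z :: "irr => nat" where
	"irr_z (Chi u e d) = u" | "irr_z (Psi u j) = u"

abbreviation sgn_bit :: "bool => nat" where
	"sgn_bit e == if e then 0 else 1"

definition flip :: "'k::field mat" where
	"flip = mat 2 2 (%(i, j). if i = j then 0 else 1)"

locale dihedral =
	fixes N n :: nat and om ze :: "'k::field"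
	assumes N: "odd N" and n: "n \<ge> 2"
		and om: "root_of_unity om N" and ze: "root_of_unity ze (2 * n)" and two: "(2 :: 'k) ~= 0"
begin

sublocale Z: root_of_unity om N by (rule om)
sublocale W: root_of_unity ze "2 * n" by (rule ze)
sublocale T: root_of_unity "-1 :: 'k" 2
proof
	have "(- 1 :: 'k) ~= 1"
	proof
		assume "(- 1 :: 'k) = 1"
		hence "(1 + 1 :: 'k) = 0" by (metis add.right_inverse)
		thus False using two by simp
	qed
	thus "primitive_root_of_unity 2 (- 1 :: 'k)"
		by (auto simp: primitive_root_of_unity_def less_2_cases_iff)
qed (use two in auto)

lemma ze_n: "ze ^ n = -1"
proof -
	have "(ze ^ n - 1) * (ze ^ n + 1) = 0"
		using W.z_pow_m by (simp add: algebra_simps power_mult power2_eq_square mult.commute[of 2])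
	moreover have "ze ^ n ~= 1" using W.z_pow_eq_1[of n] n by simp
	ultimately show ?thesis by (auto simp: eq_neg_iff_add_eq_0)
qed

section \<open>Direct summands of representations\<close>

definition trips :: "'k trip set" where
	"trips = {X : tcarrier. tZ X ^m N = idm (tdim X) & tT X * tT X = idm (tdim X) &
		 tW X ^m (2 * n) = idm (tdim X) & tZ X * tT X = tT X * tZ X & tZ X * tW X = tW X * tZ X &
		 tW X * (tT X * tW X) = tT X}"

lemma tripsD:
	assumes "X : trips"
	shows "X : tcarrier" "tZ X ^m N = idm (tdim X)" "tT X * tT X = idm (tdim X)"
		"tW X ^m (2 * n) = idm (tdim X)" "tZ X * tT X = tT X * tZ X" "tZ X * tW X = tW X * tZ X"
		"tW X * (tT X * tW X) = tT X" "tT X ^m 2 = idm (tdim X)"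
	using assms tcarrierD[of X] by (auto simp: trips_def eval_nat_numeral mrs)

text \<open>\<open>P\<close> is injective, having the left inverse \<open>Q\<close>. So a relation
  may be tested after multiplication by \<open>P\<close>, which carries it to the same relation in
  \<open>Y\<close>.\<close>

lemma trips_pull:
	assumes P: "intertw X Y P" and Q: "Q : carrier_mat (tdim X) (tdim Y)" and QP: "Q * P = idm (tdim X)"
		and Y: "Y : trips" and X: "X : tcarrier"
	shows "X : trips"
proof -
	note D = intertwD[OF P] carrier_matD[OF Q] tcarrierD[OF X] tcarrierD[OF tripsD(1)[OF Y]]
	note R = tripsD[OF Y]
	have inj: "A = B" if "P * A = P * B" "A : carrier_mat (tdim X) (tdim X)" "B : carrier_mat (tdim X) (tdim X)" for A B
	proof -
		note C = carrier_matD[OF that(2)] carrier_matD[OF that(3)]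
		have "Q * (P * A) = Q * (P * B)" by (simp add: that(1))
		thus ?thesis by (simp add: mms[OF QP] D C mrs)
	qed
	have 1: "P * (tZ X ^m N) = P * idm (tdim X)"
		by (subst pow_intw[OF D(1)]) (use D R in "auto simp: mrs")
	have 2: "P * (tT X * tT X) = P * idm (tdim X)"
		by (simp add: mms[OF D(2)] mrs D) (simp add: mms[OF R(3)] D mrs)
	have 3: "P * (tW X ^m (2 * n)) = P * idm (tdim X)"
		by (subst pow_intw[OF D(3)]) (use D R in "auto simp: mrs")
	have 4: "P * (tZ X * tT X) = P * (tT X * tZ X)"
		by (simp add: mms[OF D(2)] mms[OF D(1)] mrs D mms[OF R(5)])
	have 5: "P * (tZ X * tW X) = P * (tW X * tZ X)"
		by (simp add: mms[OF D(3)] mms[OF D(1)] mrs D mms[OF R(6)])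
	have "tW Y * (tT Y * (tW Y * P)) = tT Y * P"
		using arg_cong[OF R(7), of "%A. A * P"] by (simp add: mrs D)
	hence 6: "P * (tW X * (tT X * tW X)) = P * tT X"
		by (simp add: mms[OF D(3)] mms[OF D(2)] mrs D)
	show ?thesis
		unfolding trips_def using X inj[OF 1] inj[OF 2] inj[OF 3] inj[OF 4] inj[OF 5] inj[OF 6] D by auto
qed

text \<open>An equivariant retraction \<open>Q\<close> of an equivariant \<open>P\<close> has an
  invariant kernel. The linear complement supplied by \<open>split_complement\<close> is this
  kernel, and \<open>U\<close> is the action on it in coordinates.\<close>

lemma split_off:
	assumes X: "X : trips" and S: "S : tcarrier" and P: "intertw S X P" and Q: "intertw X S Q"
		and QP: "Q * P = idm (tdim S)"
	obtains U where "U : trips" "tdim X = tdim S + tdim U" "tiso X (tsum S U)"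
proof -
	note XC = tripsD(1)[OF X]
	note D = intertwD[OF P] intertwD[OF Q] tcarrierD[OF S] tcarrierD[OF XC]
	from split_complement[OF D(4) D(10) QP] obtain P' Q' where
		le: "tdim S \<le> tdim X" and PQ': "P' : carrier_mat (tdim X) (tdim X - tdim S)"
		"Q' : carrier_mat (tdim X - tdim S) (tdim X)" "Q' * P' = idm (tdim X - tdim S)"
		"P * Q + P' * Q' = idm (tdim X)"
		by blast
	note C = carrier_matD[OF PQ'(1)] carrier_matD[OF PQ'(2)]
	\<comment> \<open>Inserting the resolution of the identity into \<open>Q' * P\<close> and into
	  \<open>Q * P'\<close> gives \<open>A = A + A\<close> in each case, so both vanish.\<close>
	have zero: "A = zm r c" if "A = A + A" "A : carrier_mat r c" for A :: "'k mat" and r c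
	proof (rule eq_matI)
		fix i j assume "i < dim_row (zm r c :: 'k mat)" "j < dim_col (zm r c :: 'k mat)"
		hence ij: "i < r" "j < c" by auto
		hence "(A + A) $$ (i, j) = A $$ (i, j) + A $$ (i, j)"
			using that(2) by auto
		hence "A $$ (i, j) = 0" by (simp only: that(1)[symmetric] add_cancel_right_right)
		thus "A $$ (i, j) = zm r c $$ (i, j)" using ij by simp
	qed (use that in auto)
	have "Q' * P = Q' * ((P * Q + P' * Q') * P)"
		unfolding PQ' by (simp add: mrs C D)
	also have "... = Q' * P + Q' * P"
		by (simp add: mrs C D QP mms[OF PQ'(3)] del: PQ'(4))
	finally have Q'P: "Q' * P = zm (tdim X - tdim S) (tdim S)"
		by (rule zero) (auto simp: C D)
	have "Q * P' = Q * ((P * Q + P' * Q') * P')"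
		unfolding PQ' by (simp add: mrs C D)
	also have "... = Q * P' + Q * P'"
		by (simp add: mrs C D PQ'(3) mms[OF QP] del: PQ'(4))
	finally have QP': "Q * P' = zm (tdim S) (tdim X - tdim S)"
		by (rule zero) (auto simp: C D)
	define U where "U = (tdim X - tdim S, Q' * (tZ X * P'), Q' * (tT X * P'), Q' * (tW X * P'))"
	have U: "U : tcarrier" by (auto simp: tcarrier_def U_def C)
	\<comment> \<open>On the kernel of \<open>Q\<close>, which is invariant under \<open>A\<close>, the
	  projection \<open>P' * Q'\<close> is the identity.\<close>
	have *: "P' * (Q' * (A * P')) = A * P'" if "Q * A = B * Q" "A : carrier_mat (tdim X) (tdim X)"
		"B : carrier_mat (tdim S) (tdim S)" for A B
	proof -
		note F = carrier_matD[OF that(2)] carrier_matD[OF that(3)]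
		have "A * P' = (P * Q + P' * Q') * (A * P')"
			unfolding PQ' by (simp add: mrs C F)
		also have "... = P' * (Q' * (A * P'))"
			by (simp add: mrs C D F mms[OF that(1)] QP' del: PQ'(4))
		finally show ?thesis ..
	qed
	have i: "intertw U X P'"
		unfolding intertw_def U_def using PQ'(1) *[OF D(7)] *[OF D(8)] *[OF D(9)] D by simp
	have "U : trips"
		by (rule trips_pull[OF i _ _ X U]) (use PQ' in "simp_all add: U_def")
	moreover have "tdim X = tdim S + tdim U" using le by (simp add: U_def)
	moreover have "tiso X (tsum S U)"
		by (rule tiso_tsumI[OF P i D(10) _ QP _ _ _ _ XC S U]) (use PQ' QP' Q'P in "simp_all add: U_def")
	ultimately show ?thesis using that by blast
qed

end

subsection \<open>Irreducible representations and primitive idempotents\<close>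

text \<open>Through a nonzero entry at \<open>(i, j)\<close> take column \<open>j\<close> as
  \<open>v\<close> and row \<open>i\<close>, divided by that entry, as \<open>ph\<close>. Their
  product is the entry at \<open>(i, j)\<close> of \<open>E * E = E\<close>, divided by
  itself.\<close>

lemma idempotent_vectors:
	fixes E :: "'k::field mat"
	assumes E: "E : sqm d" "E * E = E" "E ~= zm d d"
	obtains v ph where "v : carrier_mat d 1" "ph : carrier_mat 1 d" "E * v = v" "ph * E = ph" "ph * v = idm 1"
proof -
	have "\<exists>i<d. \<exists>j<d. E $$ (i, j) ~= 0"
		using E by (auto intro: eq_matI)
	then obtain i j where ij: "i < d" "j < d" "E $$ (i, j) ~= 0" by blast
	define e where "e = mat d 1 (%(l, _). if l = j then 1 else (0 :: 'k))"
	define f where "f = mat 1 d (%(_, l). if l = i then inverse (E $$ (i, j)) else 0)"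
	have [simp]: "dim_row e = d" "dim_col e = 1" "dim_row f = 1" "dim_col f = d" "dim_row E = d" "dim_col E = d"
		using E by (auto simp: e_def f_def)
	show ?thesis
	proof (rule that[of "E * e" "f * E"])
		have "(f * (E * e)) $$ (0, 0) = 1"
		proof -
			have 1: "(E * e) $$ (l, 0) = E $$ (l, j)" if "l < d" for l
				using that ij E by (simp add: e_def scalar_prod_def if_mult_distrib cong: if_cong)
			have "(f * (E * e)) $$ (0, 0) = (\<Sum>l = 0..<d. f $$ (0, l) * (E * e) $$ (l, 0))"
				by (subst index_mult_mat(1)) (auto simp: scalar_prod_def simp del: index_mult_mat(1))
			also have "... = (\<Sum>l = 0..<d. if l = i then inverse (E $$ (i, j)) * E $$ (l, j) else 0)"
				using 1 by (intro sum.cong) (auto simp: f_def simp del: index_mult_mat(1))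
			finally show ?thesis using ij by simp
		qed
		moreover have "f * E * (E * e) = f * (E * e)"
			by (simp add: mma mms[OF E(2)])
		ultimately show "f * E * (E * e) = idm 1"
			by (intro eq_matI) auto
	qed (auto simp: mma mms[OF E(2)] E(2))
qed

lemma mat_add_comm:
	"dim_row A = dim_row B ==> dim_col A = dim_col B ==> A + B = B + (A :: 'a::comm_ring_1 mat)"
	by (rule comm_add_mat[of A "dim_row A" "dim_col A"]) auto

lemma flip_dim [simp]: "dim_row flip = 2" "dim_col flip = 2"
	by (simp_all add: flip_def)

lemma flip_flip [simp]: "flip * flip = idm 2"
	by (rule eq_matI) (auto simp: flip_def scalar_prod_def eval_nat_numeral less_Suc_eq)

lemma flip_diagm: "flip * diagm 2 f = diagm 2 (%i. f (1 - i)) * flip"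
	by (rule eq_matI) (auto simp: flip_def diagm_def scalar_prod_def eval_nat_numeral less_Suc_eq)

lemma sum_mat_flip:
	"prl_mat 1 1 * flip = prr_mat 1 1" "prr_mat 1 1 * flip = prl_mat 1 1"
	"flip * inl_mat 1 1 = inr_mat 1 1" "flip * inr_mat 1 1 = inl_mat 1 1"
	by (rule eq_matI; auto simp: flip_def sum_mat_defs scalar_prod_def eval_nat_numeral less_Suc_eq)+

lemma sum_mat_diagm:
	"prl_mat 1 1 * diagm 2 f = f 0 \<cdot> (prl_mat 1 1 :: 'k::comm_ring_1 mat)"
	"prr_mat 1 1 * diagm 2 f = f 1 \<cdot> (prr_mat 1 1 :: 'k::comm_ring_1 mat)"
	"diagm 2 f * inl_mat 1 1 = f 0 \<cdot> (inl_mat 1 1 :: 'k::comm_ring_1 mat)"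
	"diagm 2 f * inr_mat 1 1 = f 1 \<cdot> (inr_mat 1 1 :: 'k::comm_ring_1 mat)"
	by (rule eq_matI; auto simp: diagm_def sum_mat_defs scalar_prod_def eval_nat_numeral less_Suc_eq)+

lemma diagm_const_mult: "dim_row A = d ==> diagm d (%_. c) * A = c \<cdot> (A :: 'k::comm_ring_1 mat)"
	and mult_diagm_const: "dim_col A = d ==> A * diagm d (%_. c) = c \<cdot> (A :: 'k::comm_ring_1 mat)"
proof -
	have "diagm d (%_. c) = c \<cdot> idm d"
		using diagm_smult[of c d "%_. 1"] by (simp add: diagm_one)
	thus "dim_row A = d ==> diagm d (%_. c) * A = c \<cdot> A" "dim_col A = d ==> A * diagm d (%_. c) = c \<cdot> A"
		by (simp_all add: mrs)
qed

context dihedral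
begin

text \<open>\<open>Vt u j\<close> is irreducible unless \<open>j\<close> is divisible by \<open>n\<close>.\<close>

definition Vt :: "nat => nat => 'k trip" where
	"Vt u j = (2, diagm 2 (%_. om ^ u), flip, diagm 2 (%i. if i = 0 then ze ^ j else inverse (ze ^ j)))"

fun irr_w :: "irr => nat" where
	"irr_w (Chi u e d) = (if d then n else 0)" | "irr_w (Psi u j) = j"

fun S :: "irr => 'k trip" where
	"S (Chi u e d) = (1, diagm 1 (%_. om ^ u), diagm 1 (%_. (-1) ^ sgn_bit e), diagm 1 (%_. ze ^ (if d then n else 0)))"
| "S (Psi u j) = Vt u j"

definition K :: "irr set" where
	"K = {Chi u e d | u e d. u < N} \<union> {Psi u j | u j. u < N & 0 < j & j < n}"

lemma finite_K: "finite K"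
proof -
	have "K = (%(u, e, d). Chi u e d) ` ({..<N} \<times> UNIV \<times> UNIV) \<union> (%(u, j). Psi u j) ` ({..<N} \<times> {0<..<n})"
		by (auto simp: K_def image_iff)
	thus ?thesis by simp
qed

lemma Vt_trips: "Vt u j : trips"
proof -
	have "flip : sqm 2" by (rule carrier_matI) auto
	moreover have "diagm 2 (%i. if i = 0 then ze ^ j else inverse (ze ^ j)) ^m (2 * n) = idm 2"
		unfolding diagm_pow diagm_one[symmetric]
		by (rule diagm_cong) (auto simp: power_inverse power_mult[symmetric] W.z_pow_eq_1 simp flip: power_mult mult.assoc)
	moreover have "diagm 2 (%_. om ^ u) ^m N = idm 2"
		unfolding diagm_pow diagm_one[symmetric]
		by (rule diagm_cong) (auto simp: power_mult[symmetric] Z.z_pow_eq_1)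
	moreover have "diagm 2 (%i. if i = 0 then ze ^ j else inverse (ze ^ j)) *
			(flip * diagm 2 (%i. if i = 0 then ze ^ j else inverse (ze ^ j))) = flip"
		unfolding flip_diagm
		by (simp add: mma[symmetric] diagm_mult)
			 (rule eq_matI, auto simp: diagm_def flip_def scalar_prod_def eval_nat_numeral less_Suc_eq)
	ultimately show ?thesis
		by (simp add: trips_def Vt_def tcarrier_def diagm_const_mult mult_diagm_const)
qed

lemma S_trips: "S k : trips"
proof (cases k)
	case (Chi u e d)
	have "(ze ^ (if d then n else 0)) * (ze ^ (if d then n else 0)) = 1"
		by (auto simp: ze_n)
	moreover have "(ze ^ n) ^ (2 * n) = 1" by (simp add: ze_n)
	moreover have "(om ^ u) ^ N = 1" by (simp add: power_mult[symmetric] Z.z_pow_eq_1)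
	ultimately show ?thesis
		unfolding Chi by (simp add: trips_def tcarrier_def diagm_pow diagm_mult mult_ac power_mult[symmetric] diagm_one)
qed (simp add: Vt_trips)

text \<open>The projection onto the vectors on which \<open>w\<close> acts by \<open>ze ^ j\<close>
  and \<open>z\<close> by \<open>om ^ u\<close>.\<close>

definition F :: "nat => nat => 'k trip => 'k mat" where
	"F u j X = W.proj (tdim X) j (tW X) * Z.proj (tdim X) u (tZ X)"

text \<open>Chosen to have rank 1 on \<open>S k\<close> and rank 0 on the other irreducibles. In
  \<open>Psi u j\<close> the joint eigenvector is unique up to scalars, so \<open>F\<close>
  suffices; for \<open>Chi\<close> the eigenvalue of \<open>t\<close> still has to be
  separated.\<close>

fun E :: "irr => 'k trip => 'k mat" where
	"E (Chi u e d) X = T.proj (tdim X) (sgn_bit e) (tT X) * F u (if d then n else 0) X"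
| "E (Psi u j) X = F u j X"

lemma F_dim [simp]: "dim_row (F u j X) = tdim X" "dim_col (F u j X) = tdim X"
	by (simp_all add: F_def)

lemma E_dim [simp]: "dim_row (E k X) = tdim X" "dim_col (E k X) = tdim X"
	by (cases k; simp)+

context
	fixes X assumes X: "X : trips"
begin

private lemma D: 
	"tZ X : carrier_mat (tdim X) (tdim X)" "tT X : carrier_mat (tdim X) (tdim X)"
		"tW X : carrier_mat (tdim X) (tdim X)"
	and D' [simp]: "dim_row (tZ X) = tdim X" "dim_col (tZ X) = tdim X" "dim_row (tT X) = tdim X"
		"dim_col (tT X) = tdim X" "dim_row (tW X) = tdim X" "dim_col (tW X) = tdim X"
	using tcarrierD tripsD(1)[OF X] by blast+

private lemma D'' : "F u j X : carrier_mat (tdim X) (tdim X)"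
	by (rule carrier_matI) auto

private lemma projC: "W.proj (tdim X) j A : carrier_mat (tdim X) (tdim X)"
	"Z.proj (tdim X) j A : carrier_mat (tdim X) (tdim X)"
	"T.proj (tdim X) j A : carrier_mat (tdim X) (tdim X)"
	by (rule carrier_matI; simp)+

lemma F_eigen:
	"tZ X * F u j X = om ^ u \<cdot> F u j X" "F u j X * tZ X = om ^ u \<cdot> F u j X"
	"tW X * F u j X = ze ^ j \<cdot> F u j X" "F u j X * tW X = ze ^ j \<cdot> F u j X"
proof -
	have 1: "tZ X * W.proj (tdim X) j (tW X) = W.proj (tdim X) j (tW X) * tZ X"
		by (rule W.proj_intertwine) (use D tripsD[OF X] in auto)
	have 2: "tW X * Z.proj (tdim X) u (tZ X) = Z.proj (tdim X) u (tZ X) * tW X"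
		by (rule Z.proj_intertwine) (use D tripsD[OF X] in auto)
	note Zp = Z.mult_proj[OF D(1) tripsD(2)[OF X]] Z.proj_mult[OF D(1) tripsD(2)[OF X]]
	note Wp = W.mult_proj[OF D(3) tripsD(4)[OF X]] W.proj_mult[OF D(3) tripsD(4)[OF X]]
	show "tZ X * F u j X = om ^ u \<cdot> F u j X"
		by (simp add: F_def mms[OF 1] mma Zp mmsm)
	show "F u j X * tZ X = om ^ u \<cdot> F u j X"
		by (simp add: F_def mma Zp mmsm)
	show "tW X * F u j X = ze ^ j \<cdot> F u j X"
		by (simp add: F_def mms[OF Wp(1)] msm)
	show "F u j X * tW X = ze ^ j \<cdot> F u j X"
		by (simp add: F_def mma 2[symmetric] mms[OF Wp(2)] msm)
qed

lemma F_mult_eigen: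
	assumes "dim_row A = tdim X" "tZ X * A = om ^ u \<cdot> A" "tW X * A = ze ^ i \<cdot> A"
	shows "F u j X * A = (if i mod (2 * n) = j mod (2 * n) then A else zm (tdim X) (dim_col A))"
	using assms by (simp add: F_def mma Z.proj_mult_eigen[OF D(1), of A u]
			W.proj_mult_eigen[OF D(3), of A i])

lemma eigen_mult_F:
	assumes "dim_col A = tdim X" "A * tZ X = om ^ u \<cdot> A" "A * tW X = ze ^ i \<cdot> A"
	shows "A * F u j X = (if i mod (2 * n) = j mod (2 * n) then A else zm (dim_row A) (tdim X))"
proof -
	have "A * F u j X = (A * W.proj (tdim X) j (tW X)) * Z.proj (tdim X) u (tZ X)"
		using assms by (simp add: F_def mma)
	thus ?thesis
		using assms by (simp add: Z.eigen_mult_proj[OF D(1), of A u] W.eigen_mult_proj[OF D(3), of A i] mat_zero_mult)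
qed

lemma F_idem: "F u j X * F u j X = F u j X"
	using F_eigen by (subst F_mult_eigen) auto

text \<open>By \<open>wtw = t\<close>, the eigenspace of \<open>w\<close> for \<open>ze ^ j\<close>
  is carried by \<open>t\<close> to the one for the inverse eigenvalue, written
  \<open>ze ^ (2 * n - j)\<close> to stay with natural exponents.\<close>

lemma F_swap:
	assumes "j \<le> 2 * n"
	shows "tZ X * (tT X * F u j X) = om ^ u \<cdot> (tT X * F u j X)"
		"tW X * (tT X * F u j X) = ze ^ (2 * n - j) \<cdot> (tT X * F u j X)"
		"(F u j X * tT X) * tZ X = om ^ u \<cdot> (F u j X * tT X)"
		"(F u j X * tT X) * tW X = ze ^ (2 * n - j) \<cdot> (F u j X * tT X)"
proof -
	have inv: "ze ^ (2 * n - j) * ze ^ j = 1"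
		using assms by (simp flip: power_add)
	have sc: "A = ze ^ (2 * n - j) \<cdot> B" if "ze ^ j \<cdot> A = B" for A B
	proof -
		have "ze ^ (2 * n - j) \<cdot> B = (ze ^ (2 * n - j) * ze ^ j) \<cdot> A"
			unfolding that[symmetric] by (rule eq_matI) auto
		also have "... = A" unfolding inv by (rule eq_matI) auto
		finally show ?thesis ..
	qed
	show "tZ X * (tT X * F u j X) = om ^ u \<cdot> (tT X * F u j X)"
		by (simp add: mms[OF tripsD(5)[OF X]] mma F_eigen mmsm)
	show "(F u j X * tT X) * tZ X = om ^ u \<cdot> (F u j X * tT X)"
		by (simp add: mma tripsD(5)[OF X, symmetric] mms[OF F_eigen(2)] msm)
	have "ze ^ j \<cdot> (tW X * (tT X * F u j X)) = (tW X * (tT X * tW X)) * F u j X"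
		by (simp add: mma F_eigen mmsm)
	thus "tW X * (tT X * F u j X) = ze ^ (2 * n - j) \<cdot> (tT X * F u j X)"
		by (intro sc) (simp add: tripsD(7)[OF X])
	have "ze ^ j \<cdot> ((F u j X * tT X) * tW X) = F u j X * (tW X * (tT X * tW X))"
		by (simp add: mms[OF F_eigen(4)] msm mma)
	thus "(F u j X * tT X) * tW X = ze ^ (2 * n - j) \<cdot> (F u j X * tT X)"
		by (intro sc) (simp add: tripsD(7)[OF X])
qed

text \<open>For these \<open>j\<close> the exponents \<open>j\<close> and \<open>2 * n - j\<close>
  agree modulo \<open>2 * n\<close>, so \<open>t\<close> preserves the eigenspace.\<close>

lemma F_commute_T:
	assumes "j = 0 \<or> j = n"
	shows "F u j X * tT X = tT X * F u j X"
proof -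
	have j: "j \<le> 2 * n" "(2 * n - j) mod (2 * n) = j mod (2 * n)" using assms by auto
	have "F u j X * (tT X * F u j X) = tT X * F u j X"
		by (subst F_mult_eigen[OF _ F_swap(1,2)[OF j(1)]]) (use j in auto)
	moreover have "(F u j X * tT X) * F u j X = F u j X * tT X"
		by (subst eigen_mult_F[OF _ F_swap(3,4)[OF j(1)]]) (use j in auto)
	ultimately show ?thesis by (simp add: mma)
qed

lemma F_T_F:
	assumes "0 < j" "j < n"
	shows "F u j X * (tT X * F u j X) = zm (tdim X) (tdim X)"
proof -
	have j: "j \<le> 2 * n" "(2 * n - j) mod (2 * n) ~= j mod (2 * n)" using assms by auto
	show ?thesis
		by (subst F_mult_eigen[OF _ F_swap(1,2)[OF j(1)]]) (use j in auto)
qed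

lemma E_L_eigen:
	fixes u e d
	defines "A == E (Chi u e d) X"
	shows "tZ X * A = om ^ u \<cdot> A" "A * tZ X = om ^ u \<cdot> A"
		"tW X * A = ze ^ (if d then n else 0) \<cdot> A" "A * tW X = ze ^ (if d then n else 0) \<cdot> A"
		"tT X * A = (-1) ^ sgn_bit e \<cdot> A" "A * tT X = (-1) ^ sgn_bit e \<cdot> A" "A * A = A"
proof -
	define j where "j = (if d then n else 0)"
	have j: "j = 0 \<or> j = n" by (auto simp: j_def)
	define P where "P = T.proj (tdim X) (sgn_bit e) (tT X)"
	have [simp]: "dim_row P = tdim X" "dim_col P = tdim X" by (simp_all add: P_def)
	have A: "A = P * F u j X" by (simp add: A_def P_def j_def)
	have c: "F u j X * P = P * F u j X"
		unfolding P_def by (rule T.proj_intertwine[OF F_commute_T[OF j]]) (use D D'' in auto)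
	note Tp = T.mult_proj[OF D(2) tripsD(8)[OF X], of "sgn_bit e"] T.proj_mult[OF D(2) tripsD(8)[OF X], of "sgn_bit e"]
	have PP: "P * P = P"
		unfolding P_def using Tp(1) by (subst T.proj_mult_eigen[OF D(2)]) auto
	show "tZ X * A = om ^ u \<cdot> A"
		unfolding A c[symmetric] by (simp add: mms[OF F_eigen(1)] msm)
	show "A * tZ X = om ^ u \<cdot> A"
		unfolding A by (simp add: mma F_eigen mmsm)
	show "tW X * A = ze ^ (if d then n else 0) \<cdot> A"
		unfolding A c[symmetric] j_def[symmetric] by (simp add: mms[OF F_eigen(3)] msm)
	show "A * tW X = ze ^ (if d then n else 0) \<cdot> A"
		unfolding A j_def[symmetric] by (simp add: mma F_eigen mmsm)
	show "tT X * A = (-1) ^ sgn_bit e \<cdot> A"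
		unfolding A using Tp(1) by (simp only: mms[OF Tp(1)[folded P_def]] msm D' F_dim \<open>dim_row P = tdim X\<close> \<open>dim_col P = tdim X\<close>)
	show "A * tT X = (-1) ^ sgn_bit e \<cdot> A"
		unfolding A c[symmetric] using Tp(2)[folded P_def]
		by (simp only: mma mmsm D' F_dim \<open>dim_row P = tdim X\<close> \<open>dim_col P = tdim X\<close>)
	have "A * A = P * ((F u j X * P) * F u j X)"
		unfolding A by (simp add: mma)
	also have "... = A"
		unfolding c A by (simp add: mma F_idem mms[OF PP])
	finally show "A * A = A" .
qed

text \<open>The identity is decomposed by the projections of \<open>z\<close> and then of
  \<open>w\<close>, and some component is nonzero. The exponents \<open>0\<close> and
  \<open>n\<close> are refined by \<open>t\<close>; exponents above \<open>n\<close> are moved below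
  \<open>n\<close> by \<open>t\<close>, which is invertible.\<close>

lemma E_exhaust:
	assumes "tdim X > 0"
	obtains k where "k : K" "E k X ~= zm (tdim X) (tdim X)"
proof -
	let ?d = "tdim X"
	have "idm ?d $$ (0, 0) ~= (zm ?d ?d $$ (0, 0) :: 'k)" using assms by simp
	hence "idm ?d ~= (zm ?d ?d :: 'k mat)" by metis
	from Z.proj_exhaust[OF D(1) _ this] obtain u where u: "u < N" "Z.proj ?d u (tZ X) ~= zm ?d ?d"
		by (auto simp: mrs)
	from W.proj_exhaust[OF D(3) projC(2) u(2)] obtain j where j: "j < 2 * n" "F u j X ~= zm ?d ?d"
		by (auto simp: F_def)
	consider "j = 0 \<or> j = n" | "0 < j" "j < n" | "n < j" by linarith
	thus ?thesis
	proof cases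
		case 1
		from T.proj_exhaust[OF D(2) D'' j(2)] obtain i where i: "i < 2" "T.proj ?d i (tT X) * F u j X ~= zm ?d ?d"
			by blast
		have "i = sgn_bit (i = 0)" "j = (if j = n then n else 0)" using i(1) 1 n by auto
		hence "E (Chi u (i = 0) (j = n)) X ~= zm ?d ?d"
			using i(2) by (simp only: E.simps) (cases "i = 0"; simp)
		moreover have "Chi u (i = 0) (j = n) : K" using u by (auto simp: K_def)
		ultimately show ?thesis using that by blast
	next
		case 2
		hence "Psi u j : K" using u by (auto simp: K_def)
		thus ?thesis using that j(2) by fastforce
	next
		case 3
		have "tT X * F u j X ~= zm ?d ?d"
		proof
			assume "tT X * F u j X = zm ?d ?d"
			hence "tT X * (tT X * F u j X) = zm ?d ?d" by (simp add: mat_mult_zero)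
			thus False using j(2) by (simp add: mms[OF tripsD(3)[OF X]] mat_one_mult)
		qed
		moreover have "F u (2 * n - j) X * (tT X * F u j X) = tT X * F u j X"
			by (subst F_mult_eigen[OF _ F_swap(1,2)]) (use j in auto)
		moreover have "zm ?d ?d * (tT X * F u j X) = zm ?d ?d"
			by (simp add: mat_zero_mult)
		ultimately have "F u (2 * n - j) X ~= zm ?d ?d"
			by auto
		moreover have "Psi u (2 * n - j) : K" using u j 3 by (auto simp: K_def)
		ultimately show ?thesis using that by fastforce
	qed
qed

text \<open>A vector \<open>v\<close> and a covector \<open>ph\<close> taken from the idempotent
  give a copy of the irreducible and a retraction onto it. For \<open>Psi\<close> the basis is
  \<open>v\<close>, \<open>t v\<close> and the dual basis \<open>ph\<close>, \<open>ph t\<close>;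
  the pairing \<open>ph t v\<close> vanishes since \<open>v\<close> and \<open>t v\<close> belong to
  different eigenvalues of \<open>w\<close>.\<close>

lemma E_split:
	assumes "k : K" "E k X ~= zm (tdim X) (tdim X)"
	obtains U where "U : trips" "tdim X = tdim (S k) + tdim U" "tiso X (tsum (S k) U)"
proof (cases k)
	case (Chi u e d)
	from idempotent_vectors[OF _ E_L_eigen(7) assms(2)[unfolded Chi]] obtain v ph where
		v: "v : carrier_mat (tdim X) 1" "ph : carrier_mat 1 (tdim X)" "E k X * v = v" "ph * E k X = ph" "ph * v = idm 1"
		unfolding Chi[symmetric] by (metis E_dim carrier_matI)
	note C = carrier_matD[OF v(1)] carrier_matD[OF v(2)]
	note I = E_L_eigen[of u e d, folded Chi]
	have r: "B * v = c \<cdot> v" if "B * E k X = c \<cdot> E k X" "dim_col B = tdim X" for B c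
	proof -
		have "B * v = B * (E k X * v)" by (simp add: v(3))
		also have "... = c \<cdot> (E k X * v)" by (subst mms[OF that(1)]) (use C that in "auto simp: msm")
		finally show ?thesis by (simp add: v(3))
	qed
	have l: "ph * B = c \<cdot> ph" if "E k X * B = c \<cdot> E k X" "dim_row B = tdim X" for B c
	proof -
		have "ph * B = (ph * E k X) * B" by (simp add: v(4))
		also have "... = c \<cdot> (ph * E k X)" using C that by (simp add: mma mmsm)
		finally show ?thesis by (simp add: v(4))
	qed
	have "intertw (S k) X v"
		using v(1) by (auto simp: intertw_def Chi mult_diagm_const C r[OF I(1)] r[OF I(3)] r[OF I(5)])
	moreover have "intertw X (S k) ph"
		using v(2) by (auto simp: intertw_def Chi diagm_const_mult C l[OF I(2)] l[OF I(4)] l[OF I(6)])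
	ultimately show ?thesis
		using split_off[OF X tripsD(1)[OF S_trips]] v(5) that by (metis Chi S.simps(1) fst_conv)
next
	case (Psi u j)
	with assms have j: "0 < j" "j < n" by (auto simp: K_def)
	from idempotent_vectors[OF D'' F_idem assms(2)[unfolded Psi E.simps]] obtain v ph where
		v: "v : carrier_mat (tdim X) 1" "ph : carrier_mat 1 (tdim X)" "F u j X * v = v" "ph * F u j X = ph" "ph * v = idm 1"
		by metis
	have [simp]: "dim_row v = tdim X" "dim_col v = 1" "dim_row ph = 1" "dim_col ph = tdim X"
		using v by auto
	have r: "B * v = c \<cdot> v" if "B * F u j X = c \<cdot> F u j X" "dim_col B = tdim X" for B c
	proof -
		have "B * v = B * (F u j X * v)" by (simp add: v(3))
		also have "... = c \<cdot> (F u j X * v)" by (subst mms[OF that(1)]) (use that in "auto simp: msm")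
		finally show ?thesis by (simp add: v(3))
	qed
	have rT: "B * (tT X * v) = c \<cdot> (tT X * v)" if "B * (tT X * F u j X) = c \<cdot> (tT X * F u j X)" "dim_col B = tdim X" for B c
	proof -
		have "B * (tT X * v) = (B * (tT X * F u j X)) * v" using that(2) by (simp add: mma v(3))
		also have "... = c \<cdot> (tT X * (F u j X * v))" unfolding that(1) by (simp add: mma msm)
		finally show ?thesis by (simp add: v(3))
	qed
	have l: "ph * B = c \<cdot> ph" if "F u j X * B = c \<cdot> F u j X" "dim_row B = tdim X" for B c
	proof -
		have "ph * B = (ph * F u j X) * B" by (simp add: v(4))
		also have "... = c \<cdot> (ph * F u j X)" using that by (simp add: mma mmsm)
		finally show ?thesis by (simp add: v(4))
	qed
	have lT: "ph * (tT X * B) = c \<cdot> (ph * tT X)" if "(F u j X * tT X) * B = c \<cdot> (F u j X * tT X)" "dim_row B = tdim X" for B c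
	proof -
		have "ph * (tT X * B) = ph * ((F u j X * tT X) * B)" using that(2) by (simp add: mma mms[OF v(4)])
		also have "... = c \<cdot> ((ph * F u j X) * tT X)" unfolding that(1) by (simp add: mma mmsm)
		finally show ?thesis by (simp add: v(4))
	qed
	have phTv: "ph * (tT X * v) = zm 1 1"
	proof -
		have "ph * (tT X * v) = (ph * F u j X) * (tT X * (F u j X * v))" by (simp only: v)
		also have "... = ph * ((F u j X * (tT X * F u j X)) * v)" by (simp add: mma)
		finally show ?thesis by (simp add: F_T_F[OF j] mat_zero_mult mat_mult_zero)
	qed
	note TT = mms[OF tripsD(3)[OF X]]
	define y where "y = tT X * v"
	define p where "p = ph * tT X"
	have [simp]: "dim_row y = tdim X" "dim_col y = 1" "dim_row p = 1" "dim_col p = tdim X"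
		by (simp_all add: y_def p_def)
	have inv: "ze ^ (2 * n - j) = inverse (ze ^ j)"
		using j by (intro inverse_unique[symmetric]) (simp flip: power_add)
	have j2: "j \<le> 2 * n" using j by simp
	note SW = F_swap[OF j2, of u] F_eigen[of u j]
	have py: "p * v = zm 1 1" "ph * y = zm 1 1" "p * y = idm 1"
		using phTv by (simp_all add: p_def y_def mma TT mat_one_mult v(5))
	have act: "tZ X * v = om ^ u \<cdot> v" "tZ X * y = om ^ u \<cdot> y" "ph * tZ X = om ^ u \<cdot> ph" "p * tZ X = om ^ u \<cdot> p"
		"tW X * v = ze ^ j \<cdot> v" "tW X * y = inverse (ze ^ j) \<cdot> y" "ph * tW X = ze ^ j \<cdot> ph" "p * tW X = inverse (ze ^ j) \<cdot> p"
		"tT X * v = y" "tT X * y = v" "ph * tT X = p" "p * tT X = ph"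
		unfolding inv[symmetric] y_def p_def
		using r[OF SW(5)] rT[OF SW(1)] l[OF SW(6)] lT[OF SW(3)] r[OF SW(7)] rT[OF SW(2)] l[OF SW(8)] lT[OF SW(4)]
		by (simp_all add: TT mat_one_mult mma tripsD(3)[OF X] mat_mult_one)
	define P where "P = v * prl_mat 1 1 + y * prr_mat 1 1"
	define Q where "Q = inl_mat 1 1 * ph + inr_mat 1 1 * p"
	have [simp]: "dim_row P = tdim X" "dim_col P = 2" "dim_row Q = 2" "dim_col Q = tdim X"
		by (simp_all add: P_def Q_def)
	have "Q * P = inl_mat 1 1 * prl_mat 1 1 + inr_mat 1 1 * prr_mat 1 1"
		by (simp add: P_def Q_def mrs mms[OF v(5)] mms[OF py(1)]
				mms[OF py(2)] mms[OF py(3)] del: One_nat_def smat_simps(5))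
	hence QP: "Q * P = idm 2" by (simp del: One_nat_def)
	note C = carrier_matI[of P "tdim X" 2] carrier_matI[of Q 2 "tdim X"]
	have P: "intertw (S k) X P"
		by (simp add: intertw_def Psi Vt_def C) (simp add: P_def mrs sum_mat_flip sum_mat_diagm act
				mms[OF act(1)] mms[OF act(2)] mms[OF act(5)] mms[OF act(6)]
				mms[OF act(9)] mms[OF act(10)] mat_add_comm del: One_nat_def)
	have Q: "intertw X (S k) Q"
		by (simp add: intertw_def Psi Vt_def C) (simp add: Q_def mrs act
				mms[OF sum_mat_flip(3)] mms[OF sum_mat_flip(4)]
				mms[OF sum_mat_diagm(3)] mms[OF sum_mat_diagm(4)] mat_add_comm del: One_nat_def)
	obtain U where "U : trips" "tdim X = tdim (S k) + tdim U" "tiso X (tsum (S k) U)"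
		by (rule split_off[OF X tripsD(1)[OF S_trips] P Q]) (simp_all add: QP Psi Vt_def)
	thus ?thesis by (rule that)
qed

end

end

subsection \<open>Classification\<close>

context dihedral
begin

lemma E_intertwine:
	assumes "intertw X Y P" "X : tcarrier" "Y : tcarrier"
	shows "P * E k X = E k Y * P"
proof -
	note D = intertwD[OF assms(1)] tcarrierD[OF assms(2)] tcarrierD[OF assms(3)]
	have F: "P * F u j X = F u j Y * P" for u j
		by (simp add: F_def D mma Z.proj_intertwine[OF D(1) D(7) D(16) D(4), symmetric]
				mms[OF W.proj_intertwine[OF D(3) D(9) D(18) D(4)]])
	show ?thesis
		by (cases k) (simp_all add: F D mma mms[OF T.proj_intertwine[OF D(2) D(8) D(17) D(4)]])
qed

text \<open>The multiplicity is the rank of the idempotent, read off as the order of the root 1 of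
  its characteristic polynomial. Unlike the trace, this is a natural number in every
  characteristic.\<close>

definition mlt :: "irr => 'k trip => nat" where
	"mlt k X = order 1 (char_poly (E k X))"

lemma mlt_tiso:
	assumes "tiso X Y" "X : tcarrier" "Y : tcarrier"
	shows "mlt k X = mlt k Y"
proof -
	from assms obtain P Q where PQ: "intertw X Y P" "Q : carrier_mat (tdim X) (tdim Y)"
		"Q * P = idm (tdim X)" "P * Q = idm (tdim Y)"
		by (auto simp: tiso_def)
	note D = intertwD(4-6)[OF PQ(1)] carrier_matD[OF PQ(2)]
	have d: "tdim X = tdim Y"
		by (rule inverse_mat_dim[OF D(1) PQ(2,3,4)])
	have "E k Y = E k Y * (P * Q)" by (simp add: PQ mat_mult_one)
	also have "... = P * E k X * Q"
		by (simp add: mma D mms[OF E_intertwine[OF PQ(1) assms(2,3), symmetric]])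
	finally have "similar_mat (E k Y) (E k X)"
		using PQ D by (intro similar_matI[of _ _ P Q "tdim X"]) (auto simp: d intro!: carrier_matI)
	thus ?thesis by (simp add: mlt_def char_poly_similar)
qed

lemma char_poly_nz: "A : sqm d ==> char_poly (A :: 'k mat) ~= 0"
	using degree_monic_char_poly[of A d] by auto

lemma mlt_tsum:
	assumes "X : tcarrier" "Y : tcarrier"
	shows "mlt k (tsum X Y) = mlt k X + mlt k Y"
proof -
	let ?d = "tdim X" and ?e = "tdim Y"
	have EC: "E k X : carrier_mat ?d ?d" "E k Y : carrier_mat ?e ?e" by (auto intro: carrier_matI)
	note i = intertw_sum_mat[OF assms]
	note I = E_intertwine[OF i(1) assms(1) tsum_carrier[OF assms], of k]
		E_intertwine[OF i(2) assms(2) tsum_carrier[OF assms], of k]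
	have "E k (tsum X Y) = E k (tsum X Y) * (inl_mat ?d ?e * prl_mat ?d ?e + inr_mat ?d ?e * prr_mat ?d ?e)"
		by (simp add: mat_mult_one)
	also have "... = four_block_mat (E k X) (zm ?d ?e) (zm ?e ?d) (E k Y)"
		by (simp add: diag_block_eq[OF EC] mat_mult_add mms[OF I(1)[symmetric]]
				mms[OF I(2)[symmetric]] mma del: smat_simps)
	finally have "char_poly (E k (tsum X Y)) = char_poly (E k X) * char_poly (E k Y)"
		by (simp add: char_poly_diag_block[OF EC])
	thus ?thesis
		using char_poly_nz EC by (simp add: mlt_def order_mult)
qed

lemma mlt_zero:
	assumes "E k X = zm (tdim X) (tdim X)"
	shows "mlt k X = 0"
proof -
	have "E k X = diagm (tdim X) (%_. 0)"
		unfolding assms by (rule eq_matI) (auto simp: diagm_def)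
	thus ?thesis
		unfolding mlt_def by (simp add: char_poly_diagm order_0I poly_prod)
qed

lemma ze_inverse: "j \<le> 2 * n ==> inverse (ze ^ j) = ze ^ (2 * n - j)"
	by (intro inverse_unique) (simp flip: power_add)

text \<open>\<open>z\<close> and \<open>w\<close> are diagonal in the given bases. The entry 1 sits
  at index 0, where \<open>w\<close> acts on \<open>Psi u j\<close> by \<open>ze ^ j\<close>; the
  bounds \<open>0 < j < n\<close> separate this value from its inverse and from 1 and -1.\<close>

lemma E_S:
	assumes "k : K" "l : K"
	shows "E k (S l) = diagm (tdim (S l)) (%i. if i = 0 & k = l then 1 else 0)"
proof (cases l)
	case (Psi u' j')
	hence l: "u' < N" "0 < j'" "j' < n" using assms by (auto simp: K_def)
	have W: "diagm 2 (%i. if i = 0 then ze ^ j' else inverse (ze ^ j')) =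
			diagm 2 (%i. ze ^ (if i = 0 then j' else 2 * n - j'))"
		using l by (intro diagm_cong) (auto simp: ze_inverse)
	show ?thesis
	proof (cases k)
		case (Psi u j)
		hence "u < N" "0 < j" "j < n" using assms by (auto simp: K_def)
		thus ?thesis using l Psi \<open>l = Psi u' j'\<close>
			by (auto simp: Vt_def F_def W W.proj_diagm Z.proj_diagm diagm_mult intro!: diagm_cong)
	next
		case (Chi u e d)
		have "F u (if d then n else 0) (Vt u' j') = zm 2 2"
			using l by (auto simp: Vt_def F_def W W.proj_diagm Z.proj_diagm diagm_mult)
				(auto simp: diagm_def intro!: eq_matI)
		thus ?thesis
			using Chi Psi by (auto simp: Vt_def mat_mult_zero) (auto simp: diagm_def intro!: eq_matI)
	qed
next
	case (Chi u' e' d')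
	hence l: "u' < N" using assms by (auto simp: K_def)
	show ?thesis
	proof (cases k)
		case (Psi u j)
		hence "u < N" "0 < j" "j < n" using assms by (auto simp: K_def)
		thus ?thesis using Chi Psi n
			by (auto simp: F_def W.proj_diagm Z.proj_diagm diagm_mult intro!: diagm_cong)
	next
		case k: (Chi u e d)
		hence "u < N" using assms by (auto simp: K_def)
		thus ?thesis using l Chi k n
			by (auto simp: F_def W.proj_diagm Z.proj_diagm T.proj_diagm diagm_mult simp del: power_Suc split: if_splits intro!: diagm_cong)
	qed
qed

lemma mlt_S:
	assumes "k : K" "l : K"
	shows "mlt k (S l) = (if k = l then 1 else 0)"
proof -
	have 1: "order 1 [:- 1, 1 :: 'k:] = 1"
		using order_power_n_n[of "1 :: 'k" 1] by simp
	have 2: "order 1 [:0, 1 :: 'k:] = 0"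
		by (rule order_0I) simp
	have "order 1 ([:- 1, 1:] * [:0, 1 :: 'k:]) = 1"
		by (subst order_mult) (use 1 2 in auto)
	hence 3: "order 1 [:0, - 1, 1 :: 'k:] = 1" by simp
	have 4: "order 1 [:0, 0, 1 :: 'k:] = 0"
		by (rule order_0I) simp
	have "tdim (S l) = 1 \<or> tdim (S l) = 2" by (cases l) (auto simp: Vt_def)
	thus ?thesis
		unfolding mlt_def E_S[OF assms] char_poly_diagm
		by (auto simp: eval_nat_numeral 1 2 3 4)
qed

lemma mlt_dim_0: "tdim X = 0 ==> mlt k X = 0"
	by (rule mlt_zero, rule eq_matI) auto

text \<open>Induction on the dimension: an irreducible occurring in \<open>X\<close> also occurs in
  \<open>Y\<close>, it splits off from both, and the multiplicities of the remainders agree by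
  cancellation.\<close>

lemma tiso_if_mlt_eq:
	assumes "X : trips" "Y : trips" "!!k. k : K ==> mlt k X = mlt k Y"
	shows "tiso X Y"
	using assms
proof (induction "tdim X" arbitrary: X Y rule: less_induct)
	case less
	note XC = tripsD(1)[OF less.prems(1)] and YC = tripsD(1)[OF less.prems(2)]
	show ?case
	proof (cases "tdim X = 0")
		case True
		have "tdim Y = 0"
		proof (rule ccontr)
			assume "tdim Y ~= 0"
			then obtain k where k: "k : K" "E k Y ~= zm (tdim Y) (tdim Y)"
				using E_exhaust[OF less.prems(2)] by blast
			from E_split[OF less.prems(2) k] obtain U where U: "U : trips" "tiso Y (tsum (S k) U)"
				by blast
			have "mlt k Y = mlt k (S k) + mlt k U"
				using mlt_tiso[OF U(2) YC] U(1) by (simp add: tripsD(1) S_trips mlt_tsum)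
			thus False using less.prems(3)[OF k(1)] mlt_dim_0[OF True, of k] k(1) by (simp add: mlt_S)
		qed
		thus ?thesis using True tcarrierD[OF XC] tcarrierD[OF YC]
			by (intro tisoI[of X Y "zm 0 0" "zm 0 0"]) (auto simp: intertw_def intro!: eq_matI)
	next
		case False
		then obtain k where k: "k : K" "E k X ~= zm (tdim X) (tdim X)"
			using E_exhaust[OF less.prems(1)] by blast
		from E_split[OF less.prems(1) k] obtain U where
			U: "U : trips" "tdim X = tdim (S k) + tdim U" "tiso X (tsum (S k) U)" by blast
		have SC: "S k : tcarrier" using S_trips tripsD(1) by blast
		have UC: "U : tcarrier" using U tripsD(1) by blast
		have 1: "mlt l X = mlt l (S k) + mlt l U" for l
			using mlt_tiso[OF U(3) XC] by (simp add: SC UC mlt_tsum)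
		have "mlt k Y ~= 0" using 1[of k] less.prems(3)[OF k(1)] k(1) by (simp add: mlt_S)
		hence "E k Y ~= zm (tdim Y) (tdim Y)" using mlt_zero[of k Y] by auto
		from E_split[OF less.prems(2) k(1) this] obtain U' where
			U': "U' : trips" "tdim Y = tdim (S k) + tdim U'" "tiso Y (tsum (S k) U')" by blast
		have UC': "U' : tcarrier" using U' tripsD(1) by blast
		have 2: "mlt l Y = mlt l (S k) + mlt l U'" for l
			using mlt_tiso[OF U'(3) YC] by (simp add: SC UC' mlt_tsum)
		have "tdim (S k) > 0" by (cases k) (auto simp: Vt_def)
		hence "tiso U U'"
			using less.hyps[of U U'] U U' 1 2 less.prems(3) by simp
		hence "tiso (tsum (S k) U) (tsum (S k) U')" by (rule tsum_cong[OF _ SC UC UC'])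
		thus ?thesis
			using tiso_trans[OF U(3) _ XC] tiso_trans[OF _ tiso_sym[OF U'(3) YC] XC] SC UC UC' YC by (meson tsum_carrier)
	qed
qed

definition mu :: "'k trip => irr multiset" where
	"mu X = (\<Sum>k\<in>K. replicate_mset (mlt k X) k)"

lemma count_mu: "count (mu X) k = (if k : K then mlt k X else 0)"
proof -
	have "count (mu X) k = (\<Sum>l\<in>K. if l = k then mlt k X else 0)"
		unfolding mu_def count_sum by (intro sum.cong) auto
	thus ?thesis using finite_K by simp
qed

lemma set_mu: "set_mset (mu X) \<subseteq> K"
	by (auto simp: count_mu set_mset_def split: if_splits)

lemma mu_tiso: "tiso X Y ==> X : tcarrier ==> Y : tcarrier ==> mu X = mu Y"
	by (simp add: mu_def mlt_tiso)

lemma mu_tsum: "X : tcarrier ==> Y : tcarrier ==> mu (tsum X Y) = mu X + mu Y"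
	by (rule multiset_eqI) (simp add: count_mu mlt_tsum)

lemma mu_S: "k : K ==> mu (S k) = {#k#}"
	by (rule multiset_eqI) (auto simp: count_mu mlt_S)

lemma mu_dim_0: "tdim X = 0 ==> mu X = {#}"
	by (rule multiset_eqI) (simp add: count_mu mlt_dim_0)

lemma tiso_iff_mu:
	assumes "X : trips" "Y : trips"
	shows "tiso X Y \<longleftrightarrow> mu X = mu Y"
proof
	assume "mu X = mu Y"
	hence "mlt k X = mlt k Y" if "k : K" for k
		using that by (metis count_mu)
	thus "tiso X Y" using assms by (intro tiso_if_mlt_eq)
qed (use assms tripsD(1) mu_tiso in blast)

subsection \<open>Fusion rules\<close>

text \<open>The constituents of \<open>Vt u j\<close> for arbitrary exponents: two characters when
  \<open>ze ^ j\<close> is 1 or -1, and otherwise one \<open>Psi\<close>, where exponents above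
  \<open>n\<close> are reflected because \<open>j\<close> and \<open>2 * n - j\<close> give
  isomorphic representations.\<close>

definition vv :: "nat => nat => irr multiset" where
	"vv u j = (let v = u mod N; i = j mod (2 * n) in
		 if i = 0 then {#Chi v True False, Chi v False False#}
		 else if i = n then {#Chi v True True, Chi v False True#}
		 else {#Psi v (if i < n then i else 2 * n - i)#})"

text \<open>Exponents of \<open>z\<close> and \<open>w\<close> add. The difference
  \<open>i - j\<close> is represented by \<open>2 * n + i - j\<close>, so that truncated subtraction
  does no harm for \<open>j \<le> 2 * n\<close>.\<close>

fun fus :: "irr => irr => irr multiset" where
	"fus (Chi u e d) (Chi u' e' d') = {#Chi ((u + u') mod N) (e = e') (d ~= d')#}"
| "fus (Chi u e d) (Psi u' j) = vv (u + u') (j + (if d then n else 0))"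
| "fus (Psi u' j) (Chi u e d) = vv (u + u') (j + (if d then n else 0))"
| "fus (Psi u i) (Psi u' j) = vv (u + u') (i + j) + vv (u + u') (2 * n + i - j)"

fun dual_irr :: "irr => irr" where
	"dual_irr (Chi u e d) = Chi ((N - u) mod N) e d"
| "dual_irr (Psi u j) = Psi ((N - u) mod N) j"

lemma N_pos [simp]: "0 < N"
	using N by (cases N) auto

lemma Vt_mod: "Vt (u mod N) (j mod (2 * n)) = Vt u j"
	by (simp add: Vt_def Z.z_pow_mod W.z_pow_mod cong: if_cong)

lemma Vt_carrier: "Vt u j : tcarrier" and S_carrier: "S k : tcarrier"
	using Vt_trips S_trips tripsD(1) by blast+

lemma diag_block_diagm:
	"four_block_mat (diagm d f) (zm d e) (zm e d) (diagm e g) = diagm (d + e) (%i. if i < d then f i else (g (i - d) :: 'k))"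
	by (rule eq_matI) (auto simp: diagm_def)

text \<open>Here \<open>w\<close> is scalar, and the matrix with rows (1, 1) and (1, -1)
  diagonalises \<open>flip\<close>. Its square is twice the identity, which is where 2 has to be
  invertible.\<close>

lemma tiso_Vt_n:
	assumes "j = (if d then n else 0)"
	shows "tiso (Vt u j) (tsum (S (Chi u True d)) (S (Chi u False d)))"
proof -
	define P where "P = mat 2 2 (%(i, j). if i = 1 & j = 1 then -1 else (1 :: 'k))"
	have [simp]: "dim_row P = 2" "dim_col P = 2" by (auto simp: P_def)
	have PC: "P : sqm 2" by (rule carrier_matI) auto
	have c: "diagm 2 (%i. if i = 0 then ze ^ j else inverse (ze ^ j)) = diagm 2 (%_. ze ^ j)"
		using assms by (intro diagm_cong) (auto simp: ze_n)
	have PP: "P * P = 2 \<cdot> idm 2"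
		by (rule eq_matI) (auto simp: P_def scalar_prod_def eval_nat_numeral less_Suc_eq)
	have T: "P * flip = diagm 2 (%i. if i < 1 then 1 else -1) * P"
		by (rule eq_matI) (auto simp: P_def scalar_prod_def flip_def diagm_def eval_nat_numeral less_Suc_eq)
	have half: "(1 / 2 :: 'k) \<cdot> (2 \<cdot> idm 2) = idm 2"
		using two by (intro eq_matI) auto
	show ?thesis
	proof (rule tisoI[where P = P and Q = "(1 / 2) \<cdot> P"])
		show "intertw (Vt u j) (tsum (S (Chi u True d)) (S (Chi u False d))) P"
			using T PC by (simp add: intertw_def Vt_def tsum_def Let_def diag_block_diagm c assms[symmetric] diagm_const_mult
					mult_diagm_const one_add_one del: One_nat_def)
		show "(1 / 2) \<cdot> P * P = idm (tdim (Vt u j))"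
			using half by (simp add: msm PP Vt_def)
		show "P * ((1 / 2) \<cdot> P) = idm (tdim (tsum (S (Chi u True d)) (S (Chi u False d))))"
			using half by (simp add: mmsm PP one_add_one del: One_nat_def)
	qed (use PC in "auto simp: Vt_def one_add_one simp del: One_nat_def")
qed

lemma tiso_Vt_swap:
	assumes "j \<le> 2 * n"
	shows "tiso (Vt u j) (Vt u (2 * n - j))"
proof (rule tisoI[where P = flip and Q = flip])
	have "ze ^ j = inverse (ze ^ (2 * n - j))" using assms by (simp add: ze_inverse)
	thus "intertw (Vt u j) (Vt u (2 * n - j)) flip"
		using assms by (auto simp: intertw_def Vt_def flip_diagm ze_inverse intro!: carrier_matI arg_cong2[of _ _ _ _ times] diagm_cong)
qed (auto simp: Vt_def intro: carrier_matI)

lemma mu_Vt: "mu (Vt u j) = vv u j"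
proof -
	let ?v = "u mod N" and ?i = "j mod (2 * n)"
	have v: "?v < N" and i: "?i < 2 * n" using n by auto
	have "mu (Vt ?v ?i) = vv u j"
	proof -
		have Chi: "mu (tsum (S (Chi ?v True d)) (S (Chi ?v False d))) = {#Chi ?v True d, Chi ?v False d#}" for d
		proof -
			have "Chi ?v e d : K" for e using v by (auto simp: K_def)
			thus ?thesis by (simp add: mu_tsum[OF S_carrier S_carrier] mu_S del: S.simps)
		qed
		consider "?i = 0" | "?i = n" | "0 < ?i" "?i < n" | "n < ?i" by linarith
		thus ?thesis
		proof cases
			case 1
			thus ?thesis
				using mu_tiso[OF tiso_Vt_n[of ?i False ?v] Vt_carrier tsum_carrier[OF S_carrier S_carrier]] Chi[of False]
				by (simp add: vv_def Let_def del: S.simps)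
		next
			case 2
			thus ?thesis
				using mu_tiso[OF tiso_Vt_n[of ?i True ?v] Vt_carrier tsum_carrier[OF S_carrier S_carrier]] Chi[of True] n
				by (simp add: vv_def Let_def del: S.simps)
		next
			case 3
			thus ?thesis using mu_S[of "Psi ?v ?i"] v by (simp add: vv_def Let_def K_def)
		next
			case 4
			thus ?thesis using mu_S[of "Psi ?v (2 * n - ?i)"] v i mu_tiso[OF tiso_Vt_swap[of ?i ?v] Vt_carrier Vt_carrier]
				by (simp add: vv_def Let_def K_def)
		qed
	qed
	thus ?thesis by (simp add: Vt_mod)
qed

end

section \<open>Kronecker products\<close>

lemma kron_dim [simp]:
	"dim_row (kro P Q) = dim_row P * dim_row Q" "dim_col (kro P Q) = dim_col P * dim_col Q"
	by (simp_all add: kronecker_def)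

lemma kron_carrier: "P : carrier_mat a b ==> Q : carrier_mat c d ==> kro P Q : carrier_mat (a * c) (b * d)"
	by (intro carrier_matI) auto

lemma kron_index:
	"i < dim_row P * dim_row Q ==> j < dim_col P * dim_col Q ==>
		kro P Q $$ (i, j) = P $$ (i div dim_row Q, j div dim_col Q) * Q $$ (i mod dim_row Q, j mod dim_col Q)"
	by (simp add: kronecker_def)

lemma div_mod_bounds: "(i :: nat) < a * b ==> i div b < a" "i < a * b ==> i mod b < b"
proof -
	assume "i < a * b"
	moreover from this have "b > 0" by (cases b) auto
	ultimately show "i div b < a" "i mod b < b" by (auto simp: less_mult_imp_div_less)
qed

lemma sum_prod_index:
	"(\<Sum>l = 0..<a * b. f (l div b) (l mod b)) = (\<Sum>i = 0..<a. \<Sum>j = 0..<b. f i (j :: nat))"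
proof (cases "b = 0")
	case False
	have "(\<Sum>l = 0..<a * b. f (l div b) (l mod b)) = (\<Sum>i<a. \<Sum>l = i * b..<i * b + b. f (l div b) (l mod b))"
		using sum.nat_group[of "%l. f (l div b) (l mod b)" b a] by (simp add: atLeast0LessThan)
	also have "... = (\<Sum>i<a. \<Sum>j = 0..<b. f i j)"
	proof (rule sum.cong)
		fix i
		have "(\<Sum>l = i * b..<i * b + b. f (l div b) (l mod b)) = (\<Sum>l = 0..<b. f ((l + i * b) div b) ((l + i * b) mod b))"
			using sum.shift_bounds_nat_ivl[of "%l. f (l div b) (l mod b)" 0 "i * b" b] by (simp add: add.commute)
		also have "... = (\<Sum>j = 0..<b. f i j)"
			using False by (intro sum.cong) auto
		finally show "(\<Sum>l = i * b..<i * b + b. f (l div b) (l mod b)) = ..." .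
	qed simp
	finally show ?thesis by (simp add: atLeast0LessThan)
qed simp

lemma kron_mult:
	assumes "dim_col A = dim_row B" "dim_col C = dim_row D"
	shows "kro A C * kro B D = kro (A * B) (C * D)"
proof (rule eq_matI)
	fix i j assume "i < dim_row (kro (A * B) (C * D))" "j < dim_col (kro (A * B) (C * D))"
	hence ij: "i < dim_row A * dim_row C" "j < dim_col B * dim_col D" by auto
	note bi = div_mod_bounds[OF ij(1)] div_mod_bounds[OF ij(2)]
	let ?i = "i div dim_row C" and ?i' = "i mod dim_row C" and ?j = "j div dim_col D" and ?j' = "j mod dim_col D"
	have "(kro A C * kro B D) $$ (i, j) =
			(\<Sum>l = 0..<dim_row B * dim_row D. kro A C $$ (i, l) * kro B D $$ (l, j))"
		using ij assms by (auto simp: scalar_prod_def intro!: sum.cong)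
	also have "... = (\<Sum>l = 0..<dim_row B * dim_row D. (A $$ (?i, l div dim_row D) * B $$ (l div dim_row D, ?j)) *
			(C $$ (?i', l mod dim_row D) * D $$ (l mod dim_row D, ?j')))"
		using ij assms by (intro sum.cong) (auto simp: kron_index)
	also have "... = (\<Sum>l = 0..<dim_row B. \<Sum>l' = 0..<dim_row D. (A $$ (?i, l) * B $$ (l, ?j)) * (C $$ (?i', l') * D $$ (l', ?j')))"
		by (rule sum_prod_index)
	also have "... = (\<Sum>l = 0..<dim_row B. A $$ (?i, l) * B $$ (l, ?j)) * (\<Sum>l' = 0..<dim_row D. C $$ (?i', l') * D $$ (l', ?j'))"
		by (simp add: sum_product)
	also have "... = kro (A * B) (C * D) $$ (i, j)"
		using ij bi assms by (simp add: kron_index scalar_prod_def)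
	finally show "(kro A C * kro B D) $$ (i, j) = kro (A * B) (C * D) $$ (i, j)" .
qed auto

lemma kron_one: "kro (idm d) (idm e) = (idm (d * e) :: 'a::field mat)"
proof (rule eq_matI)
	fix i j assume "i < dim_row (idm (d * e) :: 'a mat)" "j < dim_col (idm (d * e) :: 'a mat)"
	hence ij: "i < d * e" "j < d * e" by auto
	have "i = j \<longleftrightarrow> i div e = j div e & i mod e = j mod e"
		by (metis div_mult_mod_eq)
	thus "kro (idm d) (idm e) $$ (i, j) = (idm (d * e) :: 'a mat) $$ (i, j)"
		using ij div_mod_bounds[OF ij(1)] div_mod_bounds[OF ij(2)] by (auto simp: kron_index)
qed auto

lemma kron_add_left:
	"dim_row A = dim_row B ==> dim_col A = dim_col B ==> kro (A + B) C = kro A C + kro B C"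
	by (rule eq_matI) (auto simp: kron_index div_mod_bounds distrib_right)

lemma kron_add_right:
	"dim_row A = dim_row B ==> dim_col A = dim_col B ==> kro C (A + B) = kro C A + kro C B"
	by (rule eq_matI) (auto simp: kron_index div_mod_bounds distrib_left)

lemma kron_smult_left: "kro (c \<cdot> A) B = c \<cdot> kro A B"
	by (rule eq_matI) (auto simp: kron_index div_mod_bounds mult.assoc)

lemma kron_smult_right: "kro A (c \<cdot> B) = c \<cdot> kro A B"
	by (rule eq_matI) (auto simp: kron_index div_mod_bounds mult.left_commute)

lemma kron_zero_left: "kro (zm a b) B = zm (a * dim_row B) (b * dim_col B)"
	by (rule eq_matI) (auto simp: kron_index div_mod_bounds)

lemma kron_zero_right: "kro B (zm a b) = zm (dim_row B * a) (dim_col B * b)"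
	by (rule eq_matI) (auto simp: kron_index div_mod_bounds)

lemma kron_diagm: "kro (diagm d f) (diagm e g) = diagm (d * e) (%i. f (i div e) * g (i mod e))"
proof (rule eq_matI)
	fix i j assume "i < dim_row (diagm (d * e) (%i. f (i div e) * g (i mod e)))" "j < dim_col (diagm (d * e) (%i. f (i div e) * g (i mod e)))"
	hence ij: "i < d * e" "j < d * e" by auto
	have eq: "i = j \<longleftrightarrow> i div e = j div e & i mod e = j mod e"
		by (metis div_mult_mod_eq)
	have "kro (diagm d f) (diagm e g) $$ (i, j) =
			(if i div e = j div e & i mod e = j mod e then f (i div e) * g (i mod e) else 0)"
		using ij div_mod_bounds[OF ij(1)] div_mod_bounds[OF ij(2)] by (simp add: kron_index) (simp add: diagm_def)
	also have "... = diagm (d * e) (%i. f (i div e) * g (i mod e)) $$ (i, j)"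
		unfolding eq[symmetric] using ij by (simp add: diagm_def)
	finally show "kro (diagm d f) (diagm e g) $$ (i, j) = ..." .
qed auto

lemma kron_scalar: "kro (diagm 1 (%_. c)) A = c \<cdot> A" "kro A (diagm 1 (%_. c)) = c \<cdot> A"
	by (rule eq_matI; auto simp: kron_index diagm_def)+

lemma kron_pow: "A : sqm d ==> B : sqm e ==> kro A B ^m k = kro (A ^m k) (B ^m k)"
	by (induction k) (auto simp: kron_one kron_mult)

definition ttens :: "'k::field trip => 'k trip => 'k trip" where
	"ttens X Y = (tdim X * tdim Y, kro (tZ X) (tZ Y), kro (tT X) (tT Y), kro (tW X) (tW Y))"

lemma ttens_carrier: "X : tcarrier ==> Y : tcarrier ==> ttens X Y : tcarrier"
	by (auto simp: tcarrier_def ttens_def intro!: carrier_matI)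

text \<open>Orders the basis \<open>e\<^sub>0 \<otimes> e\<^sub>0\<close>, \<open>e\<^sub>0 \<otimes> e\<^sub>1\<close>, \<open>e\<^sub>1 \<otimes> e\<^sub>0\<close>, \<open>e\<^sub>1 \<otimes> e\<^sub>1\<close> into the two pairs swapped by \<open>flip \<otimes> flip\<close>.\<close>

definition shuffle :: "nat => nat" where
	"shuffle i = (if i = 0 then 0 else if i = 1 then 3 else i - 1)"

definition perm_mat :: "nat => (nat => nat) => 'a::{zero,one} mat" where
	"perm_mat d s = mat d d (%(i, j). if j = s i then 1 else 0)"

lemma perm_mat_dim [simp]: "dim_row (perm_mat d s) = d" "dim_col (perm_mat d s) = d"
	by (simp_all add: perm_mat_def)

lemma perm_mat_mult:
	assumes "!!i. i < d ==> s i < d"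
	shows "perm_mat d s * perm_mat d t = (perm_mat d (%i. t (s i)) :: 'a::comm_ring_1 mat)"
proof (rule eq_matI)
	fix i j assume "i < dim_row (perm_mat d (%i. t (s i)) :: 'a mat)" "j < dim_col (perm_mat d (%i. t (s i)) :: 'a mat)"
	hence ij: "i < d" "j < d" by auto
	have "(perm_mat d s * perm_mat d t :: 'a mat) $$ (i, j) = (\<Sum>l = 0..<d. (if l = s i then 1 else 0) * (if j = t l then 1 else 0))"
		using ij by (simp add: perm_mat_def scalar_prod_def)
	also have "... = (\<Sum>l = 0..<d. if l = s i then if j = t l then 1 else 0 else 0)"
		by (intro sum.cong) auto
	finally show "(perm_mat d s * perm_mat d t) $$ (i, j) = (perm_mat d (%i. t (s i)) :: 'a mat) $$ (i, j)"
		using ij assms by (simp add: perm_mat_def)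
qed auto

lemma perm_mat_diagm:
	assumes "!!i. i < d ==> s i < d"
	shows "perm_mat d s * diagm d g = diagm d (%i. g (s i)) * (perm_mat d s :: 'a::comm_ring_1 mat)"
proof (rule eq_matI)
	fix i j assume "i < dim_row (diagm d (%i. g (s i)) * perm_mat d s)" "j < dim_col (diagm d (%i. g (s i)) * perm_mat d s)"
	hence ij: "i < d" "j < d" by auto
	have "(perm_mat d s * diagm d g) $$ (i, j) = (\<Sum>l = 0..<d. (if l = s i then 1 else 0) * (if l = j then g l else 0))"
		using ij by (simp add: perm_mat_def diagm_def scalar_prod_def)
	also have "... = (\<Sum>l = 0..<d. if l = s i then if l = j then g l else 0 else 0)"
		by (intro sum.cong) auto
	finally have "(perm_mat d s * diagm d g) $$ (i, j) = ..." .
	moreover have "(diagm d (%i. g (s i)) * perm_mat d s) $$ (i, j) =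
			(\<Sum>l = 0..<d. (if i = l then g (s i) else 0) * (if j = s l then 1 else 0))"
		using ij by (simp add: perm_mat_def diagm_def scalar_prod_def)
	moreover have "... = (\<Sum>l = 0..<d. if l = i then if j = s l then g (s l) else 0 else 0)"
		by (intro sum.cong) auto
	ultimately show "(perm_mat d s * diagm d g) $$ (i, j) = (diagm d (%i. g (s i)) * perm_mat d s) $$ (i, j)"
		using ij assms by simp
qed auto

lemma perm_mat_cong: "(!!i. i < d ==> s i = t i) ==> perm_mat d s = perm_mat d t"
	by (rule eq_matI) (auto simp: perm_mat_def)

lemma perm_mat_id: "perm_mat d (%i. i) = idm d"
	by (rule eq_matI) (auto simp: perm_mat_def)

lemma less_4_cases: "(i :: nat) < 4 ==> i = 0 \<or> i = 1 \<or> i = 2 \<or> i = 3"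
	by auto

context dihedral
begin

section \<open>Tensor products and duals of the irreducible representations\<close>

lemma neg_one_pow_sgn: "(-1 :: 'k) ^ sgn_bit e * (-1) ^ sgn_bit e' = (-1) ^ sgn_bit (e = e')"
	by auto

lemma ttens_L_L: "ttens (S (Chi u e d)) (S (Chi u' e' d')) = S (Chi ((u + u') mod N) (e = e') (d ~= d'))"
	by (auto simp: ttens_def kron_diagm Z.z_pow_mod power_add ze_n)

text \<open>Conjugation by \<open>diag(1, s)\<close> absorbs the sign \<open>s\<close> of
  \<open>flip\<close> and commutes with diagonal matrices. Hence the sign of \<open>t\<close> on a
  character is lost in a tensor product with a two-dimensional representation.\<close>

lemma tiso_scaled_flip:
	assumes "s * s = 1"
	shows "tiso (2, diagm 2 (%_. c), s \<cdot> flip, diagm 2 f) (2, diagm 2 (%_. c), flip, diagm 2 (f :: nat => 'k))"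
proof (rule tisoI)
	let ?P = "diagm 2 (%i. if i = 0 then 1 else s)"
	have "?P * (s \<cdot> flip) = flip * ?P"
		using assms by (intro eq_matI) (auto simp: diagm_def flip_def scalar_prod_def eval_nat_numeral less_Suc_eq)
	thus "intertw (2, diagm 2 (%_. c), s \<cdot> flip, diagm 2 f) (2, diagm 2 (%_. c), flip, diagm 2 f) ?P"
		by (simp add: intertw_def diagm_const_mult mult_diagm_const diagm_mult mult.commute)
	have "?P * ?P = idm 2" using assms by (simp add: diagm_mult flip: diagm_one) (rule diagm_cong, auto)
	thus "?P * ?P = idm (tdim (2, diagm 2 (%_. c), s \<cdot> flip, diagm 2 f))"
		"?P * ?P = idm (tdim (2, diagm 2 (%_. c), flip, diagm 2 f))"
		by simp_all
qed simp

lemma ttens_L_Vt: "tiso (ttens (S (Chi u e d)) (Vt u' j)) (Vt (u + u') (j + (if d then n else 0)))"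
	and ttens_Vt_L: "tiso (ttens (Vt u' j) (S (Chi u e d))) (Vt (u + u') (j + (if d then n else 0)))"
proof -
	have "diagm 2 (%i. ze ^ (if d then n else 0) * (if i = 0 then ze ^ j else inverse (ze ^ j))) =
			diagm 2 (%i. if i = 0 then ze ^ (j + (if d then n else 0)) else inverse (ze ^ (j + (if d then n else 0))))"
		by (rule diagm_cong) (auto simp: power_add ze_n)
	thus "tiso (ttens (S (Chi u e d)) (Vt u' j)) (Vt (u + u') (j + (if d then n else 0)))"
		"tiso (ttens (Vt u' j) (S (Chi u e d))) (Vt (u + u') (j + (if d then n else 0)))"
		using tiso_scaled_flip[of "(-1) ^ sgn_bit e" "om ^ (u + u')"
				"%i. if i = 0 then ze ^ (j + (if d then n else 0)) else inverse (ze ^ (j + (if d then n else 0)))"]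
		by (simp_all add: ttens_def kron_scalar Vt_def diagm_smult power_add mult.commute
				neg_one_pow_sgn del: One_nat_def)
qed

text \<open>On the four product basis vectors \<open>w\<close> has the exponents
  \<open>i + j\<close>, \<open>i - j\<close>, \<open>j - i\<close>, \<open>-(i + j)\<close>, and
  \<open>t\<close> reverses their order. The permutation \<open>shuffle\<close> brings the outer
  pair and the inner pair together, which gives the two summands.\<close>

lemma ttens_Vt_Vt:
	assumes "j \<le> 2 * n"
	shows "tiso (ttens (Vt u i) (Vt u' j)) (tsum (Vt (u + u') (i + j)) (Vt (u + u') (2 * n + i - j)))"
proof -
	define f where "f a = (if a = 0 then ze ^ (i + j) else if a = 1 then ze ^ i * inverse (ze ^ j) else
		 if a = 2 then inverse (ze ^ i) * ze ^ j else inverse (ze ^ (i + j)))" for a :: nat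
	define P :: "'k mat" where "P = perm_mat 4 shuffle"
	define Q :: "'k mat" where "Q = perm_mat 4 (%a. if a = 0 then 0 else if a = 3 then 1 else a + 1)"
	define G :: "'k mat" where "G = perm_mat 4 (%a. 3 - a)"
	define H :: "'k mat" where "H = four_block_mat flip (zm 2 2) (zm 2 2) flip"
	have [simp]: "dim_row P = 4" "dim_col P = 4" "dim_row Q = 4" "dim_col Q = 4" by (simp_all add: P_def Q_def)
	\<comment> \<open>With \<open>H\<close> written as a permutation matrix, the identities for
	  \<open>t\<close> reduce to equalities between maps on the four indices.\<close>
	have H: "H = perm_mat 4 (%a. if a = 0 then 1 else if a = 1 then 0 else 5 - a)"
	proof (rule eq_matI)
		fix a b assume "a < dim_row (perm_mat 4 (%a. if a = 0 then 1 else if a = 1 then 0 else 5 - a) :: 'k mat)"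
			"b < dim_col (perm_mat 4 (%a. if a = 0 then 1 else if a = 1 then 0 else 5 - a) :: 'k mat)"
		hence "a < 4" "b < 4" by auto
		from less_4_cases[OF this(1)] less_4_cases[OF this(2)]
		show "H $$ (a, b) = (perm_mat 4 (%a. if a = 0 then 1 else if a = 1 then 0 else 5 - a) :: 'k mat) $$ (a, b)"
			by (elim disjE) (simp_all add: H_def flip_def perm_mat_def)
	qed (auto simp: H_def)
	have sh: "shuffle a < 4" if "a < 4" for a
		using that by (auto simp: shuffle_def)
	define q where "q a = (if a = 0 then 0 else if a = 3 then 1 else a + 1)" for a :: nat
	have Q: "Q = perm_mat 4 q" unfolding Q_def by (rule perm_mat_cong) (simp add: q_def)
	have q: "q a < 4" "q (shuffle a) = a" "shuffle (q a) = a" if "a < 4" for a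
		using less_4_cases[OF that] by (elim disjE; simp add: q_def shuffle_def)+
	have "P * Q = perm_mat 4 (%a. q (shuffle a))" unfolding P_def Q by (rule perm_mat_mult[OF sh])
	also have "... = perm_mat 4 (%a. a)" by (rule perm_mat_cong[OF q(2)])
	finally have PQ: "P * Q = idm 4" by (simp add: perm_mat_id)
	have "Q * P = perm_mat 4 (%a. shuffle (q a))" unfolding P_def Q by (rule perm_mat_mult[OF q(1)])
	also have "... = perm_mat 4 (%a. a)" by (rule perm_mat_cong[OF q(3)])
	finally have QP: "Q * P = idm 4" by (simp add: perm_mat_id)
	have 1: "P * G = perm_mat 4 (%a. 3 - shuffle a)"
		unfolding P_def G_def by (rule perm_mat_mult[OF sh])
	have 2: "H * P = perm_mat 4 (%a. shuffle (if a = 0 then 1 else if a = 1 then 0 else 5 - a))"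
		unfolding H P_def by (rule perm_mat_mult) (auto dest!: less_4_cases)
	have "3 - shuffle a = shuffle (if a = 0 then 1 else if a = 1 then 0 else 5 - a)" if "a < 4" for a
		using less_4_cases[OF that] by (elim disjE) (simp_all add: shuffle_def)
	hence 3: "(perm_mat 4 (%a. 3 - shuffle a) :: 'k mat) = perm_mat 4 (%a. shuffle (if a = 0 then 1 else if a = 1 then 0 else 5 - a))"
		by (rule perm_mat_cong)
	have PG: "P * G = H * P"
		by (rule HOL.trans[OF 1 HOL.trans[OF 3 2[symmetric]]])
	have PD: "P * diagm 4 g = diagm 4 (%a. g (shuffle a)) * P" for g
		unfolding P_def by (rule perm_mat_diagm[OF sh])
	have FF: "kro flip flip = G"
	proof (rule eq_matI)
		fix a b assume "a < dim_row G" "b < dim_col G"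
		hence "a < 4" "b < 4" by (auto simp: G_def)
		from less_4_cases[OF this(1)] less_4_cases[OF this(2)]
		show "kro flip flip $$ (a, b) = G $$ (a, b)"
			by (elim disjE) (simp_all add: kron_index flip_def G_def perm_mat_def)
	qed (auto simp: G_def)
	have ij: "ze ^ (2 * n + i - j) = ze ^ i * inverse (ze ^ j)"
	proof -
		have "ze ^ (2 * n + i - j) * ze ^ j = ze ^ i"
			using assms by (simp flip: power_add) (simp add: power_add)
		thus ?thesis by (simp add: field_simps)
	qed
	have W: "diagm 4 (%a. (if a div 2 = 0 then ze ^ i else inverse (ze ^ i)) * (if a mod 2 = 0 then ze ^ j else inverse (ze ^ j))) =
			diagm 4 f"
		by (rule diagm_cong) (auto simp: f_def power_add dest!: less_4_cases)
	have W': "diagm 4 (%a. if a < 2 then if a = 0 then ze ^ (i + j) else inverse (ze ^ (i + j))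
			else if a - 2 = 0 then ze ^ (2 * n + i - j) else inverse (ze ^ (2 * n + i - j))) = diagm 4 (%a. f (shuffle a))"
		unfolding ij by (rule diagm_cong) (auto simp: f_def shuffle_def dest!: less_4_cases)
	have 22: "2 * 2 = (4 :: nat)" "2 + 2 = (4 :: nat)" by auto
	show ?thesis
	proof (rule tisoI[where P = P and Q = Q])
		show "intertw (ttens (Vt u i) (Vt u' j)) (tsum (Vt (u + u') (i + j)) (Vt (u + u') (2 * n + i - j))) P"
			using PG PD[of f]
			by (simp add: intertw_def ttens_def tsum_def Let_def Vt_def 22 kron_diagm FF diag_block_diagm power_add[symmetric]
					H_def W W' diagm_const_mult mult_diagm_const carrier_matI)
	qed (auto simp: ttens_def Vt_def PQ QP intro: carrier_matI)
qed

lemma mu_ttens: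
	assumes "k : K" "l : K"
	shows "mu (ttens (S k) (S l)) = fus k l"
proof -
	note TC = ttens_carrier[OF S_carrier S_carrier] ttens_carrier[OF S_carrier Vt_carrier] ttens_carrier[OF Vt_carrier S_carrier]
		ttens_carrier[OF Vt_carrier Vt_carrier]
	show ?thesis
	proof (cases k; cases l)
		fix u e d u' e' d' assume kl: "k = Chi u e d" "l = Chi u' e' d'"
		have "Chi ((u + u') mod N) (e = e') (d ~= d') : K" by (auto simp: K_def)
		thus ?thesis unfolding kl ttens_L_L by (subst mu_S) auto
	next
		fix u e d u' j assume kl: "k = Chi u e d" "l = Psi u' j"
		show ?thesis unfolding kl S.simps(2)
			using mu_tiso[OF ttens_L_Vt TC(2) Vt_carrier, of u e d u' j] by (simp only: mu_Vt fus.simps)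
	next
		fix u e d u' j assume kl: "l = Chi u e d" "k = Psi u' j"
		show ?thesis unfolding kl S.simps(2)
			using mu_tiso[OF ttens_Vt_L TC(3) Vt_carrier, of u' j u e d] by (simp only: mu_Vt fus.simps)
	next
		fix u i u' j assume kl: "k = Psi u i" "l = Psi u' j"
		hence j: "j \<le> 2 * n" using assms by (auto simp: K_def)
		show ?thesis unfolding kl S.simps(2)
			using mu_tiso[OF ttens_Vt_Vt[OF j] TC(4) tsum_carrier[OF Vt_carrier Vt_carrier]]
			by (simp only: mu_tsum[OF Vt_carrier Vt_carrier] mu_Vt fus.simps)
	qed
qed

text \<open>The contragredient representation: the inverses of \<open>z\<close> and \<open>w\<close>
  are the powers \<open>N - 1\<close> and \<open>2 * n - 1\<close>, and \<open>t\<close> is its own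
  inverse.\<close>

definition tdual :: "'k trip => 'k trip" where
	"tdual X = (tdim X, trm (tZ X ^m (N - 1)), trm (tT X), trm (tW X ^m (2 * n - 1)))"

lemma transpose_diagm [simp]: "trm (diagm d f) = (diagm d f :: 'k mat)"
	by (rule eq_matI) (auto simp: diagm_def)

lemma transpose_flip [simp]: "trm flip = (flip :: 'k mat)"
	by (rule eq_matI) (auto simp: flip_def)

lemma om_dual: "(om ^ u) ^ (N - 1) = om ^ ((N - u mod N) mod N)"
proof -
	have "om ^ u = om ^ (u mod N)" by (simp add: Z.z_pow_mod)
	hence "om ^ ((N - u mod N) mod N) * om ^ u = om ^ (N - u mod N + u mod N)"
		by (simp only: power_add Z.z_pow_mod)
	also have "... = 1" by (simp add: less_imp_le)
	also have "1 = (om ^ u) ^ N"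
		by (metis Z.z_pow_m mult.commute power_mult power_one)
	also have "... = (om ^ u) ^ (N - 1) * om ^ u"
		by (metis N_pos power_minus_mult)
	finally show ?thesis by simp
qed

lemma ze_dual: "(ze ^ j) ^ (2 * n - 1) = inverse (ze ^ j)"
proof -
	have "(ze ^ j) ^ (2 * n - 1) * ze ^ j = (ze ^ j) ^ (2 * n)"
		using n by (intro power_minus_mult) auto
	also have "... = 1" by (metis W.z_pow_m mult.commute power_mult power_one)
	finally show ?thesis by (simp add: field_simps)
qed

lemma dual_irr_K: "k : K ==> dual_irr k : K"
	by (cases k) (auto simp: K_def)

lemma mu_tdual:
	assumes "k : K"
	shows "mu (tdual (S k)) = {#dual_irr k#}"
proof -
	have "tiso (tdual (S k)) (S (dual_irr k))"
	proof (cases k)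
		case (Chi u e d)
		hence u: "u < N" using assms by (auto simp: K_def)
		have "tdual (S k) = S (dual_irr k)"
			using om_dual[of u] ze_dual[of n] u unfolding Chi by (auto simp: tdual_def diagm_pow ze_n)
		thus ?thesis by (simp only: tiso_refl S_carrier)
	next
		case (Psi u j)
		hence u: "u < N" using assms by (auto simp: K_def)
		have 1: "diagm 2 (%i. (if i = 0 then ze ^ j else inverse (ze ^ j)) ^ (2 * n - 1)) =
				diagm 2 (%i. if i = 0 then inverse (ze ^ j) else ze ^ j)"
			by (rule diagm_cong) (simp_all add: ze_dual[simplified] power_inverse)
		show ?thesis unfolding Psi
		\<comment> \<open>Dualising puts the eigenvalues of \<open>w\<close> in the opposite order, which
		  \<open>flip\<close> repairs.\<close>
		proof (rule tisoI[where P = flip and Q = flip])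
			show "intertw (tdual (S (Psi u j))) (S (dual_irr (Psi u j))) flip"
				using om_dual[of u] u by (auto simp: intertw_def tdual_def Vt_def diagm_pow 1[simplified] flip_diagm ze_dual[simplified] power_inverse
						intro!: carrier_matI arg_cong2[of _ _ _ _ times] diagm_cong)
		qed (auto simp: tdual_def Vt_def intro: carrier_matI)
	qed
	moreover have "tdual (S k) : tcarrier"
		using tcarrierD[OF S_carrier[of k]] by (auto simp: tdual_def tcarrier_def)
	ultimately show ?thesis
		using mu_tiso[OF _ _ S_carrier] mu_S[OF dual_irr_K[OF assms]] by metis
qed

end

section \<open>Modules over Hopf algebras of dihedral type\<close>

definition mod_inter :: "('k::field, 'a, 'm) module_scheme => ('k, 'a) matmod => ('k, 'a) matmod => 'k mat => bool" where
	"mod_inter A V W P \<longleftrightarrow> P : carrier_mat (fst W) (fst V) & (\<forall>a\<in>carrier A. P * snd V a = snd W a * P)"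

lemma fd_modulesD:
	assumes "V : fdms A"
	shows "!!a. a : carrier A ==> snd V a : carrier_mat (fst V) (fst V)"
		and "snd V \<one>\<^bsub>A\<^esub> = idm (fst V)"
		and "!!a b. a : carrier A ==> b : carrier A ==> snd V (a \<otimes>\<^bsub>A\<^esub> b) = snd V a * snd V b"
		and "!!a b. a : carrier A ==> b : carrier A ==> snd V (a \<oplus>\<^bsub>A\<^esub> b) = snd V a + snd V b"
		and "!!c a. a : carrier A ==> snd V (c \<odot>\<^bsub>A\<^esub> a) = c \<cdot> snd V a"
	using assms by (auto simp: fd_modules_def)

lemma fd_modulesI:
	assumes "!!a. a : carrier A ==> rh a : sqm d"
		and "rh \<one>\<^bsub>A\<^esub> = idm d"
		and "!!a b. a : carrier A ==> b : carrier A ==> rh (a \<otimes>\<^bsub>A\<^esub> b) = rh a * rh b"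
		and "!!a b. a : carrier A ==> b : carrier A ==> rh (a \<oplus>\<^bsub>A\<^esub> b) = rh a + rh b"
		and "!!c a. a : carrier A ==> rh (c \<odot>\<^bsub>A\<^esub> a) = c \<cdot> rh a"
	shows "(d, rh) : fdms A"
	using assms by (auto simp: fd_modules_def)

lemma module_iso_iff:
	"(V, W) : module_iso A \<longleftrightarrow> V : fdms A & W : fdms A &
		 (\<exists>P Q. mod_inter A V W P & Q : carrier_mat (fst V) (fst W) & Q * P = idm (fst V) & P * Q = idm (fst W))"
	by (cases V; cases W) (auto simp: module_iso_def mod_inter_def)

lemma module_sum_simp: "msum V W = (fst V + fst W, %a. four_block_mat (snd V a) (zm (fst V) (fst W)) (zm (fst W) (fst V)) (snd W a))"
	by (cases V; cases W) simp

lemma diag_block_mult: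
	assumes "A : sqm d" "B : sqm d" "C : sqm e" "D : sqm e"
	shows "four_block_mat A (zm d e) (zm e d) C * four_block_mat B (zm d e) (zm e d) D =
		four_block_mat (A * B) (zm d e) (zm e d) (C * (D :: 'a::comm_ring_1 mat))"
	using assms by (subst mult_four_block_mat[of A d d _ e _ e]) (auto simp: mrs)

lemma diag_block_add:
	assumes "A : sqm d" "B : sqm d" "C : sqm e" "D : sqm e"
	shows "four_block_mat A (zm d e) (zm e d) C + four_block_mat B (zm d e) (zm e d) D =
		four_block_mat (A + B) (zm d e) (zm e d) (C + (D :: 'a::comm_ring_1 mat))"
	using assms by (intro eq_matI) auto

lemma diag_block_smult:
	assumes "A : sqm d" "C : sqm e"
	shows "c \<cdot> four_block_mat A (zm d e) (zm e d) C =
		four_block_mat (c \<cdot> A) (zm d e) (zm e d) (c \<cdot> (C :: 'a::comm_ring_1 mat))"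
	using assms by (intro eq_matI) auto

lemma module_sum_fd:
	assumes "V : fdms A" "W : fdms A"
	shows "msum V W : fdms A"
	unfolding module_sum_simp
	using fd_modulesD[OF assms(1)] fd_modulesD[OF assms(2)]
	by (intro fd_modulesI) (simp_all add: diag_block_mult diag_block_add diag_block_smult)

lemma zero_module_fd: "zero_module : fdms A"
	unfolding zero_module_def by (intro fd_modulesI) (auto intro: eq_matI)

interpretation id_scalars: scalars "%c :: 'k::comm_ring_1. c"
	by unfold_locales auto

lemma lookup_fscale [simp]: "lkp (fscale c t) x = c * lkp t x"
	by (simp add: Poly_Mapping.map.rep_eq when_def)

lemma lin_fscale: "lin (%c. c) M (fscale c t) = c * lin (%c. c) M t"
proof -
	have "kys (fscale c t) \<subseteq> kys t" by (auto simp: in_keys_iff)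
	thus ?thesis
		by (simp add: id_scalars.lin_superset[OF finite_keys] sum_distrib_left mult.assoc) (simp add: lin_def sum_distrib_left)
qed

definition lin_act :: "nat => ('x => 'k mat) => ('x \<Rightarrow>\<^sub>0 'k) => 'k::comm_ring_1 mat" where
	"lin_act d rh t = lin_mat d d (kys t) (lkp t) rh"

lemma lin_act_dim [simp]: "dim_row (lin_act d rh t) = d" "dim_col (lin_act d rh t) = d"
	by (simp_all add: lin_act_def)

lemma lin_act_index: "i < d ==> j < d ==> lin_act d rh t $$ (i, j) = lin (%c. c) (%x. rh x $$ (i, j)) t"
	by (simp add: lin_act_def lin_mat_def lin_def)

lemma lin_act_simps:
	"lin_act d rh (s + t) = lin_act d rh s + lin_act d rh t" "lin_act d rh (s - t) = lin_act d rh s - lin_act d rh t"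
	"lin_act d rh (fscale c t) = c \<cdot> lin_act d rh t" "lin_act d rh 0 = zm d d"
	by (rule eq_matI; simp add: lin_act_index id_scalars.lin_add id_scalars.lin_diff lin_fscale)+

lemma lin_act_single: "rh x : sqm d ==> lin_act d rh (sgl x c) = c \<cdot> rh x"
	by (rule eq_matI) (auto simp: lin_act_index)

definition tens_act :: "nat => nat => ('a => 'k mat) => ('a => 'k mat) => ('a \<times> 'a \<Rightarrow>\<^sub>0 'k) => 'k::field mat" where
	"tens_act d e rh si = lin_act (d * e) (%(a, b). kro (rh a) (si b))"

lemma tens_act_dim [simp]: "dim_row (tens_act d e rh si t) = d * e" "dim_col (tens_act d e rh si t) = d * e"
	by (simp_all add: tens_act_def)

lemma module_tensor_simp:
	"mten A V W = (fst V * fst W, %x. tens_act (fst V) (fst W) (snd V) (snd W) (SOME t. t : comult A x))"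
	by (cases V; cases W)
		 (auto simp: tens_act_def lin_act_def lin_mat_def Let_def fun_eq_iff case_prod_unfold intro!: cong_mat sum.cong)

lemma fst_module_tensor: "fst (mten A V W) = fst V * fst W"
	and fst_module_sum: "fst (msum V W) = fst V + fst W"
	by (simp_all add: module_tensor_simp module_sum_simp)

lemma tens_act_zero: "tens_act d e rh si 0 = zm (d * e) (d * e)"
	by (simp add: tens_act_def lin_act_simps)

lemma tens_act_add: "tens_act d e rh si (s + t) = tens_act d e rh si s + tens_act d e rh si t"
	and tens_act_diff: "tens_act d e rh si (s - t) = tens_act d e rh si s - tens_act d e rh si t"
	and tens_act_fscale: "tens_act d e rh si (fscale c t) = c \<cdot> tens_act d e rh si t"
	by (simp_all add: tens_act_def lin_act_simps)

lemma tens_act_single: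
	assumes "rh a : sqm d" "si b : sqm e"
	shows "tens_act d e rh si (sgl (a, b) c) = c \<cdot> kro (rh a) (si b)"
	using assms by (simp add: tens_act_def lin_act_single kron_carrier)

text \<open>The action is bilinear in the two tensor factors, so it kills the generating null
  tensors. Hence all elements of a tensor class act alike, and the arbitrary choice in
  \<open>module_tensor\<close> is harmless.\<close>

lemma tens_act_null:
	assumes "t : tensor_null A" "V : fdms A" "W : fdms A"
		and cl: "!!a b. a : carrier A ==> b : carrier A ==> a \<oplus>\<^bsub>A\<^esub> b : carrier A"
			"!!c a. a : carrier A ==> c \<odot>\<^bsub>A\<^esub> a : carrier A"
	shows "tens_act (fst V) (fst W) (snd V) (snd W) t = zm (fst V * fst W) (fst V * fst W)"
	using assms(1)
proof induction
	case (add_left a a' b)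
	note R = fd_modulesD[OF assms(2)] fd_modulesD[OF assms(3)]
	have D: "dim_row (snd V x) = fst V" "dim_col (snd V x) = fst V" "dim_row (snd W x) = fst W" "dim_col (snd W x) = fst W"
		if "x : carrier A" for x using R(1,6)[OF that] by auto
	show ?case using add_left
		by (simp add: tens_act_diff tens_act_single R cl kron_add_left D) (rule eq_matI, auto simp: D)
next
	case (add_right a b b')
	note R = fd_modulesD[OF assms(2)] fd_modulesD[OF assms(3)]
	have D: "dim_row (snd V x) = fst V" "dim_col (snd V x) = fst V" "dim_row (snd W x) = fst W" "dim_col (snd W x) = fst W"
		if "x : carrier A" for x using R(1,6)[OF that] by auto
	show ?case using add_right
		by (simp add: tens_act_diff tens_act_single R cl kron_add_right D) (rule eq_matI, auto simp: D)
next
	case (smult_left a b c)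
	note R = fd_modulesD[OF assms(2)] fd_modulesD[OF assms(3)]
	have D: "dim_row (snd V x) = fst V" "dim_col (snd V x) = fst V" "dim_row (snd W x) = fst W" "dim_col (snd W x) = fst W"
		if "x : carrier A" for x using R(1,6)[OF that] by auto
	show ?case using smult_left
		by (simp add: tens_act_diff tens_act_fscale tens_act_single R cl kron_smult_left D) (rule eq_matI, auto simp: D)
next
	case (smult_right a b c)
	note R = fd_modulesD[OF assms(2)] fd_modulesD[OF assms(3)]
	have D: "dim_row (snd V x) = fst V" "dim_col (snd V x) = fst V" "dim_row (snd W x) = fst W" "dim_col (snd W x) = fst W"
		if "x : carrier A" for x using R(1,6)[OF that] by auto
	show ?case using smult_right
		by (simp add: tens_act_diff tens_act_fscale tens_act_single R cl kron_smult_right D) (rule eq_matI, auto simp: D)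
qed (simp_all add: tens_act_zero tens_act_add tens_act_fscale)

lemma tens_act_tensor_class:
	assumes s: "s : tensor_class A t" and V: "V : fdms A" "W : fdms A"
		and cl: "!!a b. a : carrier A ==> b : carrier A ==> a \<oplus>\<^bsub>A\<^esub> b : carrier A"
			"!!c a. a : carrier A ==> c \<odot>\<^bsub>A\<^esub> a : carrier A"
	shows "tens_act (fst V) (fst W) (snd V) (snd W) s = tens_act (fst V) (fst W) (snd V) (snd W) t"
proof -
	let ?f = "tens_act (fst V) (fst W) (snd V) (snd W)"
	have 0: "s - t : tensor_null A" using s by (simp add: tensor_class_def)
	have "?f s - ?f t = zm (fst V * fst W) (fst V * fst W)"
		using tens_act_null[OF 0 V cl] by (simp add: tens_act_diff)
	hence "?f s $$ (i, j) = ?f t $$ (i, j)" if "i < fst V * fst W" "j < fst V * fst W" for i j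
	proof -
		have "(?f s - ?f t) $$ (i, j) = 0" using that \<open>?f s - ?f t = _\<close> by simp
		thus ?thesis using that by simp
	qed
	thus ?thesis by (intro eq_matI) auto
qed

lemma tens_act_intertwine:
	assumes P: "mod_inter A V V' P" and P': "mod_inter A W W' P'"
		and fd: "V : fdms A" "W : fdms A" "V' : fdms A" "W' : fdms A"
		and t: "kys t \<subseteq> carrier A \<times> carrier A"
	shows "kro P P' * tens_act (fst V) (fst W) (snd V) (snd W) t =
		tens_act (fst V') (fst W') (snd V') (snd W') t * kro P P'"
proof -
	have PD: "dim_row P = fst V'" "dim_col P = fst V" "dim_row P' = fst W'" "dim_col P' = fst W"
		using P P' by (auto simp: mod_inter_def)
	have D: "dim_row (snd U x) = fst U" "dim_col (snd U x) = fst U" if "x : carrier A" "U : fdms A" for x U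
		using fd_modulesD(1)[OF that(2,1)] by auto
	have c: "a : carrier A" "b : carrier A" if "(a, b) : kys t" for a b
		using t that by auto
	have "kro P P' * tens_act (fst V) (fst W) (snd V) (snd W) t =
			lin_mat (fst V' * fst W') (fst V * fst W) (kys t) (lkp t)
				(%x. kro P P' * (case x of (a, b) => kro (snd V a) (snd W b)))"
		unfolding tens_act_def lin_act_def
		by (subst mult_lin_mat) (use c fd in "auto simp: PD D intro!: carrier_matI")
	also have "... = lin_mat (fst V' * fst W') (fst V * fst W) (kys t) (lkp t)
				(%x. (case x of (a, b) => kro (snd V' a) (snd W' b)) * kro P P')"
		using P P' by (intro lin_mat_cong) (use c fd in "auto simp: kron_mult PD D mod_inter_def")
	also have "... = tens_act (fst V') (fst W') (snd V') (snd W') t * kro P P'"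
		unfolding tens_act_def lin_act_def
		by (subst lin_mat_mult) (use c fd in "auto simp: PD D intro!: carrier_matI")
	finally show ?thesis .
qed

section \<open>Modules determined by multisets of irreducible labels\<close>

definition fusm :: "(irr => irr => irr multiset) => irr multiset => irr multiset => irr multiset" where
	"fusm f mm nu = (\<Sum>k\<in>#mm. \<Sum>l\<in>#nu. f k l)"

lemma fusm_simps [simp]:
	"fusm f {#} nu = {#}" "fusm f mm {#} = {#}" "fusm f {#k#} {#l#} = f k l"
	"fusm f (mm + mm') nu = fusm f mm nu + fusm f mm' nu" "fusm f mm (nu + nu') = fusm f mm nu + fusm f mm nu'"
	by (simp_all add: fusm_def sum_mset.distrib)

text \<open>What the group algebra and Suzuki's algebra have in common. Tensor products and duals
  enter through their constituents only, and only for modules whose triple is literally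
  \<open>S k\<close>; this leaves room for different comultiplications.\<close>

locale hopf_dihedral = dihedral N n om ze for N n :: nat and om ze :: "'k::field" +
	fixes A :: "('k, 'a) hopf_algebra" and z t w :: 'a
	assumes gens: "z : carrier A" "t : carrier A" "w : carrier A"
		and antipode_closed: "a : carrier A ==> antipode A a : carrier A"
		and trips_of_module: "V : fdms A ==> (fst V, snd V z, snd V t, snd V w) : trips"
		and gens_generate: "V : fdms A ==> W : fdms A ==> P : carrier_mat (fst W) (fst V) ==>
			(!!g. g : {z, t, w} ==> P * snd V g = snd W g * P) ==> mod_inter A V W P"
		and irr_exists: "k : K ==> \<exists>V\<in>fdms A. (fst V, snd V z, snd V t, snd V w) = S k"
		and trivial_fd: "tmod A : fdms A"
		and trivial_trip: "(1, snd (tmod A) z, snd (tmod A) t, snd (tmod A) w) = S (Chi 0 True False)"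
		and comult_rep: "a : carrier A ==> kys (SOME s. s : comult A a) \<subseteq> carrier A \<times> carrier A"
		and tensor_fd: "V : fdms A ==> W : fdms A ==> mten A V W : fdms A"
		and dual_fd: "V : fdms A ==> dmod A V : fdms A"
		and tensor_irr: "k : K ==> l : K ==> V : fdms A ==> W : fdms A ==>
			(fst V, snd V z, snd V t, snd V w) = S k ==> (fst W, snd W z, snd W t, snd W w) = S l ==>
			U = mten A V W ==> mu (fst U, snd U z, snd U t, snd U w) = fus k l"
		and dual_irr: "k : K ==> V : fdms A ==> (fst V, snd V z, snd V t, snd V w) = S k ==>
			U = dmod A V ==> mu (fst U, snd U z, snd U t, snd U w) = {#dual_irr k#}"
begin

definition tr :: "('k, 'a) matmod => 'k trip" where
	"tr V = (fst V, snd V z, snd V t, snd V w)"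

definition muM :: "('k, 'a) matmod => irr multiset" where
	"muM V = mu (tr V)"

abbreviation "fdm == fdms A"

lemma tr_trips: "V : fdm ==> tr V : trips"
	and tr_carrier: "V : fdm ==> tr V : tcarrier"
	using trips_of_module tripsD(1) by (auto simp: tr_def)

lemma set_muM: "set_mset (muM V) \<subseteq> K"
	unfolding muM_def by (rule set_mu)

lemma mod_inter_iff:
	assumes "V : fdm" "W : fdm"
	shows "mod_inter A V W P \<longleftrightarrow> intertw (tr V) (tr W) P"
proof
	show "intertw (tr V) (tr W) P" if "mod_inter A V W P"
		using that gens by (auto simp: mod_inter_def intertw_def tr_def)
	show "mod_inter A V W P" if "intertw (tr V) (tr W) P"
		by (rule gens_generate[OF assms]) (use that in "auto simp: intertw_def tr_def")
qed

lemma module_iso_muM: "(V, W) : module_iso A \<longleftrightarrow> V : fdm & W : fdm & muM V = muM W"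
proof (cases "V : fdm & W : fdm")
	case True
	hence "(V, W) : module_iso A \<longleftrightarrow> tiso (tr V) (tr W)"
		by (auto simp: module_iso_iff mod_inter_iff tiso_def) (auto simp: tr_def)
	thus ?thesis using True tiso_iff_mu tr_trips by (auto simp: muM_def)
qed (auto simp: module_iso_iff)

lemma muM_sum: "V : fdm ==> W : fdm ==> muM (msum V W) = muM V + muM W"
proof -
	have "tr (msum V W) = tsum (tr V) (tr W)"
		by (simp add: tr_def tsum_def module_sum_simp Let_def)
	thus "V : fdm ==> W : fdm ==> muM (msum V W) = muM V + muM W"
		by (simp add: muM_def mu_tsum tr_carrier)
qed

lemma muM_zero: "muM zero_module = {#}"
	unfolding muM_def by (rule mu_dim_0) (simp add: tr_def zero_module_def)

lemma muM_trivial: "muM (tmod A) = {#Chi 0 True False#}"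
proof -
	have "Chi 0 True False : K" by (auto simp: K_def)
	moreover have "tr (tmod A) = S (Chi 0 True False)"
		using trivial_trip by (simp add: tr_def trivial_module_def)
	ultimately show ?thesis unfolding muM_def by (simp only: mu_S)
qed

lemma muM_irr:
	assumes "k : K"
	obtains V where "V : fdm" "tr V = S k" "muM V = {#k#}"
	using irr_exists[OF assms] that mu_S[OF assms] by (metis muM_def tr_def)

lemma muM_surj:
	assumes "set_mset mm \<subseteq> K"
	obtains V where "V : fdm" "muM V = mm"
proof -
	have "\<exists>V\<in>fdm. muM V = mm" using assms
	proof (induction mm)
		case empty
		show ?case using zero_module_fd muM_zero by blast
	next
		case (add k mm)
		then obtain V where "V : fdm" "muM V = mm" by auto
		moreover have k: "k : K" using add.prems by simp
		moreover obtain W where "W : fdm" "tr W = S k" "muM W = {#k#}" by (rule muM_irr[OF k])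
		ultimately have "msum W V : fdm" "muM (msum W V) = add_mset k mm"
			by (simp_all add: module_sum_fd muM_sum)
		thus ?case by blast
	qed
	thus ?thesis using that by blast
qed

lemma mod_inter_tensor:
	assumes "mod_inter A V V' P" "mod_inter A W W' P'" "V : fdm" "W : fdm" "V' : fdm" "W' : fdm"
	shows "mod_inter A (mten A V W) (mten A V' W') (kro P P')"
	unfolding mod_inter_def module_tensor_simp fst_conv snd_conv
	using assms(1,2) tens_act_intertwine[OF assms comult_rep] by (auto simp: mod_inter_def intro: kron_carrier)

lemma muM_tensor_cong:
	assumes "V : fdm" "W : fdm" "V' : fdm" "W' : fdm" "muM V = muM V'" "muM W = muM W'"
	shows "muM (mten A V W) = muM (mten A V' W')"
proof -
	from assms have "(V, V') : module_iso A" "(W, W') : module_iso A" by (auto simp: module_iso_muM)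
	then obtain P Q P' Q' where PQ: "mod_inter A V V' P" "Q : carrier_mat (fst V) (fst V')"
			"Q * P = idm (fst V)" "P * Q = idm (fst V')"
		and PQ': "mod_inter A W W' P'" "Q' : carrier_mat (fst W) (fst W')"
			"Q' * P' = idm (fst W)" "P' * Q' = idm (fst W')"
		by (auto simp: module_iso_iff)
	have "(mten A V W, mten A V' W') : module_iso A"
		unfolding module_iso_iff
	proof (intro conjI exI)
		show "mod_inter A (mten A V W) (mten A V' W') (kro P P')"
			by (rule mod_inter_tensor[OF PQ(1) PQ'(1) assms(1-4)])
		show "kro Q Q' : carrier_mat (fst (mten A V W)) (fst (mten A V' W'))"
			using PQ PQ' by (simp add: module_tensor_simp kron_carrier)
		show "kro Q Q' * kro P P' = idm (fst (mten A V W))"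
			"kro P P' * kro Q Q' = idm (fst (mten A V' W'))"
			using PQ PQ' by (auto simp: kron_mult mod_inter_def module_tensor_simp kron_one)
	qed (use assms tensor_fd in auto)
	thus ?thesis by (simp add: module_iso_muM)
qed

lemma mod_inter_sum_mat:
	assumes "V : fdm" "W : fdm"
	shows "mod_inter A V (msum V W) (inl_mat (fst V) (fst W))" "mod_inter A W (msum V W) (inr_mat (fst V) (fst W))"
	using fd_modulesD(1)[OF assms(1)] fd_modulesD(1)[OF assms(2)]
	by (auto simp: mod_inter_def module_sum_simp diag_block_simps)

lemma mod_inter_one: "V : fdm ==> mod_inter A V V (idm (fst V))"
	by (auto simp: mod_inter_def mrs dest: fd_modulesD(1))

lemma muM_split:
	assumes "mod_inter A V1 V P1" "mod_inter A V2 V P2" "Q1 : carrier_mat (fst V1) (fst V)" "Q2 : carrier_mat (fst V2) (fst V)"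
		and "Q1 * P1 = idm (fst V1)" "Q2 * P2 = idm (fst V2)" "Q1 * P2 = zm (fst V1) (fst V2)"
			"Q2 * P1 = zm (fst V2) (fst V1)" "P1 * Q1 + P2 * Q2 = idm (fst V)"
		and fd: "V : fdm" "V1 : fdm" "V2 : fdm"
	shows "muM V = muM V1 + muM V2"
proof -
	have "tiso (tr V) (tsum (tr V1) (tr V2))"
		by (rule tiso_tsumI[of "tr V1" "tr V" P1 "tr V2" P2 Q1 Q2])
			(use assms in "simp_all add: mod_inter_iff[symmetric] tr_carrier, simp_all add: tr_def")
	thus ?thesis unfolding muM_def using fd by (simp add: mu_tiso[of "tr V"] mu_tsum tr_carrier)
qed

lemma muM_tensor_sum_left:
	assumes "V : fdm" "V' : fdm" "W : fdm"
	shows "muM (mten A (msum V V') W) = muM (mten A V W) + muM (mten A V' W)"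
proof (rule muM_split)
	let ?d = "fst V" and ?e = "fst V'" and ?f = "fst W"
	note fd = assms module_sum_fd[OF assms(1,2)]
	show "mod_inter A (mten A V W) (mten A (msum V V') W) (kro (inl_mat ?d ?e) (idm ?f))"
		"mod_inter A (mten A V' W) (mten A (msum V V') W) (kro (inr_mat ?d ?e) (idm ?f))"
		by (intro mod_inter_tensor mod_inter_sum_mat mod_inter_one fd)+
	show "kro (prl_mat ?d ?e) (idm ?f) : carrier_mat (fst (mten A V W)) (fst (mten A (msum V V') W))"
		"kro (prr_mat ?d ?e) (idm ?f) : carrier_mat (fst (mten A V' W)) (fst (mten A (msum V V') W))"
		by (auto simp: fst_module_tensor fst_module_sum intro!: kron_carrier)
qed (use assms in "simp_all add: kron_mult kron_one fst_module_tensor fst_module_sum kron_zero_left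
		kron_add_left[symmetric] tensor_fd module_sum_fd")

lemma muM_tensor_sum_right:
	assumes "V : fdm" "V' : fdm" "W : fdm"
	shows "muM (mten A W (msum V V')) = muM (mten A W V) + muM (mten A W V')"
proof (rule muM_split)
	let ?d = "fst V" and ?e = "fst V'" and ?f = "fst W"
	note fd = assms module_sum_fd[OF assms(1,2)]
	show "mod_inter A (mten A W V) (mten A W (msum V V')) (kro (idm ?f) (inl_mat ?d ?e))"
		"mod_inter A (mten A W V') (mten A W (msum V V')) (kro (idm ?f) (inr_mat ?d ?e))"
		by (intro mod_inter_tensor mod_inter_sum_mat mod_inter_one fd)+
	show "kro (idm ?f) (prl_mat ?d ?e) : carrier_mat (fst (mten A W V)) (fst (mten A W (msum V V')))"
		"kro (idm ?f) (prr_mat ?d ?e) : carrier_mat (fst (mten A W V')) (fst (mten A W (msum V V')))"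
		by (auto simp: fst_module_tensor fst_module_sum intro!: kron_carrier)
qed (use assms in "simp_all add: kron_mult kron_one fst_module_tensor fst_module_sum kron_zero_right
		kron_add_right[symmetric] tensor_fd module_sum_fd")

lemma muM_tensor_zero:
	"fst V = 0 \<or> fst W = 0 ==> muM (mten A V W) = {#}"
	unfolding muM_def by (rule mu_dim_0) (auto simp: tr_def module_tensor_simp)

text \<open>The constituents of a tensor product depend only on those of the factors, so each factor
  may be replaced by a sum of irreducible representatives. Additivity in each factor then reduces
  the claim to \<open>tensor_irr\<close>, by induction on both multisets.\<close>

lemma muM_tensor:
	assumes "V : fdm" "W : fdm"
	shows "muM (mten A V W) = fusm fus (muM V) (muM W)"
proof -
	have irr: "muM (mten A V W) = fusm fus {#k#} (muM W)" if k: "k : K" and V: "V : fdm" "tr V = S k" and W: "W : fdm" for k V W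
		using W
	proof (induction "muM W" arbitrary: W)
		case empty
		have "muM (mten A V W) = muM (mten A V zero_module)"
			using empty V by (intro muM_tensor_cong) (auto simp: zero_module_fd muM_zero)
		thus ?case using empty muM_tensor_zero[of V zero_module] by (simp add: zero_module_def)
	next
		case (add l nu)
		have l: "l : K" "set_mset nu \<subseteq> K" using set_muM[of W] add.hyps(2)[symmetric] by auto
		obtain U where U: "U : fdm" "tr U = S l" "muM U = {#l#}" using muM_irr l by blast
		obtain U' where U': "U' : fdm" "muM U' = nu" using muM_surj l by blast
		have "muM (mten A V W) = muM (mten A V (msum U U'))"
			using add U U' V by (intro muM_tensor_cong) (auto simp: module_sum_fd muM_sum)
		also have "... = muM (mten A V U) + muM (mten A V U')"
			using U U' V by (simp add: muM_tensor_sum_right)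
		also have "muM (mten A V U) = fus k l"
			unfolding muM_def tr_def using tensor_irr[OF k l(1) V(1) U(1)] V U by (simp add: tr_def)
		also have "muM (mten A V U') = fusm fus {#k#} nu"
			using add.hyps(1)[of U'] U' by simp
		finally show ?case
			using add.hyps(2)[symmetric] fusm_simps(5)[of fus "{#k#}" "{#l#}" nu] by simp
	qed
	show ?thesis using assms(1)
	proof (induction "muM V" arbitrary: V)
		case empty
		have "muM (mten A V W) = muM (mten A zero_module W)"
			using empty assms by (intro muM_tensor_cong) (auto simp: zero_module_fd muM_zero)
		thus ?case using empty muM_tensor_zero[of zero_module W] by (simp add: zero_module_def)
	next
		case (add l nu)
		have l: "l : K" "set_mset nu \<subseteq> K" using set_muM[of V] add.hyps(2)[symmetric] by auto
		obtain U where U: "U : fdm" "tr U = S l" "muM U = {#l#}" using muM_irr l by blast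
		obtain U' where U': "U' : fdm" "muM U' = nu" using muM_surj l by blast
		have "muM (mten A V W) = muM (mten A (msum U U') W)"
			using add U U' assms by (intro muM_tensor_cong) (auto simp: module_sum_fd muM_sum)
		also have "... = muM (mten A U W) + muM (mten A U' W)"
			using U U' assms by (simp add: muM_tensor_sum_left)
		also have "muM (mten A U W) = fusm fus {#l#} (muM W)"
			by (rule irr[OF l(1) U(1,2) assms(2)])
		also have "muM (mten A U' W) = fusm fus nu (muM W)"
			using add.hyps(1)[of U'] U' by simp
		finally show ?case
			using add.hyps(2)[symmetric] fusm_simps(4)[of fus "{#l#}" nu "muM W"] by simp
	qed
qed

lemma dual_module_simp: "dmod A V = (fst V, %a. trm (snd V (antipode A a)))"
	by (cases V) simp

lemma muM_dual_cong:
	assumes "V : fdm" "V' : fdm" "muM V = muM V'"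
	shows "muM (dmod A V) = muM (dmod A V')"
proof -
	from assms have "(V', V) : module_iso A" by (auto simp: module_iso_muM)
	then obtain P Q where PQ: "mod_inter A V' V P" "Q : carrier_mat (fst V') (fst V)"
			"Q * P = idm (fst V')" "P * Q = idm (fst V)"
		by (auto simp: module_iso_iff)
	have P: "P : carrier_mat (fst V) (fst V')" using PQ by (simp add: mod_inter_def)
	have "(dmod A V, dmod A V') : module_iso A"
		unfolding module_iso_iff
	proof (intro conjI exI)
		show "mod_inter A (dmod A V) (dmod A V') (trm P)"
			unfolding mod_inter_def dual_module_simp fst_conv snd_conv
		proof (intro conjI ballI)
			fix a assume "a : carrier A"
			hence a: "antipode A a : carrier A" by (rule antipode_closed)
			have "trm P * trm (snd V (antipode A a)) = trm (snd V (antipode A a) * P)"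
				using P fd_modulesD(1)[OF assms(1) a] by (simp add: transpose_mult)
			also have "snd V (antipode A a) * P = P * snd V' (antipode A a)"
				using PQ(1) a by (simp add: mod_inter_def)
			also have "trm ... = trm (snd V' (antipode A a)) * trm P"
				using P fd_modulesD(1)[OF assms(2) a] by (simp add: transpose_mult)
			finally show "trm P * trm (snd V (antipode A a)) = trm (snd V' (antipode A a)) * trm P" .
		qed (use P in auto)
		show "trm Q : carrier_mat (fst (dmod A V)) (fst (dmod A V'))"
			using PQ by (simp add: dual_module_simp)
		show "trm Q * trm P = idm (fst (dmod A V))"
			"trm P * trm Q = idm (fst (dmod A V'))"
			using PQ P by (simp_all add: transpose_mult[symmetric] dual_module_simp)
	qed (use assms dual_fd in auto)
	thus ?thesis by (simp add: module_iso_muM)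
qed

lemma muM_dual:
	assumes "V : fdm"
	shows "muM (dmod A V) = image_mset dual_irr (muM V)"
	using assms
proof (induction "muM V" arbitrary: V)
	case empty
	have "muM (dmod A V) = muM (dmod A zero_module)"
		using empty by (intro muM_dual_cong) (auto simp: zero_module_fd muM_zero)
	also have "... = {#}"
		unfolding muM_def by (rule mu_dim_0) (simp add: tr_def dual_module_simp zero_module_def)
	finally show ?case using empty by simp
next
	case (add l nu)
	have l: "l : K" "set_mset nu \<subseteq> K" using set_muM[of V] add.hyps(2)[symmetric] by auto
	obtain U where U: "U : fdm" "tr U = S l" "muM U = {#l#}" using muM_irr l by blast
	obtain U' where U': "U' : fdm" "muM U' = nu" using muM_surj l by blast
	have "muM (dmod A V) = muM (dmod A (msum U U'))"
		using add U U' by (intro muM_dual_cong) (auto simp: module_sum_fd muM_sum)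
	also have "tr (dmod A (msum U U')) = tsum (tr (dmod A U)) (tr (dmod A U'))"
	proof -
		have "trm (four_block_mat (snd U (antipode A a)) (zm (fst U) (fst U')) (zm (fst U') (fst U)) (snd U' (antipode A a))) =
			four_block_mat (trm (snd U (antipode A a))) (zm (fst U) (fst U')) (zm (fst U') (fst U)) (trm (snd U' (antipode A a)))"
			if "a : carrier A" for a
			using fd_modulesD(1)[OF U(1) antipode_closed[OF that]] fd_modulesD(1)[OF U'(1) antipode_closed[OF that]]
			by (subst transpose_four_block_mat) (auto simp: transpose_mat_def intro!: eq_matI)
		thus ?thesis using gens by (simp add: tr_def dual_module_simp module_sum_simp tsum_def Let_def)
	qed
	hence "muM (dmod A (msum U U')) = muM (dmod A U) + muM (dmod A U')"
		unfolding muM_def using U U' by (simp add: mu_tsum tr_carrier dual_fd)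
	also have "muM (dmod A U) = {#dual_irr l#}"
		unfolding muM_def tr_def using dual_irr[OF l(1) U(1)] U by (simp add: tr_def)
	also have "muM (dmod A U') = image_mset dual_irr nu"
		using add.hyps(1)[of U'] U' by simp
	finally show ?case using add.hyps(2)[symmetric] by simp
qed

end

section \<open>Representation rings\<close>

lemma induced_eq:
	assumes "x : X" "!!y. y : X ==> f y = f x"
	shows "induced f X = f x"
proof -
	have "f ` X = (%_. f x) ` X" by (rule image_cong[OF HOL.refl]) (rule assms(2))
	also have "... = {f x}" using assms(1) by auto
	finally have "f ` X = {f x}" .
	thus ?thesis by (simp add: induced_def)
qed

lemma induced2_eq:
	assumes "x : X" "y : Y" "!!x' y'. x' : X ==> y' : Y ==> f x' y' = f x y"
	shows "induced2 f X Y = f x y"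
proof -
	have "(%(x, y). f x y) ` (X \<times> Y) = (%_. f x y) ` (X \<times> Y)"
		by (rule image_cong) (use assms(3) in auto)
	also have "... = {f x y}" using assms(1,2) by auto
	finally have "(%(x, y). f x y) ` (X \<times> Y) = {f x y}" .
	thus ?thesis by (simp add: induced2_def)
qed

context dihedral
begin

abbreviation KM :: "irr multiset set" where "KM == {mm. set_mset mm \<subseteq> K}"

abbreviation dualm :: "irr multiset => irr multiset" where "dualm == image_mset dual_irr"

lemma vv_K: "set_mset (vv u j) \<subseteq> K"
	unfolding mu_Vt[symmetric] by (rule set_mu)

lemma fus_K: "set_mset (fus k l) \<subseteq> K"
proof (cases k; cases l)
	fix u e d u' e' d' assume "k = Chi u e d" "l = Chi u' e' d'"
	thus ?thesis by (auto simp: K_def)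
qed (use vv_K in "auto simp: subset_iff")

lemma fusm_K [simp]: "fusm fus mm nu : KM"
	using fus_K by (auto simp: fusm_def subset_iff)

lemma dualm_K: "mm : KM ==> dualm mm : KM"
	using dual_irr_K by auto

lemma neg_add_mod:
	assumes "u < N" "u' < N"
	shows "((N - u) mod N + (N - u') mod N) mod N = (N - (u + u') mod N) mod N"
proof -
	have "((N - u) + (N - u')) mod N = (N - (u + u') mod N) mod N"
	proof (cases "u + u' < N")
		case True
		hence e: "(N - u) + (N - u') = (N - (u + u')) + N" by simp
		have "(u + u') mod N = u + u'" using True by simp
		thus ?thesis unfolding e by (simp only: mod_add_self2)
	next
		case False
		hence "(u + u') mod N = u + u' - N"
			using assms by (simp add: mod_if)
		thus ?thesis using False assms by simp
	qed
	thus ?thesis by (simp add: mod_simps)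
qed

lemma vv_dual: "dualm (vv u j) = vv ((N - u mod N) mod N) j"
	by (auto simp: vv_def Let_def)

lemma vv_mod: "vv (u mod N) j = vv u j"
	by (simp add: vv_def)

lemma fus_dual:
	assumes "k : K" "l : K"
	shows "fus (dual_irr k) (dual_irr l) = dualm (fus k l)"
proof -
	have v: "vv ((N - u) mod N + (N - u') mod N) j = dualm (vv (u + u') j)" if "u < N" "u' < N" for u u' j
		using neg_add_mod[OF that] by (metis vv_dual vv_mod)
	show ?thesis
		using assms by (cases k; cases l) (auto simp: K_def v neg_add_mod)
qed

lemma fusm_dual:
	assumes "mm : KM" "nu : KM"
	shows "fusm fus (dualm mm) (dualm nu) = dualm (fusm fus mm nu)"
	using assms(1)
proof (induction mm)
	case (add k mm)
	have "fusm fus {#dual_irr k#} (dualm nu) = dualm (fusm fus {#k#} nu)"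
		using assms(2)
	proof (induction nu)
		case (add l nu)
		thus ?case
			using fusm_simps(5)[of fus "{#dual_irr k#}" "{#dual_irr l#}" "dualm nu"]
				fusm_simps(5)[of fus "{#k#}" "{#l#}" nu] fus_dual[of k l] \<open>add_mset k mm : KM\<close> by simp
	qed simp
	thus ?case
		using add fusm_simps(4)[of fus "{#dual_irr k#}" "dualm mm" "dualm nu"]
			fusm_simps(4)[of fus "{#k#}" mm nu] by simp
qed simp

end

context hopf_dihedral
begin

section \<open>The representation ring in terms of multisets of labels\<close>

abbreviation "SR == module_semiring A"

definition cl :: "irr multiset => ('k, 'a) matmod set" where
	"cl mm = {V : fdm. muM V = mm}"

lemma cl_nonempty: "mm : KM ==> \<exists>V. V : cl mm"
	using muM_surj[of mm] unfolding cl_def by blast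

lemma iso_class_cl: "V : fdm ==> iso_class A V = cl (muM V)"
	by (auto simp: cl_def module_iso_muM)

lemma cl_inj: "mm : KM ==> cl mm = cl nu \<longleftrightarrow> mm = nu"
	using cl_nonempty[of mm] by (auto simp: cl_def)

lemma carrier_SR: "carrier SR = cl ` KM"
proof -
	have "carrier SR = iso_class A ` fdm"
		by (auto simp: module_semiring_def quotient_def)
	also have "... = cl ` KM"
		using set_muM muM_surj by (auto simp: iso_class_cl image_iff) (metis)
	finally show ?thesis .
qed

lemma mult_SR: "mm : KM ==> nu : KM ==> cl mm \<otimes>\<^bsub>SR\<^esub> cl nu = cl (fusm fus mm nu)"
proof -
	assume "mm : KM" "nu : KM"
	then obtain V W where V: "V : cl mm" "W : cl nu" using cl_nonempty by blast
	have "induced2 (%V W. iso_class A (mten A V W)) (cl mm) (cl nu) = iso_class A (mten A V W)"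
		by (rule induced2_eq[OF V]) (use V in "auto simp: cl_def iso_class_cl tensor_fd muM_tensor")
	thus ?thesis using V by (auto simp: module_semiring_def cl_def iso_class_cl tensor_fd muM_tensor)
qed

lemma add_SR: "mm : KM ==> nu : KM ==> cl mm \<oplus>\<^bsub>SR\<^esub> cl nu = cl (mm + nu)"
proof -
	assume "mm : KM" "nu : KM"
	then obtain V W where V: "V : cl mm" "W : cl nu" using cl_nonempty by blast
	have "induced2 (%V W. iso_class A (msum V W)) (cl mm) (cl nu) = iso_class A (msum V W)"
		by (rule induced2_eq[OF V]) (use V in "auto simp: cl_def iso_class_cl module_sum_fd muM_sum simp del: module_sum.simps")
	thus ?thesis using V by (auto simp: module_semiring_def cl_def iso_class_cl module_sum_fd muM_sum simp del: module_sum.simps)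
qed

lemma star_SR: "mm : KM ==> star SR (cl mm) = cl (dualm mm)"
proof -
	assume "mm : KM"
	then obtain V where V: "V : cl mm" using cl_nonempty by blast
	have "induced (%V. iso_class A (dmod A V)) (cl mm) = iso_class A (dmod A V)"
		by (rule induced_eq[OF V]) (use V in "auto simp: cl_def iso_class_cl dual_fd muM_dual simp del: dual_module.simps")
	thus ?thesis using V by (auto simp: module_semiring_def cl_def iso_class_cl dual_fd muM_dual simp del: dual_module.simps)
qed

lemma one_SR: "\<one>\<^bsub>SR\<^esub> = cl {#Chi 0 True False#}" and zero_SR: "\<zero>\<^bsub>SR\<^esub> = cl {#}"
	by (simp_all add: module_semiring_def iso_class_cl trivial_fd zero_module_fd muM_trivial muM_zero)

text \<open>A class of formal differences. Multisets are cancellative, so the auxiliary summand in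
  \<open>groth_rel\<close> disappears and equality of classes becomes one multiset equation.\<close>

definition gcl :: "irr multiset => irr multiset => (('k, 'a) matmod set \<times> ('k, 'a) matmod set) set" where
	"gcl mm nu = {(cl mm', cl nu') | mm' nu'. mm' : KM & nu' : KM & mm + nu' = mm' + nu}"

lemma KM_add: "mm : KM ==> nu : KM ==> mm + nu : KM"
	by auto

lemma groth_class_gcl:
	assumes "mm : KM" "nu : KM"
	shows "groth_class SR (cl mm, cl nu) = gcl mm nu"
proof -
	have 1: "((cl mm, cl nu), (cl mm', cl nu')) : groth_rel SR \<longleftrightarrow> mm + nu' = mm' + nu" if "mm' : KM" "nu' : KM" for mm' nu'
	proof -
		have "((cl mm, cl nu), (cl mm', cl nu')) : groth_rel SR \<longleftrightarrow>
				(\<exists>ka\<in>KM. cl mm \<oplus>\<^bsub>SR\<^esub> cl nu' \<oplus>\<^bsub>SR\<^esub> cl ka = cl mm' \<oplus>\<^bsub>SR\<^esub> cl nu \<oplus>\<^bsub>SR\<^esub> cl ka)"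
			using assms that by (auto simp: groth_rel_def carrier_SR)
		also have "... \<longleftrightarrow> (\<exists>ka\<in>KM. mm + nu' + ka = mm' + nu + ka)"
		proof (rule bex_cong[OF HOL.refl])
			fix ka assume ka: "ka : KM"
			note K1 = KM_add[OF assms(1) that(2)] KM_add[OF that(1) assms(2)]
			show "(cl mm \<oplus>\<^bsub>SR\<^esub> cl nu' \<oplus>\<^bsub>SR\<^esub> cl ka = cl mm' \<oplus>\<^bsub>SR\<^esub> cl nu \<oplus>\<^bsub>SR\<^esub> cl ka) \<longleftrightarrow> mm + nu' + ka = mm' + nu + ka"
				unfolding add_SR[OF assms(1) that(2)] add_SR[OF that(1) assms(2)] add_SR[OF K1(1) ka] add_SR[OF K1(2) ka]
				by (rule cl_inj[OF KM_add[OF K1(1) ka]])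
		qed
		also have "... \<longleftrightarrow> mm + nu' = mm' + nu" by (auto intro: exI[of _ "{#}"])
		finally show ?thesis .
	qed
	have "((cl mm, cl nu), p) : groth_rel SR \<longleftrightarrow> p : gcl mm nu" for p
	proof
		assume p: "((cl mm, cl nu), p) : groth_rel SR"
		then obtain mm' nu' where *: "mm' : KM" "nu' : KM" "p = (cl mm', cl nu')"
			by (auto simp: groth_rel_def carrier_SR)
		thus "p : gcl mm nu" using 1[OF *(1,2)] p unfolding gcl_def by blast
	next
		assume "p : gcl mm nu"
		then obtain mm' nu' where *: "mm' : KM" "nu' : KM" "p = (cl mm', cl nu')" "mm + nu' = mm' + nu"
			unfolding gcl_def by blast
		thus "((cl mm, cl nu), p) : groth_rel SR" using 1[OF *(1,2)] by simp
	qed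
	thus ?thesis by (simp add: set_eq_iff)
qed

lemma gcl_mem: "mm : KM ==> nu : KM ==> (cl mm, cl nu) : gcl mm nu"
	by (auto simp: gcl_def)

lemma gclE:
	assumes "p : gcl mm nu"
	obtains mm' nu' where "p = (cl mm', cl nu')" "mm' : KM" "nu' : KM" "mm + nu' = mm' + nu"
	using assms by (auto simp: gcl_def)

lemma gcl_eq:
	assumes "mm : KM" "nu : KM" "mm' : KM" "nu' : KM"
	shows "gcl mm nu = gcl mm' nu' \<longleftrightarrow> mm + nu' = mm' + nu"
proof
	assume "gcl mm nu = gcl mm' nu'"
	hence "(cl mm', cl nu') : gcl mm nu" using gcl_mem assms by simp
	thus "mm + nu' = mm' + nu" using assms by (auto elim!: gclE simp: cl_inj)
next
	assume eq: "mm + nu' = mm' + nu"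
	have "mm + be = ap + nu \<longleftrightarrow> mm' + be = ap + nu'" for ap be :: "irr multiset"
	proof -
		have "mm + be = ap + nu \<longleftrightarrow> mm + nu' + be = ap + nu + nu'"
			by (metis add.assoc add.commute add_right_cancel)
		also have "... \<longleftrightarrow> mm' + be + nu = ap + nu' + nu"
			unfolding eq by (simp add: ac_simps)
		finally show ?thesis by simp
	qed
	thus "gcl mm nu = gcl mm' nu'" by (simp add: gcl_def)
qed

lemma carrier_Rep: "carrier (Rep A) = {gcl mm nu | mm nu. mm : KM & nu : KM}"
proof -
	have "carrier (Rep A) = groth_class SR ` (carrier SR \<times> carrier SR)"
		by (auto simp: Rep_def grothendieck_def quotient_def)
	also have "... = {gcl mm nu | mm nu. mm : KM & nu : KM}"
	proof -
		have "carrier SR \<times> carrier SR = (%(mm, nu). (cl mm, cl nu)) ` (KM \<times> KM)"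
			unfolding carrier_SR by auto
		moreover have "groth_class SR ` (%(mm, nu). (cl mm, cl nu)) ` (KM \<times> KM) = (%(mm, nu). gcl mm nu) ` (KM \<times> KM)"
			unfolding image_image
		proof (rule image_cong[OF HOL.refl])
			fix p assume "p : KM \<times> KM"
			then obtain mm nu where "p = (mm, nu)" "mm : KM" "nu : KM" by blast
			thus "groth_class SR (case p of (mm, nu) => (cl mm, cl nu)) = (case p of (mm, nu) => gcl mm nu)"
				by (simp only: split_conv groth_class_gcl)
		qed
		ultimately show ?thesis by auto
	qed
	finally show ?thesis .
qed

lemma add_Rep:
	assumes "mm : KM" "nu : KM" "mm' : KM" "nu' : KM"
	shows "gcl mm nu \<oplus>\<^bsub>Rep A\<^esub> gcl mm' nu' = gcl (mm + mm') (nu + nu')"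
proof -
	let ?f = "%(a, b) (c, d). groth_class SR (a \<oplus>\<^bsub>SR\<^esub> c, b \<oplus>\<^bsub>SR\<^esub> d)"
	have f: "?f (cl a, cl b) (cl c, cl d) = gcl (a + c) (b + d)" if "a : KM" "b : KM" "c : KM" "d : KM" for a b c d
		using that by (simp only: split_conv add_SR groth_class_gcl KM_add)
	have "induced2 ?f (gcl mm nu) (gcl mm' nu') = ?f (cl mm, cl nu) (cl mm', cl nu')"
	proof (rule induced2_eq)
		fix p q assume "p : gcl mm nu" "q : gcl mm' nu'"
		then obtain a b c d where "p = (cl a, cl b)" "a : KM" "b : KM" "mm + b = a + nu"
			"q = (cl c, cl d)" "c : KM" "d : KM" "mm' + d = c + nu'" by (auto elim!: gclE)
		moreover from this have "a + c + (nu + nu') = mm + mm' + (b + d)" by (metis add.assoc add.commute)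
		ultimately show "?f p q = ?f (cl mm, cl nu) (cl mm', cl nu')"
			using assms by (simp only: f) (simp add: gcl_eq KM_add)
	qed (use assms gcl_mem in auto)
	thus ?thesis unfolding f[OF assms] by (simp add: Rep_def grothendieck_def)
qed

text \<open>This is the well-definedness of the product of formal differences. The hypotheses are
  multiplied by \<open>ga\<close> and \<open>\<delta>\<close>, respectively by \<open>mm\<close> and
  \<open>nu\<close>; the four resulting equations are combined by linear arithmetic on
  counts.\<close>

lemma fusm_diff_cong:
	assumes "mm + be = ap + nu" "mm' + \<delta> = ga + nu'"
	shows "fusm f ap ga + fusm f be \<delta> + (fusm f mm nu' + fusm f nu mm') =
		fusm f mm mm' + fusm f nu nu' + (fusm f ap \<delta> + fusm f be ga)"
proof -
	have 1: "fusm f mm ka + fusm f be ka = fusm f ap ka + fusm f nu ka" for ka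
		using arg_cong[OF assms(1), of "%m. fusm f m ka"] by simp
	have 2: "fusm f ka mm' + fusm f ka \<delta> = fusm f ka ga + fusm f ka nu'" for ka
		using arg_cong[OF assms(2), of "fusm f ka"] by simp
	have "fusm f ap ga + fusm f be \<delta> + (fusm f mm nu' + fusm f nu mm') + (fusm f mm ga + fusm f nu \<delta>) =
			(fusm f ap ga + fusm f nu ga) + (fusm f nu mm' + fusm f nu \<delta>) + (fusm f mm ga + fusm f mm nu') + fusm f be \<delta> - fusm f nu ga"
		by (simp add: ac_simps)
	have "count (fusm f ap ga + fusm f be \<delta> + (fusm f mm nu' + fusm f nu mm')) x =
		count (fusm f mm mm' + fusm f nu nu' + (fusm f ap \<delta> + fusm f be ga)) x" for x
		using arg_cong[OF 1[of ga], of "%m. count m x"] arg_cong[OF 1[of \<delta>], of "%m. count m x"]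
			arg_cong[OF 2[of mm], of "%m. count m x"] arg_cong[OF 2[of nu], of "%m. count m x"]
		by simp
	thus ?thesis by (rule multiset_eqI)
qed

lemma mult_Rep:
	assumes "mm : KM" "nu : KM" "mm' : KM" "nu' : KM"
	shows "gcl mm nu \<otimes>\<^bsub>Rep A\<^esub> gcl mm' nu' =
		gcl (fusm fus mm mm' + fusm fus nu nu') (fusm fus mm nu' + fusm fus nu mm')"
proof -
	let ?f = "%(a, b) (c, d). groth_class SR
			 ((a \<otimes>\<^bsub>SR\<^esub> c) \<oplus>\<^bsub>SR\<^esub> (b \<otimes>\<^bsub>SR\<^esub> d), (a \<otimes>\<^bsub>SR\<^esub> d) \<oplus>\<^bsub>SR\<^esub> (b \<otimes>\<^bsub>SR\<^esub> c))"
	have f: "?f (cl a, cl b) (cl c, cl d) = gcl (fusm fus a c + fusm fus b d) (fusm fus a d + fusm fus b c)"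
		if "a : KM" "b : KM" "c : KM" "d : KM" for a b c d
		using that by (simp only: split_conv add_SR mult_SR groth_class_gcl KM_add fusm_K)
	have "induced2 ?f (gcl mm nu) (gcl mm' nu') = ?f (cl mm, cl nu) (cl mm', cl nu')"
	proof (rule induced2_eq)
		fix p q assume "p : gcl mm nu" "q : gcl mm' nu'"
		then obtain a b c d where "p = (cl a, cl b)" "a : KM" "b : KM" and 1: "mm + b = a + nu"
			and "q = (cl c, cl d)" "c : KM" "d : KM" and 2: "mm' + d = c + nu'" by (auto elim!: gclE)
		thus "?f p q = ?f (cl mm, cl nu) (cl mm', cl nu')"
			using assms fusm_diff_cong[OF 1 2, of fus] by (simp only: f) (subst gcl_eq, auto simp: fusm_K[simplified])
	qed (use assms gcl_mem in auto)
	thus ?thesis unfolding f[OF assms] by (simp add: Rep_def grothendieck_def)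
qed

lemma star_Rep:
	assumes "mm : KM" "nu : KM"
	shows "star (Rep A) (gcl mm nu) = gcl (dualm mm) (dualm nu)"
proof -
	let ?f = "%(a, b). groth_class SR (star SR a, star SR b)"
	have f: "?f (cl a, cl b) = gcl (dualm a) (dualm b)" if "a : KM" "b : KM" for a b
		using that by (simp only: split_conv star_SR groth_class_gcl dualm_K)
	have "induced ?f (gcl mm nu) = ?f (cl mm, cl nu)"
	proof (rule induced_eq)
		fix p assume "p : gcl mm nu"
		then obtain a b where "p = (cl a, cl b)" "a : KM" "b : KM" and 1: "mm + b = a + nu"
			by (auto elim!: gclE)
		moreover have "dualm a + dualm nu = dualm mm + dualm b"
			using arg_cong[OF 1, of dualm] by simp
		ultimately show "?f p = ?f (cl mm, cl nu)"
			using assms by (simp only: f gcl_eq dualm_K)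
	qed (use assms gcl_mem in auto)
	thus ?thesis unfolding f[OF assms] by (simp add: Rep_def grothendieck_def)
qed

lemma one_K: "{#Chi 0 True False#} : KM"
	by (auto simp: K_def)

lemma one_Rep: "\<one>\<^bsub>Rep A\<^esub> = gcl {#Chi 0 True False#} {#}"
	using groth_class_gcl[OF one_K, of "{#}"] by (simp add: Rep_def grothendieck_def one_SR zero_SR)

end

text \<open>The fusion rules realized in a commutative ring: \<open>val mm\<close> is the image of the class
  of the module with multiplicities \<open>mm\<close>.\<close>

locale fusion_ring = dihedral N n om ze + cring R
	for N n :: nat and om ze :: "'k::field" and R :: "'r ring" (structure) +
	fixes val :: "irr multiset => 'r"
	assumes val_closed [simp]: "mm : KM ==> val mm : carrier R"
		and val_add: "mm : KM ==> nu : KM ==> val (mm + nu) = val mm \<oplus>\<^bsub>R\<^esub> val nu"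
		and val_mult: "mm : KM ==> nu : KM ==> val (fusm fus mm nu) = val mm \<otimes>\<^bsub>R\<^esub> val nu"
		and val_zero: "val {#} = \<zero>\<^bsub>R\<^esub>"
		and val_one: "val {#Chi 0 True False#} = \<one>\<^bsub>R\<^esub>"
		and val_inj: "mm : KM ==> nu : KM ==> val mm = val nu ==> mm = nu"
		and val_surj: "x : carrier R ==> \<exists>mm\<in>KM. \<exists>nu\<in>KM. x = val mm \<ominus>\<^bsub>R\<^esub> val nu"
begin

definition dval :: "irr multiset => irr multiset => 'r" where
	"dval mm nu = val mm \<ominus>\<^bsub>R\<^esub> val nu"

lemma dval_closed [simp]: "mm : KM ==> nu : KM ==> dval mm nu : carrier R"
	by (simp add: dval_def)

lemma dval_eq:
	assumes "mm : KM" "nu : KM" "mm' : KM" "nu' : KM"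
	shows "dval mm nu = dval mm' nu' \<longleftrightarrow> mm + nu' = mm' + nu"
proof -
	have KM: "mm + nu' : KM" "mm' + nu : KM" using assms by auto
	have "dval mm nu = dval mm' nu' \<longleftrightarrow> val mm \<oplus> val nu' = val mm' \<oplus> val nu"
	proof
		assume "dval mm nu = dval mm' nu'"
		hence "dval mm nu \<oplus> (val nu \<oplus> val nu') = dval mm' nu' \<oplus> (val nu \<oplus> val nu')" by simp
		moreover have "dval mm nu \<oplus> (val nu \<oplus> val nu') = val mm \<oplus> val nu'"
			"dval mm' nu' \<oplus> (val nu \<oplus> val nu') = val mm' \<oplus> val nu"
			using val_closed[OF assms(1)] val_closed[OF assms(2)] val_closed[OF assms(3)] val_closed[OF assms(4)]
			unfolding dval_def by algebra+
		ultimately show "val mm \<oplus> val nu' = val mm' \<oplus> val nu" by simp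
	next
		assume eq: "val mm \<oplus> val nu' = val mm' \<oplus> val nu"
		note c = val_closed[OF assms(1)] val_closed[OF assms(2)] val_closed[OF assms(3)] val_closed[OF assms(4)]
		have "dval mm nu = (val mm \<oplus> val nu') \<ominus> val nu \<ominus> val nu'"
			using c unfolding dval_def by algebra
		also have "... = dval mm' nu'"
			using c unfolding dval_def eq by algebra
		finally show "dval mm nu = dval mm' nu'" .
	qed
	also have "... \<longleftrightarrow> mm + nu' = mm' + nu"
		unfolding val_add[OF assms(1,4), symmetric] val_add[OF assms(3,2), symmetric]
		using val_inj[OF KM] by auto
	finally show ?thesis .
qed

lemma dval_add:
	assumes "mm : KM" "nu : KM" "mm' : KM" "nu' : KM"
	shows "dval (mm + mm') (nu + nu') = dval mm nu \<oplus> dval mm' nu'"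
	using val_closed[OF assms(1)] val_closed[OF assms(2)] val_closed[OF assms(3)] val_closed[OF assms(4)]
	unfolding dval_def val_add[OF assms(1,3)] val_add[OF assms(2,4)] by algebra

lemma dval_mult:
	assumes "mm : KM" "nu : KM" "mm' : KM" "nu' : KM"
	shows "dval (fusm fus mm mm' + fusm fus nu nu') (fusm fus mm nu' + fusm fus nu mm') = dval mm nu \<otimes> dval mm' nu'"
	using val_closed[OF assms(1)] val_closed[OF assms(2)] val_closed[OF assms(3)] val_closed[OF assms(4)]
	unfolding dval_def val_add[OF fusm_K fusm_K] val_mult[OF assms(1,3)] val_mult[OF assms(2,4)]
		val_mult[OF assms(1,4)] val_mult[OF assms(2,3)] by algebra

lemma dval_surj:
	assumes "x : carrier R"
	obtains mm nu where "mm : KM" "nu : KM" "x = dval mm nu"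
	using val_surj[OF assms] unfolding dval_def by blast

definition rstar :: "'r => 'r" where
	"rstar x = (THE y. \<exists>mm\<in>KM. \<exists>nu\<in>KM. x = dval mm nu & y = dval (dualm mm) (dualm nu))"

lemma rstar_dval:
	assumes "mm : KM" "nu : KM"
	shows "rstar (dval mm nu) = dval (dualm mm) (dualm nu)"
	unfolding rstar_def
proof (rule the_equality)
	fix y assume "\<exists>mm'\<in>KM. \<exists>nu'\<in>KM. dval mm nu = dval mm' nu' & y = dval (dualm mm') (dualm nu')"
	then obtain mm' nu' where *: "mm' : KM" "nu' : KM" "dval mm nu = dval mm' nu'" "y = dval (dualm mm') (dualm nu')"
		by blast
	hence "mm + nu' = mm' + nu" using assms by (simp only: dval_eq)
	from arg_cong[OF this, of dualm] have "dualm mm' + dualm nu = dualm mm + dualm nu'" by simp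
	thus "y = dval (dualm mm) (dualm nu)" using * assms by (simp only: dval_eq dualm_K)
qed (use assms in blast)

lemma val_dval: "mm : KM ==> val mm = dval mm {#}"
	unfolding dval_def val_zero by (simp add: minus_eq)

lemma rstar_val: "mm : KM ==> rstar (val mm) = val (dualm mm)"
	using rstar_dval[of mm "{#}"] by (simp add: val_dval dualm_K[simplified])

lemma one_dval: "\<one> = dval {#Chi 0 True False#} {#}"
	by (subst val_dval[symmetric]) (auto simp: K_def val_one)

lemma rstar_hom: "rstar : Ring.ring_hom R R"
proof (rule ring_hom_memI)
	fix x y assume "x : carrier R" "y : carrier R"
	then obtain mm nu mm' nu' where *: "mm : KM" "nu : KM" "x = dval mm nu" "mm' : KM" "nu' : KM" "y = dval mm' nu'"
		by (elim dval_surj)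
	note D = *(1)[THEN dualm_K] *(2)[THEN dualm_K] *(4)[THEN dualm_K] *(5)[THEN dualm_K]
	show "rstar x : carrier R" using * by (simp only: rstar_dval dval_closed dualm_K)
	have 1: "mm + mm' : KM" "nu + nu' : KM" using * by auto
	show "rstar (x \<oplus> y) = rstar x \<oplus> rstar y"
		using * D by (simp only: dval_add[symmetric] rstar_dval 1 image_mset_union)
	have 2: "fusm fus mm mm' + fusm fus nu nu' : KM" "fusm fus mm nu' + fusm fus nu mm' : KM"
		using fusm_K by auto
	show "rstar (x \<otimes> y) = rstar x \<otimes> rstar y"
		using * D by (simp only: dval_mult[symmetric] rstar_dval 2 image_mset_union fusm_dual)
next
	have "dualm {#Chi 0 True False#} = {#Chi 0 True False#}" by simp
	thus "rstar \<one> = \<one>" unfolding one_dval by (subst rstar_dval) (auto simp: K_def)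
qed

end

locale fusion_rep = hopf_dihedral N n om ze A z t w + fusion_ring N n om ze R val
	for N n :: nat and om ze :: "'k::field" and A :: "('k, 'a) hopf_algebra" and z t w :: 'a
		and R :: "'r ring" (structure) and val
begin

definition rep_map :: "(('k, 'a) matmod set \<times> ('k, 'a) matmod set) set => 'r" where
	"rep_map X = (THE y. \<exists>mm\<in>KM. \<exists>nu\<in>KM. X = gcl mm nu & y = dval mm nu)"

lemma rep_map_gcl:
	assumes "mm : KM" "nu : KM"
	shows "rep_map (gcl mm nu) = dval mm nu"
	unfolding rep_map_def
proof (rule the_equality)
	fix y assume "\<exists>mm'\<in>KM. \<exists>nu'\<in>KM. gcl mm nu = gcl mm' nu' & y = dval mm' nu'"
	thus "y = dval mm nu" using assms by (auto simp: gcl_eq dval_eq)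
qed (use assms in blast)

lemma rep_map_iso: "rep_map : star_ring_iso (Rep A) (with_star R rstar)"
proof -
	have ws: "carrier (with_star R rstar) = carrier R" "!!x y. x \<otimes>\<^bsub>with_star R rstar\<^esub> y = x \<otimes> y"
		"!!x y. x \<oplus>\<^bsub>with_star R rstar\<^esub> y = x \<oplus> y" "\<one>\<^bsub>with_star R rstar\<^esub> = \<one>" "star (with_star R rstar) = rstar"
		by (simp_all add: with_star_def ring.defs star_ring.defs)
	have hom: "rep_map : Ring.ring_hom (Rep A) (with_star R rstar)"
	proof (rule ring_hom_memI)
		fix x y assume "x : carrier (Rep A)" "y : carrier (Rep A)"
		then obtain mm nu mm' nu' where *: "mm : KM" "nu : KM" "x = gcl mm nu" "mm' : KM" "nu' : KM" "y = gcl mm' nu'"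
			unfolding carrier_Rep by blast
		have 2: "fusm fus mm mm' + fusm fus nu nu' : KM" "fusm fus mm nu' + fusm fus nu mm' : KM"
			using fusm_K by auto
		show "rep_map x : carrier (with_star R rstar)"
			"rep_map (x \<oplus>\<^bsub>Rep A\<^esub> y) = rep_map x \<oplus>\<^bsub>with_star R rstar\<^esub> rep_map y"
			"rep_map (x \<otimes>\<^bsub>Rep A\<^esub> y) = rep_map x \<otimes>\<^bsub>with_star R rstar\<^esub> rep_map y"
			using * by (simp_all only: ws add_Rep mult_Rep rep_map_gcl dval_add dval_mult dval_closed 2 KM_add)
	qed (simp only: ws one_Rep, subst rep_map_gcl, use one_K in "auto simp: one_dval")
	have "inj_on rep_map (carrier (Rep A))"
	proof (rule inj_onI)
		fix x y assume "x : carrier (Rep A)" "y : carrier (Rep A)" and eq: "rep_map x = rep_map y"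
		then obtain mm nu mm' nu' where *: "mm : KM" "nu : KM" "x = gcl mm nu" "mm' : KM" "nu' : KM" "y = gcl mm' nu'"
			unfolding carrier_Rep by blast
		thus "x = y" using eq by (simp only: rep_map_gcl gcl_eq dval_eq)
	qed
	moreover have "rep_map ` carrier (Rep A) = carrier R"
	proof
		show "carrier R \<subseteq> rep_map ` carrier (Rep A)"
		proof
			fix x assume "x : carrier R"
			then obtain mm nu where "mm : KM" "nu : KM" "x = dval mm nu" by (rule dval_surj)
			thus "x : rep_map ` carrier (Rep A)"
				unfolding carrier_Rep by (intro image_eqI[of _ _ "gcl mm nu"]) (auto simp: rep_map_gcl)
		qed
	qed (auto simp: carrier_Rep rep_map_gcl)
	moreover have "rep_map (star (Rep A) x) = rstar (rep_map x)" if "x : carrier (Rep A)" for x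
	proof -
		from that obtain mm nu where "mm : KM" "nu : KM" "x = gcl mm nu" unfolding carrier_Rep by blast
		thus ?thesis by (simp only: star_Rep rep_map_gcl rstar_dval dualm_K)
	qed
	ultimately show ?thesis
		using hom by (auto simp: star_ring_iso_def ring_iso_def bij_betw_def ws)
qed

lemma Rep_iso: "Rep A \<simeq>\<^sub>* with_star R rstar"
	using rep_map_iso by (auto simp: is_star_ring_iso_def)

end

lemma (in hopf_dihedral) Rep_closed:
	assumes "x : carrier (Rep A)" "y : carrier (Rep A)"
	shows "x \<oplus>\<^bsub>Rep A\<^esub> y : carrier (Rep A)" "x \<otimes>\<^bsub>Rep A\<^esub> y : carrier (Rep A)"
		"\<one>\<^bsub>Rep A\<^esub> : carrier (Rep A)" "star (Rep A) x : carrier (Rep A)"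
proof -
	from assms obtain mm nu mm' nu' where *: "mm : KM" "nu : KM" "x = gcl mm nu" "mm' : KM" "nu' : KM" "y = gcl mm' nu'"
		unfolding carrier_Rep by blast
	have 2: "fusm fus mm mm' + fusm fus nu nu' : KM" "fusm fus mm nu' + fusm fus nu mm' : KM" "{#} : KM"
		using fusm_K by auto
	have g: "gcl a b : carrier (Rep A)" if "a : KM" "b : KM" for a b
		using that unfolding carrier_Rep by blast
	show "x \<oplus>\<^bsub>Rep A\<^esub> y : carrier (Rep A)" "x \<otimes>\<^bsub>Rep A\<^esub> y : carrier (Rep A)"
		"\<one>\<^bsub>Rep A\<^esub> : carrier (Rep A)" "star (Rep A) x : carrier (Rep A)"
		using * by (simp_all only: add_Rep mult_Rep one_Rep star_Rep g KM_add 2 one_K dualm_K)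
qed

text \<open>The map is \<open>f\<close> followed by the inverse of \<open>g\<close>. That it
  preserves the operations is checked after applying \<open>g\<close>, for which the results must
  lie in the carriers; hence the explicit closure hypotheses on the two records.\<close>

lemma star_ring_iso_common_target:
	assumes f: "f : star_ring_iso R T" and g: "g : star_ring_iso S T"
		and S: "!!x y. x : carrier S ==> y : carrier S ==> x \<oplus>\<^bsub>S\<^esub> y : carrier S & x \<otimes>\<^bsub>S\<^esub> y : carrier S &
			\<one>\<^bsub>S\<^esub> : carrier S & star S x : carrier S"
		and R: "!!x y. x : carrier R ==> y : carrier R ==> x \<oplus>\<^bsub>R\<^esub> y : carrier R & x \<otimes>\<^bsub>R\<^esub> y : carrier R &
			\<one>\<^bsub>R\<^esub> : carrier R & star R x : carrier R"
		and "x0 : carrier R"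
	shows "R \<simeq>\<^sub>* S"
proof -
	have fb: "bij_betw f (carrier R) (carrier T)" and fh: "f : Ring.ring_hom R T"
		and fs: "!!x. x : carrier R ==> f (star R x) = star T (f x)"
		using f by (auto simp: star_ring_iso_def ring_iso_def)
	have gb: "bij_betw g (carrier S) (carrier T)" and gh: "g : Ring.ring_hom S T"
		and gs: "!!x. x : carrier S ==> g (star S x) = star T (g x)"
		using g by (auto simp: star_ring_iso_def ring_iso_def)
	define h where "h = inv_into (carrier S) g \<circ> f"
	have hb: "bij_betw h (carrier R) (carrier S)"
		unfolding h_def by (rule bij_betw_trans[OF fb bij_betw_inv_into[OF gb]])
	have hc: "h x : carrier S" if "x : carrier R" for x
		using that hb by (auto simp: bij_betw_def)
	have gh': "g (h x) = f x" if "x : carrier R" for x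
	proof -
		have "f x : g ` carrier S" using that fb gb by (metis bij_betw_imp_surj_on imageI)
		thus ?thesis by (simp add: h_def f_inv_into_f)
	qed
	have eq: "h x = y" if "x : carrier R" "y : carrier S" "f x = g y" for x y
		using that gb by (auto simp: h_def bij_betw_def)
	have "h : Ring.ring_hom R S"
	proof (rule ring_hom_memI)
		fix x y assume xy: "x : carrier R" "y : carrier R"
		note R' = R[OF xy] and S' = S[OF hc[OF xy(1)] hc[OF xy(2)]]
		show "h x : carrier S" by (rule hc[OF xy(1)])
		show "h (x \<otimes>\<^bsub>R\<^esub> y) = h x \<otimes>\<^bsub>S\<^esub> h y"
		proof (rule eq)
			show "f (x \<otimes>\<^bsub>R\<^esub> y) = g (h x \<otimes>\<^bsub>S\<^esub> h y)"
				using xy by (simp only: ring_hom_mult[OF fh] ring_hom_mult[OF gh] hc gh')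
		qed (use R' S' in blast)+
		show "h (x \<oplus>\<^bsub>R\<^esub> y) = h x \<oplus>\<^bsub>S\<^esub> h y"
		proof (rule eq)
			show "f (x \<oplus>\<^bsub>R\<^esub> y) = g (h x \<oplus>\<^bsub>S\<^esub> h y)"
				using xy by (simp only: ring_hom_add[OF fh] ring_hom_add[OF gh] hc gh')
		qed (use R' S' in blast)+
	next
		show "h \<one>\<^bsub>R\<^esub> = \<one>\<^bsub>S\<^esub>"
		proof (rule eq)
			show "f \<one>\<^bsub>R\<^esub> = g \<one>\<^bsub>S\<^esub>" by (simp only: ring_hom_one[OF fh] ring_hom_one[OF gh])
		qed (use R[OF assms(5) assms(5)] S[OF hc[OF assms(5)] hc[OF assms(5)]] in blast)+
	qed
	moreover have "h (star R x) = star S (h x)" if "x : carrier R" for x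
	proof (rule eq)
		show "f (star R x) = g (star S (h x))"
			using that by (simp only: fs gs hc gh')
	qed (use R[OF that that] S[OF hc[OF that] hc[OF that]] in blast)+
	ultimately have "h : star_ring_iso R S"
		using hb by (simp add: star_ring_iso_def ring_iso_def)
	thus ?thesis by (auto simp: is_star_ring_iso_def)
qed

section \<open>Commutative rings with dihedral relations\<close>

lemma complex_root_of_unity:
	assumes "m > 0"
	shows "root_of_unity (cis (2 * pi / real m)) m"
proof
	show "of_nat m ~= (0 :: complex)" using assms by simp
	have "cis (2 * pi / real m) ^ m = 1"
		using assms by (simp add: DeMoivre)
	moreover have "cis (2 * pi / real m) ^ k ~= 1" if "0 < k" "k < m" for k
	proof
		assume "cis (2 * pi / real m) ^ k = 1"
		hence "cos (real k * (2 * pi / real m)) = 1" by (simp add: DeMoivre complex_eq_iff)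
		then obtain i :: int where "real k * (2 * pi / real m) = real_of_int i * (2 * pi)"
			by (auto simp: cos_one_2pi_int)
		hence "real k = real_of_int i * real m" using assms by (simp add: field_simps)
		hence "int k = i * int m"
			by (metis of_int_eq_iff of_int_mult of_int_of_nat_eq)
		hence "int m dvd int k" by simp
		thus False using that by (simp add: nat_dvd_not_less)
	qed
	ultimately show "primitive_root_of_unity m (cis (2 * pi / real m))"
		by (simp add: primitive_root_of_unity_def)
qed (rule assms)

text \<open>Inverse Fourier transform on the cyclic group of order \<open>m\<close>: multiplying by
  the inverse of \<open>z ^ (v * p)\<close> and summing over \<open>p\<close> isolates
  \<open>m\<close> times \<open>f v\<close>.\<close>

lemma (in root_of_unity) fourier_inj:
	assumes "!!p. (\<Sum>u<m. f u * z ^ (u * p)) = 0" "v < m"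
	shows "f v = 0"
proof -
	have "0 = (\<Sum>p<m. inverse z ^ (v * p) * (\<Sum>u<m. f u * z ^ (u * p)))"
		by (simp add: assms)
	also have "... = (\<Sum>u<m. f u * (\<Sum>p<m. inverse z ^ (v * p) * z ^ (u * p)))"
		unfolding sum_distrib_left by (subst sum.swap) (simp add: mult_ac)
	also have "... = (\<Sum>u<m. if u = v then f u * of_nat m else 0)"
		using assms(2) by (intro sum.cong) (auto simp: root_sum)
	also have "... = f v * of_nat m" using assms(2) by simp
	finally show ?thesis using m_nz by simp
qed

text \<open>The values of the extended family \<open>y\<^sub>0, y\<^sub>1, \<dots>, y\<^sub>2\<^sub>n\<^sub>-\<^sub>1\<close>, where
  \<open>p = 1 + a\<close> and \<open>q = b (1 + a)\<close>.\<close>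

definition ext_family :: "nat => 'a => 'a => (nat => 'a) => nat => 'a" where
	"ext_family n p q y k = (if k = 0 then p else if k < n then y k else if k = n then q else y (2 * n - k))"

definition dist_nat :: "nat => nat => nat" where
	"dist_nat i j = (if i \<le> j then j - i else i - j)"

text \<open>Complex values of \<open>a\<close>, \<open>b\<close> and the \<open>y j\<close> that
  respect the relations of the representation ring of the dihedral group generated by
  \<open>t\<close> and \<open>w\<close>. The columns of its character table provide such
  values.\<close>

definition dih_point :: "nat => complex => complex => (nat => complex) => bool" where
	"dih_point n ap be ey \<longleftrightarrow> ap * ap = 1 & be * be = 1 &
		 (\<forall>j. 0 < j & j < n \<longrightarrow> ap * ey j = ey j & be * ey j = ey (n - j)) &
		 (\<forall>i j. 0 < i & i < n & 0 < j & j < n \<longrightarrow> ey i * ey j =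
				ext_family n (1 + ap) (be * (1 + ap)) ey (dist_nat i j) + ext_family n (1 + ap) (be * (1 + ap)) ey (i + j))"

text \<open>Character values at a reflection: the two-dimensional characters vanish, and
  \<open>a\<close>, the nontrivial character that is trivial on rotations, is -1.\<close>

lemma dih_point_reflection:
	assumes "be * be = 1"
	shows "dih_point n (-1) be (%_. 0)"
	using assms by (auto simp: dih_point_def ext_family_def)

text \<open>Character values at a rotation with eigenvalue \<open>ty\<close>, since
  \<open>ty ^ (2 * n - j)\<close> is the inverse of \<open>ty ^ j\<close>. The index rules of
  \<open>ext_family\<close> express that this sum is even and periodic in \<open>j\<close>.\<close>

lemma dih_point_rotation:
	assumes "ty ^ (2 * n) = 1"
	shows "dih_point n 1 (ty ^ n) (%j. ty ^ j + ty ^ (2 * n - j))"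
proof -
	have eq: "ty ^ k = ty ^ l" if "k = l \<or> k = l + 2 * n \<or> l = k + 2 * n" for k l
		using that assms by (auto simp: power_add)
	have nn: "ty ^ n * ty ^ n = 1" using assms by (simp flip: power_add mult_2)
	have ext: "ext_family n (1 + 1) (ty ^ n * (1 + 1)) (%j. ty ^ j + ty ^ (2 * n - j)) k = ty ^ k + ty ^ (2 * n - k)"
		if "k < 2 * n" for k
		using that assms by (auto simp: ext_family_def algebra_simps)
	show ?thesis
		unfolding dih_point_def
	proof (intro conjI allI impI)
		fix j assume "0 < j & j < n"
		thus "ty ^ n * (ty ^ j + ty ^ (2 * n - j)) = ty ^ (n - j) + ty ^ (2 * n - (n - j))"
			using eq[of "n + (2 * n - j)" "n - j"] eq[of "n + j" "2 * n - (n - j)"]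
			by (simp add: distrib_left power_add[symmetric])
	next
		fix i j assume "0 < i & i < n & 0 < j & j < n"
		hence ij: "0 < i" "i < n" "0 < j" "j < n" by auto
		have "(ty ^ i + ty ^ (2 * n - i)) * (ty ^ j + ty ^ (2 * n - j)) =
				(ty ^ (i + (2 * n - j)) + ty ^ (2 * n - i + j)) + (ty ^ (i + j) + ty ^ (2 * n - i + (2 * n - j)))"
			by (simp add: power_add algebra_simps)
		also have "ty ^ (2 * n - i + (2 * n - j)) = ty ^ (2 * n - (i + j))"
			by (rule eq) (use ij in auto)
		also have "ty ^ (i + (2 * n - j)) + ty ^ (2 * n - i + j) = ty ^ dist_nat i j + ty ^ (2 * n - dist_nat i j)"
		proof (cases "i \<le> j")
			case True
			have "i + (2 * n - j) = 2 * n - (j - i)" "2 * n - i + j = j - i + 2 * n" using ij True by auto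
			thus ?thesis using True eq[of "2 * n - i + j" "j - i"] by (simp add: dist_nat_def)
		next
			case False
			have "2 * n - i + j = 2 * n - (i - j)" "i + (2 * n - j) = i - j + 2 * n" using ij False by auto
			thus ?thesis using False eq[of "i + (2 * n - j)" "i - j"] by (simp add: dist_nat_def)
		qed
		finally show "(ty ^ i + ty ^ (2 * n - i)) * (ty ^ j + ty ^ (2 * n - j)) =
				ext_family n (1 + 1) (ty ^ n * (1 + 1)) (%j. ty ^ j + ty ^ (2 * n - j)) (dist_nat i j) +
				ext_family n (1 + 1) (ty ^ n * (1 + 1)) (%j. ty ^ j + ty ^ (2 * n - j)) (i + j)"
			using ij by (subst (1 2) ext) (auto simp: dist_nat_def)
	qed (use nn in auto)
qed

text \<open>\<open>y j\<close> stands for \<open>Psi 0 j\<close>, \<open>a\<close> for the sign of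
  \<open>t\<close>, \<open>b\<close> for the sign of \<open>w\<close> and \<open>c\<close> for the
  character of \<open>z\<close>. In these variables the relations are those of a cyclic group times
  a dihedral group. The last assumption supplies the complex characters for linear
  independence.\<close>

locale dihedral_ring = dihedral N n om ze + cring R
	for N n :: nat and om ze :: "'k::field" and R :: "'r ring" (structure) +
	fixes a b c :: 'r and y :: "nat => 'r" and val :: "irr multiset => 'r"
	assumes closed [simp]: "a : carrier R" "b : carrier R" "c : carrier R" "y j : carrier R"
		and aa: "a \<otimes>\<^bsub>R\<^esub> a = \<one>\<^bsub>R\<^esub>" and bb: "b \<otimes>\<^bsub>R\<^esub> b = \<one>\<^bsub>R\<^esub>" and cN: "c [^]\<^bsub>R\<^esub> N = \<one>\<^bsub>R\<^esub>"
		and ay: "0 < j ==> j < n ==> a \<otimes>\<^bsub>R\<^esub> y j = y j"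
		and by': "0 < j ==> j < n ==> b \<otimes>\<^bsub>R\<^esub> y j = y (n - j)"
		and yy: "0 < i ==> i < n ==> 0 < j ==> j < n ==> y i \<otimes>\<^bsub>R\<^esub> y j =
			ext_family n (\<one>\<^bsub>R\<^esub> \<oplus>\<^bsub>R\<^esub> a) (b \<otimes>\<^bsub>R\<^esub> (\<one>\<^bsub>R\<^esub> \<oplus>\<^bsub>R\<^esub> a)) y (dist_nat i j) \<oplus>\<^bsub>R\<^esub>
			ext_family n (\<one>\<^bsub>R\<^esub> \<oplus>\<^bsub>R\<^esub> a) (b \<otimes>\<^bsub>R\<^esub> (\<one>\<^bsub>R\<^esub> \<oplus>\<^bsub>R\<^esub> a)) y (i + j)"
		and val_carrier: "val mm : carrier R"
		and val_plus: "val (mm + nu) = val mm \<oplus>\<^bsub>R\<^esub> val nu"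
		and val_empty: "val {#} = \<zero>\<^bsub>R\<^esub>"
		and val_Chi: "val {#Chi u e d#} = c [^]\<^bsub>R\<^esub> u \<otimes>\<^bsub>R\<^esub> ((if e then \<one>\<^bsub>R\<^esub> else a) \<otimes>\<^bsub>R\<^esub> (if d then b else \<one>\<^bsub>R\<^esub>))"
		and val_Psi: "val {#Psi u j#} = c [^]\<^bsub>R\<^esub> u \<otimes>\<^bsub>R\<^esub> y j"
		and generated: "[|Q \<subseteq> carrier R; !!x y. x : Q ==> y : Q ==> x \<oplus>\<^bsub>R\<^esub> y : Q & x \<otimes>\<^bsub>R\<^esub> y : Q;
			!!x. x : Q ==> \<ominus>\<^bsub>R\<^esub> x : Q; !!k. k : K ==> val {#k#} : Q|] ==> carrier R \<subseteq> Q"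
		and points: "[|dih_point n ap be ey; ga ^ N = 1|] ==> \<exists>h :: 'r => complex.
			(\<forall>x\<in>carrier R. \<forall>y\<in>carrier R. h (x \<oplus>\<^bsub>R\<^esub> y) = h x + h y & h (x \<otimes>\<^bsub>R\<^esub> y) = h x * h y) & h \<one>\<^bsub>R\<^esub> = 1 &
			h a = ap & h b = be & h c = ga & (\<forall>j. 0 < j & j < n \<longrightarrow> h (y j) = ey j)"
begin

section \<open>The irreducible labels as an additive basis\<close>

abbreviation "Y == ext_family n (\<one> \<oplus> a) (b \<otimes> (\<one> \<oplus> a)) y"

lemma Y_closed [simp]: "Y j : carrier R"
	by (simp add: ext_family_def)

lemma c_pow_mod: "c [^] (u mod N) = c [^] (u :: nat)"
proof -
	have "c [^] u = c [^] (N * (u div N) + u mod N)" by simp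
	also have "... = (c [^] N) [^] (u div N) \<otimes> c [^] (u mod N)"
		by (simp only: nat_pow_mult[symmetric] closed nat_pow_pow)
	finally show ?thesis by (simp add: cN)
qed

lemma val_pair: "val {#k, l#} = val {#k#} \<oplus> val {#l#}"
proof -
	have "{#k, l#} = {#k#} + {#l#}" by simp
	thus ?thesis by (simp only: val_plus)
qed

lemma val_vv:
	assumes "j mod (2 * n) = i"
	shows "val (vv u j) = c [^] u \<otimes> Y i"
proof -
	have i: "i < 2 * n" using n assms by auto
	consider "i = 0" | "i = n" | "0 < i" "i < n" | "n < i" by linarith
	thus ?thesis
	proof cases
		case 1
		thus ?thesis using assms
			by (simp add: vv_def Let_def val_pair val_Chi c_pow_mod ext_family_def r_distr)
	next
		case 2
		have "c [^] u \<otimes> (\<one> \<otimes> b) \<oplus> c [^] u \<otimes> (a \<otimes> b) = c [^] u \<otimes> (b \<otimes> (\<one> \<oplus> a))"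
		proof -
			have "c [^] u : carrier R" by simp
			with closed(1-3) show ?thesis by algebra
		qed
		thus ?thesis using assms 2 n
			by (simp add: vv_def Let_def val_pair val_Chi c_pow_mod ext_family_def)
	next
		case 3
		thus ?thesis using assms
			by (simp add: vv_def Let_def val_Psi c_pow_mod ext_family_def)
	next
		case 4
		thus ?thesis using assms i n
			by (simp add: vv_def Let_def val_Psi c_pow_mod ext_family_def)
	qed
qed

lemma val_fus:
	assumes "k : K" "l : K"
	shows "val (fus k l) = val {#k#} \<otimes> val {#l#}"
proof -
	have Chi_Psi: "val (vv (u + u') (j + (if d then n else 0))) = val {#Chi u e d#} \<otimes> val {#Psi u' j#}"
		if j: "0 < j" "j < n" for u e d u' j
	proof -
		have 1: "(j + (if d then n else 0)) mod (2 * n) = j + (if d then n else 0)" using j by auto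
		have 2: "Y (j + (if d then n else 0)) = (if d then y (n - j) else y j)"
			using j by (simp add: ext_family_def)
		have 3: "(if e then \<one> else a) \<otimes> (if d then b else \<one>) \<otimes> y j = (if d then y (n - j) else y j)"
		proof -
			have "a \<otimes> b \<otimes> y j = a \<otimes> y (n - j)" using by'[OF j] by (simp add: m_assoc)
			thus ?thesis using j ay[OF j] by'[OF j] ay[of "n - j"] by simp
		qed
		have "val {#Chi u e d#} \<otimes> val {#Psi u' j#} =
				(c [^] u \<otimes> c [^] u') \<otimes> ((if e then \<one> else a) \<otimes> (if d then b else \<one>) \<otimes> y j)"
		proof -
			have "c [^] u : carrier R" "c [^] u' : carrier R" "(if e then \<one> else a) : carrier R" "(if d then b else \<one>) : carrier R" by auto
			thus ?thesis unfolding val_Chi val_Psi using closed(4)[of j] by algebra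
		qed
		thus ?thesis unfolding val_vv[OF 1] 2 3 by (simp add: nat_pow_mult)
	qed
	show ?thesis
	proof (cases k; cases l)
		fix u e d u' e' d' assume kl: "k = Chi u e d" "l = Chi u' e' d'"
		have 1: "(if e = e' then \<one> else a) = (if e then \<one> else a) \<otimes> (if e' then \<one> else a)"
			using aa by auto
		have 2: "(if d ~= d' then b else \<one>) = (if d then b else \<one>) \<otimes> (if d' then b else \<one>)"
			using bb by auto
		have "c [^] u : carrier R" "c [^] u' : carrier R" "(if e then \<one> else a) : carrier R" "(if d then b else \<one>) : carrier R"
			"(if e' then \<one> else a) : carrier R" "(if d' then b else \<one>) : carrier R" by auto
		thus ?thesis
			unfolding kl fus.simps val_Chi c_pow_mod 1 2 nat_pow_mult[OF closed(3), symmetric] by algebra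
	next
		fix u e d u' j assume kl: "k = Chi u e d" "l = Psi u' j"
		thus ?thesis using assms Chi_Psi[of j u u' d e] by (auto simp: K_def)
	next
		fix u e d u' j assume kl: "k = Psi u' j" "l = Chi u e d"
		thus ?thesis using assms Chi_Psi[of j u u' d e] m_comm[OF val_carrier val_carrier] by (auto simp: K_def)
	next
		fix u i u' j assume kl: "k = Psi u i" "l = Psi u' j"
		hence ij: "0 < i" "i < n" "0 < j" "j < n" using assms by (auto simp: K_def)
		have 1: "(i + j) mod (2 * n) = i + j" using ij by simp
		define m where "m = (2 * n + i - j) mod (2 * n)"
		have m: "m = (if i < j then 2 * n - (j - i) else i - j)"
		proof (cases "i < j")
			case True
			thus ?thesis using ij by (simp add: m_def)
		next
			case False
			hence e: "2 * n + i - j = (i - j) + 2 * n" using ij by simp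
			have "m = i - j" unfolding m_def e mod_add_self2 using ij by simp
			thus ?thesis using False by simp
		qed
		have Ym: "Y m = Y (dist_nat i j)"
			using ij by (auto simp: m ext_family_def dist_nat_def)
		have "val (fus k l) = c [^] (u + u') \<otimes> Y (i + j) \<oplus> c [^] (u + u') \<otimes> Y (dist_nat i j)"
			unfolding kl fus.simps val_plus val_vv[OF 1] val_vv[OF m_def[symmetric]] Ym ..
		also have "... = c [^] (u + u') \<otimes> (y i \<otimes> y j)"
		proof -
			have "c [^] (u + u') : carrier R" by simp
			thus ?thesis unfolding yy[OF ij] using Y_closed[of "i + j"] Y_closed[of "dist_nat i j"] by algebra
		qed
		also have "... = val {#k#} \<otimes> val {#l#}"
		proof -
			have "c [^] u : carrier R" "c [^] u' : carrier R" by auto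
			thus ?thesis
				unfolding kl val_Psi nat_pow_mult[OF closed(3), symmetric] using closed(4)[of i] closed(4)[of j] by algebra
		qed
		finally show ?thesis .
	qed
qed

lemma val_fusm:
	assumes "mm : KM" "nu : KM"
	shows "val (fusm fus mm nu) = val mm \<otimes> val nu"
	using assms(1)
proof (induction mm)
	case (add k mm)
	have "val (fusm fus {#k#} nu) = val {#k#} \<otimes> val nu"
		using assms(2)
	proof (induction nu)
		case (add l nu)
		hence "val (fus k l) = val {#k#} \<otimes> val {#l#}" using \<open>add_mset k mm : KM\<close> by (intro val_fus) auto
		thus ?case
			using add fusm_simps(5)[of fus "{#k#}" "{#l#}" nu] val_plus[of "{#l#}" nu]
			by (simp add: val_plus r_distr val_carrier)
	qed (simp add: val_empty val_carrier)
	thus ?case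
		using add fusm_simps(4)[of fus "{#k#}" mm nu] val_plus[of "{#k#}" mm]
		by (simp add: val_plus l_distr val_carrier)
qed (simp add: val_empty val_carrier)

lemma val_generates:
	assumes "x : carrier R"
	shows "\<exists>mm\<in>KM. \<exists>nu\<in>KM. x = val mm \<ominus> val nu"
proof -
	define Q where "Q = {val mm \<ominus> val nu | mm nu. mm : KM & nu : KM}"
	have "carrier R \<subseteq> Q"
	proof (rule generated)
		show "Q \<subseteq> carrier R" by (auto simp: Q_def val_carrier)
		fix k assume "k : K"
		hence "{#k#} : KM" "{#} : KM" "val {#k#} = val {#k#} \<ominus> val {#}"
			using val_carrier by (auto simp: val_empty minus_eq)
		thus "val {#k#} : Q" unfolding Q_def by blast
	next
		fix x assume "x : Q"
		then obtain mm nu where *: "mm : KM" "nu : KM" "x = val mm \<ominus> val nu" unfolding Q_def by blast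
		have "\<ominus> x = val nu \<ominus> val mm"
			unfolding * using val_carrier[of mm] val_carrier[of nu] by algebra
		thus "\<ominus> x : Q" unfolding Q_def using * by blast
	next
		fix x x' assume "x : Q" "x' : Q"
		then obtain mm nu mm' nu' where *: "mm : KM" "nu : KM" "x = val mm \<ominus> val nu"
			"mm' : KM" "nu' : KM" "x' = val mm' \<ominus> val nu'" unfolding Q_def by blast
		note c = val_carrier[of mm] val_carrier[of nu] val_carrier[of mm'] val_carrier[of nu']
		have "x \<oplus> x' = val (mm + mm') \<ominus> val (nu + nu')"
			unfolding * val_plus using c by algebra
		moreover have "mm + mm' : KM" "nu + nu' : KM" using * by auto
		ultimately have 1: "x \<oplus> x' : Q" unfolding Q_def by blast
		have "x \<otimes> x' = val (fusm fus mm mm' + fusm fus nu nu') \<ominus> val (fusm fus mm nu' + fusm fus nu mm')"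
			unfolding *(3,6) val_plus val_fusm[OF *(1,4)] val_fusm[OF *(2,5)] val_fusm[OF *(1,5)] val_fusm[OF *(2,4)]
			using c by algebra
		moreover have "fusm fus mm mm' + fusm fus nu nu' : KM" "fusm fus mm nu' + fusm fus nu mm' : KM"
			using fusm_K by auto
		ultimately have "x \<otimes> x' : Q" unfolding Q_def by blast
		with 1 show "x \<oplus> x' : Q & x \<otimes> x' : Q" ..
	qed
	thus ?thesis using assms unfolding Q_def by blast
qed

lemma sum_K: "(\<Sum>k\<in>K. f k) = (\<Sum>u<N. (\<Sum>e\<in>UNIV. \<Sum>d\<in>UNIV. f (Chi u e d)) + (\<Sum>j\<in>{0<..<n}. f (Psi u j) :: complex))"
proof -
	let ?A = "(%(u, e, d). Chi u e d) ` ({..<N} \<times> UNIV \<times> UNIV)" and ?B = "(%(u, j). Psi u j) ` ({..<N} \<times> {0<..<n})"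
	have "K = ?A \<union> ?B" by (auto simp: K_def image_iff)
	moreover have "?A \<inter> ?B = {}" by auto
	ultimately have "sum f K = sum f ?A + sum f ?B" by (simp add: sum.union_disjoint)
	also have "sum f ?A = (\<Sum>(u, e, d)\<in>{..<N} \<times> UNIV \<times> UNIV. f (Chi u e d))"
		by (subst sum.reindex) (auto intro!: inj_onI simp: case_prod_unfold)
	also have "... = (\<Sum>u<N. \<Sum>e\<in>UNIV. \<Sum>d\<in>UNIV. f (Chi u e d))"
		by (simp add: sum.cartesian_product)
	also have "sum f ?B = (\<Sum>(u, j)\<in>{..<N} \<times> {0<..<n}. f (Psi u j))"
		by (subst sum.reindex) (auto intro!: inj_onI simp: case_prod_unfold)
	also have "... = (\<Sum>u<N. \<Sum>j\<in>{0<..<n}. f (Psi u j))"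
		by (simp add: sum.cartesian_product)
	finally show ?thesis by (simp add: sum.distrib)
qed

text \<open>Linear independence by characters. Fourier inversion in the value of \<open>c\<close>
  isolates a fixed \<open>u\<close>; the reflections then equate the coefficients of
  \<open>Chi u True d\<close> and \<open>Chi u False d\<close>, and Fourier inversion over the
  rotations removes what is left.\<close>

lemma val_injective:
	assumes mm: "mm : KM" and nu: "nu : KM" and eq: "val mm = val nu"
	shows "mm = nu"
proof -
	define m :: "irr => complex" where "m k = of_nat (count mm k) - of_nat (count nu k)" for k
	\<comment> \<open>The value, at a character of the dihedral part, of the component in which
	  \<open>z\<close> has exponent \<open>u\<close>.\<close>
	define br where "br u ap be ey = (\<Sum>e\<in>UNIV. \<Sum>d\<in>UNIV. m (Chi u e d) * ((if e then 1 else ap) * (if d then be else 1))) +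
			(\<Sum>j\<in>{0<..<n}. m (Psi u j) * ey j)" for u ap be and ey :: "nat => complex"
	define \<omega> where "\<omega> = cis (2 * pi / real N)"
	interpret \<omega>: root_of_unity \<omega> N unfolding \<omega>_def by (rule complex_root_of_unity) simp
	define \<zeta> where "\<zeta> = cis (2 * pi / real (2 * n))"
	interpret \<zeta>: root_of_unity \<zeta> "2 * n" unfolding \<zeta>_def by (rule complex_root_of_unity) (use n in simp)
	have br0: "br u ap be ey = 0" if p: "dih_point n ap be ey" and u: "u < N" for u ap be ey
	proof (rule \<omega>.fourier_inj[OF _ u])
		fix q :: nat
		have "(\<omega> ^ q) ^ N = 1" by (metis \<omega>.z_pow_m mult.commute power_mult power_one)
		from points[OF p this] obtain h where h:
			"!!x y. x : carrier R ==> y : carrier R ==> h (x \<oplus> y) = h x + h y"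
			"!!x y. x : carrier R ==> y : carrier R ==> h (x \<otimes> y) = h x * h y"
			"h \<one> = 1" "h a = ap" "h b = be" "h c = \<omega> ^ q" "!!j. 0 < j ==> j < n ==> h (y j) = ey j"
			by blast
		have h0: "h \<zero> = 0" using h(1)[of \<zero> \<zero>] by simp
		have hval: "h (val ka) = (\<Sum>k\<in>K. of_nat (count ka k) * h (val {#k#}))" if "ka : KM" for ka
			using that
		proof (induction ka)
			case (add l ka)
			have "h (val (add_mset l ka)) = h (val {#l#}) + h (val ka)"
				using val_plus[of "{#l#}" ka] h(1) val_carrier by simp
			also have "h (val {#l#}) = (\<Sum>k\<in>K. if k = l then h (val {#k#}) else 0)"
				using add.prems finite_K by simp
			also have "... + h (val ka) = (\<Sum>k\<in>K. (if k = l then h (val {#k#}) else 0) + of_nat (count ka k) * h (val {#k#}))"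
				using add by (simp add: sum.distrib)
			also have "... = (\<Sum>k\<in>K. of_nat (count (add_mset l ka) k) * h (val {#k#}))"
				by (intro sum.cong) (auto simp: algebra_simps)
			finally show ?case .
		qed (simp add: val_empty h0)
		have hpow: "h (c [^] (i :: nat)) = \<omega> ^ (i * q)" for i
			by (induction i) (auto simp: h power_add mult.commute)
		have "0 = h (val mm) - h (val nu)" using eq by simp
		also have "... = (\<Sum>k\<in>K. m k * h (val {#k#}))"
			using hval mm nu by (simp add: m_def sum_subtractf left_diff_distrib)
		also have "... = (\<Sum>u<N. br u ap be ey * \<omega> ^ (u * q))"
			unfolding sum_K br_def
			by (intro sum.cong) (auto simp: val_Chi val_Psi h hpow distrib_left distrib_right sum_distrib_left sum_distrib_right mult_ac UNIV_bool intro!: sum.cong)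
		finally show "(\<Sum>u<N. br u ap be ey * \<omega> ^ (u * q)) = 0" by simp
	qed
	have mChi: "m (Chi u True d) = m (Chi u False d)" if "u < N" for u d
	proof -
		have "br u (-1) 1 (%_. 0) = 0" "br u (-1) (-1) (%_. 0) = 0"
			using that by (intro br0 dih_point_reflection; simp)+
		hence "(m (Chi u True False) - m (Chi u False False)) + (m (Chi u True True) - m (Chi u False True)) = 0"
			"(m (Chi u True False) - m (Chi u False False)) - (m (Chi u True True) - m (Chi u False True)) = 0"
			by (auto simp: br_def UNIV_bool algebra_simps)
		hence "m (Chi u True False) - m (Chi u False False) = 0 & m (Chi u True True) - m (Chi u False True) = 0"
			by (metis add.commute add_cancel_right_right diff_add_cancel diff_eq_eq eq_iff_diff_eq_0 mult_2 mult_eq_0_iff zero_neq_numeral)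
		thus ?thesis by (cases d) auto
	qed
	have m0: "m (Chi u e d) = 0" "0 < j ==> j < n ==> m (Psi u j) = 0" if u: "u < N" for u e d j
	proof -
		\<comment> \<open>The total coefficient of \<open>ty ^ i\<close> at a rotation. The factor 2 at
		  \<open>0\<close> and \<open>n\<close> comes from two characters with equal coefficients;
		  \<open>i\<close> and \<open>2 * n - i\<close> share a coefficient because \<open>Psi\<close>
		  contributes both powers.\<close>
		define f where "f i = (if i = 0 then 2 * m (Chi u True False) else if i = n then 2 * m (Chi u True True)
			else if i < n then m (Psi u i) else m (Psi u (2 * n - i)))" for i
		have f0: "f i = 0" if "i < 2 * n" for i
		proof (rule \<zeta>.fourier_inj[OF _ that])
			fix q :: nat
			define ty where "ty = \<zeta> ^ q"
			have ty: "ty ^ (2 * n) = 1" unfolding ty_def by (metis \<zeta>.z_pow_m mult.commute power_mult power_one)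
			have "{..<2 * n} = {0, n} \<union> {0<..<n} \<union> {n<..<2 * n}" using n by auto
			hence "(\<Sum>i<2 * n. f i * \<zeta> ^ (i * q)) = (\<Sum>i\<in>{0, n} \<union> {0<..<n} \<union> {n<..<2 * n}. f i * ty ^ i)"
				by (simp add: ty_def power_mult[symmetric] mult.commute)
			also have "... = (\<Sum>i\<in>{0, n}. f i * ty ^ i) + (\<Sum>i\<in>{0<..<n}. f i * ty ^ i) + (\<Sum>i\<in>{n<..<2 * n}. f i * ty ^ i)"
				by (subst sum.union_disjoint, simp, simp, use n in force, subst sum.union_disjoint) auto
			also have "(\<Sum>i\<in>{n<..<2 * n}. f i * ty ^ i) = (\<Sum>i\<in>{0<..<n}. f i * ty ^ (2 * n - i))"
				by (rule sum.reindex_bij_witness[of _ "%i. 2 * n - i" "%i. 2 * n - i"]) (auto simp: f_def)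
			also have "(\<Sum>i\<in>{0, n}. f i * ty ^ i) + (\<Sum>i\<in>{0<..<n}. f i * ty ^ i) + ... = br u 1 (ty ^ n) (%j. ty ^ j + ty ^ (2 * n - j))"
				using n mChi[OF u] by (simp add: br_def UNIV_bool f_def distrib_left sum.distrib)
			also have "... = 0" by (rule br0[OF dih_point_rotation[OF ty] u])
			finally show "(\<Sum>i<2 * n. f i * \<zeta> ^ (i * q)) = 0" .
		qed
		have "m (Chi u True d) = 0" using f0[of 0] f0[of n] n by (cases d) (auto simp: f_def)
		thus "m (Chi u e d) = 0" using mChi[OF u, of d] by (cases e) auto
		show "0 < j ==> j < n ==> m (Psi u j) = 0" using f0[of j] by (auto simp: f_def)
	qed
	show ?thesis
	proof (rule multiset_eqI)
		fix k
		show "count mm k = count nu k"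
		proof (cases "k : K")
			case True
			hence "m k = 0" using m0 by (auto simp: K_def)
			thus ?thesis by (simp add: m_def)
		next
			case False
			hence "k \<notin># mm" "k \<notin># nu" using mm nu by auto
			thus ?thesis by (simp add: not_in_iff)
		qed
	qed
qed

sublocale fusion_ring N n om ze R val
proof
	have "val {#Chi 0 True False#} = \<one>" by (simp add: val_Chi)
	thus "val {#Chi 0 True False#} = \<one>" .
qed (use val_carrier val_plus val_fusm val_empty val_injective val_generates in auto)

end

hide_const (open) Multiset.mult

section \<open>The presented rings\<close>

lemma zpoly_ring_simps [simp]:
	"mult (zpoly_ring V) = (*)" "one (zpoly_ring V) = 1" "zero (zpoly_ring V) = 0" "add (zpoly_ring V) = (+)"
	by (simp_all add: zpoly_ring_def)

lemma zpoly_carrier: "p : carrier (zpoly_ring V) \<longleftrightarrow> (\<forall>m\<in>kys p. set_mset m \<subseteq> V)"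
	by (simp add: zpoly_ring_def)

lemma zpoly_closed [simp]:
	assumes "p : carrier (zpoly_ring V)" "q : carrier (zpoly_ring V)"
	shows "p + q : carrier (zpoly_ring V)" "p * q : carrier (zpoly_ring V)" "- p : carrier (zpoly_ring V)"
		"p - q : carrier (zpoly_ring V)"
proof -
	have 1: "p + q : carrier (zpoly_ring V)" if "p : carrier (zpoly_ring V)" "q : carrier (zpoly_ring V)" for p q
		using that keys_add[of p q] by (auto simp: zpoly_carrier)
	have 2: "- p : carrier (zpoly_ring V)" if "p : carrier (zpoly_ring V)" for p
		using that by (auto simp: zpoly_carrier in_keys_iff)
	show "p + q : carrier (zpoly_ring V)" "- p : carrier (zpoly_ring V)"
		using 1 2 assms by auto
	show "p * q : carrier (zpoly_ring V)"
		using assms keys_mult[of p q] by (fastforce simp: zpoly_carrier)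
	show "p - q : carrier (zpoly_ring V)"
		using 1[OF assms(1) 2[OF assms(2)]] by simp
qed

lemma zpoly_one_zero [simp]: "1 : carrier (zpoly_ring V)" "0 : carrier (zpoly_ring V)"
	by (auto simp: zpoly_carrier in_keys_iff lookup_one when_def)

lemma zpoly_pow [simp]: "p : carrier (zpoly_ring V) ==> p ^ k : carrier (zpoly_ring V)"
	by (induction k) auto

lemma zpoly_cring: "cring (zpoly_ring V)"
proof (intro cringI abelian_groupI comm_monoidI)
	fix x assume x: "x : carrier (zpoly_ring V)"
	hence "- x \<oplus>\<^bsub>zpoly_ring V\<^esub> x = \<zero>\<^bsub>zpoly_ring V\<^esub>" "- x : carrier (zpoly_ring V)" by auto
	thus "\<exists>y\<in>carrier (zpoly_ring V). y \<oplus>\<^bsub>zpoly_ring V\<^esub> x = \<zero>\<^bsub>zpoly_ring V\<^esub>" by blast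
qed (auto simp: algebra_simps)

lemma pvar_carrier [simp]: "pvar v : carrier (zpoly_ring V) \<longleftrightarrow> v : V"
	by (simp add: zpoly_carrier pvar_def)

definition zeval :: "(rvar => complex) => rvar zpoly => complex" where
	"zeval ph = lin of_int (%m. prod_mset (image_mset ph m))"

interpretation of_int_scalars: scalars "of_int :: int => complex"
	by unfold_locales auto

lemma zeval_simps [simp]:
	"zeval ph (p + q) = zeval ph p + zeval ph q" "zeval ph (p * q) = zeval ph p * zeval ph q"
	"zeval ph (p - q) = zeval ph p - zeval ph q" "zeval ph 1 = 1" "zeval ph 0 = 0" "zeval ph (pvar v) = ph v"
	unfolding zeval_def
	by (simp_all add: of_int_scalars.lin_add of_int_scalars.lin_diff of_int_scalars.lin_one pvar_def)
		 (subst of_int_scalars.lin_mult, auto)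

lemma zeval_pow [simp]: "zeval ph (p ^ k) = zeval ph p ^ k"
	by (induction k) auto

locale presentation =
	fixes V :: "rvar set" and E :: "rvar zpoly set"
	assumes E_sub: "E \<subseteq> carrier (zpoly_ring V)"
begin

abbreviation "P == zpoly_ring V"
abbreviation "I == Idl\<^bsub>P\<^esub> E"
abbreviation "PR == presented_cring V E"
abbreviation pm (infixl "**" 70) where "pm == (\<otimes>\<^bsub>PR\<^esub>)"
abbreviation pw (infixr "^^^" 75) where "pw == ([^]\<^bsub>PR\<^esub>)"
abbreviation "p1 == \<one>\<^bsub>PR\<^esub>"
abbreviation "pe == pelm V E"

lemma ideal_I: "ideal I P"
	using cring.axioms(1)[OF zpoly_cring] E_sub by (rule ring.genideal_ideal)

lemma cring_PR: "cring PR"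
	unfolding presented_cring_def by (rule ideal.quotient_is_cring[OF ideal_I zpoly_cring])

lemma pe_closed [simp]: "p : carrier P ==> pe p : carrier PR"
	by (auto simp: presented_cring_def presented_elem_def FactRing_def A_RCOSETS_def')

lemma carrier_PR: "x : carrier PR ==> \<exists>p\<in>carrier P. x = pe p"
	by (auto simp: presented_cring_def presented_elem_def FactRing_def A_RCOSETS_def')

lemma pe_add: "p : carrier P ==> q : carrier P ==> pe (p + q) = pe p \<oplus>\<^bsub>PR\<^esub> pe q"
	using ideal.a_rcos_sum[OF ideal_I, of p q] abelian_subgroup.a_rcos_sum[OF abelian_subgroupI3, of I P p q]
		ideal_I by (simp add: presented_cring_def presented_elem_def FactRing_def)

lemma pe_mult: "p : carrier P ==> q : carrier P ==> pe (p * q) = pe p ** pe q"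
	using ideal.rcoset_mult_add[OF ideal_I, of p q]
	by (simp add: presented_cring_def presented_elem_def FactRing_def)

lemma pe_one: "pe 1 = p1"
	by (simp add: presented_cring_def presented_elem_def FactRing_def)

lemma pe_zero: "pe 0 = \<zero>\<^bsub>PR\<^esub>"
proof -
	interpret ideal I P by (rule ideal_I)
	show ?thesis using a_coset_add_zero[OF a_subset]
		by (simp add: presented_cring_def presented_elem_def FactRing_def)
qed

sublocale PR: cring PR by (rule cring_PR)

lemma pe_uminus: "p : carrier P ==> pe (- p) = \<ominus>\<^bsub>PR\<^esub> pe p"
	using pe_add[of "- p" p] pe_zero by (intro PR.minus_equality[symmetric]) auto

lemma pe_pow: "p : carrier P ==> pe (p ^ k) = pe p ^^^ (k :: nat)"
	by (induction k) (auto simp: pe_one pe_mult PR.m_comm)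

lemma pe_eqI:
	assumes "p - q : E" "p : carrier P" "q : carrier P"
	shows "pe p = pe q"
proof -
	interpret ring P by (rule cring.axioms(1)[OF zpoly_cring])
	have "p \<ominus>\<^bsub>P\<^esub> q = p - q"
		using assms minus_equality[of "- q" q] by (simp add: minus_eq)
	hence "p \<ominus>\<^bsub>P\<^esub> q : I" using genideal_self[OF E_sub] assms(1) by auto
	thus ?thesis
		unfolding presented_elem_def using quotient_eq_iff_same_a_r_cos[OF ideal_I assms(2,3)] by simp
qed

lemma zeval_I:
	assumes "!!e. e : E ==> zeval ph e = 0" "p : I"
	shows "zeval ph p = 0"
proof -
	interpret ring P by (rule cring.axioms(1)[OF zpoly_cring])
	have "ideal {p : carrier P. zeval ph p = 0} P"
	proof (rule idealI)
		show "subgroup {p : carrier P. zeval ph p = 0} (add_monoid P)"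
		proof (rule add.subgroupI)
			show "{p : carrier P. zeval ph p = 0} ~= {}" using zpoly_one_zero(2) zeval_simps(5) by blast
			fix p assume "p : {p : carrier P. zeval ph p = 0}"
			hence p: "p : carrier P" "zeval ph p = 0" by auto
			have "\<ominus>\<^bsub>P\<^esub> p = 0 - p" using p minus_equality[of "- p" p] by simp
			thus "\<ominus>\<^bsub>P\<^esub> p : {p : carrier P. zeval ph p = 0}" using p by (simp del: diff_0)
		qed auto
	qed (auto intro: ring_axioms)
	hence "I \<subseteq> {p : carrier P. zeval ph p = 0}"
		by (rule genideal_minimal) (use assms E_sub in auto)
	thus ?thesis using assms(2) by blast
qed

lemma zeval_induced:
	assumes "!!e. e : E ==> zeval ph e = 0" "p : carrier P"
	shows "induced (zeval ph) (pe p) = zeval ph p"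
proof (rule induced_eq)
	interpret ideal I P by (rule ideal_I)
	show "p : pe p" unfolding presented_elem_def using a_rcos_self[OF assms(2)] .
	fix q assume "q : pe p"
	then obtain i where "i : I" "q = i + p"
		by (auto simp: presented_elem_def a_r_coset_def')
	thus "zeval ph q = zeval ph p" using zeval_I[OF assms(1)] by simp
qed

lemma pe_generated:
	assumes Q: "!!x y. x : Q ==> y : Q ==> x \<oplus>\<^bsub>PR\<^esub> y : Q & x ** y : Q"
		"!!x. x : Q ==> \<ominus>\<^bsub>PR\<^esub> x : Q" "p1 : Q" "!!v. v : V ==> pe (pvar v) : Q" "Q \<subseteq> carrier PR"
	shows "carrier PR \<subseteq> Q"
proof -
	have nat: "pe (of_nat k) : Q & of_nat k : carrier P" for k
	proof (induction k)
		case 0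
		have "\<zero>\<^bsub>PR\<^esub> = p1 \<oplus>\<^bsub>PR\<^esub> \<ominus>\<^bsub>PR\<^esub> p1" using PR.r_neg[OF PR.one_closed] by simp
		thus ?case using Q(1)[OF Q(3) Q(2)[OF Q(3)]] pe_zero by simp
	qed (use Q in "simp add: pe_add pe_one")
	have int: "pe (of_int c) : Q & of_int c : carrier P" for c
	proof (cases c)
		case (neg k)
		have "pe (- of_nat (Suc k)) = \<ominus>\<^bsub>PR\<^esub> pe (of_nat (Suc k))" using nat[of "Suc k"] by (intro pe_uminus) blast
		moreover have "- of_nat (Suc k) : carrier P" using nat[of "Suc k"] zpoly_closed(3) by blast
		moreover have "of_int c = - (of_nat (Suc k) :: rvar zpoly)" using neg by simp
		ultimately show ?thesis using nat[of "Suc k"] Q(2) by simp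
	qed (use nat in simp)
	have single: "pe (sgl m c) : Q & sgl m c : carrier P"
		if "set_mset m \<subseteq> V" for m and c :: int
		using that
	proof (induction m)
		case empty
		have "sgl {#} c = (of_int c :: rvar zpoly)"
			using single_of_int[of c, where 'b = int] by simp
		thus ?case using int[of c] by simp
	next
		case (add v m)
		have "sgl (add_mset v m) c = pvar v * sgl m c"
			by (simp add: pvar_def mult_single)
		thus ?case using add Q by (simp add: pe_mult)
	qed
	show ?thesis
	proof
		fix x assume "x : carrier PR"
		then obtain p where p: "p : carrier P" "x = pe p" using carrier_PR by blast
		have "pe (\<Sum>m\<in>S. sgl m (lkp p m)) : Q &
				(\<Sum>m\<in>S. sgl m (lkp p m)) : carrier P"
			if "finite S" "S \<subseteq> kys p" for S
			using that
		proof (induction S)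
			case empty
			thus ?case using int[of 0] by simp
		next
			case (insert m S)
			hence "set_mset m \<subseteq> V" using p(1) by (auto simp: zpoly_carrier)
			thus ?case using insert single[of m] Q(1) by (simp add: pe_add)
		qed
		from this[of "kys p"] show "x : Q" by (simp add: poly_mapping_sum_single p(2))
	qed
qed

end

lemma dist_nat_abs: "nat \<bar>int i - int j\<bar> = dist_nat i j"
	by (auto simp: dist_nat_def)

definition hodd :: "nat => nat => nat" where
	"hodd m j = (if odd j then m else 0)"

text \<open>In both presentations \<open>x\<^sub>j\<close> is \<open>y\<^sub>j\<close> times the square root \<open>c\<^bsup>(N + 1) / 2\<^esup>\<close> of \<open>c\<close> when
  \<open>j\<close> is odd. For odd \<open>n\<close> the generator \<open>b\<close> of the presentation is \<open>\<beta> c\<^bsup>(N + 1) / 2\<^esup>\<close> with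
  \<open>c = b\<^sup>2\<close> and \<open>\<beta> = b\<^sup>N\<close>.\<close>

locale paper_ring = dihedral N n om ze + presentation V E
	for N n :: nat and om ze :: "'k::field" and V E +
	fixes bp cp :: "rvar zpoly"
	assumes in_P: "bp : carrier (zpoly_ring V)" "cp : carrier (zpoly_ring V)" "VA : V" "VB : V"
			"0 < j ==> j < n ==> VX j : V"
		and aa: "pelm V E (pvar VA * pvar VA) = pelm V E 1"
		and bb: "pelm V E (bp * bp) = pelm V E 1"
		and cN: "pelm V E (cp ^ N) = pelm V E 1"
		and bn: "bp = cp ^ hodd (N div 2) n * pvar VB"
		and ax: "0 < j ==> j < n ==> pelm V E (pvar VA * pvar (VX j)) = pelm V E (pvar (VX j))"
		and bx: "0 < j ==> j < n ==> pelm V E (bp * (cp ^ hodd (N div 2) j * pvar (VX j))) =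
			pelm V E (cp ^ hodd (N div 2) (n - j) * pvar (VX (n - j)))"
		and xx: "0 < i ==> i < n ==> 0 < j ==> j < n ==> pelm V E (pvar (VX i) * pvar (VX j)) =
			pelm V E (cp ^ (if odd (i * j) then 1 else 0) * (xpoly n (dist_nat i j) + xpoly n (i + j)))"
		and gens: "v : V ==> v = VA \<or> v = VB \<or> pvar v = cp \<or> (\<exists>j. 0 < j & j < n & v = VX j)"
		and evals: "[|dih_point n ap be ey; ga ^ N = 1|] ==> \<exists>ph. (\<forall>e\<in>E. zeval ph e = 0) & ph VA = ap &
			zeval ph bp = be & zeval ph cp = ga & (\<forall>j. 0 < j & j < n \<longrightarrow> ph (VX j) = ga ^ hodd (N div 2 + 1) j * ey j)"
begin

text \<open>The value 0 outside \<open>0 < j < n\<close> is a default that keeps \<open>yp j\<close>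
  in the ring for every \<open>j\<close>.\<close>

definition yp :: "nat => rvar zpoly" where
	"yp j = (if 0 < j & j < n then cp ^ hodd (N div 2) j * pvar (VX j) else 0)"

fun elp :: "irr => rvar zpoly" where
	"elp (Chi u e d) = cp ^ u * ((if e then 1 else pvar VA) * (if d then bp else 1))"
| "elp (Psi u j) = cp ^ u * yp j"

definition pval :: "irr multiset => rvar zpoly set" where
	"pval mm = pe (\<Sum>k\<in>#mm. elp k)"

lemma yp_closed [simp]: "yp j : carrier P"
	using in_P by (auto simp: yp_def)

lemma elp_closed [simp]: "elp k : carrier P"
	using in_P by (cases k) auto

lemma sum_elp_closed: "(\<Sum>k\<in>#mm. elp k) : carrier P"
	by (induction mm) auto

lemma N_half: "N = 2 * (N div 2) + 1"
	using N by (metis odd_two_times_div_two_succ)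

lemma ext_yp:
	assumes "k < 2 * n"
	shows "ext_family n (1 + pvar VA) (bp * (1 + pvar VA)) yp k = cp ^ hodd (N div 2) k * xpoly n k"
proof -
	have "odd (2 * n - k) = odd k" using assms by simp
	thus ?thesis using assms by (auto simp: ext_family_def xpoly_def yp_def bn hodd_def mult.assoc)
qed

lemma pe_cp_pow_mod: "x : carrier P ==> pe (cp ^ (N + k) * x) = pe (cp ^ k * x)"
	using in_P(2) by (simp add: power_add pe_mult cN pe_one)

text \<open>The exponents \<open>N div 2 + 1\<close> and \<open>N div 2\<close> add up to
  \<open>N\<close>, so the normalisation of \<open>x j\<close> can be undone.\<close>

lemma pe_half:
	assumes "x : carrier P"
	shows "pe x = pe (cp ^ hodd (N div 2 + 1) j * (cp ^ hodd (N div 2) j * x))"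
proof (cases "odd j")
	case True
	have "N div 2 + 1 + N div 2 = N" using N_half by linarith
	hence "cp ^ hodd (N div 2 + 1) j * (cp ^ hodd (N div 2) j * x) = cp ^ (N + 0) * x"
		using True by (simp add: hodd_def flip: power_add power_Suc mult.assoc)
	thus ?thesis using pe_cp_pow_mod[OF assms, of 0] by simp
qed (simp add: hodd_def)

text \<open>The powers of \<open>c\<close> match by parity. For \<open>i\<close> and
  \<open>j\<close> odd, twice \<open>N div 2\<close> plus the 1 from the relation is
  \<open>N\<close>; otherwise the exponent is the one of the index \<open>i + j\<close>, which has
  the same parity as \<open>dist_nat i j\<close>.\<close>

lemma yp_mult:
	assumes ij: "0 < i" "i < n" "0 < j" "j < n"
	shows "pe (yp i * yp j) = pe (ext_family n (1 + pvar VA) (bp * (1 + pvar VA)) yp (dist_nat i j) +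
		ext_family n (1 + pvar VA) (bp * (1 + pvar VA)) yp (i + j))"
proof -
	let ?h = "hodd (N div 2)" and ?e = "if odd (i * j) then 1 else 0 :: nat"
	let ?X = "xpoly n (dist_nat i j) + xpoly n (i + j)"
	have X: "?X : carrier P"
		using ij in_P by (auto simp: xpoly_def dist_nat_def)
	have par: "odd (dist_nat i j) = odd (i + j)" by (auto simp: dist_nat_def)
	have "pe (yp i * yp j) = pe (cp ^ (?h i + ?h j) * (pvar (VX i) * pvar (VX j)))"
		using ij by (simp add: yp_def power_add mult_ac)
	also have "... = pe (cp ^ (?h i + ?h j)) ** pe (pvar (VX i) * pvar (VX j))"
		using ij in_P by (intro pe_mult) auto
	also have "... = pe (cp ^ (?h i + ?h j)) ** pe (cp ^ ?e * ?X)"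
		by (simp only: xx[OF ij])
	also have "... = pe (cp ^ (?h i + ?h j) * (cp ^ ?e * ?X))"
		using X in_P by (intro pe_mult[symmetric]) auto
	also have "... = pe (cp ^ (?h i + ?h j + ?e) * ?X)"
		by (simp add: power_add mult.assoc)
	also have "... = pe (cp ^ ?h (i + j) * ?X)"
	proof (cases "odd i & odd j")
		case True
		hence "?h i + ?h j + ?e = N + ?h (i + j)" using N_half by (auto simp: hodd_def)
		thus ?thesis using pe_cp_pow_mod[OF X] by simp
	next
		case False
		hence "?h i + ?h j + ?e = ?h (i + j)" by (auto simp: hodd_def)
		thus ?thesis by simp
	qed
	also have "cp ^ ?h (i + j) * ?X = cp ^ ?h (dist_nat i j) * xpoly n (dist_nat i j) + cp ^ ?h (i + j) * xpoly n (i + j)"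
		using par by (simp add: distrib_left hodd_def)
	finally show ?thesis using ij by (subst (1 2) ext_yp) (auto simp: dist_nat_def)
qed

lemma pe_ext: "ext_family n (p1 \<oplus>\<^bsub>PR\<^esub> pe (pvar VA)) (pe bp ** (p1 \<oplus>\<^bsub>PR\<^esub> pe (pvar VA))) (%j. pe (yp j)) k =
		pe (ext_family n (1 + pvar VA) (bp * (1 + pvar VA)) yp k)"
	using in_P by (auto simp: ext_family_def pe_add pe_mult pe_one)

lemma ext_yp_closed: "ext_family n (1 + pvar VA) (bp * (1 + pvar VA)) yp k : carrier P"
	using in_P by (auto simp: ext_family_def)

sublocale dihedral_ring N n om ze PR "pe (pvar VA)" "pe bp" "pe cp" "%j. pe (yp j)" pval
proof
	show "pe (pvar VA) : carrier PR" "pe bp : carrier PR" "pe cp : carrier PR" "!!j. pe (yp j) : carrier PR"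
		using in_P by auto
	show "pe (pvar VA) ** pe (pvar VA) = p1" "pe bp ** pe bp = p1" "pe cp ^^^ N = p1"
		using aa bb cN in_P by (simp_all add: pe_mult pe_pow pe_one)
	fix j assume j: "0 < j" "j < n"
	have "pe (pvar VA * yp j) = pe (cp ^ hodd (N div 2) j * (pvar VA * pvar (VX j)))"
		using j by (simp add: yp_def mult_ac)
	also have "... = pe (yp j)"
		using j in_P ax[OF j] by (subst pe_mult) (auto simp: yp_def pe_mult[symmetric])
	finally show "pe (pvar VA) ** pe (yp j) = pe (yp j)" using in_P by (simp add: pe_mult)
	show "pe bp ** pe (yp j) = pe (yp (n - j))"
		using bx[OF j] j in_P by (simp add: pe_mult[symmetric] yp_def)
	fix i assume i: "0 < i" "i < n"
	show "pe (yp i) ** pe (yp j) =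
		 ext_family n (p1 \<oplus>\<^bsub>PR\<^esub> pe (pvar VA)) (pe bp ** (p1 \<oplus>\<^bsub>PR\<^esub> pe (pvar VA))) (%j. pe (yp j)) (dist_nat i j) \<oplus>\<^bsub>PR\<^esub>
		 ext_family n (p1 \<oplus>\<^bsub>PR\<^esub> pe (pvar VA)) (pe bp ** (p1 \<oplus>\<^bsub>PR\<^esub> pe (pvar VA))) (%j. pe (yp j)) (i + j)"
		unfolding pe_ext using yp_mult[OF i j] by (simp add: pe_mult[symmetric] pe_add[symmetric] ext_yp_closed)
next
	show "pval mm : carrier PR" for mm by (simp add: pval_def sum_elp_closed)
	show "pval (mm + nu) = pval mm \<oplus>\<^bsub>PR\<^esub> pval nu" for mm nu by (simp add: pval_def sum_elp_closed pe_add)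
	show "pval {#} = \<zero>\<^bsub>PR\<^esub>" by (simp add: pval_def pe_zero)
	show 1: "pval {#Chi u e d#} = pe cp ^^^ u **
			((if e then p1 else pe (pvar VA)) ** (if d then pe bp else p1))" for u e d
		using in_P by (simp add: pval_def pe_mult pe_pow pe_one)
	show 2: "pval {#Psi u j#} = pe cp ^^^ u ** pe (yp j)" for u j
		using in_P by (simp add: pval_def pe_mult pe_pow)
	fix Q assume Q: "Q \<subseteq> carrier PR" "!!x y. x : Q ==> y : Q ==> x \<oplus>\<^bsub>PR\<^esub> y : Q & x ** y : Q"
		"!!x. x : Q ==> \<ominus>\<^bsub>PR\<^esub> x : Q" "!!k. k : K ==> pval {#k#} : Q"
	show "carrier PR \<subseteq> Q"
	proof (rule pe_generated[OF Q(2,3) _ _ Q(1)])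
		have el: "pe (elp k) : Q" if "k : K" for k using Q(4)[OF that] by (simp add: pval_def)
		have kk: "Chi 0 True False : K" "Chi 0 True True : K" "Chi 0 False False : K"
			using N_pos by (auto simp: K_def)
		show one: "p1 : Q" using el[OF kk(1)] by (simp add: pe_one)
		have "pe cp : Q"
		\<comment> \<open>The label \<open>Chi 1 True False\<close> belongs to \<open>K\<close> only for
		  \<open>N > 1\<close>; for \<open>N = 1\<close> the element \<open>c\<close> is 1.\<close>
		proof (cases "N = 1")
			case True
			thus ?thesis using cN one by (simp add: pe_one)
		next
			case False
			hence "1 < N" using N_pos by linarith
			hence "Chi 1 True False : K" by (auto simp: K_def)
			from el[OF this] show ?thesis by simp
		qed
		hence c: "pe (cp ^ m * x) : Q" if "pe x : Q" "x : carrier P" for m x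
			using that Q(2) in_P(2) by (induction m) (simp_all add: mult.assoc pe_mult[of cp "_ * _"])
		have b: "pe bp : Q" using el[OF kk(2)] by simp
		fix v assume "v : V"
		from gens[OF this] show "pe (pvar v) : Q"
		proof (elim disjE exE conjE)
			assume "v = VA"
			thus ?thesis using el[OF kk(3)] by simp
		next
			assume "v = VB"
			thus ?thesis using c[OF b in_P(1)] pe_half[of "pvar VB" n] in_P(4) by (simp add: bn[symmetric])
		next
			assume "pvar v = cp"
			thus ?thesis using \<open>pe cp : Q\<close> by simp
		next
			fix j assume j: "0 < j" "j < n" "v = VX j"
			hence "pe (yp j) : Q" using el[of "Psi 0 j"] by (simp add: K_def)
			from c[OF this yp_closed] show ?thesis using pe_half[of "pvar (VX j)" j] in_P(5) j by (simp add: yp_def)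
		qed
	qed
next
	fix ap be ga :: complex and ey assume "dih_point n ap be ey" and ga: "ga ^ N = 1"
	from evals[OF this] obtain ph where ph: "!!e. e : E ==> zeval ph e = 0" "ph VA = ap" "zeval ph bp = be" "zeval ph cp = ga"
		"!!j. 0 < j ==> j < n ==> ph (VX j) = ga ^ hodd (N div 2 + 1) j * ey j" by blast
	let ?h = "induced (zeval ph)"
	note h = zeval_induced[of ph, OF ph(1)]
	show "\<exists>h. (\<forall>x\<in>carrier PR. \<forall>y\<in>carrier PR. h (x \<oplus>\<^bsub>PR\<^esub> y) = h x + h y & h (x ** y) = h x * h y) &
			h p1 = 1 & h (pe (pvar VA)) = ap & h (pe bp) = be & h (pe cp) = ga &
			(\<forall>j. 0 < j & j < n \<longrightarrow> h (pe (yp j)) = ey j)"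
	proof (rule exI[of _ ?h], intro conjI ballI allI impI)
		fix x y assume "x : carrier PR" "y : carrier PR"
		then obtain p q where "p : carrier P" "x = pe p" "q : carrier P" "y = pe q" using carrier_PR by metis
		thus "?h (x \<oplus>\<^bsub>PR\<^esub> y) = ?h x + ?h y" "?h (x ** y) = ?h x * ?h y"
			by (simp_all add: pe_add[symmetric] pe_mult[symmetric] h)
	next
		show "?h p1 = 1" using h[of 1] by (simp add: pe_one)
		show "?h (pe (pvar VA)) = ap" "?h (pe bp) = be" "?h (pe cp) = ga" using in_P ph by (simp_all add: h)
		fix j assume j: "0 < j & j < n"
		have "ga ^ hodd (N div 2) j * ga ^ hodd (N div 2 + 1) j = 1"
		proof (cases "odd j")
			case True
			have "N div 2 + (N div 2 + 1) = N" using N_half by linarith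
			thus ?thesis using True ga by (simp add: hodd_def flip: power_add power_Suc)
		qed (simp add: hodd_def)
		thus "?h (pe (yp j)) = ey j"
			using j ph in_P by (simp add: h yp_def flip: mult.assoc)
	qed
qed

section \<open>The star operation on the generators\<close>

lemma c_root: "pe cp ^^^ (N - u mod N) ** pe cp ^^^ (u :: nat) = p1"
proof -
	have "pe cp ^^^ (N - u mod N) ** pe cp ^^^ u = pe cp ^^^ (N - u mod N) ** pe cp ^^^ (u mod N)"
		by (simp only: c_pow_mod)
	also have "... = pe cp ^^^ N" by (simp add: PR.nat_pow_mult less_imp_le)
	finally show ?thesis using cN in_P by (simp add: pe_pow pe_one)
qed

lemma inv_c: "inv\<^bsub>PR\<^esub> (pe cp) = pe cp ^^^ (N - 1 mod N)"
	using c_root[of 1] by (intro PR.comm_inv_char) (auto simp: PR.m_comm)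

lemma rstar_Chi: "rstar (pe cp ^^^ u ** ((if e then p1 else pe (pvar VA)) ** (if d then pe bp else p1))) =
		pe cp ^^^ (N - u mod N) ** ((if e then p1 else pe (pvar VA)) ** (if d then pe bp else p1))"
proof -
	have "{#Chi (u mod N) e d#} : KM" by (auto simp: K_def)
	from rstar_val[OF this] show ?thesis by (simp only: val_Chi c_pow_mod image_mset_single dual_irr.simps)
qed

lemma rstar_Psi:
	assumes "0 < j" "j < n"
	shows "rstar (pe cp ^^^ u ** pe (yp j)) = pe cp ^^^ (N - u mod N) ** pe (yp j)"
proof -
	have "{#Psi (u mod N) j#} : KM" using assms by (auto simp: K_def)
	from rstar_val[OF this] show ?thesis by (simp only: val_Psi c_pow_mod image_mset_single dual_irr.simps)
qed

lemma x_eq: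
	assumes "0 < j" "j < n"
	shows "pe (pvar (VX j)) = pe cp ^^^ hodd (N div 2 + 1) j ** pe (yp j)"
proof -
	have "pe (pvar (VX j)) = pe (cp ^ hodd (N div 2 + 1) j * yp j)"
		using pe_half[of "pvar (VX j)" j] in_P assms by (simp add: yp_def)
	thus ?thesis using in_P by (simp add: pe_mult pe_pow)
qed

text \<open>For odd \<open>j\<close>, \<open>x j\<close> is \<open>c ^ ((N + 1) div 2)\<close> times
  the self-dual \<open>y j\<close>. Modulo \<open>N\<close> the negative of this exponent is the
  exponent minus 1, so the dual of \<open>x j\<close> is \<open>x j\<close> divided by
  \<open>c\<close>.\<close>

lemma rstar_x:
	assumes "0 < j" "j < n"
	shows "rstar (pe (pvar (VX j))) = (if odd j then inv\<^bsub>PR\<^esub> (pe cp) else p1) ** pe (pvar (VX j))"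
proof (cases "odd j")
	case True
	let ?M = "N div 2" and ?c = "pe cp" and ?y = "pe (yp j)"
	have cc: "?c : carrier PR" by simp
	have "?c ^^^ (N - (?M + 1) mod N) = ?c ^^^ (N - 1 mod N) ** ?c ^^^ (?M + 1)"
	proof -
		have "?c ^^^ (N - (?M + 1) mod N) = ?c ^^^ ((N - (?M + 1) mod N) mod N)" by (simp only: c_pow_mod)
		also have "(N - (?M + 1) mod N) mod N = (N - 1 mod N + (?M + 1)) mod N"
		\<comment> \<open>\<open>1 mod N\<close> is 1 only for \<open>N > 1\<close>, so
		  \<open>N = 1\<close> is treated apart.\<close>
		proof (cases "N = 1")
			case False
			hence "N \<ge> 3" using N N_pos by presburger
			hence e: "(?M + 1) mod N = ?M + 1" "1 mod N = 1" "N - (?M + 1) = ?M" "N - 1 + (?M + 1) = ?M + N"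
				using N_half by auto
			show ?thesis unfolding e by (simp only: mod_add_self2)
		qed simp
		also have "?c ^^^ ... = ?c ^^^ (N - 1 mod N) ** ?c ^^^ (?M + 1)"
			by (simp only: c_pow_mod PR.nat_pow_mult[OF cc])
		finally show ?thesis .
	qed
	hence "rstar (pe (pvar (VX j))) = (?c ^^^ (N - 1 mod N) ** ?c ^^^ (?M + 1)) ** ?y"
		unfolding x_eq[OF assms] rstar_Psi[OF assms] using True by (simp add: hodd_def)
	also have "... = ?c ^^^ (N - 1 mod N) ** (?c ^^^ (?M + 1) ** ?y)"
		by (rule PR.m_assoc) auto
	finally show ?thesis unfolding x_eq[OF assms] inv_c using True by (simp add: hodd_def)
next
	case False
	have "pe cp ^^^ N = p1" using cN in_P by (simp add: pe_pow pe_one)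
	thus ?thesis unfolding x_eq[OF assms] rstar_Psi[OF assms] using False by (simp add: hodd_def)
qed

lemma rstar_a: "rstar (pe (pvar VA)) = pe (pvar VA)"
	using rstar_Chi[of 0 False False] c_root[of 0] by simp

lemma rstar_b: "rstar (pe bp) = pe bp"
	using rstar_Chi[of 0 True True] c_root[of 0] by simp

lemma rstar_c: "rstar (pe cp) = inv\<^bsub>PR\<^esub> (pe cp)"
	using rstar_Chi[of 1 True False] by (simp add: inv_c)

end

section \<open>The two presentations as rings with dihedral relations\<close>

lemma xpoly_carrier:
	assumes "VA : V" "VB : V" "!!j. 0 < j ==> j < n ==> VX j : V" "k < 2 * n"
	shows "xpoly n k : carrier (zpoly_ring V)"
	using assms by (auto simp: xpoly_def)

lemma xpoly_var: "0 < j ==> j < n ==> xpoly n j = pvar (VX j)"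
	by (simp add: xpoly_def)

lemma rels_even_xx: "nat ((1 - (- 1) ^ (i * j)) div 2 :: int) = (if odd (i * j) then 1 else 0)"
	by (cases "odd (i * j)") auto

lemma rels_odd_xx: "nat (1 - (- 1) ^ (i * j) :: int) = 2 * (if odd (i * j) then 1 else 0)"
	by (cases "odd (i * j)") auto

lemma zeval_xpoly:
	assumes "ph VA = ap" "ph VB = ga ^ hodd m n * be"
		"!!j. 0 < j ==> j < n ==> ph (VX j) = ga ^ hodd m j * ey j" "k < 2 * n"
	shows "zeval ph (xpoly n k) = ga ^ hodd m k * ext_family n (1 + ap) (be * (1 + ap)) ey k"
proof -
	have "odd (2 * n - k) = odd k" using assms(4) by simp
	thus ?thesis using assms by (auto simp: xpoly_def ext_family_def hodd_def)
qed

text \<open>With \<open>ga ^ m\<close> a square root of \<open>ga\<close>, the factors attached to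
  odd indices multiply to \<open>ga\<close> for two odd indices and to the factor of
  \<open>i + j\<close> otherwise. This is the power of \<open>c\<close> in the relation.\<close>

lemma zeval_xx:
	assumes ph: "ph VA = ap" "ph VB = ga ^ hodd m n * be"
		"!!j. 0 < j ==> j < n ==> ph (VX j) = ga ^ hodd m j * ey j"
		and p: "dih_point n ap be ey" and ga: "ga ^ (m + m) = ga"
		and ij: "0 < i" "i < n" "0 < j" "j < n"
	shows "zeval ph (xpoly n i) * zeval ph (xpoly n j) =
		ga ^ (if odd (i * j) then 1 else 0) * (zeval ph (xpoly n (dist_nat i j)) + zeval ph (xpoly n (i + j)))"
proof -
	let ?e = "ext_family n (1 + ap) (be * (1 + ap)) ey"
	have d: "dist_nat i j < 2 * n" "odd (dist_nat i j) = odd (i + j)" using ij by (auto simp: dist_nat_def)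
	have "zeval ph (xpoly n i) * zeval ph (xpoly n j) = ga ^ hodd m i * ga ^ hodd m j * (ey i * ey j)"
		using ij ph(3) by (simp add: xpoly_var)
	also have "ey i * ey j = ?e (dist_nat i j) + ?e (i + j)"
		using p ij by (simp add: dih_point_def)
	also have "ga ^ hodd m i * ga ^ hodd m j = ga ^ (if odd (i * j) then 1 else 0) * ga ^ hodd m (i + j)"
		using ga by (auto simp: hodd_def power_add)
	finally show ?thesis
		using ij d(2) zeval_xpoly[of ph ap ga m n be ey, OF ph d(1)] zeval_xpoly[of ph ap ga m n be ey "i + j", OF ph]
		by (simp add: hodd_def distrib_left mult.assoc)
qed

context dihedral
begin

lemma N_eq_half: "N = N div 2 + 1 + N div 2"
	using N by (metis odd_two_times_div_two_succ add.commute add.left_commute mult_2)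

lemma root_half: "ga ^ N = 1 ==> ga ^ (N div 2 + 1 + (N div 2 + 1)) = (ga :: complex)"
proof -
	assume "ga ^ N = 1"
	moreover have "N div 2 + 1 + (N div 2 + 1) = N + 1" using N_eq_half by linarith
	ultimately show ?thesis by simp
qed

text \<open>For even \<open>n\<close> the indices \<open>j\<close> and \<open>n - j\<close> have
  equal parity. So multiplication by \<open>b\<close> respects the normalisation of the
  \<open>x j\<close>, and \<open>b\<close> itself serves as the sign character.\<close>

lemma paper_ring_even:
	assumes ev: "even n"
	shows "paper_ring N n om ze (vars_even n) (rels_even N n) (pvar VB) (pvar VC)"
proof -
	let ?V = "vars_even n" and ?E = "rels_even N n"
	have V: "VA : ?V" "VB : ?V" "VC : ?V" "!!j. 0 < j ==> j < n ==> VX j : ?V"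
		by (auto simp: vars_even_def)
	have X: "xpoly n k : carrier (zpoly_ring ?V)" if "k < 2 * n" for k
		using xpoly_carrier[of ?V n k] V that by blast
	have n1: "i : {1..n - 1} \<longleftrightarrow> 0 < i & i < n" for i using n by auto
	have E: "?E \<subseteq> carrier (zpoly_ring ?V)"
		using V by (auto simp: rels_even_def n1 dist_nat_abs intro!: zpoly_closed X) (auto simp: dist_nat_def)
	interpret presentation ?V ?E by unfold_locales (rule E)
	have e: "r : ?E" if "r : {pvar VA ^ 2 - 1, pvar VB ^ 2 - 1, pvar VC ^ N - 1}" for r
		using that unfolding rels_even_def by blast
	show ?thesis
	proof
		show "pvar VB : carrier (zpoly_ring ?V)" "pvar VC : carrier (zpoly_ring ?V)" "VA : ?V" "VB : ?V"
			"!!j. 0 < j ==> j < n ==> VX j : ?V" using V by auto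
		show "pe (pvar VA * pvar VA) = pe 1" "pe (pvar VB * pvar VB) = pe 1" "pe (pvar VC ^ N) = pe 1"
			by (rule pe_eqI; use V e in "auto simp: power2_eq_square")+
		show "pvar VB = pvar VC ^ hodd (N div 2) n * pvar VB" using ev by (simp add: hodd_def)
		fix j assume j: "0 < j" "j < n"
		have "pvar VA * xpoly n j - xpoly n j : ?E" "pvar VB * xpoly n j - xpoly n (n - j) : ?E"
			using j unfolding rels_even_def n1 by blast+
		hence *: "pe (pvar VA * pvar (VX j)) = pe (pvar (VX j))" "pe (pvar VB * pvar (VX j)) = pe (pvar (VX (n - j)))"
			using j V by (simp_all add: xpoly_var pe_eqI)
		show "pe (pvar VA * pvar (VX j)) = pe (pvar (VX j))" by (rule *)
		have h: "hodd (N div 2) (n - j) = hodd (N div 2) j" using ev j by (simp add: hodd_def)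
		have "pe (pvar VB * (pvar VC ^ hodd (N div 2) j * pvar (VX j))) =
				pe (pvar VC ^ hodd (N div 2) j * (pvar VB * pvar (VX j)))" by (simp add: mult_ac)
		also have "... = pe (pvar VC ^ hodd (N div 2) (n - j) * pvar (VX (n - j)))"
			unfolding h using V j * by (subst (1 2) pe_mult) auto
		finally show "pe (pvar VB * (pvar VC ^ hodd (N div 2) j * pvar (VX j))) = ..." .
		fix i assume i: "0 < i" "i < n"
		have "xpoly n i * xpoly n j - pvar VC ^ nat ((1 - (-1) ^ (i * j)) div 2) * (xpoly n (nat \<bar>int i - int j\<bar>) + xpoly n (i + j)) : ?E"
			using i j unfolding rels_even_def n1 by blast
		thus "pe (pvar (VX i) * pvar (VX j)) =
				pe (pvar VC ^ (if odd (i * j) then 1 else 0) * (xpoly n (dist_nat i j) + xpoly n (i + j)))"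
			unfolding rels_even_xx dist_nat_abs using i j V X[of "dist_nat i j"] X[of "i + j"]
			by (intro pe_eqI) (auto simp: xpoly_var[of i] xpoly_var[of j] dist_nat_def)
	next
		show "v = VA \<or> v = VB \<or> pvar v = pvar VC \<or> (\<exists>j. 0 < j & j < n & v = VX j)" if "v : ?V" for v
			using that by (auto simp: vars_even_def)
	next
		fix ap be ga :: complex and ey assume p: "dih_point n ap be ey" and ga: "ga ^ N = 1"
		define ph where "ph v = (case v of VA => ap | VB => be | VC => ga | VX j => ga ^ hodd (N div 2 + 1) j * ey j)" for v
		have ph: "ph VA = ap" "ph VB = ga ^ hodd (N div 2 + 1) n * be" "ph VC = ga" "ph VB = be"
			"!!j. ph (VX j) = ga ^ hodd (N div 2 + 1) j * ey j"
			using ev by (auto simp: ph_def hodd_def)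
		have dp: "ap * ap = 1" "be * be = 1" "!!j. 0 < j ==> j < n ==> ap * ey j = ey j" "!!j. 0 < j ==> j < n ==> be * ey j = ey (n - j)"
			using p by (auto simp: dih_point_def)
		have "zeval ph r = 0" if "r : ?E" for r
		proof -
			from that consider "r : {pvar VA ^ 2 - 1, pvar VB ^ 2 - 1, pvar VC ^ N - 1}"
				| i where "0 < i" "i < n" "r = pvar VA * xpoly n i - xpoly n i"
				| i where "0 < i" "i < n" "r = pvar VB * xpoly n i - xpoly n (n - i)"
				| i j where "0 < i" "i < n" "0 < j" "j < n" "r = xpoly n i * xpoly n j -
						pvar VC ^ nat ((1 - (-1) ^ (i * j)) div 2) * (xpoly n (nat \<bar>int i - int j\<bar>) + xpoly n (i + j))"
				unfolding rels_even_def n1 by blast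
			thus ?thesis
			proof cases
				case 1
				thus ?thesis using ph dp ga by (auto simp: power2_eq_square)
			next
				case (2 i)
				thus ?thesis using ph dp(3)[of i] by (simp add: xpoly_var mult.left_commute)
			next
				case (3 i)
				hence "hodd (N div 2 + 1) (n - i) = hodd (N div 2 + 1) i" using ev by (simp add: hodd_def)
				thus ?thesis using 3 ph dp(4)[of i] by (simp add: xpoly_var mult.left_commute)
			next
				case (4 i j)
				show ?thesis
					unfolding 4(5) rels_even_xx dist_nat_abs
					using zeval_xx[of ph ap ga "N div 2 + 1" n be ey i j, OF ph(1,2,5) p root_half[OF ga] 4(1-4)] ph(3) by simp
			qed
		qed
		thus "\<exists>ph. (\<forall>e\<in>?E. zeval ph e = 0) & ph VA = ap & zeval ph (pvar VB) = be & zeval ph (pvar VC) = ga &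
				(\<forall>j. 0 < j & j < n \<longrightarrow> ph (VX j) = ga ^ hodd (N div 2 + 1) j * ey j)"
			using ph by (intro exI[of _ ph]) auto
	qed
qed

lemma is_star_even_rstar:
	assumes "even n"
	shows "is_star_even N n (fusion_ring.rstar N n (R_even N n) (paper_ring.pval N n (vars_even n) (rels_even N n) (pvar VB) (pvar VC)))"
proof -
	interpret paper_ring N n om ze "vars_even n" "rels_even N n" "pvar VB" "pvar VC"
		by (rule paper_ring_even[OF assms])
	have R: "R_even N n = PR" by (simp add: R_even_def)
	have "rstar (pe (pvar (VX i))) = (pe (pvar VC) [^]\<^bsub>PR\<^esub> (((-1) ^ i - 1) div 2 :: int)) \<otimes>\<^bsub>PR\<^esub> pe (pvar (VX i))"
		if "i : {1..n - 1}" for i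
	proof -
		have i: "0 < i" "i < n" using that n by auto
		have "pe (pvar VC) [^]\<^bsub>PR\<^esub> (- 1 :: int) = inv\<^bsub>PR\<^esub> (pe (pvar VC))"
			by (simp add: int_pow_def2)
		moreover have "pe (pvar VC) [^]\<^bsub>PR\<^esub> (0 :: int) = \<one>\<^bsub>PR\<^esub>"
			by (simp add: int_pow_def2)
		ultimately show ?thesis using rstar_x[OF i] by (cases "odd i") auto
	qed
	thus ?thesis
		unfolding is_star_even_def Let_def R using rstar_hom rstar_a rstar_b rstar_c by auto
qed

text \<open>For odd \<open>n\<close> the sign character exchanges even and odd indices, so the
  generator \<open>b\<close> includes the factor \<open>c ^ ((N + 1) div 2)\<close>; then
  \<open>b ^ N\<close> is the sign character and \<open>b ^ 2\<close> is \<open>c\<close>.\<close>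

lemma paper_ring_odd:
	assumes od: "odd n"
	shows "paper_ring N n om ze (vars_odd n) (rels_odd N n) (pvar VB ^ N) (pvar VB ^ 2)"
proof -
	let ?V = "vars_odd n" and ?E = "rels_odd N n" and ?c = "pvar VB ^ 2" and ?M = "N div 2"
	have V: "VA : ?V" "VB : ?V" "!!j. 0 < j ==> j < n ==> VX j : ?V"
		by (auto simp: vars_odd_def)
	have X: "xpoly n k : carrier (zpoly_ring ?V)" if "k < 2 * n" for k
		using xpoly_carrier[of ?V n k] V that by blast
	have n1: "i : {1..n - 1} \<longleftrightarrow> 0 < i & i < n" for i using n by auto
	have E: "?E \<subseteq> carrier (zpoly_ring ?V)"
		using V by (auto simp: rels_odd_def n1 dist_nat_abs intro!: zpoly_closed X) (auto simp: dist_nat_def)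
	interpret presentation ?V ?E by unfold_locales (rule E)
	have e: "r : ?E" if "r : {pvar VA ^ 2 - 1, pvar VB ^ (2 * N) - 1}" for r
		using that unfolding rels_odd_def by blast
	have b2N: "pe (pvar VB ^ (2 * N)) = pe 1" by (rule pe_eqI; use V e in auto)
	have b2N': "pe (pvar VB ^ (2 * N + k) * x) = pe (pvar VB ^ k * x)" if "x : carrier P" for k x
	proof -
		have "pe (pvar VB ^ (2 * N + k) * x) = pe (pvar VB ^ (2 * N)) \<otimes>\<^bsub>PR\<^esub> pe (pvar VB ^ k * x)"
			using that V by (simp add: power_add mult.assoc pe_mult[symmetric])
		thus ?thesis using that V by (simp add: b2N pe_one)
	qed
	have N': "N = 2 * ?M + 1" using N_eq_half by linarith
	show ?thesis
	proof
		show "pvar VB ^ N : carrier (zpoly_ring ?V)" "?c : carrier (zpoly_ring ?V)" "VA : ?V" "VB : ?V"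
			"!!j. 0 < j ==> j < n ==> VX j : ?V" using V by auto
		show "pe (pvar VA * pvar VA) = pe 1"
			by (rule pe_eqI; use V e in "auto simp: power2_eq_square")
		show "pe (pvar VB ^ N * pvar VB ^ N) = pe 1" "pe (?c ^ N) = pe 1"
			using b2N by (simp_all add: power_add[symmetric] mult_2 power_mult[symmetric])
		have "pvar VB ^ N = (pvar VB ^ (2 * ?M + 1) :: rvar zpoly)" using N' by simp
		thus "pvar VB ^ N = ?c ^ hodd ?M n * pvar VB" using od by (simp add: hodd_def power_mult mult.commute)
		fix j assume j: "0 < j" "j < n"
		have "pvar VA * xpoly n j - xpoly n j : ?E"
			using j unfolding rels_odd_def n1 by blast
		thus "pe (pvar VA * pvar (VX j)) = pe (pvar (VX j))"
			using j V by (simp add: xpoly_var pe_eqI)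
		have bx: "pe (pvar VB * pvar (VX i)) = pe (pvar (VX (n - i)))" if i: "0 < i" "i < n" "even i" for i
		proof -
			have "pvar VB * xpoly n i - xpoly n (n - i) : ?E" using i unfolding rels_odd_def n1 by blast
			thus ?thesis using i V by (simp add: xpoly_var pe_eqI)
		qed
		show "pe (pvar VB ^ N * (?c ^ hodd ?M j * pvar (VX j))) = pe (?c ^ hodd ?M (n - j) * pvar (VX (n - j)))"
		proof (cases "even j")
			case True
			have "pe (pvar VB ^ N * (?c ^ hodd ?M j * pvar (VX j))) = pe (?c ^ ?M * (pvar VB * pvar (VX j)))"
				using True by (subst (1) N') (simp add: hodd_def power_mult mult_ac)
			also have "... = pe (?c ^ ?M * pvar (VX (n - j)))"
				using V j bx[OF j True] by (subst (1 2) pe_mult) auto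
			finally show ?thesis using True od j by (simp add: hodd_def)
		next
			\<comment> \<open>The presentation gives \<open>b x_i = x_(n-i)\<close> for even \<open>i\<close>
			  only. Applied to the even index \<open>n - j\<close> it expresses \<open>x_j\<close>, and the
			  powers of \<open>b\<close> then add up to \<open>2 * N\<close>.\<close>
			case False
			have "pe (pvar (VX j)) = pe (pvar VB * pvar (VX (n - j)))"
				using bx[of "n - j"] j False od by simp
			hence "pe (pvar VB ^ N * (?c ^ hodd ?M j * pvar (VX j))) =
					pe (pvar VB ^ N * ?c ^ ?M * (pvar VB * pvar (VX (n - j))))"
				using V j False unfolding mult.assoc[symmetric, of "pvar VB ^ N"] hodd_def
				by (subst (1 2) pe_mult) auto
			also have "pvar VB ^ N * ?c ^ ?M * (pvar VB * pvar (VX (n - j))) = pvar VB ^ (N + (2 * ?M + 1)) * pvar (VX (n - j))"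
				by (simp add: power_add power_mult mult_ac)
			also have "N + (2 * ?M + 1) = 2 * N + 0" using N' by linarith
			also have "pe (pvar VB ^ (2 * N + 0) * pvar (VX (n - j))) = pe (pvar VB ^ 0 * pvar (VX (n - j)))"
				using V j by (intro b2N') auto
			finally show ?thesis using False od j by (simp add: hodd_def)
		qed
		fix i assume i: "0 < i" "i < n"
		have "xpoly n i * xpoly n j - pvar VB ^ nat (1 - (-1) ^ (i * j)) * (xpoly n (nat \<bar>int i - int j\<bar>) + xpoly n (i + j)) : ?E"
			using i j unfolding rels_odd_def n1 by blast
		thus "pe (pvar (VX i) * pvar (VX j)) = pe (?c ^ (if odd (i * j) then 1 else 0) * (xpoly n (dist_nat i j) + xpoly n (i + j)))"
			unfolding rels_odd_xx dist_nat_abs unfolding power_mult using i j V X[of "dist_nat i j"] X[of "i + j"]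
			by (intro pe_eqI) (auto simp: xpoly_var[of i] xpoly_var[of j] dist_nat_def)
	next
		show "v = VA \<or> v = VB \<or> pvar v = ?c \<or> (\<exists>j. 0 < j & j < n & v = VX j)" if "v : ?V" for v
			using that by (auto simp: vars_odd_def)
	next
		fix ap be ga :: complex and ey assume p: "dih_point n ap be ey" and ga: "ga ^ N = 1"
		\<comment> \<open>The value at \<open>VB\<close> is the element with square \<open>ga\<close> and
		  \<open>N\<close>-th power \<open>be\<close>. The value at \<open>VC\<close>, which is not among
		  the variables, is a mere default.\<close>
		define ph where "ph v = (case v of VA => ap | VB => ga ^ (?M + 1) * be | VC => 0 | VX j => ga ^ hodd (?M + 1) j * ey j)" for v
		have dp: "ap * ap = 1" "be * be = 1" "!!j. 0 < j ==> j < n ==> ap * ey j = ey j" "!!j. 0 < j ==> j < n ==> be * ey j = ey (n - j)"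
			using p by (auto simp: dih_point_def)
		have ph: "ph VA = ap" "ph VB = ga ^ hodd (?M + 1) n * be" "ph VB = ga ^ (?M + 1) * be"
			"!!j. ph (VX j) = ga ^ hodd (?M + 1) j * ey j"
			using od by (auto simp: ph_def hodd_def)
		have b2: "ph VB ^ 2 = ga"
			using root_half[OF ga] dp(2) unfolding ph(3) power_mult_distrib power_mult[symmetric] mult_2_right
			by (simp add: power2_eq_square)
		have bN: "ph VB ^ N = be"
		proof -
			have "ph VB ^ N = (ga ^ N) ^ (?M + 1) * be ^ N"
				unfolding ph(3) by (simp only: power_mult_distrib power_mult[symmetric] mult.commute[of N])
			also have "... = be ^ (2 * ?M + 1)" using ga N' by simp
			also have "... = be" using dp(2) by (simp add: power_mult power2_eq_square)
			finally show ?thesis .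
		qed
		have "zeval ph r = 0" if "r : ?E" for r
		proof -
			from that consider "r : {pvar VA ^ 2 - 1, pvar VB ^ (2 * N) - 1}"
				| i where "0 < i" "i < n" "r = pvar VA * xpoly n i - xpoly n i"
				| i where "0 < i" "i < n" "even i" "r = pvar VB * xpoly n i - xpoly n (n - i)"
				| i j where "0 < i" "i < n" "0 < j" "j < n" "r = xpoly n i * xpoly n j -
						pvar VB ^ nat (1 - (-1) ^ (i * j)) * (xpoly n (nat \<bar>int i - int j\<bar>) + xpoly n (i + j))"
				unfolding rels_odd_def n1 by blast
			thus ?thesis
			proof cases
				case 1
				have "ph VB ^ (2 * N) = 1" using b2 ga by (simp add: power_mult)
				thus ?thesis using 1 ph(1) dp by (auto simp: power2_eq_square)
			next
				case (2 i)
				thus ?thesis using ph dp(3)[of i] by (simp add: xpoly_var mult.left_commute)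
			next
				case (3 i)
				hence "odd (n - i)" using od by simp
				thus ?thesis using 3 ph(3,4) dp(4)[of i] by (simp add: xpoly_var hodd_def mult.assoc)
			next
				case (4 i j)
				show ?thesis
					unfolding 4(5) rels_odd_xx dist_nat_abs unfolding power_mult
					using zeval_xx[of ph ap ga "?M + 1" n be ey i j, OF ph(1,2,4) p root_half[OF ga] 4(1-4)] b2 by simp
			qed
		qed
		thus "\<exists>ph. (\<forall>e\<in>?E. zeval ph e = 0) & ph VA = ap & zeval ph (pvar VB ^ N) = be & zeval ph ?c = ga &
				(\<forall>j. 0 < j & j < n \<longrightarrow> ph (VX j) = ga ^ hodd (?M + 1) j * ey j)"
			using ph b2 bN by (intro exI[of _ ph]) auto
	qed
qed

lemma is_star_odd_rstar:
	assumes "odd n"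
	shows "is_star_odd N n (fusion_ring.rstar N n (R_odd N n) (paper_ring.pval N n (vars_odd n) (rels_odd N n) (pvar VB ^ N) (pvar VB ^ 2)))"
proof -
	interpret paper_ring N n om ze "vars_odd n" "rels_odd N n" "pvar VB ^ N" "pvar VB ^ 2"
		by (rule paper_ring_odd[OF assms])
	have R: "R_odd N n = PR" by (simp add: R_odd_def)
	let ?b = "pe (pvar VB)" and ?c = "pe (pvar VB ^ 2)"
	have V: "pvar VB : carrier P" using in_P by simp
	have bb: "?b \<otimes>\<^bsub>PR\<^esub> ?b = ?c" using V by (simp add: pe_mult[symmetric] power2_eq_square)
	\<comment> \<open>The exponent of \<open>b\<close> on the right is
	  \<open>2 * (N div 2 + 1) + N\<close>, that is \<open>2 * N + 1\<close>. In this form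
	  \<open>b\<close> is the value of a character label, and its star is known from
	  \<open>rstar_Chi\<close>.\<close>
	have b: "?b = ?c [^]\<^bsub>PR\<^esub> (N div 2 + 1) \<otimes>\<^bsub>PR\<^esub> (\<one>\<^bsub>PR\<^esub> \<otimes>\<^bsub>PR\<^esub> pe (pvar VB ^ N))"
	proof -
		have "(pvar VB ^ 2) ^ (N div 2 + 1) * pvar VB ^ N = (pvar VB ^ 2) ^ N * pvar VB"
		proof -
			have "2 * (N div 2 + 1) + N = 2 * N + 1" by (subst (2 3) N_eq_half) simp
			hence "pvar VB ^ (2 * (N div 2 + 1) + N) = pvar VB ^ (2 * N + 1)" by (simp only:)
			thus ?thesis by (simp only: power_add power_mult power_one_right)
		qed
		hence "pe ((pvar VB ^ 2) ^ (N div 2 + 1) * pvar VB ^ N) = pe ((pvar VB ^ 2) ^ N) \<otimes>\<^bsub>PR\<^esub> ?b"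
			using V by (simp only: pe_mult zpoly_pow)
		also have "... = ?b" using V cN by (simp only: pe_one zpoly_pow) simp
		finally show ?thesis using V by (simp add: pe_mult pe_pow del: One_nat_def add_Suc_right power_Suc PR.nat_pow_Suc)
	qed
	have sb: "rstar ?b = ?c [^]\<^bsub>PR\<^esub> (N - (N div 2 + 1) mod N) \<otimes>\<^bsub>PR\<^esub> (\<one>\<^bsub>PR\<^esub> \<otimes>\<^bsub>PR\<^esub> pe (pvar VB ^ N))"
		using rstar_Chi[of "N div 2 + 1" True True] unfolding b[symmetric] if_True .
	have "rstar ?b \<otimes>\<^bsub>PR\<^esub> ?b = \<one>\<^bsub>PR\<^esub>"
	proof -
		have c: "?c [^]\<^bsub>PR\<^esub> (N - (N div 2 + 1) mod N) : carrier PR" "?c [^]\<^bsub>PR\<^esub> (N div 2 + 1) : carrier PR"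
			"pe (pvar VB ^ N) : carrier PR" using V by auto
		have "rstar ?b \<otimes>\<^bsub>PR\<^esub> ?b = (?c [^]\<^bsub>PR\<^esub> (N - (N div 2 + 1) mod N) \<otimes>\<^bsub>PR\<^esub> ?c [^]\<^bsub>PR\<^esub> (N div 2 + 1)) \<otimes>\<^bsub>PR\<^esub>
				(pe (pvar VB ^ N) \<otimes>\<^bsub>PR\<^esub> pe (pvar VB ^ N))"
			unfolding sb using c by (subst b) (simp only: PR.l_one PR.m_ac PR.m_closed)
		also have "pe (pvar VB ^ N) \<otimes>\<^bsub>PR\<^esub> pe (pvar VB ^ N) = \<one>\<^bsub>PR\<^esub>"
			using bb V paper_ring.bb[OF paper_ring_axioms] by (simp add: pe_mult[symmetric] pe_one)
		finally show ?thesis by (simp only: c_root) simp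
	qed
	moreover have "rstar ?b : carrier PR" unfolding sb using V by simp
	ultimately have b_inv: "rstar ?b = inv\<^bsub>PR\<^esub> ?b"
		using V by (intro PR.comm_inv_char[symmetric]) (auto simp: PR.m_comm)
	have "rstar (pe (pvar (VX i))) = (?b [^]\<^bsub>PR\<^esub> ((-1) ^ i - 1 :: int)) \<otimes>\<^bsub>PR\<^esub> pe (pvar (VX i))"
		if "i : {1..n - 1}" for i
	proof -
		have i: "0 < i" "i < n" using that n by auto
		have "?b [^]\<^bsub>PR\<^esub> (- 2 :: int) = inv\<^bsub>PR\<^esub> (?b [^]\<^bsub>PR\<^esub> (2 :: nat))"
			by (simp add: int_pow_def2)
		also have "?b [^]\<^bsub>PR\<^esub> (2 :: nat) = ?c" using V by (simp add: pe_pow)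
		finally have "?b [^]\<^bsub>PR\<^esub> (- 2 :: int) = inv\<^bsub>PR\<^esub> ?c" .
		moreover have "?b [^]\<^bsub>PR\<^esub> (0 :: int) = \<one>\<^bsub>PR\<^esub>"
			by (simp add: int_pow_def2)
		ultimately show ?thesis using rstar_x[OF i] by (cases "odd i") auto
	qed
	thus ?thesis
		unfolding is_star_odd_def Let_def R using rstar_hom rstar_a b_inv by auto
qed

end

section \<open>Group algebras\<close>

lemma fd_modules_cong:
	assumes "(d, rh) : fdms A" "!!a. a : carrier A ==> si a = rh a"
		and "\<one>\<^bsub>A\<^esub> : carrier A" "!!a b. a : carrier A ==> b : carrier A ==> a \<otimes>\<^bsub>A\<^esub> b : carrier A & a \<oplus>\<^bsub>A\<^esub> b : carrier A"
			"!!c a. a : carrier A ==> c \<odot>\<^bsub>A\<^esub> a : carrier A"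
	shows "(d, si) : fdms A"
	using assms by (auto simp: fd_modules_def)

lemma tensor_class_self: "kys t \<subseteq> carrier A \<times> carrier A ==> t : tensor_class A t"
	by (simp add: tensor_class_def tensor_null.zero)

lemma fscale_single: "fscale c (sgl x d) = sgl x (c * d)"
	by (simp add: map_single)

lemma tensor_null_mono:
	assumes "t : tensor_null A" "carrier A = carrier B" "!!a b. a \<oplus>\<^bsub>A\<^esub> b = a \<oplus>\<^bsub>B\<^esub> b"
		"!!c a. c \<odot>\<^bsub>A\<^esub> a = c \<odot>\<^bsub>B\<^esub> a"
	shows "t : tensor_null B"
	using assms(1)
proof induction
	case (add_left a a' b)
	thus ?case using tensor_null.add_left[of a B a' b] assms(2-) by simp
next
	case (add_right a b b')
	thus ?case using tensor_null.add_right[of a B b b'] assms(2-) by simp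
next
	case (smult_left a b c)
	thus ?case using tensor_null.smult_left[of a B b c] assms(2-) by simp
next
	case (smult_right a b c)
	thus ?case using tensor_null.smult_right[of a B b c] assms(2-) by simp
qed (auto intro: tensor_null.zero tensor_null.plus tensor_null.scale)

text \<open>The comultiplication is defined with tensor classes over the underlying module record,
  whereas the Hopf algebra extends that record; the null tensors agree.\<close>

lemma tensor_class_cong:
	assumes "carrier A = carrier B" "!!a b. a \<oplus>\<^bsub>A\<^esub> b = a \<oplus>\<^bsub>B\<^esub> b" "!!c a. c \<odot>\<^bsub>A\<^esub> a = c \<odot>\<^bsub>B\<^esub> a"
	shows "tensor_class A t = tensor_class B t"
	unfolding tensor_class_def
	using tensor_null_mono[of _ A B] tensor_null_mono[of _ B A] assms by (intro Collect_cong conj_cong) auto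

abbreviation gs :: "'g => ('g \<Rightarrow>\<^sub>0 'k::comm_ring_1)" where "gs g == sgl g 1"

locale group_rep = group G for G :: "'g monoid" (structure) +
	fixes A :: "('k::field, 'g \<Rightarrow>\<^sub>0 'k) hopf_algebra"
	assumes A: "A = group_hopf_algebra G"
begin

lemma A_simps:
	"carrier A = {f. kys f \<subseteq> carrier G}" "\<one>\<^bsub>A\<^esub> = gs \<one>" "a \<oplus>\<^bsub>A\<^esub> b = a + b" "c \<odot>\<^bsub>A\<^esub> a = fscale c a"
	"a \<otimes>\<^bsub>A\<^esub> b = (\<Sum>g\<in>kys a. \<Sum>h\<in>kys b.
		 sgl (g \<otimes> h) (lkp a g * lkp b h))"
	"counit A a = (\<Sum>g\<in>kys a. lkp a g)"
	"antipode A a = (\<Sum>g\<in>kys a. sgl (inv g) (lkp a g))"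
	by (simp_all add: A group_hopf_algebra_def group_algebra_def module.defs hopf_algebra.defs)

lemma comult_A: "comult A f = tensor_class A (\<Sum>g\<in>kys f. sgl (gs g, gs g) (lkp f g))"
proof -
	have "comult A f = tensor_class (group_algebra G) (\<Sum>g\<in>kys f. sgl (gs g, gs g) (lkp f g))"
		by (simp add: A group_hopf_algebra_def module.defs hopf_algebra.defs fscale_single)
	also have "tensor_class (group_algebra G) t = tensor_class A t" for t
		by (rule tensor_class_cong) (simp_all add: A group_hopf_algebra_def module.defs)
	finally show ?thesis .
qed

lemma keys_sum_subset:
	assumes "!!x. x : S ==> kys (f x) \<subseteq> T"
	shows "kys (sum f S) \<subseteq> T"
	by (rule order_trans[OF keys_sum UN_least[OF assms]])

lemma A_closed:
	"\<one>\<^bsub>A\<^esub> : carrier A" "a : carrier A ==> b : carrier A ==> a \<otimes>\<^bsub>A\<^esub> b : carrier A & a \<oplus>\<^bsub>A\<^esub> b : carrier A"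
	"a : carrier A ==> c \<odot>\<^bsub>A\<^esub> a : carrier A" "a : carrier A ==> antipode A a : carrier A"
proof -
	show "\<one>\<^bsub>A\<^esub> : carrier A" by (simp add: A_simps)
	assume "a : carrier A"
	hence a: "kys a \<subseteq> carrier G" by (simp add: A_simps)
	thus "c \<odot>\<^bsub>A\<^esub> a : carrier A" by (auto simp: A_simps in_keys_iff)
	show "antipode A a : carrier A"
		unfolding A_simps using a by (intro CollectI keys_sum_subset) auto
	assume "b : carrier A"
	hence b: "kys b \<subseteq> carrier G" by (simp add: A_simps)
	have "a \<otimes>\<^bsub>A\<^esub> b : carrier A"
		unfolding A_simps using a b by (intro CollectI keys_sum_subset) auto
	moreover have "a \<oplus>\<^bsub>A\<^esub> b : carrier A" using a b keys_add[of a b] by (auto simp: A_simps)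
	ultimately show "a \<otimes>\<^bsub>A\<^esub> b : carrier A & a \<oplus>\<^bsub>A\<^esub> b : carrier A" ..
qed

lemma gs_closed [simp]: "g : carrier G ==> gs g : carrier A"
	by (simp add: A_simps)

lemma gs_mult: "gs g \<otimes>\<^bsub>A\<^esub> gs h = gs (g \<otimes> h)"
	by (simp add: A_simps)

lemma gs_rep:
	assumes "V : fdms A"
	shows "g : carrier G ==> snd V (gs g) : carrier_mat (fst V) (fst V)"
		and "snd V (gs \<one>) = idm (fst V)"
		and "g : carrier G ==> h : carrier G ==> snd V (gs (g \<otimes> h)) = snd V (gs g) * snd V (gs h)"
proof -
	show "g : carrier G ==> snd V (gs g) : carrier_mat (fst V) (fst V)"
		using fd_modulesD(1)[OF assms] by simp
	show "snd V (gs \<one>) = idm (fst V)" using fd_modulesD(2)[OF assms] by (simp only: A_simps)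
	show "g : carrier G ==> h : carrier G ==> snd V (gs (g \<otimes> h)) = snd V (gs g) * snd V (gs h)"
		using fd_modulesD(3)[OF assms, of "gs g" "gs h"] by (simp add: gs_mult)
qed

lemma fd_expand:
	assumes V: "V : fdms A" and f: "f : carrier A"
	shows "snd V f = lin_act (fst V) (%g. snd V (gs g)) f"
proof -
	let ?s = "%S. \<Sum>g\<in>S. sgl g (lkp f g)"
	have "?s S : carrier A & snd V (?s S) = lin_act (fst V) (%g. snd V (gs g)) (?s S)"
		if "finite S" "S \<subseteq> carrier G" for S
		using that
	proof induction
		case empty
		have "snd V (0 \<odot>\<^bsub>A\<^esub> \<one>\<^bsub>A\<^esub>) = 0 \<cdot> idm (fst V)"
			by (simp only: fd_modulesD(5)[OF V A_closed(1)] fd_modulesD(2)[OF V])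
		also have "0 \<odot>\<^bsub>A\<^esub> \<one>\<^bsub>A\<^esub> = 0" by (simp add: A_simps fscale_single)
		also have "0 \<cdot> idm (fst V) = (zm (fst V) (fst V) :: 'k mat)" by (rule eq_matI) auto
		finally show ?case by (simp add: lin_act_simps A_simps)
	next
		case (insert g S)
		have g: "gs g : carrier A" "g : carrier G" using insert by auto
		let ?c = "lkp f g"
		have 1: "?s (insert g S) = (?c \<odot>\<^bsub>A\<^esub> gs g) \<oplus>\<^bsub>A\<^esub> ?s S"
			using insert by (simp add: A_simps fscale_single)
		have S: "?s S : carrier A" "snd V (?s S) = lin_act (fst V) (%g. snd V (gs g)) (?s S)"
			using insert by auto
		have "snd V (?s (insert g S)) = ?c \<cdot> snd V (gs g) + snd V (?s S)"
			unfolding 1 by (simp only: fd_modulesD(4)[OF V A_closed(3)[OF g(1)] S(1)] fd_modulesD(5)[OF V g(1)])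
		also have "... = lin_act (fst V) (%g. snd V (gs g)) (sgl g ?c + ?s S)"
			using gs_rep(1)[OF V g(2)] by (simp only: lin_act_simps lin_act_single S(2))
		also have "sgl g ?c + ?s S = ?s (insert g S)" using insert by simp
		finally show ?case using A_closed(2)[OF A_closed(3)[OF g(1)] S(1)] unfolding 1 by blast
	qed
	from this[of "kys f"] f show ?thesis by (simp add: poly_mapping_sum_single A_simps)
qed

text \<open>A matrix representation of the group extends linearly to the group algebra; for
  products, both sides expand into one sum over two group elements and a matrix index.\<close>

lemma rep_fd:
	assumes si: "!!g. g : carrier G ==> si g : sqm d" "si \<one> = idm d"
		"!!g h. g : carrier G ==> h : carrier G ==> si (g \<otimes> h) = si g * si h"
		and rh: "!!f. f : carrier A ==> rh f = lin_act d si f"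
	shows "(d, rh) : fdms A"
proof (rule fd_modules_cong[OF _ rh A_closed(1-3)])
	show "(d, lin_act d si) : fdms A"
	proof (rule fd_modulesI)
		show "lin_act d si \<one>\<^bsub>A\<^esub> = idm d" using si(1)[of \<one>] si(2) by (simp add: lin_act_single A_simps) (rule eq_matI, auto)
		fix a b assume ab: "a : carrier A" "b : carrier A"
		show "lin_act d si (a \<otimes>\<^bsub>A\<^esub> b) = lin_act d si a * lin_act d si b"
		proof (rule eq_matI)
			fix i j assume "i < dim_row (lin_act d si a * lin_act d si b)" "j < dim_col (lin_act d si a * lin_act d si b)"
			hence ij: "i < d" "j < d" by auto
			let ?a = "lkp a" and ?b = "lkp b"
			have "lin_act d si (a \<otimes>\<^bsub>A\<^esub> b) $$ (i, j) =
					(\<Sum>g\<in>kys a. \<Sum>h\<in>kys b. ?a g * ?b h * si (g \<otimes> h) $$ (i, j))"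
				using ij by (simp add: lin_act_index id_scalars.lin_sum A_simps)
			also have "... = (\<Sum>g\<in>kys a. \<Sum>h\<in>kys b. \<Sum>l = 0..<d.
					?a g * si g $$ (i, l) * (?b h * si h $$ (l, j)))"
			proof (intro sum.cong HOL.refl)
				fix g h assume "g : kys a" "h : kys b"
				hence gh: "g : carrier G" "h : carrier G" using ab by (auto simp: A_simps)
				show "?a g * ?b h * si (g \<otimes> h) $$ (i, j) = (\<Sum>l = 0..<d. ?a g * si g $$ (i, l) * (?b h * si h $$ (l, j)))"
					using si(1)[OF gh(1)] si(1)[OF gh(2)] ij
					by (auto simp: si(3)[OF gh] scalar_prod_def sum_distrib_left mult_ac intro!: sum.cong)
			qed
			also have "... = (\<Sum>g\<in>kys a. \<Sum>l = 0..<d. \<Sum>h\<in>kys b.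
					?a g * si g $$ (i, l) * (?b h * si h $$ (l, j)))"
				by (intro sum.cong HOL.refl sum.swap)
			also have "... = (\<Sum>l = 0..<d. \<Sum>g\<in>kys a. \<Sum>h\<in>kys b.
					?a g * si g $$ (i, l) * (?b h * si h $$ (l, j)))"
				by (rule sum.swap)
			also have "... = (lin_act d si a * lin_act d si b) $$ (i, j)"
				using ij by (simp add: scalar_prod_def lin_act_index lin_def sum_product)
			finally show "lin_act d si (a \<otimes>\<^bsub>A\<^esub> b) $$ (i, j) = (lin_act d si a * lin_act d si b) $$ (i, j)" .
		qed auto
	qed (auto simp: lin_act_simps A_simps intro: carrier_matI)
qed auto

lemma rep_gs:
	"(!!f. f : carrier A ==> rh f = lin_act d si f) ==> g : carrier G ==> si g : sqm d ==> rh (gs g) = si g"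
	using lin_act_single[of si g d 1] by simp (rule eq_matI, auto)

lemma comult_some:
	assumes "f : carrier A"
	shows "(SOME s. s : comult A f) : comult A f"
proof (rule someI)
	have "kys (\<Sum>g\<in>kys f. sgl (gs g :: 'g \<Rightarrow>\<^sub>0 'k, gs g :: 'g \<Rightarrow>\<^sub>0 'k) (lkp f g))
			\<subseteq> carrier A \<times> carrier A"
		by (rule keys_sum_subset) (use assms in "auto simp: A_simps")
	thus "(\<Sum>g\<in>kys f. sgl (gs g, gs g) (lkp f g)) : comult A f"
		unfolding comult_A by (rule tensor_class_self)
qed

text \<open>The representative picked by the choice operator acts like the sum of the
  \<open>g \<otimes> g\<close>, since it lies in the tensor class of that sum.\<close>

lemma module_tensor_group:
	assumes V: "V : fdms A" "W : fdms A" and f: "f : carrier A"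
	shows "snd (mten A V W) f = lin_act (fst V * fst W) (%g. kro (snd V (gs g)) (snd W (gs g))) f"
proof -
	let ?t = "\<Sum>g\<in>kys f. sgl (gs g, gs g) (lkp f g)"
	have "snd (mten A V W) f = tens_act (fst V) (fst W) (snd V) (snd W) ?t"
		unfolding module_tensor_simp snd_conv
		using comult_some[OF f] unfolding comult_A by (rule tens_act_tensor_class[OF _ V]) (use A_closed in blast)+
	also have "... = lin_act (fst V * fst W) (%g. kro (snd V (gs g)) (snd W (gs g))) f"
		by (rule eq_matI) (simp_all add: tens_act_def lin_act_index id_scalars.lin_sum, simp add: lin_def)
	finally show ?thesis .
qed

lemma dual_module_group:
	assumes V: "V : fdms A" and f: "f : carrier A"
	shows "snd (dmod A V) f = lin_act (fst V) (%g. trm (snd V (gs (inv g)))) f"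
proof -
	have "snd (dmod A V) f = trm (lin_act (fst V) (%g. snd V (gs g)) (antipode A f))"
		using fd_expand[OF V A_closed(4)[OF f]] by (cases V) simp
	also have "... = lin_act (fst V) (%g. trm (snd V (gs (inv g)))) f"
	proof (rule eq_matI)
		fix i j assume "i < dim_row (lin_act (fst V) (%g. trm (snd V (gs (inv g)))) f)"
			"j < dim_col (lin_act (fst V) (%g. trm (snd V (gs (inv g)))) f)"
		hence ij: "i < fst V" "j < fst V" by auto
		have "trm (snd V (gs (inv g))) $$ (i, j) = snd V (gs (inv g)) $$ (j, i)" if "g : kys f" for g
			using gs_rep(1)[OF V, of "inv g"] that f ij by (auto simp: A_simps)
		thus "trm (lin_act (fst V) (%g. snd V (gs g)) (antipode A f)) $$ (i, j) =
				lin_act (fst V) (%g. trm (snd V (gs (inv g)))) f $$ (i, j)"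
			using ij by (simp add: lin_act_index id_scalars.lin_sum A_simps) (simp add: lin_def)
	qed auto
	finally show ?thesis .
qed

lemma module_tensor_fd:
	assumes V: "V : fdms A" "W : fdms A"
	shows "mten A V W : fdms A"
		and "g : carrier G ==> snd (mten A V W) (gs g) = kro (snd V (gs g)) (snd W (gs g))"
proof -
	note R = gs_rep[OF V(1)] gs_rep[OF V(2)]
	have C: "g : carrier G ==> kro (snd V (gs g)) (snd W (gs g)) : carrier_mat (fst V * fst W) (fst V * fst W)" for g
		using R by (intro kron_carrier)
	have "(fst V * fst W, snd (mten A V W)) : fdms A"
	proof (rule rep_fd[where si = "%g. kro (snd V (gs g)) (snd W (gs g))"])
		fix g h assume gh: "g : carrier G" "h : carrier G"
		show "kro (snd V (gs (g \<otimes> h))) (snd W (gs (g \<otimes> h))) =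
				kro (snd V (gs g)) (snd W (gs g)) * kro (snd V (gs h)) (snd W (gs h))"
			using R(1)[OF gh(1)] R(1)[OF gh(2)] R(4)[OF gh(1)] R(4)[OF gh(2)]
			by (subst kron_mult) (simp_all only: R(3)[OF gh] R(6)[OF gh] carrier_matD)
	qed (use C R module_tensor_group[OF V] in "simp_all add: kron_one")
	thus "mten A V W : fdms A" by (simp add: module_tensor_simp)
	show "g : carrier G ==> snd (mten A V W) (gs g) = kro (snd V (gs g)) (snd W (gs g))"
		by (rule rep_gs[OF module_tensor_group[OF V] _ C])
qed

lemma dual_module_fd:
	assumes V: "V : fdms A"
	shows "dmod A V : fdms A"
		and "g : carrier G ==> snd (dmod A V) (gs g) = trm (snd V (gs (inv g)))"
proof -
	note R = gs_rep[OF V]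
	have "(fst V, snd (dmod A V)) : fdms A"
	proof (rule rep_fd[where si = "%g. trm (snd V (gs (inv g)))"])
		fix g h assume "g : carrier G" "h : carrier G"
		thus "trm (snd V (gs (inv (g \<otimes> h)))) = trm (snd V (gs (inv g))) * trm (snd V (gs (inv h)))"
			using R(1)[of "inv g"] R(1)[of "inv h"] by (simp add: inv_mult_group R(3) transpose_mult)
	qed (use R dual_module_group[OF V] in simp_all)
	thus "dmod A V : fdms A" by (cases V) simp
	show "g : carrier G ==> snd (dmod A V) (gs g) = trm (snd V (gs (inv g)))"
		by (rule rep_gs[OF dual_module_group[OF V]]) (use R(1)[of "inv g"] in auto)
qed

lemma trivial_group_fd: "tmod A : fdms A"
	and trivial_group_gs: "g : carrier G ==> snd (tmod A) (gs g) = idm 1"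
proof -
	have *: "snd (tmod A) f = lin_act 1 (%_. idm 1) f" for f
		by (rule eq_matI) (auto simp: trivial_module_def lin_act_index lin_def A_simps)
	show "tmod A : fdms A"
		unfolding trivial_module_def
		by (rule rep_fd[where si = "%_. idm 1"]) (use * in "auto simp: trivial_module_def")
	show "g : carrier G ==> snd (tmod A) (gs g) = idm 1"
		by (rule rep_gs[OF *]) auto
qed

lemma mod_inter_groupI:
	assumes "V : fdms A" "W : fdms A" "P : carrier_mat (fst W) (fst V)"
		and P: "!!g. g : carrier G ==> P * snd V (gs g) = snd W (gs g) * P"
	shows "mod_inter A V W P"
	unfolding mod_inter_def
proof (intro conjI ballI)
	fix f assume f: "f : carrier A"
	have g: "g : carrier G" if "g : kys f" for g using f that by (auto simp: A_simps)
	have "P * snd V f = lin_mat (fst W) (fst V) (kys f) (lkp f) (%g. P * snd V (gs g))"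
		unfolding fd_expand[OF assms(1) f] lin_act_def
		using assms(3) gs_rep(1)[OF assms(1) g] by (subst mult_lin_mat) auto
	also have "... = lin_mat (fst W) (fst V) (kys f) (lkp f) (%g. snd W (gs g) * P)"
		by (rule lin_mat_cong) (rule P[OF g])
	also have "... = snd W f * P"
		unfolding fd_expand[OF assms(2) f] lin_act_def
		using assms(3) gs_rep(1)[OF assms(2) g] by (subst lin_mat_mult) auto
	finally show "P * snd V f = snd W f * P" .
qed (rule assms(3))

end


section \<open>Groups given by generators and relations\<close>

context
	fixes E :: "(('x \<times> bool) list \<times> ('x \<times> bool) list) set"
begin

abbreviation pcl :: "('x \<times> bool) list => ('x \<times> bool) list set" where
	"pcl u == pres_rel E `` {u}"

lemma pres_equiv: "equiv UNIV (pres_rel E)"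
	by (rule equivI) (auto intro!: refl_onI symI transI intro: pres_rel.refl pres_rel.sym pres_rel.trans)

lemma pres_append:
	assumes "(u, u') : pres_rel E" "(v, v') : pres_rel E"
	shows "(u @ v, u' @ v') : pres_rel E"
proof -
	have "(a @ u @ v, a @ u' @ v) : pres_rel E" if "(u, u') : pres_rel E" for a u u' v
		using that
	proof induction
		case (cancel u x s w)
		show ?case using pres_rel.cancel[of "a @ u" x s "w @ v" E] by simp
	next
		case (relation l r u w)
		show ?case using pres_rel.relation[OF relation, of "a @ u" "w @ v"] by simp
	qed (auto intro: pres_rel.refl pres_rel.sym pres_rel.trans)
	from this[OF assms(1), of "[]" v] this[OF assms(2), of u' "[]"] show ?thesis
		by (auto intro: pres_rel.trans)
qed

lemma pcl_eq_iff: "pcl u = pcl v \<longleftrightarrow> (u, v) : pres_rel E"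
	using equiv_class_eq_iff[OF pres_equiv] by simp

lemma pg_simps:
	"carrier (presented_group E) = range pcl" "\<one>\<^bsub>presented_group E\<^esub> = pcl []"
	"pcl u \<otimes>\<^bsub>presented_group E\<^esub> pcl v = pcl (u @ v)"
proof -
	show "carrier (presented_group E) = range pcl" by (auto simp: presented_group_def quotient_def)
	show "\<one>\<^bsub>presented_group E\<^esub> = pcl []" by (simp add: presented_group_def)
	show "pcl u \<otimes>\<^bsub>presented_group E\<^esub> pcl v = pcl (u @ v)"
		unfolding presented_group_def monoid.simps
		by (rule induced2_eq) (auto simp: pcl_eq_iff intro: pres_rel.refl pres_append pres_rel.sym)
qed

lemma group_presented: "group (presented_group E)"
proof (rule groupI)
	fix x assume "x : carrier (presented_group E)"
	then obtain u where u: "x = pcl u" by (auto simp: pg_simps)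
	have "\<exists>v. (v @ u, []) : pres_rel E"
	proof (induction u)
		case (Cons y u)
		then obtain v where v: "(v @ u, []) : pres_rel E" by blast
		obtain x s where y: "y = (x, s)" by fastforce
		have "((v @ [(x, \<not> s)]) @ y # u, v @ u) : pres_rel E"
			using pres_rel.cancel[of v x "\<not> s" u E] by (simp add: y)
		thus ?case using v by (blast intro: pres_rel.trans)
	qed (auto intro: pres_rel.refl)
	then obtain v where "(v @ u, []) : pres_rel E" ..
	hence "pcl v \<otimes>\<^bsub>presented_group E\<^esub> x = \<one>\<^bsub>presented_group E\<^esub>"
		by (simp add: u pg_simps pcl_eq_iff)
	thus "\<exists>y\<in>carrier (presented_group E). y \<otimes>\<^bsub>presented_group E\<^esub> x = \<one>\<^bsub>presented_group E\<^esub>"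
		by (auto simp: pg_simps)
qed (auto simp: pg_simps)

definition weval :: "nat => ('x \<times> bool => 'k mat) => ('x \<times> bool) list => 'k::comm_ring_1 mat" where
	"weval d L u = foldr (%x M. L x * M) u (idm d)"

lemma weval_simps [simp]: "weval d L [] = idm d" "weval d L (x # u) = L x * weval d L u"
	by (simp_all add: weval_def)

lemma weval_closed: "(!!x. L x : sqm d) ==> weval d L u : sqm d"
proof (induction u)
	case (Cons x u)
	hence "L x : sqm d" "weval d L u : sqm d" by blast+
	thus ?case by simp
qed simp

lemma weval_append:
	assumes L: "!!x. L x : sqm d"
	shows "weval d L (u @ v) = weval d L u * weval d L v"
proof (induction u)
	case Nil
	show ?case using weval_closed[of L d v, OF L] by simp
next
	case (Cons x u)
	show ?case using assoc_mult_mat[OF L[of x] weval_closed[of L d u, OF L] weval_closed[of L d v, OF L]] Cons by simp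
qed

lemma weval_replicate: "(!!x. L x : sqm d) ==> weval d L (replicate k x) = L x ^m k"
proof (induction k)
	case 0
	have "dim_row (L x) = d" using 0[of x] by simp
	thus ?case by simp
next
	case (Suc k)
	have "weval d L (replicate k x @ [x]) = L x ^m k * L x"
		using Suc carrier_matD[OF Suc.prems[of x]] by (simp add: weval_append mat_mult_one)
	thus ?case by (simp add: replicate_append_same)
qed

lemma weval_pres:
	assumes L: "!!x. L x : sqm d" "!!x s. L (x, s) * L (x, \<not> s) = idm d"
		and E: "!!l r. (l, r) : E ==> weval d L l = weval d L r"
		and uv: "(u, v) : pres_rel E"
	shows "weval d L u = weval d L v"
	using uv
proof induction
	case (cancel u x s v)
	have "weval d L [(x, s), (x, \<not> s)] = idm d" using L(1)[of "(x, \<not> s)"] L(2) by simp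
	moreover have "weval d L (u @ [(x, s), (x, \<not> s)] @ v) = weval d L u * (weval d L [(x, s), (x, \<not> s)] * weval d L v)"
		by (simp only: weval_append[of L d, OF L(1)])
	ultimately show ?case
		using weval_closed[of L d v, OF L(1)] by (simp only: weval_append[of L d, OF L(1)] left_mult_one_mat)
next
	case (relation l r u v)
	thus ?case using E by (simp add: weval_append[of L d, OF L(1)])
qed auto

definition wrep :: "('k, ('x \<times> bool) list set \<Rightarrow>\<^sub>0 'k) matmod => ('x \<times> bool) list => 'k::field mat" where
	"wrep V u = snd V (gs (pcl u))"

interpretation P: group_rep "presented_group E" "group_hopf_algebra (presented_group E)"
	by (simp add: group_rep_def group_rep_axioms_def group_presented)

lemma wrep_simps:
	assumes V: "V : fdms (group_hopf_algebra (presented_group E))"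
	shows "wrep V u : carrier_mat (fst V) (fst V)" "wrep V [] = idm (fst V)" "wrep V (u @ v) = wrep V u * wrep V v"
		"(u, v) : pres_rel E ==> wrep V u = wrep V v" "wrep V (replicate k x) = wrep V [x] ^m k"
proof -
	note R = P.gs_rep[OF V]
	show 1: "wrep V u : carrier_mat (fst V) (fst V)" for u
		using R(1)[of "pcl u"] by (simp add: wrep_def pg_simps)
	show 2: "wrep V [] = idm (fst V)" using R(2) by (simp add: wrep_def pg_simps)
	show 3: "wrep V (u @ v) = wrep V u * wrep V v" for u v
		using R(3)[of "pcl u" "pcl v"] by (simp add: wrep_def pg_simps)
	show "(u, v) : pres_rel E ==> wrep V u = wrep V v"
		by (simp add: wrep_def pcl_eq_iff[symmetric])
	show "wrep V (replicate k x) = wrep V [x] ^m k"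
	proof (induction k)
		case 0
		have "dim_row (wrep V [x]) = fst V" using 1[of "[x]"] by simp
		thus ?case using 2 by simp
	next
		case (Suc k)
		have "wrep V (replicate k x @ [x]) = wrep V [x] ^m k * wrep V [x]" by (simp only: 3 Suc)
		thus ?case by (simp add: replicate_append_same)
	qed
qed

text \<open>The universal property of the presented group, for matrices: an assignment to letters
  and formal inverses that satisfies the relations is constant on classes of words, and its linear
  extension is a module.\<close>

lemma wrep_exists:
	fixes L :: "'x \<times> bool => 'k::field mat"
	assumes L: "!!x. L x : sqm d" "!!x s. L (x, s) * L (x, \<not> s) = idm d"
		and E: "!!l r. (l, r) : E ==> weval d L l = weval d L r"
	obtains V where "V : fdms (group_hopf_algebra (presented_group E))" "fst V = d"
		"!!u. wrep V u = weval d L u"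
proof -
	let ?si = "induced (weval d L)"
	let ?V = "(d, lin_act d ?si) :: ('k, ('x \<times> bool) list set \<Rightarrow>\<^sub>0 'k) matmod"
	have s: "?si (pcl u) = weval d L u" for u
		by (rule induced_eq) (use weval_pres[OF assms, of u] in "auto intro: pres_rel.refl")
	note C = weval_closed[of L d, OF L(1)]
	have "?V : fdms (group_hopf_algebra (presented_group E))"
		by (rule P.rep_fd[OF _ _ _ HOL.refl])
			 (use C in "auto simp: pg_simps s weval_append[of L d, OF L(1)]")
	moreover have "wrep ?V u = weval d L u" for u
		using P.rep_gs[OF HOL.refl, of "pcl u" ?si d] C by (simp add: wrep_def pg_simps s)
	ultimately show thesis using that[of ?V] by simp
qed

lemma wrep_intertwine:
	assumes V: "V : fdms (group_hopf_algebra (presented_group E))" "W : fdms (group_hopf_algebra (presented_group E))"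
		and P: "P : carrier_mat (fst W) (fst V)" "!!x. P * wrep V [x] = wrep W [x] * P"
	shows "mod_inter (group_hopf_algebra (presented_group E)) V W P"
proof (rule P.mod_inter_groupI[OF V P(1)])
	fix g assume "g : carrier (presented_group E)"
	then obtain u where u: "g = pcl u" by (auto simp: pg_simps)
	have "P * wrep V u = wrep W u * P"
	proof (induction u)
		case Nil
		show ?case using P(1) by (simp add: wrep_simps(2)[OF V(1)] wrep_simps(2)[OF V(2)])
	next
		case (Cons x u)
		note C = wrep_simps(1)[OF V(1)] wrep_simps(1)[OF V(2)]
		have "P * (wrep V [x] * wrep V u) = (P * wrep V [x]) * wrep V u"
			by (rule assoc_mult_mat[OF P(1) C(1,1), symmetric])
		also have "... = wrep W [x] * (P * wrep V u)"
			unfolding P(2) by (rule assoc_mult_mat[OF C(2) P(1) C(1)])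
		also have "... = (wrep W [x] * wrep W u) * P"
			unfolding Cons by (rule assoc_mult_mat[OF C(2,2) P(1), symmetric])
		finally show ?case
			using wrep_simps(3)[OF V(1), of "[x]" u] wrep_simps(3)[OF V(2), of "[x]" u] by simp
	qed
	thus "P * snd V (gs g) = snd W (gs g) * P" by (simp add: wrep_def u)
qed

lemma wrep_tensor:
	assumes "V : fdms (group_hopf_algebra (presented_group E))" "W : fdms (group_hopf_algebra (presented_group E))"
	shows "wrep (mten (group_hopf_algebra (presented_group E)) V W) u = kro (wrep V u) (wrep W u)"
	using P.module_tensor_fd(2)[OF assms, of "pcl u"] by (simp add: wrep_def pg_simps)

lemma wrep_trivial: "wrep (tmod (group_hopf_algebra (presented_group E))) u = idm 1"
	using P.trivial_group_gs[of "pcl u"] by (simp add: wrep_def pg_simps)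

lemma wrep_dual:
	assumes V: "V : fdms (group_hopf_algebra (presented_group E))"
		and u: "M * wrep V u = idm (fst V)" "M : carrier_mat (fst V) (fst V)"
	shows "wrep (dmod (group_hopf_algebra (presented_group E)) V) u = trm M"
proof -
	have c: "pcl u : carrier (presented_group E)" by (simp add: pg_simps)
	let ?I = "snd V (gs (inv\<^bsub>presented_group E\<^esub> (pcl u)))"
	have I: "?I : carrier_mat (fst V) (fst V)" using P.gs_rep(1)[OF V] c by simp
	have "wrep V u * ?I = idm (fst V)"
		using P.gs_rep(3)[OF V c P.inv_closed[OF c]] P.gs_rep(2)[OF V] c by (simp add: wrep_def)
	hence "?I = (M * wrep V u) * ?I" using u I by simp
	also have "... = M * (wrep V u * ?I)"
		by (rule assoc_mult_mat[OF u(2) wrep_simps(1)[OF V] I])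
	also have "... = M" using u \<open>wrep V u * ?I = _\<close> by simp
	finally have "?I = M" .
	thus ?thesis using P.dual_module_fd(2)[OF V c] by (simp add: wrep_def)
qed

end

section \<open>The group \<open>G_Nn\<close>\<close>

text \<open>Matrices of size 0 form the zero ring, which has no unital map to a ring with
  \<open>0 ~= 1\<close>. So the transfer to operators is made for positive sizes, and size 0 is
  settled separately.\<close>

lemma mat_eq_opr:
	assumes "A : sqm d" "B : sqm d" "d > 0 ==> opr d A = opr d B"
	shows "A = B"
proof (cases "d = 0")
	case True
	thus ?thesis using assms by (intro eq_matI) auto
next
	case False
	thus ?thesis using assms by (intro opr_inj[of d]) auto
qed

locale dih_rels =
	fixes N n :: nat and z t w :: "'b::monoid_mult"
	assumes N: "odd N" and n: "n > 0"
		and zN: "z ^ N = 1" and tt: "t * t = 1" and w2n: "w ^ (2 * n) = 1"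
		and zt: "z * t = t * z" and zw: "z * w = w * z" and wtw: "w * (t * w) = t"
begin

lemma z_pow_comm: "z ^ k * t = t * z ^ k" "z ^ k * w = w * z ^ k" "w ^ l * z ^ k = z ^ k * w ^ l"
proof -
	show "z ^ k * t = t * z ^ k" "z ^ k * w = w * z ^ k" using zt zw by (simp_all add: power_commuting_commutes)
	hence "w * z ^ k = z ^ k * w" by simp
	thus "w ^ l * z ^ k = z ^ k * w ^ l" by (rule power_commuting_commutes)
qed

lemma w_inv: "w ^ (2 * n - 1) * w = 1" "w * w ^ (2 * n - 1) = 1"
	using power_minus_mult[of "2 * n" w] n w2n by (simp_all add: power_commutes)

lemma tw: "t * w = w ^ (2 * n - 1) * t"
proof -
	have "w ^ (2 * n - 1) * w * (t * w) = t * w"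
		by (simp only: w_inv mult_1_left)
	thus ?thesis by (simp only: mult.assoc wtw)
qed

lemma t_pow: "t * w ^ k = (w ^ (2 * n - 1)) ^ k * t"
proof (induction k)
	case (Suc k)
	have "t * w ^ Suc k = (w ^ (2 * n - 1)) ^ k * (t * w)"
		using Suc by (simp add: power_Suc2 mult.assoc[symmetric] del: power_Suc)
	also have "... = (w ^ (2 * n - 1)) ^ Suc k * t"
		by (simp only: tw power_Suc2 mult.assoc)
	finally show ?case .
qed simp

text \<open>\<open>t\<close> inverts \<open>w\<close>, and \<open>w ^ n\<close> is its own
  inverse.\<close>

lemma wn_t: "w ^ n * t = t * w ^ n"
proof -
	have "(2 * n - 1) * n = 2 * n * (n - 1) + n" using n by (cases n) (auto simp: algebra_simps)
	hence "(w ^ (2 * n - 1)) ^ n = w ^ n"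
		by (simp only: power_mult[symmetric]) (simp only: power_add power_mult[of w "2 * n"] w2n power_one mult_1_left)
	thus ?thesis using t_pow[of n] by simp
qed

lemma wn_wn: "w ^ n * w ^ n = 1"
	using w2n by (simp add: power_add[symmetric] mult_2)

text \<open>The element \<open>h\<close> of the group, rebuilt from \<open>z\<close> and
  \<open>w\<close>. Since \<open>z\<close> is central, \<open>w ^ n\<close> has square 1 and
  \<open>N\<close> is odd, its square is \<open>z\<close> and its \<open>N\<close>-th power is
  \<open>w ^ n\<close>.\<close>

definition root :: 'b where "root = w ^ n * z ^ (N div 2 + 1)"

lemma N_half: "N = N div 2 + 1 + N div 2"
	using N by (metis odd_two_times_div_two_succ add.commute add.left_commute mult_2)

lemma root_sq: "root * root = z"
proof -
	have "root * root = w ^ n * (z ^ (N div 2 + 1) * w ^ n) * z ^ (N div 2 + 1)"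
		by (simp only: root_def mult.assoc)
	also have "... = w ^ n * w ^ n * (z ^ (N div 2 + 1) * z ^ (N div 2 + 1))"
		by (simp only: z_pow_comm(3)[symmetric] mult.assoc)
	also have "... = z ^ (N div 2 + 1 + (N div 2 + 1))"
		by (simp only: wn_wn power_add mult_1_left)
	also have "N div 2 + 1 + (N div 2 + 1) = N + 1" using N_half by linarith
	finally show ?thesis using zN by simp
qed

lemma root_2N: "root ^ (2 * N) = 1"
	using root_sq zN by (simp add: power_mult power2_eq_square)

lemma root_N: "root ^ N = w ^ n"
proof -
	have "N = Suc (2 * (N div 2))" using N_half by linarith
	hence "root ^ N = root ^ Suc (2 * (N div 2))" by simp
	also have "... = root * (root * root) ^ (N div 2)"
		by (simp only: power_Suc power_mult power2_eq_square)
	also have "... = w ^ n * (z ^ (N div 2 + 1) * z ^ (N div 2))"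
		unfolding root_sq by (simp only: root_def mult.assoc)
	also have "z ^ (N div 2 + 1) * z ^ (N div 2) = 1"
		using zN N_half by (simp only: power_add[symmetric])
	finally show ?thesis by simp
qed

lemma root_comm: "root * t = t * root" "root * w = w * root"
proof -
	have "root * t = w ^ n * (z ^ (N div 2 + 1) * t)" by (simp only: root_def mult.assoc)
	also have "... = w ^ n * t * z ^ (N div 2 + 1)" by (simp only: z_pow_comm(1) mult.assoc)
	finally show "root * t = t * root" by (simp only: wn_t root_def mult.assoc)
	have "root * w = w ^ n * (z ^ (N div 2 + 1) * w)" by (simp only: root_def mult.assoc)
	also have "... = w ^ n * w * z ^ (N div 2 + 1)" by (simp only: z_pow_comm(2) mult.assoc)
	finally show "root * w = w * root" by (simp only: power_commutes root_def mult.assoc)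
qed

end

text \<open>With \<open>z = h ^ 2\<close>, the relation \<open>w ^ n = h ^ N\<close> gives back
  \<open>h\<close> as \<open>h ^ N * h ^ (N + 1)\<close>, because
  \<open>h ^ (2 * N) = 1\<close>.\<close>

lemma dihedral_relationsI:
	fixes h t w w' :: "'b::monoid_mult"
	assumes "odd N" "n > 0" and h: "h ^ (2 * N) = 1" and wn: "w ^ n = h ^ N" and tt: "t * t = 1" and tw: "t * w = w' * t"
		and ww': "w * w' = 1" and ht: "h * t = t * h" and hw: "h * w = w * h"
	shows "dih_rels N n (h * h) t w" "h = w ^ n * (h * h) ^ (N div 2 + 1)"
proof -
	show "dih_rels N n (h * h) t w"
	proof
		show "(h * h) ^ N = 1" using h by (simp add: power_mult power2_eq_square)
		show "w ^ (2 * n) = 1" using wn h by (simp add: mult_2 power_add)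
		show "h * h * t = t * (h * h)" by (metis ht mult.assoc)
		show "h * h * w = w * (h * h)" by (metis hw mult.assoc)
		show "w * (t * w) = t" by (simp add: tw mult.assoc[symmetric] ww')
	qed (use assms in auto)
	have "w ^ n * (h * h) ^ (N div 2 + 1) = h ^ (N + 2 * (N div 2 + 1))"
		by (simp only: wn power_add power_mult power2_eq_square)
	also have "N + 2 * (N div 2 + 1) = 2 * N + 1" using \<open>odd N\<close> by presburger
	finally show "h = w ^ n * (h * h) ^ (N div 2 + 1)" using h by simp
qed

definition G_rels :: "nat => nat => ((ggen \<times> bool) list \<times> (ggen \<times> bool) list) set" where
	"G_rels N n = (let h = (GH, True); t = (GT, True); w = (GW, True); w' = (GW, False) in
		 {([t, t], []), (replicate (2 * N) h, []), (replicate n w, replicate N h), ([t, w], [w', t]),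
			([h, t], [t, h]), ([h, w], [w, h])})"

lemma G_Nn_eq: "G_Nn N n = presented_group (G_rels N n)"
	unfolding G_Nn_def G_rels_def ..

context dihedral
begin

lemma tripsI_opr:
	assumes X: "X : tcarrier"
		and rel: "tdim X > 0 ==> dih_rels N n (opr (tdim X) (tZ X)) (opr (tdim X) (tT X)) (opr (tdim X) (tW X))"
	shows "X : trips"
proof -
	note C = tcarrierD(1-3)[OF X]
	show ?thesis
		unfolding trips_def
	proof (intro CollectI conjI X)
		show "tZ X ^m N = idm (tdim X)" "tW X ^m (2 * n) = idm (tdim X)" "tT X * tT X = idm (tdim X)"
			"tZ X * tT X = tT X * tZ X" "tZ X * tW X = tW X * tZ X" "tW X * (tT X * tW X) = tT X"
			by (rule mat_eq_opr[of _ "tdim X"]; use C dih_rels.zN[OF rel] dih_rels.w2n[OF rel]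
				dih_rels.tt[OF rel] dih_rels.zt[OF rel] dih_rels.zw[OF rel]
				dih_rels.wtw[OF rel] in "simp add: opr_pow opr_mult")+
	qed
qed

lemma trips_opr:
	assumes X: "X : trips" and d: "tdim X > 0"
	shows "dih_rels N n (opr (tdim X) (tZ X)) (opr (tdim X) (tT X)) (opr (tdim X) (tW X))"
proof -
	note C = tcarrierD(1-3)[OF tripsD(1)[OF X]]
	let ?o = "opr (tdim X)"
	show ?thesis
	proof
		have "?o (tZ X ^m N) = ?o (idm (tdim X))" "?o (tT X * tT X) = ?o (idm (tdim X))"
			"?o (tW X ^m (2 * n)) = ?o (idm (tdim X))" "?o (tZ X * tT X) = ?o (tT X * tZ X)" "?o (tZ X * tW X) = ?o (tW X * tZ X)"
			"?o (tW X * (tT X * tW X)) = ?o (tT X)"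
			by (simp_all only: tripsD[OF X])
		thus "?o (tZ X) ^ N = 1" "?o (tT X) * ?o (tT X) = 1" "?o (tW X) ^ (2 * n) = 1"
			"?o (tZ X) * ?o (tT X) = ?o (tT X) * ?o (tZ X)" "?o (tZ X) * ?o (tW X) = ?o (tW X) * ?o (tZ X)"
			"?o (tW X) * (?o (tT X) * ?o (tW X)) = ?o (tT X)"
			using C d by (simp_all add: opr_pow opr_mult)
	qed (use N n in auto)
qed

lemma inverse_intertwine:
	fixes P :: "'k mat"
	assumes "P : carrier_mat e d" "A : sqm d" "A' : sqm d" "B : sqm e" "B' : sqm e"
		and PA: "P * A = B * P" and "A * A' = idm d" and BB: "B' * B = idm e"
	shows "P * A' = B' * P"
proof -
	note C = assms(1-5)
	have "P * A' = B' * B * (P * A')" using assms by simp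
	also have "... = B' * (B * P * A')"
		using assoc_mult_mat[OF C(5,4), of "P * A'" d] assoc_mult_mat[OF C(4,1,3)] C by simp
	also have "... = B' * (P * (A * A'))"
		using assoc_mult_mat[OF C(1,2,3)] by (simp only: PA)
	finally show ?thesis using assms by simp
qed

abbreviation "GA == group_hopf_algebra (presented_group (G_rels N n)) :: ('k, (ggen \<times> bool) list set \<Rightarrow>\<^sub>0 'k) hopf_algebra"
abbreviation "gw u == wrep (G_rels N n) (u :: ('k, (ggen \<times> bool) list set \<Rightarrow>\<^sub>0 'k) matmod)"

lemma G_wrep:
	assumes V: "V : fdms GA"
	defines "H == gw V [(GH, True)]" and "T == gw V [(GT, True)]" and "W == gw V [(GW, True)]"
	shows "(fst V, gw V [(GH, True), (GH, True)], T, W) : trips"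
		and "H = W ^m n * gw V [(GH, True), (GH, True)] ^m (N div 2 + 1)"
		and "gw V [(x, s)] * gw V [(x, \<not> s)] = idm (fst V)"
proof -
	note R = wrep_simps[OF V]
	define W' where "W' = gw V [(GW, False)]"
	note C = R(1)[of "[(GH, True)]", folded H_def] R(1)[of "[(GT, True)]", folded T_def] R(1)[of "[(GW, True)]", folded W_def]
		R(1)[of "[(GW, False)]", folded W'_def]
	have rel: "gw V l = gw V r" if "(l, r) : G_rels N n" for l r
		using pres_rel.relation[OF that, of "[]" "[]"] by (simp add: R(4))
	have inv: "gw V [(x, s)] * gw V [(x, \<not> s)] = idm (fst V)" for x s
		using pres_rel.cancel[of "[]" x s "[]" "G_rels N n"] R(3)[of "[(x, s)]" "[(x, \<not> s)]"] R(2) R(4) by fastforce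
	show "gw V [(x, s)] * gw V [(x, \<not> s)] = idm (fst V)" by (rule inv)
	have two: "gw V [x, y] = gw V [x] * gw V [y]" for x y
		using R(3)[of "[x]" "[y]"] by simp
	have Z: "gw V [(GH, True), (GH, True)] = H * H" by (simp add: two H_def)
	have "gw V [(GT, True), (GT, True)] = gw V []" "gw V (replicate (2 * N) (GH, True)) = gw V []"
		"gw V (replicate n (GW, True)) = gw V (replicate N (GH, True))" "gw V [(GT, True), (GW, True)] = gw V [(GW, False), (GT, True)]"
		"gw V [(GH, True), (GT, True)] = gw V [(GT, True), (GH, True)]" "gw V [(GH, True), (GW, True)] = gw V [(GW, True), (GH, True)]"
		by (rule rel; simp add: G_rels_def Let_def)+
	hence M: "T * T = idm (fst V)" "H ^m (2 * N) = idm (fst V)" "W ^m n = H ^m N" "T * W = W' * T" "H * T = T * H" "H * W = W * H"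
		"W * W' = idm (fst V)"
		using inv[of GW True] by (simp_all only: two R(5) R(2) H_def T_def W_def W'_def simp_thms)
	let ?o = "opr (fst V)"
	have main: "dih_rels N n (?o H * ?o H) (?o T) (?o W)" "?o H = ?o W ^ n * (?o H * ?o H) ^ (N div 2 + 1)" if d: "fst V > 0"
	proof -
		have "?o (T * T) = ?o (idm (fst V))" "?o (H ^m (2 * N)) = ?o (idm (fst V))" "?o (W ^m n) = ?o (H ^m N)"
			"?o (T * W) = ?o (W' * T)" "?o (H * T) = ?o (T * H)" "?o (H * W) = ?o (W * H)" "?o (W * W') = ?o (idm (fst V))"
			by (simp_all only: M)
		hence *: "?o T * ?o T = 1" "?o H ^ (2 * N) = 1" "?o W ^ n = ?o H ^ N" "?o T * ?o W = ?o W' * ?o T"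
			"?o H * ?o T = ?o T * ?o H" "?o H * ?o W = ?o W * ?o H" "?o W * ?o W' = 1"
			using C d by (simp_all add: opr_pow opr_mult)
		have n0: "n > 0" using n by simp
		note D = dihedral_relationsI[OF N n0 *(2,3,1,4,7,5,6)]
		show "dih_rels N n (?o H * ?o H) (?o T) (?o W)" "?o H = ?o W ^ n * (?o H * ?o H) ^ (N div 2 + 1)"
			by (rule D)+
	qed
	show "(fst V, gw V [(GH, True), (GH, True)], T, W) : trips"
		unfolding Z by (rule tripsI_opr) (use C main(1) in "auto simp: tcarrier_def opr_mult")
	show "H = W ^m n * gw V [(GH, True), (GH, True)] ^m (N div 2 + 1)"
		unfolding Z
	proof (rule mat_eq_opr[of _ "fst V"])
		show c: "W ^m n * (H * H) ^m (N div 2 + 1) : carrier_mat (fst V) (fst V)"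
			using C by (intro mult_carrier_mat[of _ "fst V" "fst V"] pow_carrier_mat)
	qed (use C main(2) in "simp_all add: opr_mult opr_pow del: pow_mat.simps power_Suc add_Suc_right One_nat_def")
qed

text \<open>\<open>h\<close> is a product of powers of \<open>w\<close> and of \<open>h * h\<close>,
  so equivariance for \<open>h * h\<close>, \<open>t\<close> and \<open>w\<close> gives it for
  \<open>h\<close>, and then for the formal inverses.\<close>

lemma G_intertwine:
	assumes V: "V : fdms GA" and W: "W : fdms GA" and P: "P : carrier_mat (fst W) (fst V)"
		and g: "!!u. u : {[(GH, True), (GH, True)], [(GT, True)], [(GW, True)]} ==> P * gw V u = gw W u * P"
	shows "mod_inter GA V W P"
proof (rule wrep_intertwine[OF V W P])
	note C = wrep_simps(1)[OF V] wrep_simps(1)[OF W]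
	have pos: "P * gw V [(x, True)] = gw W [(x, True)] * P" for x
	proof (cases x)
		case GH
		let ?z = "[(GH, True), (GH, True)]" and ?w = "[(GW, True)]" and ?m = "N div 2 + 1"
		have 1: "P * gw V ?w ^m n = gw W ?w ^m n * P" "P * gw V ?z ^m ?m = gw W ?z ^m ?m * P"
			by (rule pow_intw[OF g C P]; simp)+
		have c: "gw V ?w ^m n : carrier_mat (fst V) (fst V)" "gw V ?z ^m ?m : carrier_mat (fst V) (fst V)"
			 "gw W ?w ^m n : carrier_mat (fst W) (fst W)" "gw W ?z ^m ?m : carrier_mat (fst W) (fst W)"
			by (rule pow_carrier_mat; rule C)+
		have "P * (gw V ?w ^m n * gw V ?z ^m ?m) = gw W ?w ^m n * P * gw V ?z ^m ?m"
			using assoc_mult_mat[OF P c(1,2)] 1(1) by simp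
		also have "... = gw W ?w ^m n * (P * gw V ?z ^m ?m)" by (rule assoc_mult_mat[OF c(3) P c(2)])
		also have "... = gw W ?w ^m n * gw W ?z ^m ?m * P" unfolding 1(2) by (rule assoc_mult_mat[OF c(3,4) P, symmetric])
		finally show ?thesis unfolding GH by (simp only: G_wrep(2)[OF V] G_wrep(2)[OF W])
	qed (use g in auto)
	fix y :: "ggen \<times> bool"
	obtain x s where y: "y = (x, s)" by fastforce
	show "P * gw V [y] = gw W [y] * P"
	proof (cases s)
		case False
		have "gw V [(x, True)] * gw V [(x, False)] = idm (fst V)" "gw W [(x, False)] * gw W [(x, True)] = idm (fst W)"
			using G_wrep(3)[OF V, of x True] G_wrep(3)[OF W, of x False] by simp_all
		from inverse_intertwine[OF P C(1,1,2,2) pos this] show ?thesis using False y by simp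
	qed (use pos y in simp)
qed

lemma G_irr_exists:
	assumes X: "X : trips" and d: "tdim X > 0"
	obtains V where "V : fdms GA" "(fst V, gw V [(GH, True), (GH, True)], gw V [(GT, True)], gw V [(GW, True)]) = X"
proof -
	note C = tcarrierD(1-3)[OF tripsD(1)[OF X]]
	define H where "H = tW X ^m n * tZ X ^m (N div 2 + 1)"
	have H: "H : carrier_mat (tdim X) (tdim X)" using C by (auto simp: H_def)
	\<comment> \<open>The letter \<open>h\<close> goes to the square root \<open>H\<close> of the
	  matrix of \<open>z\<close>; formal inverses go to powers, according to the orders
	  \<open>2 * N\<close>, 2 and \<open>2 * n\<close>.\<close>
	define L where "L y = (case y of (GH, s) => (if s then H else H ^m (2 * N - 1)) | (GT, s) => tT X |
		(GW, s) => (if s then tW X else tW X ^m (2 * n - 1)))" for y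
	interpret D: dih_rels N n "opr (tdim X) (tZ X)" "opr (tdim X) (tT X)" "opr (tdim X) (tW X)"
		by (rule trips_opr[OF X d])
	have oH: "opr (tdim X) H = D.root"
		using C d by (simp add: H_def D.root_def opr_mult opr_pow del: pow_mat.simps power_Suc add_Suc_right)
	have L: "L y : carrier_mat (tdim X) (tdim X)" for y
		using C H by (auto simp: L_def split: prod.split ggen.split)
	have HH: "H * H = tZ X" by (rule mat_eq_opr[of _ "tdim X"]) (use C H d in "simp_all add: opr_mult oH D.root_sq")
	have inv: "L (x, s) * L (x, \<not> s) = idm (tdim X)" for x s
	proof (rule mat_eq_opr[of _ "tdim X"])
		have "D.root * D.root ^ (2 * N - 1) = 1" "D.root ^ (2 * N - 1) * D.root = 1"
			using power_minus_mult[of "2 * N" D.root] D.root_2N N_pos by (simp_all add: power_commutes)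
		thus "opr (tdim X) (L (x, s) * L (x, \<not> s)) = opr (tdim X) (idm (tdim X))"
			using C H d by (cases x; cases s) (simp_all add: L_def opr_mult opr_pow oH D.tt D.w_inv del: One_nat_def)
		show "L (x, s) * L (x, \<not> s) : carrier_mat (tdim X) (tdim X)" by (rule mult_carrier_mat[OF L L])
	qed simp
	have E: "weval (tdim X) L l = weval (tdim X) L r" if "(l, r) : G_rels N n" for l r
	proof (rule mat_eq_opr[of _ "tdim X"])
		have w: "weval (tdim X) L (replicate k y) = L y ^m k" for k y by (rule weval_replicate[OF L])
		from that consider "l = [(GT, True), (GT, True)]" "r = []" | "l = replicate (2 * N) (GH, True)" "r = []"
			| "l = replicate n (GW, True)" "r = replicate N (GH, True)" | "l = [(GT, True), (GW, True)]" "r = [(GW, False), (GT, True)]"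
			| "l = [(GH, True), (GT, True)]" "r = [(GT, True), (GH, True)]" | "l = [(GH, True), (GW, True)]" "r = [(GW, True), (GH, True)]"
			by (auto simp: G_rels_def Let_def)
		thus "opr (tdim X) (weval (tdim X) L l) = opr (tdim X) (weval (tdim X) L r)"
			by cases (use C H d in "simp_all add: w L_def opr_mult opr_pow oH D.tt D.root_2N D.root_N D.tw D.root_comm")
	qed (use weval_closed[of L, OF L] in auto)
	from wrep_exists[of L "tdim X" "G_rels N n", OF L inv E]
	obtain V where V: "V : fdms GA" "fst V = tdim X" "!!u. gw V u = weval (tdim X) L u" by blast
	have "gw V [(GH, True), (GH, True)] = tZ X" "gw V [(GT, True)] = tT X" "gw V [(GW, True)] = tW X"
		using C H HH by (simp_all add: V(3) L_def)
	thus thesis using that[OF V(1)] V(2) by simp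
qed

lemma pow_left_inverse: "A : sqm d ==> A ^m m = idm d ==> m > 0 ==> A ^m (m - 1) * A = (idm d :: 'k mat)"
	by (cases m) auto

lemma group_hopf_dihedral:
	"hopf_dihedral N n om ze GA (gs (pcl (G_rels N n) [(GH, True), (GH, True)])) (gs (pcl (G_rels N n) [(GT, True)]))
		(gs (pcl (G_rels N n) [(GW, True)]))"
		(is "hopf_dihedral _ _ _ _ _ ?z ?t ?w")
proof -
	interpret P: group_rep "presented_group (G_rels N n)" GA
		by (simp add: group_rep_def group_rep_axioms_def group_presented)
	have snd: "snd V (gs (pcl (G_rels N n) u)) = gw V u" for V u by (simp add: wrep_def)
	have pc: "pcl (G_rels N n) u : carrier (presented_group (G_rels N n))" for u
		by (simp add: pg_simps)
	show ?thesis
	proof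
		show "?z : carrier GA" "?t : carrier GA" "?w : carrier GA" by (rule P.gs_closed[OF pc])+
		show "antipode GA a : carrier GA" if "a : carrier GA" for a using that by (rule P.A_closed(4))
		show "(fst V, snd V ?z, snd V ?t, snd V ?w) : trips" if "V : fdms GA" for V
			unfolding snd by (rule G_wrep(1)[OF that])
		show "mod_inter GA V W P" if "V : fdms GA" "W : fdms GA" "P : carrier_mat (fst W) (fst V)"
			"!!g. g : {?z, ?t, ?w} ==> P * snd V g = snd W g * P" for V W P
			by (rule G_intertwine[OF that(1-3)]) (use that(4) in "auto simp: wrep_def")
		show "\<exists>V\<in>fdms GA. (fst V, snd V ?z, snd V ?t, snd V ?w) = S k" if "k : K" for k
		proof -
			have "tdim (S k) > 0" by (cases k) (auto simp: Vt_def)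
			from G_irr_exists[OF S_trips this] show ?thesis unfolding snd by metis
		qed
		show "tmod GA : fdms GA" by (rule P.trivial_group_fd)
		show "(1, snd (tmod GA) ?z, snd (tmod GA) ?t, snd (tmod GA) ?w) = S (Chi 0 True False)"
			unfolding snd wrep_trivial by (simp add: diagm_one)
		show "kys (SOME s. s : comult GA a) \<subseteq> carrier GA \<times> carrier GA" if "a : carrier GA" for a
			using P.comult_some[OF that] unfolding P.comult_A by (simp add: tensor_class_def)
		show "mten GA V W : fdms GA" if "V : fdms GA" "W : fdms GA" for V W
			using that by (rule P.module_tensor_fd)
		show "dmod GA V : fdms GA" if "V : fdms GA" for V
			using that by (rule P.dual_module_fd)
		fix k V assume k: "k : K" and V: "V : fdms GA" "(fst V, snd V ?z, snd V ?t, snd V ?w) = S k"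
		{
			fix l W U assume l: "l : K" and W: "W : fdms GA" "(fst W, snd W ?z, snd W ?t, snd W ?w) = S l"
				and U: "U = mten GA V W"
			have "(fst U, snd U ?z, snd U ?t, snd U ?w) = ttens (S k) (S l)"
				unfolding U V(2)[symmetric] W(2)[symmetric] ttens_def snd by (simp add: wrep_tensor[OF V(1) W(1)] fst_module_tensor)
			thus "mu (fst U, snd U ?z, snd U ?t, snd U ?w) = fus k l" using mu_ttens[OF k l] by simp
		}
		fix U assume U: "U = dmod GA V"
		note C = wrep_simps(1)[OF V(1)]
		note T = tripsD[OF S_trips[of k, folded V(2), unfolded snd]]
		have "gw U [(GH, True), (GH, True)] = trm (gw V [(GH, True), (GH, True)] ^m (N - 1))"
			unfolding U using T(2) C by (intro wrep_dual[OF V(1)] pow_left_inverse) auto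
		moreover have "gw U [(GW, True)] = trm (gw V [(GW, True)] ^m (2 * n - 1))"
			unfolding U using T(4) C n by (intro wrep_dual[OF V(1)] pow_left_inverse) auto
		moreover have "gw U [(GT, True)] = trm (gw V [(GT, True)])"
			unfolding U using T(3) C by (intro wrep_dual[OF V(1)]) auto
		ultimately have "(fst U, snd U ?z, snd U ?t, snd U ?w) = tdual (S k)"
			unfolding V(2)[symmetric] tdual_def snd by (cases V) (simp add: U)
		thus "mu (fst U, snd U ?z, snd U ?t, snd U ?w) = {#dual_irr k#}" using mu_tdual[OF k] by simp
	qed
qed

end

section \<open>Quotients of monoid algebras as rings of operators\<close>

interpretation fconst_scalars: scalars "fconst :: 'k::comm_ring_1 => 'm::monoid_add \<Rightarrow>\<^sub>0 'k"
	by unfold_locales (simp_all add: single_add mult_single)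

lemma fconst_commute: "fconst c * p = p * (fconst c :: 'm::monoid_add \<Rightarrow>\<^sub>0 'k::comm_ring_1)"
	by (induction p rule: pm_induct) (simp_all add: mult_single mult.commute algebra_simps)

definition rhom :: "('a::ring_1 => 'b::ring_1) => bool" where
	"rhom L \<longleftrightarrow> L 1 = 1 & (\<forall>p q. L (p + q) = L p + L q) & (\<forall>p q. L (p * q) = L p * L q)"

lemma rhom_simps:
	assumes "rhom L"
	shows "L 1 = 1" "L (p + q) = L p + L q" "L (p * q) = L p * L q" "L 0 = 0" "L (- p) = - L p" "L (p - q) = L p - L q"
		"L (p ^ k) = L p ^ k" "L (if b then p else q) = (if b then L p else L q)"
proof -
	show 1: "L 1 = 1" "L (p + q) = L p + L q" "L (p * q) = L p * L q" for p q
		using assms by (simp_all add: rhom_def)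
	show 2: "L 0 = 0" using 1(2)[of 0 0] by simp
	show 3: "L (- p) = - L p" for p using 1(2)[of p "- p"] 2 by (simp add: minus_unique)
	show "L (p - q) = L p - L q" using 1(2)[of p "- q"] 3[of q] by simp
	show "L (p ^ k) = L p ^ k" by (induction k) (simp_all add: 1)
qed simp

lemma rhom_comp: "rhom L ==> rhom M ==> rhom (%p. M (L p))"
	by (simp add: rhom_def)

definition two_sided :: "'a::ring_1 set => bool" where
	"two_sided J \<longleftrightarrow> 0 : J & (\<forall>p\<in>J. \<forall>q\<in>J. p + q : J) & (\<forall>p\<in>J. \<forall>q. q * p : J & p * q : J)"

lemma two_sided_uminus: "two_sided J ==> p : J ==> - p : J"
	unfolding two_sided_def by (metis mult_minus1)

lemma two_sided_diff: "two_sided J ==> p : J ==> q : J ==> p - q : J"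
	using two_sided_uminus[of J q] unfolding two_sided_def by (metis diff_conv_add_uminus)

text \<open>With a linear projection \<open>\<pi>\<close> along the ideal \<open>J\<close>, the element \<open>p\<close> acts on the image of \<open>\<pi>\<close> by \<open>\<pi> (p q)\<close>.
  On \<open>J\<close> itself it is made to act by the scalar \<open>ep p\<close>, so that \<open>1\<close> acts as the identity.\<close>

lemma quotient_embedding:
	fixes J :: "('m::monoid_add \<Rightarrow>\<^sub>0 'k::field) set"
	assumes J: "two_sided J" and ep: "rhom ep" "!!p. p : J ==> ep p = (0 :: 'k)"
	obtains L :: "('m \<Rightarrow>\<^sub>0 'k) => ('m \<Rightarrow>\<^sub>0 'k) endo" where "rhom L" "!!p. L p = 0 \<longleftrightarrow> p : J"
proof -
	interpret vector_space "%c (p :: 'm \<Rightarrow>\<^sub>0 'k). fconst c * p"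
		by unfold_locales
			(simp_all add: distrib_left distrib_right single_add mult.assoc[symmetric] mult_single)
	interpret vector_space_pair "%c (p :: 'm \<Rightarrow>\<^sub>0 'k). fconst c * p" "%c (p :: 'm \<Rightarrow>\<^sub>0 'k). fconst c * p" ..
	have subJ: "subspace J" using J unfolding subspace_def two_sided_def by blast
	obtain B where B: "B \<subseteq> J" "independent B" "J \<subseteq> span B" by (rule basis_exists[of J])
	have sB: "span B = J" using B subJ by (metis span_minimal subset_antisym)
	let ?B = "extend_basis B"
	have B': "independent ?B" "span ?B = UNIV" "B \<subseteq> ?B"
		using B(2) by (auto simp: independent_extend_basis span_extend_basis extend_basis_superset)
	obtain \<pi> where \<pi>: "Vector_Spaces.linear (%c p. fconst c * p) (%c p. fconst c * p) \<pi>" "!!b. b : ?B ==> \<pi> b = (if b : B then 0 else b)"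
		using linear_independent_extend[OF B'(1), of "%b. if b : B then 0 else b"] by blast
	interpret \<pi>: Vector_Spaces.linear "%c (p :: 'm \<Rightarrow>\<^sub>0 'k). fconst c * p" "%c (p :: 'm \<Rightarrow>\<^sub>0 'k). fconst c * p" \<pi> by (rule \<pi>(1))
	have 1: "p - \<pi> p : J" for p
	proof -
		have "p : span ?B" using B' by simp
		thus ?thesis
		proof (induction rule: span_induct_alt)
			case base
			thus ?case using J by (simp add: two_sided_def \<pi>.zero)
		next
			case (step c b p)
			have "b - \<pi> b : J" using \<pi>(2)[OF step(1)] B(1) J by (auto simp: two_sided_def)
			hence "fconst c * (b - \<pi> b) + (p - \<pi> p) : J" using step(2) J by (simp add: two_sided_def)
			thus ?case by (simp add: \<pi>.add \<pi>.scale algebra_simps)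
		qed
	qed
	have 0: "\<pi> p = 0 \<longleftrightarrow> p : J" for p
	proof
		assume "\<pi> p = 0"
		thus "p : J" using 1[of p] by simp
	next
		assume "p : J"
		hence "p : span B" by (simp add: sB)
		thus "\<pi> p = 0"
			by (induction rule: span_induct_alt) (use \<pi>(2) B' in "auto simp: \<pi>.zero \<pi>.add \<pi>.scale")
	qed
	have eq: "\<pi> p = \<pi> q" if "p - q : J" for p q
		using 0[of "p - q"] that by (simp add: \<pi>.diff)
	have \<pi>\<pi>: "\<pi> (\<pi> p) = \<pi> p" for p
		using eq[OF 1, of p] by simp
	define L where "L p = Abs_endo (%q. \<pi> (p * q) + fconst (ep p) * (q - \<pi> q))" for p
	have L: "Rep_endo (L p) q = \<pi> (p * q) + fconst (ep p) * (q - \<pi> q)" for p q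
		unfolding L_def by (subst Abs_endo_inverse) (auto simp: distrib_left \<pi>.add algebra_simps)
	have "rhom L"
		unfolding rhom_def
	proof (intro conjI allI)
		note e = rhom_simps[OF ep(1)]
		show "L 1 = 1" by (simp add: Rep_endo_inject[symmetric] fun_eq_iff L one_endo.rep_eq e)
		fix p p'
		show "L (p + p') = L p + L p'"
			by (simp add: Rep_endo_inject[symmetric] fun_eq_iff L plus_endo.rep_eq e distrib_right \<pi>.add single_add)
		\<comment> \<open>Under \<open>\<pi> (p * _)\<close> the argument matters only modulo
		  \<open>J\<close>; both the scalar part and the difference between \<open>p' * q\<close> and its
		  projection lie in \<open>J\<close>.\<close>
		have "\<pi> (p * (\<pi> (p' * q) + fconst (ep p') * (q - \<pi> q))) = \<pi> (p * p' * q)" for q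
		proof (rule eq)
			have "p * (\<pi> (p' * q) + fconst (ep p') * (q - \<pi> q)) - p * p' * q =
					p * (fconst (ep p') * (q - \<pi> q) - (p' * q - \<pi> (p' * q)))"
				by (simp add: algebra_simps)
			also have "... : J"
			proof -
				have l: "u * v : J" if "v : J" for u v using J that by (simp add: two_sided_def)
				show ?thesis by (rule l[OF two_sided_diff[OF J l[OF 1] 1]])
			qed
			finally show "p * (\<pi> (p' * q) + fconst (ep p') * (q - \<pi> q)) - p * p' * q : J" .
		qed
		moreover have "\<pi> (fconst (ep p') * (q - \<pi> q)) = 0" for q
			using 1[of q] J unfolding 0 by (simp add: two_sided_def)
		ultimately show "L (p * p') = L p * L p'"
			by (simp add: Rep_endo_inject[symmetric] fun_eq_iff L times_endo.rep_eq e \<pi>.add \<pi>\<pi>)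
	qed
	moreover have "L p = 0 \<longleftrightarrow> p : J" for p
	proof
		assume "p : J"
		hence "ep p = 0" "p * q : J" for q using ep(2) J by (auto simp: two_sided_def)
		thus "L p = 0" by (simp add: Rep_endo_inject[symmetric] fun_eq_iff L zero_endo.rep_eq 0)
	next
		\<comment> \<open>Evaluated at 1 and projected once more, the operator gives
		  \<open>\<pi> p\<close>, because \<open>\<pi>\<close> kills the scalar part.\<close>
		assume "L p = 0"
		hence "\<pi> (p * 1) + fconst (ep p) * (1 - \<pi> 1) = 0" using L[of p 1] by (simp add: zero_endo.rep_eq)
		hence "\<pi> (\<pi> p + fconst (ep p) * (1 - \<pi> 1)) = 0" by (simp add: \<pi>.zero)
		moreover have "\<pi> (fconst (ep p) * (1 - \<pi> 1)) = 0"
			using 1[of 1] J unfolding 0 by (simp add: two_sided_def)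
		ultimately show "p : J" by (simp add: \<pi>.add \<pi>\<pi> 0)
	qed
	ultimately show thesis using that by blast
qed


section \<open>Solutions of Suzuki's relations\<close>

lemma alternating_0 [simp]: "alte 0 a b = 1"
	by (simp add: alternating_def)

lemma alternating_Suc: "alte (Suc k) a b = alte k a b * (if even k then a else b)"
	by (simp add: alternating_def)

lemma rhom_alternating: "rhom L ==> L (alte k a b) = alte k (L a) (L b)"
	by (induction k) (simp_all add: alternating_Suc rhom_simps)

lemma alternating_double: "alte (2 * k) a b = (a * b) ^ k"
	by (induction k) (simp_all add: alternating_Suc mult.assoc power_Suc2 del: power_Suc)

lemma alternating_double_Suc: "alte (2 * k + 1) a b = (a * b) ^ k * a"
	by (simp add: alternating_Suc alternating_double)

text \<open>All mixed products of neighbouring letters vanish. The empty word would be counted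
  twice, so the induction starts at one letter; it carries along that each word is killed by the
  next letter of the other kind.\<close>

lemma alternating_sum:
	fixes a a' b b' :: "'b::ring_1"
	assumes "a * b' = 0" "a' * b = 0" "b * a' = 0" "b' * a = 0" "k > 0"
	shows "alte k (a + a') (b + b') = alte k a b + alte k a' b'"
proof -
	obtain m where k: "k = Suc m" using assms(5) by (cases k) auto
	have "alte (Suc m) (a + a') (b + b') = alte (Suc m) a b + alte (Suc m) a' b' &
		alte (Suc m) a b * (if even m then b' else a') = 0 & alte (Suc m) a' b' * (if even m then b else a) = 0"
	proof (induction m)
		case 0
		show ?case using assms by (simp add: alternating_Suc)
	next
		case (Suc m)
		show ?case using Suc assms by (subst (1 2 3 4 5) alternating_Suc) (auto simp: distrib_left distrib_right mult.assoc)
	qed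
	thus ?thesis by (simp add: k)
qed

lemma alternating_commute:
	assumes "a * c = c * a" "b * c = c * (b :: 'b::monoid_mult)"
	shows "alte k a b * c = c * alte k a b"
proof (induction k)
	case (Suc k)
	have "alte (Suc k) a b * c = alte k a b * c * (if even k then a else b)"
		using assms by (simp add: alternating_Suc mult.assoc)
	thus ?case by (simp only: Suc alternating_Suc mult.assoc)
qed simp

lemma alternating_mult:
	fixes a a' b b' :: "'b::monoid_mult"
	assumes "a' * a = a * a'" "a' * b = b * a'" "b' * a = a * b'" "b' * b = b * b'"
	shows "alte k (a * a') (b * b') = alte k a b * alte k a' b'"
proof (induction k)
	case (Suc k)
	let ?x = "if even k then a else b" and ?x' = "if even k then a' else b'"
	have c: "alte k a' b' * ?x = ?x * alte k a' b'"
		using assms by (intro alternating_commute) auto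
	have "alte (Suc k) (a * a') (b * b') = alte k a b * (alte k a' b' * ?x) * ?x'"
		by (simp add: alternating_Suc Suc mult.assoc)
	also have "... = alte (Suc k) a b * alte (Suc k) a' b'"
		by (simp only: c alternating_Suc mult.assoc)
	finally show ?case .
qed simp

lemma alternating_same: "alte k a a = a ^ k"
	by (induction k) (simp_all add: alternating_Suc power_Suc2 del: power_Suc)

lemma power_orthogonal_sum:
	fixes a b :: "'b::ring_1"
	assumes "a * b = 0" "b * a = 0" "k > 0"
	shows "(a + b) ^ k = a ^ k + b ^ k"
	using alternating_sum[of a b b a k] assms by (simp add: alternating_same)

lemma power_mult_commute: "b * a = a * b ==> (a * b) ^ k = a ^ k * (b :: 'b::monoid_mult) ^ k"
	using alternating_mult[of b a a b k] by (simp add: alternating_same)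

lemma mult_swap: "p' * q = q * p' ==> (p * p') * (q * q') = (p * q) * (p' * (q' :: 'b::monoid_mult))"
	by (metis mult.assoc)

text \<open>If \<open>Y = V X\<close> with \<open>X\<^sup>2\<close> central and \<open>V X V = X\<close>, then \<open>X Y\<close> is \<open>X\<^sup>2 V\<^sup>-\<^sup>1\<close> and \<open>Y X\<close> is \<open>X\<^sup>2 V\<close>.\<close>

lemma alternating_twist:
	fixes X V :: "'b::monoid_mult"
	assumes V: "V * (X * V) = X" "V * (X * X) = X * X * V"
	shows "V ^ k * alte k X (V * X) = alte k (V * X) X"
proof -
	have c: "X * X * V ^ m = V ^ m * (X * X)" for m
		using V(2) by (simp add: power_commuting_commutes)
	have U: "V * (X * (V * X)) = X * X" "X * (V * X) * V = X * X"
		using V(1) by (metis mult.assoc)+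
	have 1: "V ^ m * (X * (V * X)) ^ m = (X * X) ^ m" for m
		using power_mult_commute[of "X * (V * X)" V m] U by simp
	have 2: "(V * X * X) ^ m = V ^ m * (X * X) ^ m" for m
		using power_mult_commute[of "X * X" V m] V(2) by (simp add: mult.assoc)
	show ?thesis
	proof (cases "even k")
		case True
		then obtain m where k: "k = 2 * m" by (elim evenE)
		have "V ^ k * alte k X (V * X) = V ^ m * (V ^ m * (X * (V * X)) ^ m)"
			unfolding k alternating_double by (simp add: mult_2 power_add mult.assoc)
		thus ?thesis unfolding 1 2[symmetric] k alternating_double .
	next
		case False
		then obtain m where k: "k = 2 * m + 1" by (elim oddE)
		have "2 * m + 1 = m + 1 + m" by simp
		hence "V ^ (2 * m + 1) = V ^ m * V * V ^ m" by (simp only: power_add power_one_right)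
		hence "V ^ k * alte k X (V * X) = V ^ m * V * (V ^ m * (X * (V * X)) ^ m) * X"
			unfolding k alternating_double_Suc by (simp only: mult.assoc)
		also have "... = V ^ m * (V * (X * X) ^ m) * X"
			unfolding 1 by (simp only: mult.assoc)
		also have "V * (X * X) ^ m = (X * X) ^ m * V"
			using V(2) by (simp add: power_commuting_commutes)
		finally show ?thesis unfolding k alternating_double_Suc 2 by (simp only: mult.assoc)
	qed
qed

text \<open>The value of the parameter \<open>\<mu>\<close> in \<open>A_Nn\<close>.\<close>

abbreviation alt_sign :: "nat => 'b::ring_1" where "alt_sign n == if odd n then 1 else - 1"

text \<open>The relations for a family in an arbitrary ring type, that is, for the image of the
  algebra under a homomorphism. With two index values, \<open>(i = j) ~= (l = m)\<close> says that
  the index differences have different parity.\<close>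

locale suz_rels =
	fixes N n :: nat and x :: "idx \<times> idx => 'b::ring_1"
	assumes N: "odd N" and n: "n > 0"
		and sq: "x (I2, I2) ^ 2 = x (I1, I1) ^ 2" "x (I2, I1) ^ 2 = x (I1, I2) ^ 2"
		and cross: "(i = j) ~= (l = m) ==> x (i, j) * x (l, m) = 0"
		and unit: "x (I1, I1) ^ (2 * N) + x (I1, I2) ^ (2 * N) = 1"
		and alt1: "alte n (x (I2, I2)) (x (I1, I1)) = alte n (x (I1, I1)) (x (I2, I2))"
		and alt2: "alte n (x (I2, I1)) (x (I1, I2)) = alt_sign n * alte n (x (I1, I2)) (x (I2, I1))"
begin

lemma N_pos: "N > 0" using N by (cases N) auto

lemma zeros: "x (I1, I1) * x (I1, I2) = 0" "x (I1, I1) * x (I2, I1) = 0" "x (I2, I2) * x (I1, I2) = 0" "x (I2, I2) * x (I2, I1) = 0"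
	"x (I1, I2) * x (I1, I1) = 0" "x (I1, I2) * x (I2, I2) = 0" "x (I2, I1) * x (I1, I1) = 0" "x (I2, I1) * x (I2, I2) = 0"
	by (rule cross; simp)+

lemma pow_sq: "x (I2, I2) ^ (2 * k) = x (I1, I1) ^ (2 * k)" "x (I2, I1) ^ (2 * k) = x (I1, I2) ^ (2 * k)"
	by (simp_all only: power_mult sq)

end

text \<open>The comultiplication respects the relations: two commuting families combine to a third.
  In each sum the two summands annihilate each other, so powers and alternating words split; the
  sign then occurs twice in a summand or not at all, or else once in every summand.\<close>

lemma suzuki_comult:
	fixes x y :: "idx \<times> idx => 'b::ring_1"
	assumes x: "suz_rels N n x" and y: "suz_rels N n y" and xy: "!!p q. y q * x p = x p * y q"
	shows "suz_rels N n (%(i, j). x (i, I1) * y (I1, j) + x (i, I2) * y (I2, j))"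
proof -
	interpret x: suz_rels N n x by (rule x)
	interpret y: suz_rels N n y by (rule y)
	have m: "x p * y q * (x p' * y q') = x p * x p' * (y q * y q')" for p q p' q'
		by (rule mult_swap[OF xy])
	have z: "x p * y q * (x p' * y q') = 0" if "x p * x p' = 0 \<or> y q * y q' = 0" for p q p' q'
		using that unfolding m by auto
	have pw: "(x p * y q + x p' * y q') ^ k = x p ^ k * y q ^ k + x p' ^ k * y q' ^ k"
		if "k > 0" "x p * x p' = 0" "x p' * x p = 0" for p q p' q' k
		using power_orthogonal_sum[OF z z, of p p' q q' k] that by (simp add: power_mult_commute[OF xy])
	have al: "alte k (x p * y q + x p' * y q') (x r * y s + x r' * y s') =
			alte k (x p) (x r) * alte k (y q) (y s) + alte k (x p') (x r') * alte k (y q') (y s')"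
		if "k > 0" "x p * x r' = 0" "x p' * x r = 0" "x r * x p' = 0" "x r' * x p = 0" for p q p' q' r s r' s' k
		using alternating_sum[where a = "x p * y q" and a' = "x p' * y q'" and b = "x r * y s" and b' = "x r' * y s'",
			OF z z z z, of k] that by (simp add: alternating_mult xy)
	note Z = x.zeros
	show ?thesis
	proof
		show "odd N" "n > 0" by (rule x.N, rule x.n)
		show "(case (I2, I2) of (i, j) => x (i, I1) * y (I1, j) + x (i, I2) * y (I2, j))\<^sup>2 =
				(case (I1, I1) of (i, j) => x (i, I1) * y (I1, j) + x (i, I2) * y (I2, j))\<^sup>2"
			"(case (I2, I1) of (i, j) => x (i, I1) * y (I1, j) + x (i, I2) * y (I2, j))\<^sup>2 =
				(case (I1, I2) of (i, j) => x (i, I1) * y (I1, j) + x (i, I2) * y (I2, j))\<^sup>2"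
			by (simp_all add: pw Z x.sq y.sq add.commute)
		fix i j l m' :: idx assume "(i = j) ~= (l = m')"
		hence "x (i, p) * y (p, j) * (x (l, q) * y (q, m')) = 0" for p q
			by (intro z) (cases i; cases j; cases l; cases m'; cases p; cases q; simp add: x.zeros y.zeros)
		thus "(case (i, j) of (i, j) => x (i, I1) * y (I1, j) + x (i, I2) * y (I2, j)) *
				(case (l, m') of (i, j) => x (i, I1) * y (I1, j) + x (i, I2) * y (I2, j)) = 0"
			by (simp add: distrib_left distrib_right)
	next
		\<comment> \<open>The sum factors because the power \<open>2 * N\<close> of a generator depends
		  only on the parity of its index difference.\<close>
		have "x (I1, I1) ^ (2 * N) * y (I1, I1) ^ (2 * N) + x (I1, I2) ^ (2 * N) * y (I2, I1) ^ (2 * N) +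
				(x (I1, I1) ^ (2 * N) * y (I1, I2) ^ (2 * N) + x (I1, I2) ^ (2 * N) * y (I2, I2) ^ (2 * N)) =
				(x (I1, I1) ^ (2 * N) + x (I1, I2) ^ (2 * N)) * (y (I1, I1) ^ (2 * N) + y (I1, I2) ^ (2 * N))"
			unfolding y.pow_sq by (simp only: distrib_left distrib_right ac_simps)
		also have "... = 1" by (simp only: x.unit y.unit mult_1_left)
		finally show "(case (I1, I1) of (i, j) => x (i, I1) * y (I1, j) + x (i, I2) * y (I2, j)) ^ (2 * N) +
				(case (I1, I2) of (i, j) => x (i, I1) * y (I1, j) + x (i, I2) * y (I2, j)) ^ (2 * N) = 1"
			using x.N_pos by (simp add: pw Z)
	next
		have "alte n (x (I2, I2) * y (I2, I2) + x (I2, I1) * y (I1, I2)) (x (I1, I1) * y (I1, I1) + x (I1, I2) * y (I2, I1)) =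
				alte n (x (I1, I1) * y (I1, I1) + x (I1, I2) * y (I2, I1)) (x (I2, I2) * y (I2, I2) + x (I2, I1) * y (I1, I2))"
			using x.n by (simp add: al Z x.alt1 y.alt1 x.alt2 y.alt2)
		thus "alte n (case (I2, I2) of (i, j) => x (i, I1) * y (I1, j) + x (i, I2) * y (I2, j))
				(case (I1, I1) of (i, j) => x (i, I1) * y (I1, j) + x (i, I2) * y (I2, j)) =
			alte n (case (I1, I1) of (i, j) => x (i, I1) * y (I1, j) + x (i, I2) * y (I2, j))
				(case (I2, I2) of (i, j) => x (i, I1) * y (I1, j) + x (i, I2) * y (I2, j))"
			by (simp add: add.commute)
		have "alte n (x (I2, I1) * y (I1, I1) + x (I2, I2) * y (I2, I1)) (x (I1, I2) * y (I2, I2) + x (I1, I1) * y (I1, I2)) =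
				alt_sign n * alte n (x (I1, I2) * y (I2, I2) + x (I1, I1) * y (I1, I2)) (x (I2, I1) * y (I1, I1) + x (I2, I2) * y (I2, I1))"
			using x.n by (simp add: al Z x.alt1 y.alt1 x.alt2 y.alt2 distrib_left)
		thus "alte n (case (I2, I1) of (i, j) => x (i, I1) * y (I1, j) + x (i, I2) * y (I2, j))
				(case (I1, I2) of (i, j) => x (i, I1) * y (I1, j) + x (i, I2) * y (I2, j)) =
			alt_sign n * alte n (case (I1, I2) of (i, j) => x (i, I1) * y (I1, j) + x (i, I2) * y (I2, j))
				(case (I2, I1) of (i, j) => x (i, I1) * y (I1, j) + x (i, I2) * y (I2, j))"
			by (simp add: add.commute)
	qed
qed

lemma idem_pow: "e * e = e ==> k > 0 ==> (e :: 'b::monoid_mult) ^ k = e"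
	by (induction k) (auto, metis mult_1_right power_0 power_commutes neq0_conv)

lemma pow_mult_zero:
	fixes a b :: "'b::ring_1"
	assumes "a * b = 0" "k > 0" "l > 0"
	shows "a ^ k * b ^ l = 0"
proof -
	obtain k' l' where "k = Suc k'" "l = Suc l'" using assms by (metis gr0_conv_Suc)
	hence "a ^ k * b ^ l = a ^ k' * (a * b) * b ^ l'" by (simp only: power_Suc2[of a] power_Suc[of b] mult.assoc)
	thus ?thesis by (simp add: assms)
qed

section \<open>The dihedral triple inside a solution of the relations\<close>

context suz_rels
begin

abbreviation "e0 == x (I1, I1) ^ (2 * N)"
abbreviation "e1 == x (I1, I2) ^ (2 * N)"

lemma idems: "e0 * e1 = 0" "e1 * e0 = 0" "e0 * e0 = e0" "e1 * e1 = e1"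
proof -
	show 1: "e0 * e1 = 0" "e1 * e0 = 0" using N_pos by (simp_all add: pow_mult_zero zeros)
	have "e0 * (e0 + e1) = e0" "e1 * (e0 + e1) = e1" by (simp_all only: unit mult_1_right)
	thus "e0 * e0 = e0" "e1 * e1 = e1" using 1 by (simp_all add: distrib_left)
qed

text \<open>The odd power is \<open>x * (x ^ 2) ^ (N - 1)\<close>, and the two letters of an
  alternating word have the same square, which commutes with both. So each word is the original one
  times a common factor; transposing the indices respects the sign, whose square is 1.\<close>

lemma antipode: "suz_rels N n (%(i, j). x (j, i) ^ (2 * N - 1))"
proof -
	have p: "2 * N - 1 > 0" using N_pos by simp
	have odd: "x p ^ (2 * N - 1) = x p * (x p ^ 2) ^ (N - 1)" for p
	proof -
		have "2 * N - 1 = Suc (2 * (N - 1))" using N_pos by simp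
		thus ?thesis by (simp only: power_Suc power_mult)
	qed
	have comm: "(x p ^ 2) ^ k * x p = x p * (x p ^ 2) ^ k" for p k
		by (simp only: power_mult[symmetric] power_commutes)
	have al: "alte k (x p ^ (2 * N - 1)) (x q ^ (2 * N - 1)) = alte k (x p) (x q) * ((x p ^ 2) ^ (N - 1)) ^ k"
		if "x q ^ 2 = x p ^ 2" for p q k
	proof -
		have "x q ^ (2 * N - 1) = x q * (x p ^ 2) ^ (N - 1)" using odd[of q] that by simp
		thus ?thesis
			unfolding odd[of p] using comm[of p "N - 1"] comm[of q "N - 1"] that by (simp add: alternating_mult alternating_same)
	qed
	show ?thesis
	proof
		show "odd N" "n > 0" by (rule N, rule n)
		show "(case (I2, I2) of (i, j) => x (j, i) ^ (2 * N - 1))\<^sup>2 = (case (I1, I1) of (i, j) => x (j, i) ^ (2 * N - 1))\<^sup>2"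
			"(case (I2, I1) of (i, j) => x (j, i) ^ (2 * N - 1))\<^sup>2 = (case (I1, I2) of (i, j) => x (j, i) ^ (2 * N - 1))\<^sup>2"
			using pow_sq[of "2 * N - 1"] by (simp_all add: power_mult[symmetric] mult.commute)
		fix i j l m :: idx assume "(i = j) ~= (l = m)"
		hence "x (j, i) * x (m, l) = 0" by (intro cross) auto
		thus "(case (i, j) of (i, j) => x (j, i) ^ (2 * N - 1)) * (case (l, m) of (i, j) => x (j, i) ^ (2 * N - 1)) = 0"
			using p by (simp add: pow_mult_zero)
	next
		have "(x p ^ (2 * N - 1)) ^ (2 * N) = (x p ^ (2 * N)) ^ (2 * N - 1)" for p
			by (simp only: power_mult[symmetric] mult.commute)
		thus "(case (I1, I1) of (i, j) => x (j, i) ^ (2 * N - 1)) ^ (2 * N) + (case (I1, I2) of (i, j) => x (j, i) ^ (2 * N - 1)) ^ (2 * N) = 1"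
			using unit p by (simp add: idem_pow[OF idems(3)] idem_pow[OF idems(4)] pow_sq)
	next
		show "alte n (case (I2, I2) of (i, j) => x (j, i) ^ (2 * N - 1)) (case (I1, I1) of (i, j) => x (j, i) ^ (2 * N - 1)) =
				alte n (case (I1, I1) of (i, j) => x (j, i) ^ (2 * N - 1)) (case (I2, I2) of (i, j) => x (j, i) ^ (2 * N - 1))"
			unfolding prod.case using sq by (simp only: al alt1)
		have "alte n (x (I1, I2)) (x (I2, I1)) = alt_sign n * alte n (x (I2, I1)) (x (I1, I2))"
			using alt2 by simp
		thus "alte n (case (I2, I1) of (i, j) => x (j, i) ^ (2 * N - 1)) (case (I1, I2) of (i, j) => x (j, i) ^ (2 * N - 1)) =
				alt_sign n * alte n (case (I1, I2) of (i, j) => x (j, i) ^ (2 * N - 1)) (case (I2, I1) of (i, j) => x (j, i) ^ (2 * N - 1))"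
			unfolding prod.case using sq by (simp only: al mult.assoc)
	qed
qed

text \<open>\<open>X\<close> and \<open>Y\<close> are the sums of the generators in each row. Since
  \<open>X ^ (2 * N) = 1\<close>, \<open>V\<close> is \<open>Y\<close> times the inverse of
  \<open>X\<close>. Multiplication by \<open>P\<close> fixes generators with equal indices and
  negates the others.\<close>

definition X :: 'b where "X = x (I1, I1) + x (I1, I2)"
definition Y :: 'b where "Y = x (I2, I2) + x (I2, I1)"
definition P :: 'b where "P = e0 - e1"
text \<open>A correction making \<open>(Q * V) ^ n = P\<close> for both parities of
  \<open>n\<close>, as \<open>V ^ n\<close> is 1 for odd \<open>n\<close> and \<open>P\<close> for
  even \<open>n\<close>.\<close>

definition Q :: 'b where "Q = (if odd n then P else 1)"
definition V :: 'b where "V = Y * X ^ (2 * N - 1)"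

lemma X_pow: "k > 0 ==> X ^ k = x (I1, I1) ^ k + x (I1, I2) ^ k"
	and Y_pow: "k > 0 ==> Y ^ k = x (I2, I2) ^ k + x (I2, I1) ^ k"
	by (simp_all add: X_def Y_def power_orthogonal_sum zeros)

lemma X_2N: "X ^ (2 * N) = 1"
	using N_pos unit by (simp add: X_pow)

lemma YY: "Y * Y = X * X"
	using X_pow[of 2] Y_pow[of 2] sq by (simp add: power2_eq_square)

lemma X_inv: "X ^ (2 * N - 1) * X = 1" "X * X ^ (2 * N - 1) = 1"
	using power_minus_mult[of "2 * N" X] N_pos X_2N by (simp_all add: power_commutes)

lemma e_mult: "e0 * x p = (if fst p = snd p then x p else 0)" "e1 * x p = (if fst p = snd p then 0 else x p)"
	"x p * e0 = (if fst p = snd p then x p else 0)" "x p * e1 = (if fst p = snd p then 0 else x p)"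
proof -
	have *: "e0 * x p = 0 & x p * e0 = 0" if "fst p ~= snd p"
	proof -
		have "x (I1, I1) * x p = 0" "x p * x (I1, I1) = 0"
			using cross[of I1 I1 "fst p" "snd p"] cross[of "fst p" "snd p" I1 I1] that by auto
		thus ?thesis using pow_mult_zero[of "x (I1, I1)" "x p" "2 * N" 1] pow_mult_zero[of "x p" "x (I1, I1)" 1 "2 * N"] N_pos
			by simp
	qed
	have **: "e1 * x p = 0 & x p * e1 = 0" if "fst p = snd p"
	proof -
		have "x (I1, I2) * x p = 0" "x p * x (I1, I2) = 0"
			using cross[of I1 I2 "fst p" "snd p"] cross[of "fst p" "snd p" I1 I2] that by (cases p, auto)+
		thus ?thesis using pow_mult_zero[of "x (I1, I2)" "x p" "2 * N" 1] pow_mult_zero[of "x p" "x (I1, I2)" 1 "2 * N"] N_pos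
			by simp
	qed
	have "e0 * x p + e1 * x p = x p" "x p * e0 + x p * e1 = x p"
		by (simp_all only: unit mult_1_left mult_1_right flip: distrib_left distrib_right)
	thus "e0 * x p = (if fst p = snd p then x p else 0)" "e1 * x p = (if fst p = snd p then 0 else x p)"
		"x p * e0 = (if fst p = snd p then x p else 0)" "x p * e1 = (if fst p = snd p then 0 else x p)"
		using * ** by auto
qed

lemma P_mult: "P * x p = (if fst p = snd p then x p else - x p)" "x p * P = P * x p"
	by (simp_all add: P_def left_diff_distrib right_diff_distrib e_mult)

lemma P_comm: "P * X = X * P" "P * Y = Y * P"
	by (simp_all add: X_def Y_def distrib_left distrib_right P_mult)

lemma PP: "P * P = 1"
	using unit by (simp add: P_def left_diff_distrib right_diff_distrib idems)

lemma Q_comm: "Q * X = X * Q" "Q * Y = Y * Q" "Q * V = V * Q" and QQ: "Q * Q = 1"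
proof -
	show 1: "Q * X = X * Q" "Q * Y = Y * Q" "Q * Q = 1" using P_comm PP by (simp_all add: Q_def)
	have "X ^ (2 * N - 1) * Q = Q * X ^ (2 * N - 1)" using 1(1) by (intro power_commuting_commutes) simp
	thus "Q * V = V * Q" by (metis V_def 1(2) mult.assoc)
qed

lemma VX: "V * X = Y"
	by (simp only: V_def mult.assoc X_inv mult_1_right)

lemma V_comm: "V * (X * X) = X * X * V"
proof -
	have "X * X * Y = Y * (X * X)" by (metis YY mult.assoc)
	moreover have "X ^ (2 * N - 1) * (X * X) = X * X * X ^ (2 * N - 1)"
		by (rule power_commuting_commutes) (simp add: mult.assoc)
	ultimately show ?thesis by (metis V_def mult.assoc)
qed

lemma VXV: "V * (X * V) = X"
proof -
	have "V * (X * V) * X = Y * Y" by (simp only: mult.assoc VX) (simp only: VX mult.assoc[symmetric])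
	hence "V * (X * V) * X * X ^ (2 * N - 1) = X * X * X ^ (2 * N - 1)" by (simp only: YY)
	thus ?thesis by (simp only: mult.assoc X_inv mult_1_right)
qed

lemma P_alternating: "P * x p = r * x p ==> k > 0 ==> P * alte k (x p) (x q) = r * alte k (x p) (x q)"
proof (induction k)
	case (Suc k)
	show ?case
	proof (cases "k = 0")
		case True
		thus ?thesis using Suc.prems by (simp add: alternating_Suc)
	next
		case False
		thus ?thesis using Suc by (simp add: alternating_Suc mult.assoc[symmetric])
	qed
qed simp

text \<open>Alternating words in \<open>X\<close> and \<open>Y\<close> split into parts with equal
  and with distinct indices. By the relations, reversing the letters multiplies the second part by a
  sign, which amounts to a factor 1 or \<open>P\<close>. By \<open>alternating_twist\<close> the
  reversal is also multiplication by \<open>V ^ n\<close>, and the word has a right inverse.\<close>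

lemma V_pow: "V ^ n = (if odd n then 1 else P)"
proof -
	let ?R = "if odd n then 1 else P" and ?A = "alte n (x (I1, I1)) (x (I2, I2))"
		and ?B = "alte n (x (I1, I2)) (x (I2, I1))"
	have XY: "alte n X Y = ?A + ?B" "alte n Y X = ?A + alt_sign n * ?B"
		using n by (simp_all add: X_def Y_def alternating_sum zeros alt1 alt2)
	have "P * ?A = ?A" "P * ?B = - ?B"
		using P_alternating[of "(I1, I1)" 1] P_alternating[of "(I1, I2)" "- 1"] n by (simp_all add: P_mult)
	hence "alte n Y X = ?R * alte n X Y"
		unfolding XY by (simp add: distrib_left)
	hence eq: "V ^ n * alte n X Y = ?R * alte n X Y"
		using alternating_twist[OF VXV V_comm, of n] by (simp only: VX)
	have "Y * (Y * (X ^ (2 * N - 1) * X ^ (2 * N - 1))) = X * (X * X ^ (2 * N - 1)) * X ^ (2 * N - 1)"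
		by (metis YY mult.assoc)
	hence Y_inv: "Y * (Y * (X ^ (2 * N - 1) * X ^ (2 * N - 1))) = 1" by (simp only: X_inv mult_1_right)
	have "\<exists>u. alte k X Y * u = 1" for k
	proof (induction k)
		case (Suc k)
		then obtain u where u: "alte k X Y * u = 1" ..
		show ?case
		proof (cases "even k")
			case True
			have "alte (Suc k) X Y * (X ^ (2 * N - 1) * u) = alte k X Y * (X * X ^ (2 * N - 1)) * u"
				using True by (simp only: alternating_Suc if_True mult.assoc)
			thus ?thesis unfolding X_inv using u by auto
		next
			case False
			let ?Y = "Y * (X ^ (2 * N - 1) * X ^ (2 * N - 1))"
			have "alte (Suc k) X Y * (?Y * u) = alte k X Y * (Y * ?Y) * u"
				using False by (simp only: alternating_Suc if_False mult.assoc)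
			thus ?thesis unfolding Y_inv using u by auto
		qed
	qed simp
	then obtain u where u: "alte n X Y * u = 1" by blast
	from arg_cong[OF eq, of "%v. v * u"] show ?thesis by (simp only: mult.assoc u mult_1_right)
qed

lemma W_pow: "(Q * V) ^ n = P"
proof -
	have "(Q * V) ^ n = Q ^ n * V ^ n" using Q_comm(3) by (intro power_mult_commute) simp
	also have "... = P"
	proof (cases "odd n")
		case True
		then obtain m where m: "n = 2 * m + 1" by (elim oddE)
		have "P ^ n = P" by (simp add: m power_mult power2_eq_square PP)
		thus ?thesis using True by (simp add: Q_def V_pow)
	qed (simp add: Q_def V_pow)
	finally show ?thesis .
qed

lemma XX_pow_comm: "(X * X) ^ k * X = X * (X * X) ^ k" "(X * X) ^ k * V = V * (X * X) ^ k" "(X * X) ^ k * Q = Q * (X * X) ^ k"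
	using V_comm Q_comm(1) by (auto intro!: power_commuting_commutes simp: mult.assoc) (metis mult.assoc)

lemma X_N: "X ^ N = X * (X * X) ^ (N div 2)"
proof -
	have "N = Suc (2 * (N div 2))" using N by presburger
	hence "X ^ N = X ^ Suc (2 * (N div 2))" by simp
	thus ?thesis by (simp only: power_Suc power_mult power2_eq_square)
qed

lemma dihedral: "dih_rels N n (X ^ 2) (X ^ N) (Q * V)"
proof
	show "odd N" "n > 0" by (rule N, rule n)
	show "(X ^ 2) ^ N = 1" using X_2N by (simp add: power_mult)
	show "X ^ N * X ^ N = 1" using X_2N by (simp add: power_add[symmetric] mult_2)
	show "(Q * V) ^ (2 * n) = 1" by (simp add: mult_2 power_add W_pow PP)
	show "X ^ 2 * X ^ N = X ^ N * X ^ 2" by (simp add: power_add[symmetric] add.commute)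
	show "X ^ 2 * (Q * V) = Q * V * X ^ 2"
		using XX_pow_comm(2)[of 1] XX_pow_comm(3)[of 1] by (simp add: power2_eq_square) (metis mult.assoc)
	have "V * (X ^ N * V) = V * (X * V) * (X * X) ^ (N div 2)"
		by (simp only: X_N mult.assoc XX_pow_comm(2))
	hence 1: "V * (X ^ N * V) = X ^ N" by (simp only: VXV X_N)
	have "X ^ N * Q = Q * X ^ N" using Q_comm(1) by (intro power_commuting_commutes) simp
	hence "Q * V * (X ^ N * (Q * V)) = Q * Q * (V * (X ^ N * V))"
		by (metis Q_comm(3) mult.assoc)
	thus "Q * V * (X ^ N * (Q * V)) = X ^ N" by (simp only: QQ 1 mult_1_left)
qed

text \<open>\<open>N + 2 * (N div 2 + 1)\<close> is \<open>2 * N + 1\<close>, which returns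
  \<open>X\<close>. The generators appear doubled because 2 is not assumed invertible here.\<close>

lemma recover:
	"X = X ^ N * (X ^ 2) ^ (N div 2 + 1)" "Y = Q * (Q * V) * X"
	"x (i, j) + x (i, j) = (if i = j then 1 + P else 1 - P) * (if i = I1 then X else Y)"
proof -
	have "N + 2 * (N div 2 + 1) = Suc (2 * N)" using N by presburger
	hence "X ^ (N + 2 * (N div 2 + 1)) = X" by (simp only: power_Suc X_2N mult_1_right)
	thus "X = X ^ N * (X ^ 2) ^ (N div 2 + 1)" by (simp only: power_add power_mult)
	show "Y = Q * (Q * V) * X" by (simp only: mult.assoc[symmetric] QQ) (simp only: mult_1_left VX)
	show "x (i, j) + x (i, j) = (if i = j then 1 + P else 1 - P) * (if i = I1 then X else Y)"
		by (cases i; cases j) (simp_all add: X_def Y_def distrib_left distrib_right left_diff_distrib P_mult)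
qed

end

text \<open>A converse for the case in which \<open>P\<close> is 1 or -1, so that half of the
  generators vanish; \<open>s\<close> says that those with distinct indices survive.\<close>

lemma suzuki_of_twist:
	fixes X V :: "'b::ring_1"
	assumes "odd N" "n > 0" and V: "V * (X * V) = X" "V * (X * X) = X * X * V" and X: "X ^ (2 * N) = 1"
		and Vn: "V ^ n = (if odd n \<or> \<not> s then 1 else - 1)"
	shows "suz_rels N n (%(i, j). if s = (i ~= j) then if i = I1 then X else V * X else 0)"
proof
	have N: "N > 0" using \<open>odd N\<close> by (cases N) auto
	have "V * X * (V * X) = X * X" using V(1) by (simp add: mult.assoc[symmetric])
	thus "(case (I2, I2) of (i, j) => if s = (i ~= j) then if i = I1 then X else V * X else 0)\<^sup>2 =
			(case (I1, I1) of (i, j) => if s = (i ~= j) then if i = I1 then X else V * X else 0)\<^sup>2"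
		"(case (I2, I1) of (i, j) => if s = (i ~= j) then if i = I1 then X else V * X else 0)\<^sup>2 =
			(case (I1, I2) of (i, j) => if s = (i ~= j) then if i = I1 then X else V * X else 0)\<^sup>2"
		by (simp_all add: power2_eq_square)
qed (use assms alternating_twist[OF V, of n] in "auto simp: alternating_same zero_power odd_pos")

section \<open>Suzuki's algebras\<close>

lemma fconst_alt_sign: "fconst (alt_sign n :: 'k::comm_ring_1) = (alt_sign n :: 'm::monoid_add \<Rightarrow>\<^sub>0 'k)"
	by (simp add: single_uminus)

definition arhom :: "('a::ring_1 => 'b::ring_1) => bool" where
	"arhom L \<longleftrightarrow> L 1 = 1 & (\<forall>p q. L (p + q) = L p + L q) & (\<forall>p q. L (p * q) = L q * L p)"

lemma arhom_simps:
	assumes "arhom L"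
	shows "L 1 = 1" "L (p + q) = L p + L q" "L (p * q) = L q * L p" "L 0 = 0" "L (- p) = - L p" "L (p - q) = L p - L q"
		"L (p ^ k) = L p ^ k"
		"L (alte k p q) = (if odd k then alte k (L p) (L q) else alte k (L q) (L p))"
proof -
	show 1: "L 1 = 1" "L (p + q) = L p + L q" "L (p * q) = L q * L p" for p q
		using assms by (simp_all add: arhom_def)
	show 2: "L 0 = 0" using 1(2)[of 0 0] by simp
	show 3: "L (- p) = - L p" for p using 1(2)[of p "- p"] 2 by (simp add: minus_unique)
	show "L (p - q) = L p - L q" using 1(2)[of p "- q"] 3[of q] by simp
	show 4: "L (p ^ k) = L p ^ k" for p k by (induction k) (simp_all add: 1 power_commutes)
	have 5: "a * (b * a) ^ m = (a * b) ^ m * a" for a b :: 'b and m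
	proof (induction m)
		case (Suc m)
		have "a * (b * a) ^ Suc m = a * (b * a) ^ m * (b * a)" by (simp only: power_Suc2 mult.assoc)
		thus ?case unfolding Suc by (simp only: power_Suc2 mult.assoc)
	qed simp
	show "L (alte k p q) = (if odd k then alte k (L p) (L q) else alte k (L q) (L p))"
	proof (cases "even k")
		case True
		then obtain m where "k = 2 * m" by (elim evenE)
		thus ?thesis by (simp add: alternating_double 1 4)
	next
		case False
		then obtain m where k: "k = 2 * m + 1" by (elim oddE)
		have "L (alte k p q) = L p * (L q * L p) ^ m" unfolding k alternating_double_Suc by (simp only: 1 4)
		thus ?thesis unfolding 5 using False by (simp only: k alternating_double_Suc) simp
	qed
qed

lemma ring_free_alg: "ring (free_alg_ring :: 'k::comm_ring_1 free_alg ring)"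
proof (rule ringI)
	show "abelian_group (free_alg_ring :: 'k free_alg ring)"
	proof (rule abelian_groupI)
		fix x :: "'k free_alg"
		show "\<exists>y\<in>carrier free_alg_ring. y \<oplus>\<^bsub>free_alg_ring\<^esub> x = \<zero>\<^bsub>free_alg_ring\<^esub>"
			by (rule bexI[of _ "- x"]) (auto simp: free_alg_ring_def)
	qed (auto simp: free_alg_ring_def ac_simps)
	show "Group.monoid (free_alg_ring :: 'k free_alg ring)" by (rule monoidI) (auto simp: free_alg_ring_def ac_simps)
qed (auto simp: free_alg_ring_def algebra_simps)

lemma free_alg_simps [simp]: "carrier free_alg_ring = UNIV" "mult free_alg_ring = (*)" "add free_alg_ring = (+)"
	"one free_alg_ring = 1" "zero free_alg_ring = 0"
	by (simp_all add: free_alg_ring_def)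

lemma free_alg_uminus: "\<ominus>\<^bsub>free_alg_ring\<^esub> p = - p"
	using abelian_group.minus_equality[OF ring.is_abelian_group[OF ring_free_alg], of "- p" p] by simp

lemma module_extend_simps:
	"carrier (module.extend S X) = carrier S" "mult (module.extend S X) = mult S" "add (module.extend S X) = add S"
	"one (module.extend S X) = one S" "module.smult (module.extend S X) = module.smult S"
	by (simp_all add: module.extend_def)

lemma ring_extend_simps:
	"carrier (ring.extend S (module.fields X)) = carrier S" "mult (ring.extend S (module.fields X)) = mult S"
	"add (ring.extend S (module.fields X)) = add S" "one (ring.extend S (module.fields X)) = one S"
	"module.smult (ring.extend S (module.fields X)) = X"
	by (simp_all add: ring.extend_def module.fields_def)

locale suzuki_alg =
	fixes N n :: nat and mm :: "'k::field" and A :: "('k, 'k free_alg set) hopf_algebra"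
	assumes N: "odd N" and n: "n > 0" and mm: "mm = alt_sign n" and A: "A = suzuki N n 1 mm"
begin

abbreviation rels :: "'k free_alg set" where "rels == suzuki_relators N n 1 mm"
abbreviation I :: "'k free_alg set" where "I == suzuki_ideal N n 1 mm"
abbreviation cls :: "'k free_alg => 'k free_alg set" where "cls == suzuki_class N n 1 mm"

lemma ideal_I: "ideal I free_alg_ring"
	unfolding suzuki_ideal_def by (rule ring.genideal_ideal[OF ring_free_alg]) simp

lemma rels_I: "rels \<subseteq> I"
	unfolding suzuki_ideal_def by (rule ring.genideal_self[OF ring_free_alg]) simp

lemma two_sided_I: "two_sided I"
proof -
	note G = ideal.axioms(1)[OF ideal_I]
	show ?thesis
		unfolding two_sided_def
		using additive_subgroup.zero_closed[OF G] additive_subgroup.a_closed[OF G] ideal.I_l_closed[OF ideal_I] ideal.I_r_closed[OF ideal_I]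
		by simp
qed

lemma I_minimal:
	assumes J: "two_sided J" "rels \<subseteq> J"
	shows "I \<subseteq> J"
	unfolding suzuki_ideal_def
proof (rule ring.genideal_minimal[OF ring_free_alg _ J(2)])
	interpret ring free_alg_ring by (rule ring_free_alg)
	show "ideal J free_alg_ring"
	proof (rule idealI[OF ring_free_alg])
		show "subgroup J (add_monoid free_alg_ring)"
			by (rule add.subgroupI) (use J two_sided_uminus[OF J(1)] in "auto simp: two_sided_def free_alg_uminus")
	qed (use J in "auto simp: two_sided_def")
qed

lemma cls_eq: "cls p = cls q \<longleftrightarrow> p - q : I"
proof -
	interpret ring free_alg_ring by (rule ring_free_alg)
	have "p \<ominus>\<^bsub>free_alg_ring\<^esub> q = p - q" by (simp add: a_minus_def free_alg_uminus)
	thus ?thesis using quotient_eq_iff_same_a_r_cos[OF ideal_I, of p q] by simp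
qed

lemma cls_mem: "q : cls p \<longleftrightarrow> q - p : I"
	by (auto simp: a_r_coset_def' intro: bexI[of _ "q - p"])

lemma induced_cls:
	assumes "!!q. q - p : I ==> f q = f p"
	shows "induced f (cls p) = f p"
proof (rule induced_eq)
	show "p : cls p" using two_sided_I by (simp add: cls_mem two_sided_def)
	show "f q = f p" if "q : cls p" for q using that assms by (simp only: cls_mem)
qed

lemma A_ext: "carrier A = carrier (suzuki_algebra N n 1 mm)" "mult A = mult (suzuki_algebra N n 1 mm)"
	"add A = add (suzuki_algebra N n 1 mm)" "\<one>\<^bsub>A\<^esub> = \<one>\<^bsub>suzuki_algebra N n 1 mm\<^esub>" "module.smult A = module.smult (suzuki_algebra N n 1 mm)"
	unfolding A suzuki_def module_extend_simps by (rule HOL.refl)+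

lemma A_simps:
	"carrier A = range cls" "cls p \<otimes>\<^bsub>A\<^esub> cls q = cls (p * q)" "cls p \<oplus>\<^bsub>A\<^esub> cls q = cls (p + q)" "\<one>\<^bsub>A\<^esub> = cls 1"
	"c \<odot>\<^bsub>A\<^esub> cls p = cls (fconst c * p)"
proof -
	interpret ideal I free_alg_ring by (rule ideal_I)
	have 0: "carrier A = carrier (free_alg_ring Quot I)" "mult A = mult (free_alg_ring Quot I)" "add A = add (free_alg_ring Quot I)"
		"\<one>\<^bsub>A\<^esub> = \<one>\<^bsub>free_alg_ring Quot I\<^esub>" "module.smult A = (%c. induced (%p. cls (fconst c * p)))"
		unfolding A_ext suzuki_algebra_def ring_extend_simps by (rule HOL.refl)+
	show "carrier A = range cls" by (auto simp: 0 FactRing_def A_RCOSETS_def')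
	show "cls p \<otimes>\<^bsub>A\<^esub> cls q = cls (p * q)" using rcoset_mult_add[of p q] by (simp add: 0 FactRing_def)
	show "cls p \<oplus>\<^bsub>A\<^esub> cls q = cls (p + q)" using a_rcos_sum[of p q] by (simp add: 0 FactRing_def)
	show "\<one>\<^bsub>A\<^esub> = cls 1" by (simp add: 0 FactRing_def)
	show "c \<odot>\<^bsub>A\<^esub> cls p = cls (fconst c * p)"
		unfolding 0
	proof (rule induced_cls)
		fix q assume "q - p : I"
		hence "fconst c * (q - p) : I" using two_sided_I by (simp add: two_sided_def)
		thus "cls (fconst c * q) = cls (fconst c * p)" by (simp add: cls_eq right_diff_distrib)
	qed
qed

lemma cls_closed [simp]: "cls p : carrier A"
	by (simp add: A_simps)

lemma carrier_A: "a : carrier A ==> \<exists>p. a = cls p"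
	by (auto simp: A_simps)

lemma A_closed: "a : carrier A ==> b : carrier A ==> a \<oplus>\<^bsub>A\<^esub> b : carrier A" "a : carrier A ==> c \<odot>\<^bsub>A\<^esub> a : carrier A"
	using A_simps(3,5) by (auto simp: A_simps(1))

lemma parity: "[idx_val i - idx_val j = idx_val l - idx_val m] (mod 2) \<longleftrightarrow> (i = j) = (l = m)"
	by (cases i; cases j; cases l; cases m) (simp_all add: cong_def)

lemma rels_cases:
	assumes "r : rels"
	obtains "r = gen I1 I1 ^ 2 - gen I2 I2 ^ 2" | "r = gen I1 I2 ^ 2 - gen I2 I1 ^ 2"
		| i j l m where "r = gen i j * gen l m" "(i = j) ~= (l = m)"
		| "r = gen I1 I1 ^ (2 * N) + gen I1 I2 ^ (2 * N) - 1"
		| "r = alte n (gen I1 I1) (gen I2 I2) - alte n (gen I2 I2) (gen I1 I1)"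
		| "r = alte n (gen I2 I1) (gen I1 I2) - alt_sign n * alte n (gen I1 I2) (gen I2 I1)"
	using assms unfolding suzuki_relators_def parity mm fconst_alt_sign single_one mult_1_left by blast

lemma rels_mem:
	"gen I1 I1 ^ 2 - gen I2 I2 ^ 2 : rels" "gen I1 I2 ^ 2 - gen I2 I1 ^ 2 : rels"
	"(i = j) ~= (l = m) ==> gen i j * gen l m : rels"
	"gen I1 I1 ^ (2 * N) + gen I1 I2 ^ (2 * N) - 1 : rels"
	"alte n (gen I1 I1) (gen I2 I2) - alte n (gen I2 I2) (gen I1 I1) : rels"
	"alte n (gen I2 I1) (gen I1 I2) - alt_sign n * alte n (gen I1 I2) (gen I2 I1) : rels"
	unfolding suzuki_relators_def parity mm fconst_alt_sign single_one mult_1_left by blast+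

lemma suzuki_relations_iff:
	assumes L: "rhom (L :: 'k free_alg => 'b::ring_1)"
	shows "suz_rels N n (%(i, j). L (gen i j)) \<longleftrightarrow> (\<forall>r\<in>rels. L r = 0)"
proof
	assume "suz_rels N n (%(i, j). L (gen i j))"
	then interpret suz_rels N n "%(i, j). L (gen i j)" .
	show "\<forall>r\<in>rels. L r = 0"
	proof
		fix r assume "r : rels"
		thus "L r = 0"
			by (cases rule: rels_cases)
				(use sq cross unit alt1 alt2 in "simp_all add: rhom_simps[OF L] rhom_alternating[OF L]")
	qed
next
	assume *: "\<forall>r\<in>rels. L r = 0"
	note r = rels_mem[THEN *[rule_format]]
	show "suz_rels N n (%(i, j). L (gen i j))"
		by unfold_locales
			(use N n r in "simp_all add: rhom_simps[OF L] rhom_alternating[OF L] split: if_splits")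
qed

lemma rhom_kill:
	assumes L: "rhom (L :: 'k free_alg => 'b::ring_1)" "suz_rels N n (%(i, j). L (gen i j))" and p: "p : I"
	shows "L p = 0"
proof -
	have "two_sided {p. L p = 0}" by (simp add: two_sided_def rhom_simps[OF L(1)])
	from I_minimal[OF this] show ?thesis using L p suzuki_relations_iff[OF L(1)] by auto
qed

lemma arhom_kill:
	assumes L: "arhom (L :: 'k free_alg => 'b::ring_1)" "suz_rels N n (%(i, j). L (gen i j))" and p: "p : I"
	shows "L p = 0"
proof -
	interpret suz_rels N n "%(i, j). L (gen i j)" by (rule L(2))
	have "L r = 0" if "r : rels" for r
		using that by (cases rule: rels_cases)
			(use sq cross unit alt1 alt2 in "auto simp: arhom_simps[OF L(1)]")
	moreover have "two_sided {p. L p = 0}" by (simp add: two_sided_def arhom_simps[OF L(1)])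
	ultimately show ?thesis using I_minimal[of "{p. L p = 0}"] p by blast
qed

lemma counit_rhom: "rhom (free_counit :: 'k free_alg => 'k)"
	unfolding rhom_def free_counit_def by (simp add: id_scalars.free_hom_add id_scalars.free_hom_mult)

lemma counit_I: "p : I ==> free_counit p = 0"
proof (rule rhom_kill[OF counit_rhom])
	have "alte n (0 :: 'k) 0 = 0" "alte n (1 :: 'k) 1 = 1" using n by (simp_all add: alternating_same)
	thus "suz_rels N n (%(i, j). free_counit (gen i j) :: 'k)"
		using N n by unfold_locales (auto simp: free_counit_def intro: idx.exhaust)
qed

text \<open>Makes the quotient by \<open>I\<close> available inside a ring type; the counit serves
  as the augmentation required for this.\<close>

lemma embedding:
	obtains L :: "'k free_alg => 'k free_alg endo" where "rhom L" "!!p. L p = 0 \<longleftrightarrow> p : I"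
	by (rule quotient_embedding[OF two_sided_I counit_rhom counit_I], assumption, rule that)

lemma embedding_relations:
	assumes "rhom (L :: 'k free_alg => 'b::ring_1)" "!!p. p : I ==> L p = 0"
	shows "suz_rels N n (%(i, j). L (gen i j))"
	using assms rels_I suzuki_relations_iff[OF assms(1)] by auto

lemma antipode_arhom: "arhom (free_antipode N :: 'k free_alg => 'k free_alg)"
	unfolding arhom_def free_antipode_def
	by (simp add: fconst_scalars.free_antihom_add fconst_scalars.free_antihom_mult fconst_commute)

lemma antipode_gen: "free_antipode N (gen i j) = (gen j i ^ (2 * N - 1) :: 'k free_alg)"
	by (simp add: free_antipode_def)

text \<open>Modulo \<open>I\<close> the generators satisfy the relations, hence so do the powers
  that define the antipode. So the antipode followed by the embedding kills
  \<open>I\<close>.\<close>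

lemma antipode_I:
	assumes "p : I"
	shows "free_antipode N p : I"
proof -
	obtain L :: "'k free_alg => 'k free_alg endo" where L: "rhom L" "!!p. L p = 0 \<longleftrightarrow> p : I" by (rule embedding, rule that)
	have "suz_rels N n (%(i, j). L (gen i j))" using L by (intro embedding_relations) auto
	from suz_rels.antipode[OF this]
	have "suz_rels N n (%(i, j). L (free_antipode N (gen i j)))"
		by (simp add: antipode_gen rhom_simps[OF L(1)])
	moreover have "arhom (%p. L (free_antipode N p))"
		using L(1) antipode_arhom by (simp add: arhom_def rhom_def)
	ultimately show ?thesis using arhom_kill[of "%p. L (free_antipode N p)"] assms L(2) by blast
qed

lemma counit_A: "counit A (cls p) = free_counit p"
proof -
	have "counit A = induced free_counit"
		by (simp add: A suzuki_def module.defs hopf_algebra.defs)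
	moreover have "free_counit q = free_counit p" if "q - p : I" for q
		using counit_I[OF that] by (simp add: rhom_simps[OF counit_rhom])
	ultimately show ?thesis by (simp add: induced_cls)
qed

lemma antipode_A: "antipode A (cls p) = cls (free_antipode N p)"
proof -
	have "antipode A = induced (%p. cls (free_antipode N p))"
		by (simp add: A suzuki_def module.defs hopf_algebra.defs)
	moreover have "cls (free_antipode N q) = cls (free_antipode N p)" if "q - p : I" for q
		using antipode_I[OF that] by (simp add: cls_eq arhom_simps[OF antipode_arhom])
	ultimately show ?thesis by (simp add: induced_cls)
qed

end


subsection \<open>The comultiplication\<close>

type_synonym 'k free_alg2 = "(idx \<times> idx) free_monoid \<times> (idx \<times> idx) free_monoid \<Rightarrow>\<^sub>0 'k"

definition ten_l :: "'k::comm_ring_1 free_alg => 'k free_alg2" where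
	"ten_l = lin fconst (%u. sgl (u, 0) 1)"

definition ten_r :: "'k::comm_ring_1 free_alg => 'k free_alg2" where
	"ten_r = lin fconst (%u. sgl (0, u) 1)"

lemma ten_single: "ten_l (sgl u c) = sgl (u, 0) c" "ten_r (sgl u c) = sgl (0, u) c"
	by (simp_all add: ten_l_def ten_r_def mult_single)

lemma rhom_ten_l: "rhom ten_l" and rhom_ten_r: "rhom ten_r"
	unfolding rhom_def ten_l_def ten_r_def
	by (simp_all add: fconst_scalars.lin_add fconst_scalars.lin_mult fconst_scalars.lin_one mult_single fconst_commute zero_prod_def[symmetric])

lemma ten_commute: "ten_r q * ten_l p = ten_l p * ten_r q"
proof (induction p rule: pm_induct)
	case (single u c)
	show ?case
		by (induction q rule: pm_induct)
			(simp_all add: ten_single mult_single mult.commute rhom_simps[OF rhom_ten_r] distrib_left distrib_right)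
qed (simp_all add: rhom_simps[OF rhom_ten_l] distrib_left distrib_right)

lemma single_ten: "sgl (u, v) c = ten_l (sgl u c) * ten_r (sgl v 1)"
	by (simp add: ten_single mult_single)

lemma rhom_comult: "rhom (free_comult :: 'k::comm_ring_1 free_alg => 'k free_alg2)"
	unfolding rhom_def free_comult_def
	by (simp add: fconst_scalars.free_hom_add fconst_scalars.free_hom_mult fconst_commute)

lemma comult_gen: "free_comult (gen i j) = ten_l (gen i I1) * ten_r (gen I1 j) + ten_l (gen i I2) * ten_r (gen I2 j)"
	unfolding free_comult_def fconst_scalars.free_hom_gen by (simp add: gen_def ten_single mult_single)

context suzuki_alg
begin

text \<open>The ideal \<open>I \<otimes> F + F \<otimes> I\<close> in the tensor square of the free
  algebra \<open>F\<close>; it dies in \<open>A \<otimes> A\<close>.\<close>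

inductive_set K2 :: "'k free_alg2 set" where
	zero: "0 : K2"
| plus: "s : K2 ==> t : K2 ==> s + t : K2"
| gen: "p : I \<or> q : I ==> ten_l p * ten_r q : K2"

lemma two_sided_K2: "two_sided K2"
proof -
	have "s * t : K2 & t * s : K2" if "t : K2" for s t
	proof (induction s rule: pm_induct)
		case (single x c)
		obtain u v where x: "x = (u, v)" by fastforce
		have I: "a * b : I" "b * a : I" if "b : I" for a b using two_sided_I that by (simp_all add: two_sided_def)
		from that show ?case
		proof induction
			case (gen p q)
			let ?u = "sgl u c" and ?v = "sgl v 1 :: 'k free_alg"
			have "sgl x c * (ten_l p * ten_r q) = ten_l (?u * p) * ten_r (?v * q)"
				"ten_l p * ten_r q * sgl x c = ten_l (p * ?u) * ten_r (q * ?v)"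
				unfolding x single_ten rhom_simps(3)[OF rhom_ten_l] rhom_simps(3)[OF rhom_ten_r]
				by (rule mult_swap[OF ten_commute])+
			moreover have "?u * p : I \<or> ?v * q : I" "p * ?u : I \<or> q * ?v : I" using gen I by blast+
			ultimately show ?case by (simp add: K2.gen)
		qed (auto simp: distrib_left distrib_right intro: K2.intros)
	qed (auto simp: distrib_left distrib_right intro: K2.intros)
	thus ?thesis by (simp add: two_sided_def K2.zero K2.plus)
qed

text \<open>The tensor square of the counit, the augmentation that allows the quotient by
  \<open>K2\<close> to be embedded in a ring type.\<close>

definition counit2 :: "'k free_alg2 => 'k" where
	"counit2 = lin (%c. c) (%(u, v). free_counit (sgl u 1) * free_counit (sgl v 1))"

lemma counit_single_add: "free_counit (sgl (u + v) 1) = free_counit (sgl u 1) * (free_counit (sgl v 1) :: 'k)"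
	using rhom_simps(3)[OF counit_rhom, of "sgl u 1" "sgl v 1"] by (simp add: mult_single)

lemma rhom_counit2: "rhom counit2"
	unfolding rhom_def
proof (intro conjI allI)
	show "counit2 1 = 1" unfolding counit2_def
		by (rule id_scalars.lin_one) (simp add: zero_prod_def rhom_simps(1)[OF counit_rhom])
	show "counit2 (p + q) = counit2 p + counit2 q" for p q by (simp add: counit2_def id_scalars.lin_add)
	show "counit2 (p * q) = counit2 p * counit2 q" for p q
		unfolding counit2_def by (rule id_scalars.lin_mult) (auto simp: counit_single_add)
qed

lemma counit2_K2: "t : K2 ==> counit2 t = 0"
proof (induction rule: K2.induct)
	case (gen p q)
	have "counit2 (ten_l p) = free_counit p" for p
	proof (induction p rule: pm_induct)
		case (single u c)
		have "free_counit (fconst c * sgl u 1) = c * free_counit (sgl u 1)"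
			unfolding rhom_simps(3)[OF counit_rhom] by (simp add: free_counit_def)
		thus ?case using rhom_simps(1)[OF counit_rhom] by (simp add: ten_single counit2_def mult_single)
	qed (simp_all add: rhom_simps[OF rhom_ten_l] rhom_simps[OF rhom_counit2] rhom_simps[OF counit_rhom])
	moreover have "counit2 (ten_r p) = free_counit p" for p
	proof (induction p rule: pm_induct)
		case (single u c)
		have "free_counit (fconst c * sgl u 1) = c * free_counit (sgl u 1)"
			unfolding rhom_simps(3)[OF counit_rhom] by (simp add: free_counit_def)
		thus ?case using rhom_simps(1)[OF counit_rhom] by (simp add: ten_single counit2_def mult_single)
	qed (simp_all add: rhom_simps[OF rhom_ten_r] rhom_simps[OF rhom_counit2] rhom_simps[OF counit_rhom])
	ultimately show ?case using gen counit_I by (auto simp: rhom_simps[OF rhom_counit2])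
qed (simp_all add: rhom_simps[OF rhom_counit2])

text \<open>Modulo \<open>K2\<close> the two tensor legs are commuting solutions of the relations,
  so \<open>suzuki_comult\<close> applies to their combination.\<close>

lemma comult_K2:
	assumes "p : I"
	shows "free_comult p : K2"
proof -
	obtain L :: "'k free_alg2 => 'k free_alg2 endo" where L: "rhom L" "!!t. L t = 0 \<longleftrightarrow> t : K2"
		by (rule quotient_embedding[OF two_sided_K2 rhom_counit2 counit2_K2], assumption, rule that)
	have K: "ten_l p : K2 & ten_r p : K2" if "p : I" for p
		using K2.gen[of p 1] K2.gen[of 1 p] that by (simp add: rhom_simps[OF rhom_ten_l] rhom_simps[OF rhom_ten_r])
	have "suz_rels N n (%(i, j). L (ten_l (gen i j)))" "suz_rels N n (%(i, j). L (ten_r (gen i j)))"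
		by (rule embedding_relations[OF rhom_comp[OF rhom_ten_l L(1)]], use K L(2) in blast)
			(rule embedding_relations[OF rhom_comp[OF rhom_ten_r L(1)]], use K L(2) in blast)
	note rels = this
	have c: "L (ten_r p) * L (ten_l q) = L (ten_l q) * L (ten_r p)" for p q
		by (simp only: rhom_simps(3)[OF L(1), symmetric] ten_commute)
	have "(case q of (i, j) => L (ten_r (gen i j))) * (case p of (i, j) => L (ten_l (gen i j))) =
			(case p of (i, j) => L (ten_l (gen i j))) * (case q of (i, j) => L (ten_r (gen i j)))" for p q
		by (simp add: split_beta c)
	from suzuki_comult[OF rels this]
	have "suz_rels N n (%(i, j). L (free_comult (gen i j)))"
		by (simp only: comult_gen rhom_simps[OF L(1)] prod.case)
	from rhom_kill[OF rhom_comp[OF rhom_comult L(1)] this assms] show ?thesis by (simp add: L(2))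
qed

section \<open>Descent of the comultiplication to classes\<close>

abbreviation sp :: "'k free_alg2 => _" where "sp == suzuki_project N n 1 mm"
abbreviation cw :: "(idx \<times> idx) free_monoid => 'k free_alg set" where "cw u == cls (sgl u 1)"

lemma sp_superset:
	assumes "finite S" "kys t \<subseteq> S"
	shows "sp t = (\<Sum>x\<in>S. sgl (cw (fst x), cw (snd x)) (lkp t x))"
	unfolding suzuki_project_def case_prod_unfold prod.collapse
	using assms by (intro sum.mono_neutral_left) (auto simp: in_keys_iff)

lemma sp_add: "sp (s + t) = sp s + sp t"
proof -
	let ?S = "kys s \<union> kys t"
	show ?thesis
		using sp_superset[of ?S "s + t"] sp_superset[of ?S s] sp_superset[of ?S t] keys_add[of s t]
		by (simp add: lookup_add single_add sum.distrib)
qed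

lemma sp_zero: "sp 0 = 0"
	by (simp add: suzuki_project_def)

lemma sp_single: "sp (sgl (u, v) c) = sgl (cw u, cw v) c"
	using sp_superset[of "{(u, v)}" "sgl (u, v) c"] by simp

lemma sp_diff: "sp (s - t) = sp s - sp t"
	using sp_add[of "s - t" t] by simp

lemma null_uminus: "t : tensor_null A ==> - t : tensor_null A"
proof -
	have "- t = fscale (- 1) t" by (rule poly_mapping_eqI) simp
	thus "t : tensor_null A ==> - t : tensor_null A" by (simp only: tensor_null.scale)
qed

lemma null_diff: "s : tensor_null A ==> t : tensor_null A ==> s - t : tensor_null A"
	using tensor_null.plus[of s A "- t"] null_uminus[of t] by simp

lemma null_zero: "ptensor (cls 0) b : tensor_null A" "ptensor b (cls 0) : tensor_null A" if "b : carrier A"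
proof -
	have 0: "fscale 0 t = 0" for t :: "'k free_alg set \<times> 'k free_alg set \<Rightarrow>\<^sub>0 'k" by (rule poly_mapping_eqI) simp
	show "ptensor (cls 0) b : tensor_null A" "ptensor b (cls 0) : tensor_null A"
		using tensor_null.smult_left[of "cls 0" A b 0] tensor_null.smult_right[of b A "cls 0" 0] that
		by (simp_all add: A_simps 0)
qed

text \<open>The projection is defined on pairs of words; bilinearity modulo null tensors extends its
  description to pairs of arbitrary elements.\<close>

lemma sp_tensor: "sp (ten_l p * ten_r q) - ptensor (cls p) (cls q) : tensor_null A"
proof (induction p rule: pm_induct)
	case zero
	show ?case using null_uminus[OF null_zero(1)[of "cls q"]] by (simp add: rhom_simps[OF rhom_ten_l] sp_zero)
next
	case (single u c)
	show ?case
	proof (induction q rule: pm_induct)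
		case zero
		show ?case using null_uminus[OF null_zero(2)] by (simp add: rhom_simps[OF rhom_ten_r] sp_zero)
	next
		case (single v d)
		have 1: "cls (sgl u c) = c \<odot>\<^bsub>A\<^esub> cw u" "cls (sgl v d) = d \<odot>\<^bsub>A\<^esub> cw v"
			by (simp_all add: A_simps mult_single)
		have "ptensor (c \<odot>\<^bsub>A\<^esub> cw u) (d \<odot>\<^bsub>A\<^esub> cw v) - fscale c (ptensor (cw u) (d \<odot>\<^bsub>A\<^esub> cw v)) : tensor_null A"
			by (rule tensor_null.smult_left) (auto simp: A_closed)
		moreover have "fscale c (ptensor (cw u) (d \<odot>\<^bsub>A\<^esub> cw v) - fscale d (ptensor (cw u) (cw v))) : tensor_null A"
			by (intro tensor_null.scale tensor_null.smult_right) auto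
		ultimately have "(ptensor (c \<odot>\<^bsub>A\<^esub> cw u) (d \<odot>\<^bsub>A\<^esub> cw v) - fscale c (ptensor (cw u) (d \<odot>\<^bsub>A\<^esub> cw v))) +
				fscale c (ptensor (cw u) (d \<odot>\<^bsub>A\<^esub> cw v) - fscale d (ptensor (cw u) (cw v))) : tensor_null A"
			by (rule tensor_null.plus)
		also have "fscale c (s - t) = fscale c s - fscale c t" for s t :: "'k free_alg set \<times> 'k free_alg set \<Rightarrow>\<^sub>0 'k"
			by (rule poly_mapping_eqI) (simp add: lookup_minus right_diff_distrib)
		finally have "ptensor (c \<odot>\<^bsub>A\<^esub> cw u) (d \<odot>\<^bsub>A\<^esub> cw v) - sgl (cw u, cw v) (c * d) : tensor_null A"
			by (simp add: fscale_single)
		from null_uminus[OF this] show ?case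
			unfolding 1 by (simp add: ten_single mult_single sp_single)
	next
		case (add s t)
		let ?p = "sgl u c"
		have "ptensor (cls ?p) (cls s \<oplus>\<^bsub>A\<^esub> cls t) - ptensor (cls ?p) (cls s) - ptensor (cls ?p) (cls t) : tensor_null A"
			by (rule tensor_null.add_right) auto
		from null_diff[OF tensor_null.plus[OF add] this] show ?case
			by (simp add: rhom_simps[OF rhom_ten_r] distrib_left sp_add A_simps algebra_simps)
	qed
next
	case (add s t)
	have "ptensor (cls s \<oplus>\<^bsub>A\<^esub> cls t) (cls q) - ptensor (cls s) (cls q) - ptensor (cls t) (cls q) : tensor_null A"
		by (rule tensor_null.add_left) auto
	from null_diff[OF tensor_null.plus[OF add] this] show ?case
		by (simp add: rhom_simps[OF rhom_ten_l] distrib_right sp_add A_simps algebra_simps)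
qed

lemma sp_K2: "t : K2 ==> sp t : tensor_null A"
proof (induction rule: K2.induct)
	case (gen p q)
	hence "cls p = cls 0 \<or> cls q = cls 0" by (auto simp: cls_eq)
	hence "ptensor (cls p) (cls q) : tensor_null A" using null_zero by (metis cls_closed)
	from tensor_null.plus[OF sp_tensor[of p q] this] show ?case by simp
qed (auto simp: sp_zero sp_add intro: tensor_null.intros)

lemma comult_A: "comult A (cls p) = tensor_class A (sp (free_comult p))"
proof -
	have "comult A = induced (%p. tensor_class (suzuki_algebra N n 1 mm) (sp (free_comult p)))"
		by (simp add: A suzuki_def module.defs hopf_algebra.defs)
	also have "tensor_class (suzuki_algebra N n 1 mm) = tensor_class A"
		by (intro ext tensor_class_cong) (simp_all only: A_ext)
	finally have "comult A = induced (%p. tensor_class A (sp (free_comult p)))" .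
	moreover have "tensor_class A (sp (free_comult q)) = tensor_class A (sp (free_comult p))" if "q - p : I" for q
	proof -
		have d: "sp (free_comult q) - sp (free_comult p) : tensor_null A"
			using sp_K2[OF comult_K2[OF that]] by (simp add: rhom_simps[OF rhom_comult] sp_diff)
		have "s - sp (free_comult q) : tensor_null A \<longleftrightarrow> s - sp (free_comult p) : tensor_null A" for s
			using tensor_null.plus[OF _ d, of "s - sp (free_comult q)"] null_diff[OF _ d, of "s - sp (free_comult p)"] by auto
		thus ?thesis by (simp add: tensor_class_def)
	qed
	ultimately show ?thesis by (simp add: induced_cls)
qed

lemma comult_some: "(SOME s. s : comult A (cls p)) : tensor_class A (sp (free_comult p))"
proof -
	have "kys (sp t) \<subseteq> carrier A \<times> carrier A" for t
		unfolding suzuki_project_def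
		by (rule order_trans[OF keys_sum UN_least]) (auto split: if_splits)
	hence "sp (free_comult p) : comult A (cls p)" unfolding comult_A by (rule tensor_class_self)
	hence "(SOME s. s : comult A (cls p)) : comult A (cls p)" by (rule someI)
	thus ?thesis by (simp only: comult_A)
qed

end

section \<open>Modules over Suzuki's algebras\<close>

definition gX :: "'k::comm_ring_1 free_alg" where "gX = gen I1 I1 + gen I1 I2"
definition gY :: "'k::comm_ring_1 free_alg" where "gY = gen I2 I2 + gen I2 I1"
definition gP :: "nat => 'k::comm_ring_1 free_alg" where "gP N = gen I1 I1 ^ (2 * N) - gen I1 I2 ^ (2 * N)"
definition gW :: "nat => nat => 'k::comm_ring_1 free_alg" where
	"gW N n = (if odd n then gP N else 1) * (gY * gX ^ (2 * N - 1))"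

lemma rhom_g:
	assumes L: "rhom L" and S: "suz_rels N n (%(i, j). L (gen i j))"
	shows "L gX = suz_rels.X (%(i, j). L (gen i j))" "L gY = suz_rels.Y (%(i, j). L (gen i j))"
		"L (gP N) = suz_rels.P N (%(i, j). L (gen i j))"
		"L (gW N n) = suz_rels.Q N n (%(i, j). L (gen i j)) * suz_rels.V N (%(i, j). L (gen i j))"
proof -
	interpret suz_rels N n "%(i, j). L (gen i j)" by (rule S)
	show "L gX = X" "L gY = Y" "L (gP N) = P" "L (gW N n) = Q * V"
		by (simp_all add: gX_def gY_def gP_def gW_def X_def Y_def P_def Q_def V_def rhom_simps[OF L])
qed

context suz_rels
begin

text \<open>The inverse of \<open>w\<close> in terms of \<open>X\<close> and the inverse of
  \<open>Y\<close>, both written as powers; it serves to compare the dual module with the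
  contragredient triple.\<close>

lemma W_inv: "(Q * V) ^ (2 * n - 1) = Q * (X * Y ^ (2 * N - 1))"
proof -
	interpret D: dih_rels N n "X ^ 2" "X ^ N" "Q * V" by (rule dihedral)
	have Y2N: "Y * Y ^ (2 * N - 1) = 1"
	proof -
		have "Y ^ (2 * N - 1) * Y = Y ^ (2 * N)"
			by (rule power_minus_mult) (use N_pos in simp)
		hence "Y * Y ^ (2 * N - 1) = Y ^ (2 * N)" by (simp only: power_commutes)
		also have "... = X ^ (2 * N)" by (simp only: power_mult power2_eq_square YY)
		finally show ?thesis by (simp only: X_2N)
	qed
	have "(Q * V) * (Q * (X * Y ^ (2 * N - 1))) = Q * Q * (V * X * Y ^ (2 * N - 1))"
		unfolding mult_swap[OF Q_comm(3)[symmetric]] by (simp only: mult.assoc)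
	also have "... = 1" by (simp only: QQ VX Y2N mult_1_left)
	finally have "(Q * V) ^ (2 * n - 1) * ((Q * V) * (Q * (X * Y ^ (2 * N - 1)))) = (Q * V) ^ (2 * n - 1)" by simp
	thus ?thesis unfolding mult.assoc[symmetric, of "(Q * V) ^ (2 * n - 1)" "Q * V"] D.w_inv by simp
qed

end

definition itw :: "'k::field mat => nat => nat => 'k mat => 'k mat => bool" where
	"itw P d e A B \<longleftrightarrow> A : sqm d & B : sqm e & P * A = B * P"

lemma itw_intros:
	assumes P: "P : carrier_mat e d"
	shows "itw P d e A B ==> itw P d e A' B' ==> itw P d e (A * A') (B * B')"
		"itw P d e A B ==> itw P d e A' B' ==> itw P d e (A + A') (B + B')"
		"itw P d e A B ==> itw P d e A' B' ==> itw P d e (A - A') (B - B')"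
		"itw P d e (idm d) (idm e)"
		"itw P d e A B ==> itw P d e (c \<cdot> A) (c \<cdot> B)"
		"itw P d e A B ==> itw P d e (A ^m k) (B ^m k)"
proof -
	show "itw P d e (A * A') (B * B')" if "itw P d e A B" "itw P d e A' B'"
	proof -
		have C: "A : sqm d" "A' : sqm d" "B : sqm e" "B' : sqm e"
			and PA: "P * A = B * P" "P * A' = B' * P" using that by (auto simp: itw_def)
		have "P * (A * A') = B * P * A'" using assoc_mult_mat[OF P C(1,2)] by (simp add: PA)
		also have "... = B * (P * A')" by (rule assoc_mult_mat[OF C(3) P C(2)])
		also have "... = B * B' * P" unfolding PA by (rule assoc_mult_mat[OF C(3,4) P, symmetric])
		finally show ?thesis using C by (simp add: itw_def)
	qed
	show "itw P d e (A + A') (B + B')" "itw P d e (A - A') (B - B')" if "itw P d e A B" "itw P d e A' B'"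
	proof -
		have C: "A : sqm d" "A' : sqm d" "B : sqm e" "B' : sqm e"
			and PA: "P * A = B * P" "P * A' = B' * P" using that by (auto simp: itw_def)
		have "P * (A + A') = (B + B') * P" "P * (A - A') = (B - B') * P"
			unfolding mult_add_distrib_mat[OF P C(1,2)] add_mult_distrib_mat[OF C(3,4) P]
				mult_minus_distrib_mat[OF P C(1,2)] minus_mult_distrib_mat[OF C(3,4) P] PA by (rule HOL.refl)+
		thus "itw P d e (A + A') (B + B')" "itw P d e (A - A') (B - B')"
			using C minus_carrier_mat[OF C(2), of A] minus_carrier_mat[OF C(4), of B] by (simp_all add: itw_def)
	qed
	show "itw P d e (idm d) (idm e)" using P by (simp add: itw_def)
	show "itw P d e (c \<cdot> A) (c \<cdot> B)" if "itw P d e A B"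
		using that mult_smult_distrib[OF P, of A d c] mult_smult_assoc_mat[OF _ P, of B e c] by (simp add: itw_def)
	show "itw P d e A B ==> itw P d e (A ^m k) (B ^m k)"
		using P by (auto simp: itw_def pow_intw)
qed

lemma opr_diff:
	assumes "d > 0" "A : sqm d" "B : sqm d"
	shows "opr d (A - B) = opr d A - opr d B"
proof -
	have "opr d ((A - B) + B) = opr d (A - B) + opr d B" using assms by (intro opr_add) auto
	also have "(A - B) + B = A" using assms by (intro eq_matI) auto
	finally show ?thesis by simp
qed

lemma opr_lin_act:
	assumes d: "d > 0" and M: "!!x. M x : sqm d"
	shows "opr d (lin_act d M t) = lin op_scalar (%x. opr d (M x)) t"
proof (induction t rule: pm_induct)
	case (single x c)
	show ?case using d M by (simp add: lin_act_single opr_smult)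
next
	case (add s t)
	have "lin_act d M s : sqm d" "lin_act d M t : sqm d" by (auto intro: carrier_matI)
	thus ?case using add d by (simp add: lin_act_simps op_scalar.lin_add opr_add)
qed (use d in "simp add: lin_act_simps")

lemma lin_act_carrier [simp]: "lin_act d M t : sqm d"
	by (auto intro: carrier_matI)

lemma rhom_op_scalar: "rhom op_scalar"
	by (simp add: rhom_def op_scalar.io_add op_scalar.io_mult op_scalar.io_1)

lemma smult_smult: "c \<cdot> (d \<cdot> M) = (c * d) \<cdot> (M :: 'k::comm_ring_1 mat)"
	by (rule eq_matI) (auto simp: mult.assoc)

section \<open>Modules as matrix solutions of the relations\<close>

context suzuki_alg
begin

lemma fdI:
	assumes C: "!!p. rh (cls p) : sqm d"
		and r: "d > 0 ==> rhom (%p. opr d (rh (cls p)))" "!!c. d > 0 ==> opr d (rh (cls (fconst c))) = op_scalar c"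
	shows "(d, rh) : fdms A"
proof (rule fd_modulesI)
	show "rh a : sqm d" if "a : carrier A" for a using carrier_A[OF that] C by blast
	show "rh \<one>\<^bsub>A\<^esub> = idm d"
		unfolding A_simps by (rule mat_eq_opr[OF C]) (use rhom_simps(1)[OF r(1)] in auto)
	fix a assume "a : carrier A"
	then obtain p where a: "a = cls p" using carrier_A by blast
	show "rh (c \<odot>\<^bsub>A\<^esub> a) = c \<cdot> rh a" for c
		unfolding a A_simps
		by (rule mat_eq_opr[OF C]) (use C rhom_simps(3)[OF r(1)] r(2) in "auto simp: opr_smult")
	fix b assume "b : carrier A"
	then obtain q where b: "b = cls q" using carrier_A by blast
	show "rh (a \<otimes>\<^bsub>A\<^esub> b) = rh a * rh b" unfolding a b A_simps
		by (rule mat_eq_opr[OF C mult_carrier_mat[OF C C]]) (use rhom_simps(3)[OF r(1)] C in "simp add: opr_mult")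
	show "rh (a \<oplus>\<^bsub>A\<^esub> b) = rh a + rh b" unfolding a b A_simps
		by (rule mat_eq_opr[OF C add_carrier_mat[OF C]]) (use rhom_simps(2)[OF r(1)] C in "simp add: opr_add")
qed

definition vr :: "('k, 'k free_alg set) matmod => 'k free_alg => 'k mat" where
	"vr V p = snd V (cls p)"

lemma vr_simps:
	assumes V: "V : fdms A"
	shows "vr V p : carrier_mat (fst V) (fst V)" "vr V 1 = idm (fst V)" "vr V (p * q) = vr V p * vr V q"
		"vr V (p + q) = vr V p + vr V q" "vr V (fconst c * p) = c \<cdot> vr V p" "vr V (p ^ k) = vr V p ^m k"
proof -
	note F = fd_modulesD[OF V]
	show 1: "vr V p : carrier_mat (fst V) (fst V)" for p unfolding vr_def by (rule F(1)) simp
	show 2: "vr V 1 = idm (fst V)" using F(2) by (simp add: vr_def A_simps)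
	show 3: "vr V (p * q) = vr V p * vr V q" for p q using F(3)[of "cls p" "cls q"] by (simp add: vr_def A_simps)
	show "vr V (p + q) = vr V p + vr V q" using F(4)[of "cls p" "cls q"] by (simp add: vr_def A_simps)
	show "vr V (fconst c * p) = c \<cdot> vr V p" using F(5)[of "cls p" c] by (simp add: vr_def A_simps)
	show "vr V (p ^ k) = vr V p ^m k"
	proof (induction k)
		case 0
		show ?case using 1[of p] 2 by simp
	next
		case (Suc k)
		thus ?case by (simp add: power_Suc2 3 del: power_Suc)
	qed
qed

lemma rhom_vr:
	assumes V: "V : fdms A" and d: "fst V > 0"
	shows "rhom (%p. opr (fst V) (vr V p))" "suz_rels N n (%(i, j). opr (fst V) (vr V (gen i j)))"
proof -
	show r: "rhom (%p. opr (fst V) (vr V p))"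
		unfolding rhom_def using vr_simps[OF V] d by (simp add: opr_mult opr_add)
	have "opr (fst V) (vr V p) = 0" if "p : I" for p
	proof -
		have "cls p = cls 0" using that by (simp add: cls_eq)
		hence "vr V p = vr V 0" by (simp add: vr_def)
		thus ?thesis using rhom_simps(4)[OF r] by simp
	qed
	thus "suz_rels N n (%(i, j). opr (fst V) (vr V (gen i j)))" by (intro embedding_relations r)
qed

lemma vr_zero: "V : fdms A ==> vr V 0 = zm (fst V) (fst V)"
	using vr_simps[of V] rhom_simps(4)[OF rhom_vr(1)] by (intro mat_eq_opr[of _ "fst V"]) auto

lemma module_intertwine:
	assumes V: "V : fdms A" "W : fdms A" and P: "P : carrier_mat (fst W) (fst V)"
		and gen: "!!i j. P * vr V (gen i j) = vr W (gen i j) * P"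
	shows "mod_inter A V W P"
proof -
	note R = vr_simps[OF V(1)] vr_simps[OF V(2)]
	note T = itw_intros[OF P]
	have "itw P (fst V) (fst W) (vr V p) (vr W p)" for p
	proof (induction p rule: gen_induct)
		case (const c)
		have "itw P (fst V) (fst W) (vr V (fconst c * 1)) (vr W (fconst c * 1))"
			unfolding R(2,5,8,11) by (intro T)
		thus ?case by simp
	next
		case (gen i j)
		show ?case using gen[of i j] assms(4) R by (simp add: itw_def)
	qed (auto simp: R intro: T)
	hence "P * vr V p = vr W p * P" for p by (simp add: itw_def)
	thus ?thesis unfolding mod_inter_def using P carrier_A by (auto simp: vr_def)
qed

lemma trivial_fd: "tmod A : fdms A"
	and vr_trivial: "vr (tmod A) p = free_counit p \<cdot> idm 1"
proof -
	have m: "mat 1 1 (%_. c) = c \<cdot> idm 1" for c :: 'k by (rule eq_matI) auto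
	show "vr (tmod A) p = free_counit p \<cdot> idm 1"
		by (simp only: vr_def trivial_module_def snd_conv counit_A m)
	have o: "opr 1 (mat 1 1 (%_. counit A (cls p))) = op_scalar (free_counit p)" for p
		unfolding m counit_A by (subst opr_smult) auto
	have "free_counit (fconst c) = c" for c :: 'k by (simp add: free_counit_def)
	thus "tmod A : fdms A"
		unfolding trivial_module_def by (intro fdI) (simp_all only: o rhom_comp[OF counit_rhom rhom_op_scalar], auto)
qed

lemma vr_tensor:
	assumes V: "V : fdms A" "W : fdms A"
	shows "vr (mten A V W) p = lin_act (fst V * fst W)
		(%(u, v). kro (vr V (sgl u 1)) (vr W (sgl v 1))) (free_comult p)"
proof -
	let ?t = "tens_act (fst V) (fst W) (snd V) (snd W)"
		and ?M = "%(u, v). kro (vr V (sgl u 1)) (vr W (sgl v 1))"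
	have "vr (mten A V W) p = ?t (sp (free_comult p))"
		unfolding vr_def module_tensor_simp snd_conv
		by (rule tens_act_tensor_class[OF comult_some V]) (auto intro: A_closed)
	also have "?t (sp s) = lin_act (fst V * fst W) ?M s" for s
	proof (induction s rule: pm_induct)
		case (single x c)
		obtain u v where x: "x = (u, v)" by fastforce
		have C: "vr V q : carrier_mat (fst V) (fst V)" "vr W q : carrier_mat (fst W) (fst W)" for q
			using vr_simps(1)[OF V(1)] vr_simps(1)[OF V(2)] by blast+
		show ?case unfolding x sp_single
			by (subst tens_act_single) (use C kron_carrier[OF C] in "auto simp: vr_def lin_act_single")
	qed (simp_all add: sp_zero sp_add tens_act_zero tens_act_add lin_act_simps)
	finally show ?thesis .
qed

lemma tensor_act:
	assumes V: "V : fdms A" "W : fdms A"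
	shows "lin_act (fst V * fst W)
		(%(u, v). kro (vr V (sgl u 1)) (vr W (sgl v 1))) (ten_l p * ten_r q) =
		kro (vr V p) (vr W q)"
proof -
	note R = vr_simps[OF V(1)] vr_simps[OF V(2)]
	have D: "dim_row (vr V p) = fst V" "dim_col (vr V p) = fst V" "dim_row (vr W p) = fst W" "dim_col (vr W p) = fst W" for p
		using R(1)[of p] R(7)[of p] by auto
	show ?thesis
	proof (induction p rule: pm_induct)
		case (single u c)
		show ?case
		proof (induction q rule: pm_induct)
			case (single v d)
			have s: "vr V (sgl u c) = c \<cdot> vr V (sgl u 1)"
				"vr W (sgl v d) = d \<cdot> vr W (sgl v 1)"
				using R(5)[of c "sgl u 1"] R(11)[of d "sgl v 1"] by (simp_all add: mult_single)
			have "kro (vr V (sgl u 1)) (vr W (sgl v 1)) : carrier_mat (fst V * fst W) (fst V * fst W)"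
				by (rule kron_carrier[OF R(1) R(7)])
			thus ?case
				by (simp add: ten_single mult_single lin_act_single s kron_smult_left kron_smult_right smult_smult mult.commute)
		qed (simp_all add: rhom_simps[OF rhom_ten_r] lin_act_simps vr_zero[OF V(2)] R kron_zero_right kron_add_right D distrib_left)
	qed (simp_all add: rhom_simps[OF rhom_ten_l] lin_act_simps vr_zero[OF V(1)] R kron_zero_left kron_add_left D distrib_right)
qed

lemma tensor_fd:
	assumes V: "V : fdms A" "W : fdms A"
	shows "mten A V W : fdms A"
		and "vr (mten A V W) (gen i j) = kro (vr V (gen i I1)) (vr W (gen I1 j)) + kro (vr V (gen i I2)) (vr W (gen I2 j))"
proof -
	show "vr (mten A V W) (gen i j) = kro (vr V (gen i I1)) (vr W (gen I1 j)) + kro (vr V (gen i I2)) (vr W (gen I2 j))"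
		unfolding vr_tensor[OF V] comult_gen lin_act_simps tensor_act[OF V] ..
	let ?D = "fst V * fst W"
	let ?M = "%(u, v). kro (vr V (sgl u 1)) (vr W (sgl v 1))"
	note R = vr_simps[OF V(1)] vr_simps[OF V(2)]
	have M: "?M x : carrier_mat ?D ?D" for x
		by (cases x) (simp add: kron_carrier[OF R(1) R(7)])
	have s: "snd (mten A V W) (cls p) = lin_act ?D ?M (free_comult p)" for p
		using vr_tensor[OF V] by (simp only: vr_def)
	have M0: "?M 0 = idm ?D" by (simp add: zero_prod_def R kron_one)
	have Mplus: "?M (x + y) = ?M x * ?M y" for x y
	proof -
		have "vr V (sgl (u + v) 1) = vr V (sgl u 1) * vr V (sgl v 1)"
			"vr W (sgl (u + v) 1) = vr W (sgl u 1) * vr W (sgl v 1)" for u v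
			using R(3)[of "sgl u 1" "sgl v 1"] R(9)[of "sgl u 1" "sgl v 1"]
			by (simp_all add: mult_single)
		thus ?thesis using carrier_matD[OF R(1)] carrier_matD[OF R(7)] by (cases x; cases y) (simp add: kron_mult)
	qed
	have "(?D, snd (mten A V W)) : fdms A"
	proof (rule fdI)
		assume D: "?D > 0"
		have o: "opr ?D (lin_act ?D ?M t) = lin op_scalar (%x. opr ?D (?M x)) t" for t by (rule opr_lin_act[OF D M])
		have "rhom (%t. lin op_scalar (%x. opr ?D (?M x)) t)"
			unfolding rhom_def
		proof (intro conjI allI)
			show "lin op_scalar (%x. opr ?D (?M x)) 1 = 1" by (rule op_scalar.lin_one) (simp only: M0 opr_one[OF D])
			show "lin op_scalar (%x. opr ?D (?M x)) (p * q) = lin op_scalar (%x. opr ?D (?M x)) p * lin op_scalar (%x. opr ?D (?M x)) q" for p q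
				by (rule op_scalar.lin_mult) (simp_all only: Mplus opr_mult[OF D M M] opr_scalar_commute)
		qed (rule op_scalar.lin_add)
		from rhom_comp[OF rhom_comult this] show "rhom (%p. opr ?D (snd (mten A V W) (cls p)))" by (simp only: s o)
		have c: "free_comult (fconst c) = fconst c" for c :: 'k by (simp add: free_comult_def)
		show "opr ?D (snd (mten A V W) (cls (fconst c))) = op_scalar c" for c
			unfolding s o c op_scalar.lin_single M0 opr_one[OF D] by simp
	qed (simp add: s)
	thus "mten A V W : fdms A" by (simp add: module_tensor_simp)
qed

lemma dual_fd:
	assumes V: "V : fdms A"
	shows "dmod A V : fdms A"
		and "vr (dmod A V) (gen i j) = trm (vr V (gen j i) ^m (2 * N - 1))"
proof -
	note R = vr_simps[OF V] and S = arhom_simps[OF antipode_arhom]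
	have s: "snd (dmod A V) (cls p) = trm (vr V (free_antipode N p))" for p
		by (cases V) (simp add: antipode_A vr_def)
	show "vr (dmod A V) (gen i j) = trm (vr V (gen j i) ^m (2 * N - 1))"
		unfolding vr_def[of "dmod A V"] s antipode_gen R(6) ..
	have "(fst V, snd (dmod A V)) : fdms A"
	proof (rule fdI)
		assume d: "fst V > 0"
		have T: "trm (vr V p) : carrier_mat (fst V) (fst V)" for p using R(1) by simp
		show "rhom (%p. opr (fst V) (snd (dmod A V) (cls p)))"
			unfolding rhom_def s S R(2,3,4) transpose_mult[OF R(1) R(1)] transpose_add[OF R(1) R(1)] opr_mult[OF d T T] opr_add[OF d T T]
			using d by simp
		have c: "free_antipode N (fconst c) = (fconst c :: 'k free_alg)" for c by (simp add: free_antipode_def)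
		have "vr V (fconst c) = c \<cdot> idm (fst V)" for c using R(5)[of c 1] R(2) by simp
		moreover have "trm (c \<cdot> idm (fst V)) = (c \<cdot> idm (fst V) :: 'k mat)" for c by (rule eq_matI) auto
		ultimately show "opr (fst V) (snd (dmod A V) (cls (fconst c))) = op_scalar c" for c
			using d by (simp add: s c opr_smult)
	qed (use R(1) in "simp add: s")
	thus "dmod A V : fdms A" by (cases V) simp
qed

text \<open>The universal property of the algebra, for matrices: words are evaluated letter by
  letter, and the linear extension kills \<open>I\<close>, so it is constant on classes.\<close>

lemma module_exists:
	fixes x :: "idx \<times> idx => 'k mat"
	assumes d: "d > 0" and x: "!!g. x g : sqm d" "suz_rels N n (%g. opr d (x g))"
	obtains V where "V : fdms A" "fst V = d" "!!p. opr d (vr V p) = free_hom op_scalar (%g. opr d (x g)) p"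
proof -
	define M where "M u = foldr (%g B. x g * B) (letters u) (idm d)" for u
	have f: "foldr (%g B. x g * B) gs (idm d) : sqm d &
			opr d (foldr (%g B. x g * B) gs (idm d)) = prod_list (map (%g. opr d (x g)) gs)" for gs
	proof (induction gs)
		case (Cons g gs)
		have "x g * foldr (%g B. x g * B) gs (idm d) : sqm d"
			using mult_carrier_mat[OF x(1)] Cons by blast
		thus ?case using Cons d x(1)[of g] by (simp add: opr_mult)
	qed (use d in simp)
	have M: "M u : sqm d" for u using f by (simp add: M_def)
	have o: "opr d (lin_act d M p) = free_hom op_scalar (%g. opr d (x g)) p" for p
		unfolding opr_lin_act[OF d M] free_hom_lin by (simp add: M_def f)
	have r: "rhom (free_hom op_scalar (%g. opr d (x g)))"
		unfolding rhom_def by (simp add: op_scalar.free_hom_add op_scalar.free_hom_mult opr_scalar_commute)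
	have "(%(i, j). free_hom op_scalar (%g. opr d (x g)) (gen i j)) = (%g. opr d (x g))" by (auto simp: fun_eq_iff)
	hence kill: "free_hom op_scalar (%g. opr d (x g)) p = 0" if "p : I" for p
		using rhom_kill[OF r _ that] x(2) by simp
	have ind: "induced (lin_act d M) (cls p) = lin_act d M p" for p
	proof (rule induced_cls)
		fix q assume "q - p : I"
		hence "opr d (lin_act d M q) = opr d (lin_act d M p)"
			using kill[of "q - p"] unfolding o by (simp add: rhom_simps[OF r])
		thus "lin_act d M q = lin_act d M p" by (rule opr_inj) auto
	qed
	let ?V = "(d, induced (lin_act d M))"
	have "?V : fdms A"
		by (rule fdI) (use r in "simp_all add: ind o")
	moreover have "opr d (vr ?V p) = free_hom op_scalar (%g. opr d (x g)) p" for p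
		by (simp add: vr_def ind o)
	ultimately show thesis using that[of ?V] by simp
qed

end

section \<open>Modules over Suzuki's algebra through their dihedral triples\<close>

locale suzuki_dihedral = dihedral N n om ze + SA: suzuki_alg N n mm A
	for N n :: nat and om ze mm :: "'k::field" and A :: "('k, 'k free_alg set) hopf_algebra"
begin

abbreviation "h == N div 2 + 1"
definition half :: 'k where "half = inverse 2"
abbreviation "ez == SA.cls (gX ^ 2)"
abbreviation "et == SA.cls (gX ^ N)"
abbreviation "ew == SA.cls (gW N n)"
abbreviation vr where "vr == SA.vr"
abbreviation fdm where "fdm == fdms A"

definition vt :: "('k, 'k free_alg set) matmod => 'k trip" where
	"vt V = (fst V, vr V (gX ^ 2), vr V (gX ^ N), vr V (gW N n))"

lemma vt_carrier: "V : fdm ==> vt V : tcarrier"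
	by (simp add: vt_def tcarrier_def SA.vr_simps(1))

lemma vt_trips:
	assumes V: "V : fdm"
	shows "vt V : trips"
proof (rule tripsI_opr[OF vt_carrier[OF V]])
	assume d: "tdim (vt V) > 0"
	hence d: "fst V > 0" by (simp add: vt_def)
	note r = SA.rhom_vr[OF V d]
	from suz_rels.dihedral[OF r(2)]
	show "dih_rels N n (opr (tdim (vt V)) (tZ (vt V))) (opr (tdim (vt V)) (tT (vt V))) (opr (tdim (vt V)) (tW (vt V)))"
		by (simp only: vt_def fst_conv snd_conv rhom_simps(7)[OF r(1)] rhom_g[OF r])
qed

text \<open>The way back from triples to generators: \<open>(1 + w ^ n) / 2\<close> and
  \<open>(1 - w ^ n) / 2\<close> select the parity of the index difference, \<open>t z ^ h\<close>
  is \<open>X\<close>, and \<open>Y\<close> is \<open>Q w X\<close> with \<open>Q\<close> equal to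
  \<open>w ^ n\<close> or 1.\<close>

fun xm :: "'k trip => idx \<times> idx => 'k mat" where
	"xm X (i, j) = half \<cdot> ((if i = j then idm (tdim X) + tW X ^m n else idm (tdim X) - tW X ^m n) *
		 (if i = I1 then tT X * tZ X ^m h else (if odd n then tW X ^m n else idm (tdim X)) * tW X * (tT X * tZ X ^m h)))"

declare xm.simps [simp del]

lemma xm_carrier:
	assumes "X : tcarrier"
	shows "xm X g : carrier_mat (tdim X) (tdim X)"
	using tcarrierD(1-3)[OF assms] by (cases g) (auto simp: xm.simps intro!: mult_carrier_mat pow_carrier_mat minus_carrier_mat)

lemma xm_intertwine:
	assumes P: "intertw X Y P" and X: "X : tcarrier" "Y : tcarrier"
	shows "P * xm X g = xm Y g * P"
proof -
	note C = tcarrierD(1-3)[OF X(1)] tcarrierD(1-3)[OF X(2)] and D = intertwD[OF P]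
	have "itw P (tdim X) (tdim Y) (tZ X) (tZ Y)" "itw P (tdim X) (tdim Y) (tT X) (tT Y)" "itw P (tdim X) (tdim Y) (tW X) (tW Y)"
		using C D by (simp_all add: itw_def)
	note T = itw_intros[OF D(4)] this
	have "itw P (tdim X) (tdim Y) (xm X g) (xm Y g)"
	proof (cases g)
		case (Pair i j)
		show ?thesis
			unfolding Pair xm.simps
			by (cases "i = j"; cases "i = I1"; cases "odd n") (simp only: if_True if_False simp_thms, intro T)+
	qed
	thus ?thesis by (simp add: itw_def)
qed

lemma op_half: "op_scalar half + op_scalar half = 1"
proof -
	have "half + half = 1" using two by (simp add: half_def field_simps)
	thus ?thesis by (simp only: op_scalar.io_add[symmetric] op_scalar.io_1)
qed

lemma opr_xm:
	assumes X: "X : tcarrier" and d: "tdim X > 0"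
	defines "o1 == opr (tdim X)"
	shows "o1 (xm X (i, j)) = op_scalar half * (if i = j then 1 + o1 (tW X) ^ n else 1 - o1 (tW X) ^ n) *
		(if i = I1 then o1 (tT X) * o1 (tZ X) ^ h else (if odd n then o1 (tW X) ^ n else 1) * o1 (tW X) * (o1 (tT X) * o1 (tZ X) ^ h))"
proof -
	note C = tcarrierD(1-3)[OF X]
	have mm: "opr (tdim X) (B * B') = opr (tdim X) B * opr (tdim X) B' & B * B' : carrier_mat (tdim X) (tdim X)"
		if "B : carrier_mat (tdim X) (tdim X)" "B' : carrier_mat (tdim X) (tdim X)" for B B'
		using that d by (simp add: opr_mult)
	have pp: "opr (tdim X) (B ^m k) = opr (tdim X) B ^ k & B ^m k : carrier_mat (tdim X) (tdim X)"
		if "B : carrier_mat (tdim X) (tdim X)" for B k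
		using that d by (simp add: opr_pow)
	define B1 where "B1 = (if i = j then idm (tdim X) + tW X ^m n else idm (tdim X) - tW X ^m n)"
	have B1: "opr (tdim X) B1 = (if i = j then 1 + o1 (tW X) ^ n else 1 - o1 (tW X) ^ n)" "B1 : carrier_mat (tdim X) (tdim X)"
		using pp[OF C(3), of n] d unfolding B1_def o1_def by (auto simp: opr_add opr_diff intro: minus_carrier_mat)
	define B2 where "B2 = (if odd n then tW X ^m n else idm (tdim X))"
	have B2: "opr (tdim X) B2 = (if odd n then o1 (tW X) ^ n else 1)" "B2 : carrier_mat (tdim X) (tdim X)"
		using pp[OF C(3), of n] d unfolding B2_def o1_def by auto
	have TZ: "opr (tdim X) (tT X * tZ X ^m h) = o1 (tT X) * o1 (tZ X) ^ h" "tT X * tZ X ^m h : carrier_mat (tdim X) (tdim X)"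
		using mm[OF C(2) conjunct2[OF pp[OF C(1), of h]]] pp[OF C(1), of h] unfolding o1_def by auto
	have BW: "B2 * tW X : carrier_mat (tdim X) (tdim X)" using B2 C by simp
	have main: "opr (tdim X) (half \<cdot> (B1 * M)) = op_scalar half * opr (tdim X) B1 * opr (tdim X) M"
		if "M : carrier_mat (tdim X) (tdim X)" for M
		using mm[OF B1(2) that] by (simp only: opr_smult[OF d] mult.assoc)
	have BWTZ: "opr (tdim X) (B2 * tW X * (tT X * tZ X ^m h)) = opr (tdim X) B2 * opr (tdim X) (tW X) * (o1 (tT X) * o1 (tZ X) ^ h)"
		using mm[OF B2(2) C(3)] mm[OF BW TZ(2)] TZ(1) by (simp only:)
	show ?thesis
	proof (cases "i = I1")
		case True
		thus ?thesis unfolding xm.simps B1_def[symmetric] using main[OF TZ(2)] unfolding B1(1) TZ(1) o1_def by (simp only: if_True simp_thms)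
	next
		case False
		have "opr (tdim X) (half \<cdot> (B1 * (B2 * tW X * (tT X * tZ X ^m h)))) =
				op_scalar half * opr (tdim X) B1 * opr (tdim X) (B2 * tW X * (tT X * tZ X ^m h))"
			by (rule main) (use mm[OF BW TZ(2)] in blast)
		thus ?thesis using False
			unfolding xm.simps B1_def[symmetric] B2_def[symmetric] BWTZ B1(1) B2(1) o1_def by (simp only: if_False)
	qed
qed

lemma vr_gen:
	assumes V: "V : fdm"
	shows "vr V (gen i j) = xm (vt V) (i, j)"
proof (rule mat_eq_opr)
	show "vr V (gen i j) : carrier_mat (fst V) (fst V)" by (rule SA.vr_simps(1)[OF V])
	show "xm (vt V) (i, j) : carrier_mat (fst V) (fst V)" using xm_carrier[OF vt_carrier[OF V]] by (simp add: vt_def)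
	assume d: "fst V > 0"
	note r = SA.rhom_vr[OF V d]
	interpret S: suz_rels N n "%(i, j). opr (fst V) (vr V (gen i j))" by (rule r(2))
	let ?o = "opr (fst V)"
	have d': "tdim (vt V) > 0" using d by (simp add: vt_def)
	have g: "?o (tZ (vt V)) = S.X ^ 2" "?o (tT (vt V)) = S.X ^ N" "?o (tW (vt V)) = S.Q * S.V"
		by (simp_all only: vt_def fst_conv snd_conv rhom_simps(7)[OF r(1)] rhom_g[OF r])
	have "op_scalar half * (?o (vr V (gen i j)) + ?o (vr V (gen i j))) =
			op_scalar half * ((if i = j then 1 + S.P else 1 - S.P) * (if i = I1 then S.X else S.Y))"
		using S.recover(3)[of i j] by simp
	also have "op_scalar half * (?o (vr V (gen i j)) + ?o (vr V (gen i j))) = (op_scalar half + op_scalar half) * ?o (vr V (gen i j))"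
		by (simp add: distrib_left distrib_right)
	also have "... = ?o (vr V (gen i j))" by (simp add: op_half)
	also have "op_scalar half * ((if i = j then 1 + S.P else 1 - S.P) * (if i = I1 then S.X else S.Y)) = ?o (xm (vt V) (i, j))"
	proof -
		have t: "tdim (vt V) = fst V" by (simp add: vt_def)
		have "S.Y = (if odd n then S.P else 1) * (S.Q * S.V) * S.X" using S.recover(2) by (simp only: S.Q_def)
		thus ?thesis
			using opr_xm[OF vt_carrier[OF V] d', of i j] unfolding t g S.W_pow S.recover(1)[symmetric] by (simp add: mult.assoc)
	qed
	finally show "?o (vr V (gen i j)) = ?o (xm (vt V) (i, j))" .
qed

text \<open>\<open>w ^ n\<close>, that is \<open>P\<close>, acts on \<open>S k\<close> by -1 exactly
  when \<open>par k\<close> holds; then only the generators with distinct indices survive.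
  \<open>SX\<close> and \<open>SY\<close> are the actions of \<open>X\<close> and
  \<open>Y\<close>.\<close>

definition par :: "irr => bool" where "par k = odd (irr_w k)"
definition SX :: "irr => 'k mat" where "SX k = tT (S k) * tZ (S k) ^m h"
definition SY :: "irr => 'k mat" where "SY k = (if odd n & par k then - 1 else 1) \<cdot> (tW (S k) * SX k)"

lemma S_wn: "tW (S k) ^m n = (if par k then - 1 else 1) \<cdot> idm (tdim (S k))"
proof -
	have e: "ze ^ (n * i) = (if odd i then - 1 else 1)" "ze ^ (i * n) = (if odd i then - 1 else 1)" for i
		by (simp_all add: power_mult ze_n mult.commute[of i])
	have "tW (S k) ^m n = diagm (tdim (S k)) (%_. if par k then - 1 else 1)"
	proof (cases k)
		case (Psi u j)
		have "diagm 2 (%i. (if i = 0 then ze ^ j else inverse (ze ^ j)) ^ n) = diagm 2 (%_. if odd j then - 1 else 1)"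
			by (rule diagm_cong) (auto simp: power_inverse power_mult[symmetric] e)
		thus ?thesis unfolding Psi by (simp add: Vt_def diagm_pow par_def)
	qed (auto simp: diagm_pow par_def power_mult[symmetric] e)
	also have "... = (if par k then - 1 else 1) \<cdot> idm (tdim (S k))"
		by (simp add: diagm_one[symmetric] diagm_smult)
	finally show ?thesis .
qed

lemma S_dims: "SX k : carrier_mat (tdim (S k)) (tdim (S k))" "SY k : carrier_mat (tdim (S k)) (tdim (S k))"
	using tcarrierD(1-3)[OF S_carrier[of k]]
	by (auto simp: SX_def SY_def intro!: mult_carrier_mat pow_carrier_mat smult_carrier_mat simp del: pow_mat.simps S.simps)

lemma xm_S: "xm (S k) (i, j) = (if par k = (i ~= j) then if i = I1 then SX k else SY k else zm (tdim (S k)) (tdim (S k)))"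
proof -
	note C = tcarrierD(1-3)[OF S_carrier[of k]]
	let ?d = "tdim (S k)" and ?s = "if par k then - 1 else 1 :: 'k"
	have one: "idm ?d + ?s \<cdot> idm ?d = (1 + ?s) \<cdot> idm ?d" "idm ?d - ?s \<cdot> idm ?d = (1 - ?s) \<cdot> (idm ?d :: 'k mat)"
		by (rule eq_matI; auto)+
	have m: "(c \<cdot> idm ?d) * M = c \<cdot> M" if "M : carrier_mat ?d ?d" for c and M :: "'k mat"
		using that by (simp add: mult_smult_assoc_mat[of _ ?d ?d _ ?d])
	have Q: "(if odd n then ?s \<cdot> idm ?d else idm ?d) * tW (S k) * SX k = SY k"
	proof -
		have 1: "1 \<cdot> M = M" for M :: "'k mat" by (rule eq_matI) auto
		show ?thesis using C S_dims(1)[of k] by (simp add: SY_def m 1 mult_smult_assoc_mat[of _ ?d ?d _ ?d])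
	qed
	have h: "half \<cdot> (((1 + 1) \<cdot> idm ?d) * M) = M" "half \<cdot> (((1 + - 1) \<cdot> idm ?d) * M) = zm ?d ?d"
		"half \<cdot> (((1 - 1) \<cdot> idm ?d) * M) = zm ?d ?d" "half \<cdot> (((1 - - 1) \<cdot> idm ?d) * M) = M"
		if M: "M : carrier_mat ?d ?d" for M :: "'k mat"
		unfolding m[OF M] smult_smult using M two by (auto simp: half_def intro!: eq_matI)
	show ?thesis
		unfolding xm.simps S_wn one SX_def[symmetric] Q
		using h[OF S_dims(1)] h[OF S_dims(2)]
		by (cases "par k"; cases "i = j"; cases "i = I1") (simp_all only: if_True if_False simp_thms)
qed

lemma vr_S:
	assumes "V : fdm" "vt V = S k"
	shows "vr V (gen i j) = (if par k = (i ~= j) then if i = I1 then SX k else SY k else zm (fst V) (fst V))"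
proof -
	have "tdim (S k) = fst V" unfolding assms(2)[symmetric] by (simp add: vt_def)
	thus ?thesis using vr_gen[OF assms(1), of i j] xm_S[of k i j] assms(2) by simp
qed

text \<open>The representation with \<open>x\<^sub>1\<^sub>1 + x\<^sub>1\<^sub>2 = X\<close> and \<open>x\<^sub>2\<^sub>1 + x\<^sub>2\<^sub>2 = Y\<close> in which either the \<open>x\<^sub>i\<^sub>j\<close> with
  \<open>i \<noteq> j\<close> or those with \<open>i = j\<close> vanish\<close>

definition trXY :: "nat => bool => 'k mat => 'k mat => 'k trip" where
	"trXY d s X Y = (d, X ^m 2, X ^m N, (if odd n & s then - 1 else 1) \<cdot> (Y * X ^m (2 * N - 1)))"

text \<open>On such a module \<open>P\<close> is 1 or -1, so \<open>Q\<close> is the sign in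
  \<open>trXY\<close>. The second equation writes the contragredient triple with powers of exponent
  \<open>2 * N - 1\<close>, the form in which the antipode yields inverses.\<close>

lemma vt_trXY:
	assumes V: "V : fdm" and d: "fst V > 0"
		and s: "!!i j. vr V (gen i j) = (if s = (i ~= j) then if i = I1 then X else Y else zm (fst V) (fst V))"
		and C: "X : carrier_mat (fst V) (fst V)" "Y : carrier_mat (fst V) (fst V)"
	shows "vt V = trXY (fst V) s X Y"
		and "tdual (vt V) = (fst V, trm ((X ^m (2 * N - 1)) ^m 2), trm ((X ^m (2 * N - 1)) ^m N),
			trm ((if odd n & s then - 1 else 1) \<cdot> ((X ^m (2 * N - 1)) ^m (2 * N - 1) * Y ^m (2 * N - 1))))"
proof -
	note r = SA.rhom_vr[OF V d] and R = SA.vr_simps[OF V]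
	interpret S: suz_rels N n "%(i, j). opr (fst V) (vr V (gen i j))" by (rule r(2))
	let ?o = "opr (fst V)" and ?q = "if odd n & s then - 1 else 1 :: 'k"
	have X: "vr V gX = X" "vr V gY = Y"
		using C by (cases s; simp add: gX_def gY_def R s)+
	have oX: "S.X = ?o X" "S.Y = ?o Y" using rhom_g(1,2)[OF r] by (simp_all add: X)
	have N0: "2 * N > 0" by simp
	have "S.P = (if s then - 1 else 1)"
	proof (cases s)
		case True
		have "S.e0 = 0" using d N0 by (simp add: s True zero_power)
		thus ?thesis using S.unit True by (simp add: S.P_def)
	next
		case False
		have "S.e1 = 0" using d N0 by (simp add: s False zero_power)
		thus ?thesis using S.unit False by (simp add: S.P_def)
	qed
	moreover have "op_scalar (1 :: 'k) = 1" "op_scalar (- 1 :: 'k) = - 1"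
		using op_scalar.io_1[where 'a = 'k] rhom_simps(5)[OF rhom_op_scalar, of "1 :: 'k"] by (simp_all only:)
	ultimately have Q: "S.Q = op_scalar ?q" by (cases "odd n"; cases s) (simp_all only: S.Q_def if_True if_False simp_thms)
	have W: "vr V (gW N n) = ?q \<cdot> (Y * X ^m (2 * N - 1))"
	proof (rule mat_eq_opr[OF R(1)])
		show "?q \<cdot> (Y * X ^m (2 * N - 1)) : carrier_mat (fst V) (fst V)"
			using C by (intro smult_carrier_mat mult_carrier_mat[of _ "fst V" "fst V"] pow_carrier_mat)
		show "?o (vr V (gW N n)) = ?o (?q \<cdot> (Y * X ^m (2 * N - 1)))"
			unfolding rhom_g(4)[OF r] Q S.V_def oX
			using C d mult_carrier_mat[OF C(2) pow_carrier_mat[OF C(1)]] by (simp only: opr_smult opr_mult opr_pow pow_carrier_mat)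
	qed
	show "vt V = trXY (fst V) s X Y" unfolding vt_def trXY_def W R(6) X ..
	have "(vr V gX ^m 2) ^m (N - 1) = (X ^m (2 * N - 1)) ^m 2"
	proof (rule opr_inj[of "fst V"])
		have "2 * (N - 1) + 2 * N = (2 * N - 1) * 2" using N0 by (cases N) auto
		hence "S.X ^ ((2 * N - 1) * 2) = S.X ^ (2 * (N - 1) + 2 * N)" by simp
		also have "... = S.X ^ (2 * (N - 1))" by (simp only: power_add S.X_2N mult_1_right)
		finally show "?o ((vr V gX ^m 2) ^m (N - 1)) = ?o ((X ^m (2 * N - 1)) ^m 2)"
			using C d by (simp only: X opr_pow pow_carrier_mat oX[symmetric] power_mult)
	qed (use C X in "simp_all only: pow_carrier_mat")
	moreover have "vr V gX ^m N = (X ^m (2 * N - 1)) ^m N"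
	proof (rule opr_inj[of "fst V"])
		have "N + 2 * N * (N - 1) = (2 * N - 1) * N" using N0 by (cases N) (auto simp: algebra_simps)
		hence "S.X ^ ((2 * N - 1) * N) = S.X ^ (N + 2 * N * (N - 1))" by simp
		also have "... = S.X ^ N" by (simp only: power_add power_mult[of _ "2 * N"] S.X_2N power_one mult_1_right)
		finally show "?o (vr V gX ^m N) = ?o ((X ^m (2 * N - 1)) ^m N)"
			using C d by (simp only: X opr_pow pow_carrier_mat oX[symmetric] power_mult)
	qed (use C X in "simp_all only: pow_carrier_mat")
	moreover have "vr V (gW N n) ^m (2 * n - 1) = ?q \<cdot> ((X ^m (2 * N - 1)) ^m (2 * N - 1) * Y ^m (2 * N - 1))"
	proof (rule opr_inj[of "fst V"])
		have "1 + 2 * N * (2 * (N - 1)) = (2 * N - 1) * (2 * N - 1)" using N0 by (cases N) (auto simp: algebra_simps)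
		hence "S.X ^ ((2 * N - 1) * (2 * N - 1)) = S.X ^ (1 + 2 * N * (2 * (N - 1)))" by simp
		also have "... = S.X" by (simp only: power_add power_mult[of _ "2 * N"] S.X_2N power_one mult_1_right power_one_right)
		finally have XX: "(S.X ^ (2 * N - 1)) ^ (2 * N - 1) = S.X" by (simp only: power_mult)
		have c: "(X ^m (2 * N - 1)) ^m (2 * N - 1) * Y ^m (2 * N - 1) : carrier_mat (fst V) (fst V)"
			using C by (intro mult_carrier_mat[of _ "fst V" "fst V"] pow_carrier_mat)
		thus "?q \<cdot> ((X ^m (2 * N - 1)) ^m (2 * N - 1) * Y ^m (2 * N - 1)) : carrier_mat (fst V) (fst V)" by simp
		show "?o (vr V (gW N n) ^m (2 * n - 1)) = ?o (?q \<cdot> ((X ^m (2 * N - 1)) ^m (2 * N - 1) * Y ^m (2 * N - 1)))"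
			using S.W_inv c C d R(1)
			by (simp only: opr_smult opr_mult opr_pow pow_carrier_mat oX[symmetric] XX Q[symmetric] rhom_g(4)[OF r])
	qed (use R in "simp only: pow_carrier_mat")
	ultimately show "tdual (vt V) = (fst V, trm ((X ^m (2 * N - 1)) ^m 2), trm ((X ^m (2 * N - 1)) ^m N),
			trm (?q \<cdot> ((X ^m (2 * N - 1)) ^m (2 * N - 1) * Y ^m (2 * N - 1))))"
		by (simp only: tdual_def vt_def fst_conv snd_conv R(6))
qed

lemma trXY_tiso:
	assumes J: "J : sqm d" "J' : sqm d" "J' * J = idm d" "J * J' = idm d"
		and C: "X : sqm d" "Y : sqm d" "X' : sqm d" "Y' : sqm d"
		and X: "J * X = X' * J" "J * Y = Y' * J"
	shows "tiso (trXY d s X Y) (trXY d s X' Y')"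
proof (rule tisoI)
	have "itw J d d X X'" "itw J d d Y Y'" using C X by (simp_all add: itw_def)
	note T = itw_intros[OF J(1)] this
	have "itw J d d (tZ (trXY d s X Y)) (tZ (trXY d s X' Y'))" "itw J d d (tT (trXY d s X Y)) (tT (trXY d s X' Y'))"
		"itw J d d (tW (trXY d s X Y)) (tW (trXY d s X' Y'))"
		unfolding trXY_def fst_conv snd_conv by (intro T)+
	thus "intertw (trXY d s X Y) (trXY d s X' Y') J" using J by (simp add: intertw_def itw_def trXY_def)
qed (use J in "simp_all add: trXY_def")

lemma trXY_carrier: "X : sqm d ==> Y : sqm d ==> trXY d s X Y : tcarrier"
	unfolding trXY_def tcarrier_def mem_Collect_eq fst_conv snd_conv
	by (intro conjI smult_carrier_mat mult_carrier_mat[of _ d d] pow_carrier_mat)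

lemma trXY_ttens:
	assumes "X : sqm d" "Y : sqm d" "X' : sqm e" "Y' : sqm e"
	shows "ttens (trXY d s X Y) (trXY e s' X' Y') = trXY (d * e) (s ~= s') (kro X X') (kro Y Y')"
proof -
	have p: "dim_row (X ^m k) = d" "dim_row (X' ^m k) = e" for k
		using pow_carrier_mat[OF assms(1), of k] pow_carrier_mat[OF assms(3), of k] by auto
	show ?thesis
		unfolding ttens_def trXY_def fst_conv snd_conv kron_pow[OF assms(1,3)] kron_smult_left kron_smult_right smult_smult
		using assms p by (subst kron_mult) (auto simp del: One_nat_def)
qed

text \<open>Every irreducible triple comes from a solution of Suzuki's relations:
  \<open>X = t z ^ h\<close> has square \<open>z\<close>, and \<open>V\<close> is \<open>w\<close>
  with the sign that gives \<open>V ^ n\<close> the value required by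
  \<open>suzuki_of_twist\<close>.\<close>

lemma S_relations:
	fixes k
	defines "d == tdim (S k)"
	shows "suz_rels N n (%(i, j). if par k = (i ~= j) then if i = I1 then opr d (SX k) else opr d (SY k) else 0)"
		"S k = trXY d (par k) (SX k) (SY k)" "d > 0"
proof -
	show d: "d > 0" unfolding d_def by (cases k) (auto simp: Vt_def)
	let ?q = "if odd n & par k then - 1 else 1 :: 'k" and ?e = "if odd n & par k then - 1 else 1 :: 'k op"
	note C = tcarrierD(1-3)[OF S_carrier[of k], folded d_def] and SC = S_dims[of k, folded d_def]
	define z t w where "z = opr d (tZ (S k))" and "t = opr d (tT (S k))" and "w = opr d (tW (S k))"
	interpret D: dih_rels N n z t w
		using trips_opr[OF S_trips[of k]] d unfolding z_def t_def w_def d_def by simp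
	have q: "op_scalar ?q = ?e"
		using op_scalar.io_1[where 'a = 'k] rhom_simps(5)[OF rhom_op_scalar, of "1 :: 'k"] by simp
	define x where "x = t * z ^ h"
	have X: "opr d (SX k) = x"
		unfolding x_def SX_def t_def z_def using C d by (simp only: opr_mult opr_pow pow_carrier_mat)
	define V where "V = ?e * w"
	have Y: "opr d (SY k) = V * opr d (SX k)"
		unfolding SY_def V_def w_def q[symmetric] using C d SC mult_carrier_mat[OF C(3) SC(1)]
		by (simp only: opr_mult opr_smult mult.assoc)
	have XX: "x * x = z"
	proof -
		have "x * x = t * (z ^ h * t) * z ^ h" by (simp only: x_def mult.assoc)
		also have "... = t * t * (z ^ h * z ^ h)" by (simp only: D.z_pow_comm(1) mult.assoc)
		also have "... = z ^ (h + h)" by (simp only: D.tt mult_1_left power_add)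
		also have "h + h = N + 1" using D.N_half by linarith
		finally show ?thesis using D.zN by simp
	qed
	have "w * (t * z ^ h * w) = w * (t * w) * z ^ h" by (simp only: mult.assoc D.z_pow_comm(2))
	hence VXV: "V * (x * V) = x" by (simp add: V_def x_def D.wtw)
	have Vz: "V * z = z * V" using D.zw by (simp add: V_def)
	have X2N: "x ^ (2 * N) = 1" using D.zN by (simp add: power_mult power2_eq_square XX)
	have "w ^ n = (if par k then - 1 else 1)"
	proof -
		have "w ^ n = opr d (tW (S k) ^m n)" unfolding w_def using C d by (simp add: opr_pow)
		also have "... = op_scalar (if par k then - 1 else 1)"
			unfolding S_wn using d by (simp add: opr_smult d_def[symmetric])
		finally show ?thesis using op_scalar.io_1[where 'a = 'k] rhom_simps(5)[OF rhom_op_scalar, of "1 :: 'k"] by simp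
	qed
	hence Vn: "V ^ n = (if odd n \<or> \<not> par k then 1 else - 1)" by (auto simp: V_def power_minus_odd)
	show "suz_rels N n (%(i, j). if par k = (i ~= j) then if i = I1 then opr d (SX k) else opr d (SY k) else 0)"
		unfolding Y X by (rule suzuki_of_twist[OF N D.n VXV _ X2N Vn]) (simp only: XX Vz)
	have "SX k ^m 2 = tZ (S k)" "SX k ^m N = tT (S k)" "?q \<cdot> (SY k * SX k ^m (2 * N - 1)) = tW (S k)"
	proof -
		show "SX k ^m 2 = tZ (S k)"
			by (rule opr_inj[of d]) (use C SC d XX in "simp_all only: opr_pow pow_carrier_mat X power2_eq_square z_def")
		have "N = Suc (2 * (N div 2))" using D.N_half by linarith
		hence "x ^ N = x ^ Suc (2 * (N div 2))" by simp
		also have "... = x * z ^ (N div 2)" by (simp only: power_Suc power_mult power2_eq_square XX)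
		also have "... = t * (z ^ h * z ^ (N div 2))" by (simp only: x_def mult.assoc)
		also have "z ^ h * z ^ (N div 2) = 1" using D.zN D.N_half by (simp only: power_add[symmetric])
		finally have "x ^ N = t" by simp
		thus "SX k ^m N = tT (S k)"
			by (intro opr_inj[of d]) (use C SC d in "simp_all only: opr_pow pow_carrier_mat X t_def[symmetric]")
		have c: "SY k * SX k ^m (2 * N - 1) : sqm d" using SC by (intro mult_carrier_mat[of _ d d] pow_carrier_mat)
		have "x * x ^ (2 * N - 1) = 1"
			using power_minus_mult[of "2 * N" x] X2N N_pos by (simp add: power_commutes)
		hence "?e * (V * x * x ^ (2 * N - 1)) = w" by (simp add: V_def mult.assoc)
		thus "?q \<cdot> (SY k * SX k ^m (2 * N - 1)) = tW (S k)"
			by (intro opr_inj[of d])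
				(use C SC d c in "simp_all only: opr_smult opr_mult opr_pow pow_carrier_mat smult_carrier_mat X Y q w_def[symmetric]")
	qed
	thus "S k = trXY d (par k) (SX k) (SY k)" by (simp add: trXY_def d_def)
qed

lemma irr_module:
	obtains V where "V : fdm" "vt V = S k"
proof -
	let ?d = "tdim (S k)"
	let ?x = "%(i, j). if par k = (i ~= j) then if i = I1 then SX k else SY k else zm ?d ?d"
	note R = S_relations[of k] and C = S_dims[of k]
	have "(%g. opr ?d (?x g)) = (%(i, j). if par k = (i ~= j) then if i = I1 then opr ?d (SX k) else opr ?d (SY k) else 0)"
		using R(3) by (auto simp: fun_eq_iff)
	moreover have xC: "?x g : carrier_mat ?d ?d" for g using C by (cases g) simp
	ultimately have r: "suz_rels N n (%g. opr ?d (?x g))" using R(1) by (simp only:)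
	obtain V where V: "V : fdm" "fst V = ?d" "!!p. opr ?d (vr V p) = free_hom op_scalar (%g. opr ?d (?x g)) p"
		using SA.module_exists[OF R(3) xC r] by blast
	have "vr V (gen i j) = ?x (i, j)" for i j
		by (rule opr_inj[of ?d]) (use SA.vr_simps(1)[OF V(1)] V xC[of "(i, j)"] in "simp_all only: op_scalar.free_hom_gen")
	from vt_trXY(1)[OF V(1), of "par k" "SX k" "SY k"] this C R(2,3) show thesis
		using that[OF V(1)] unfolding V(2) by simp
qed

lemma SX_SY_Psi:
	assumes "k = Psi u j"
	obtains c r where "r ~= 0" "SX k = c \<cdot> flip" "SY k = c \<cdot> (diagm 2 (%i. if i = 0 then r else inverse r) * flip)"
proof -
	let ?c = "(om ^ u) ^ h" and ?q = "if odd n & par k then - 1 else 1 :: 'k"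
	have F: "flip : sqm 2" by (rule carrier_matI) auto
	have sm: "q \<cdot> (B * (c \<cdot> flip)) = c \<cdot> ((q \<cdot> B) * flip)" if "B : sqm 2" for q c :: 'k and B
		by (simp only: mult_smult_distrib[OF that F] mult_smult_assoc_mat[OF that F] smult_smult mult.commute)
	have X: "SX k = ?c \<cdot> flip"
		unfolding SX_def assms S.simps Vt_def fst_conv snd_conv diagm_pow by (rule mult_diagm_const) simp
	have "SY k = ?q \<cdot> (diagm 2 (%i. if i = 0 then ze ^ j else inverse (ze ^ j)) * (?c \<cdot> flip))"
		unfolding SY_def X by (simp add: assms Vt_def)
	also have "... = ?c \<cdot> ((?q \<cdot> diagm 2 (%i. if i = 0 then ze ^ j else inverse (ze ^ j))) * flip)"
		by (rule sm) simp
	also have "?q \<cdot> diagm 2 (%i. if i = 0 then ze ^ j else inverse (ze ^ j)) =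
			diagm 2 (%i. if i = 0 then ?q * ze ^ j else inverse (?q * ze ^ j))"
		unfolding diagm_smult by (rule diagm_cong) auto
	finally show thesis using that[of "?q * ze ^ j" ?c] X by simp
qed

lemma swap_exists:
	assumes k: "!!u e d. k = Chi u e d ==> odd n \<or> \<not> d"
	obtains J J' where "J : carrier_mat (tdim (S k)) (tdim (S k))" "J' : carrier_mat (tdim (S k)) (tdim (S k))"
		"J' * J = idm (tdim (S k))" "J * J' = idm (tdim (S k))" "J * SX k = SY k * J" "J * SY k = SX k * J"
proof (cases k)
	case (Chi u e d)
	have "(- 1) * ze ^ n = (1 :: 'k)" by (simp add: ze_n)
	hence "SY k = SX k"
		using k[OF Chi] ze_n unfolding SY_def SX_def Chi by (auto simp: par_def diagm_mult diagm_pow diagm_smult)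
	thus thesis using that[of "idm (tdim (S k))" "idm (tdim (S k))"] S_dims[of k] by simp
next
	case (Psi u j)
	obtain c r where r: "r ~= 0" and X: "SX k = c \<cdot> flip" and Y: "SY k = c \<cdot> (diagm 2 (%i. if i = 0 then r else inverse r) * flip)"
		by (rule SX_SY_Psi[OF Psi])
	define J where "J = mat 2 2 (%(i, j). if i = (0::nat) & j = (1::nat) then r else if i = 1 & j = 0 then 1 else 0)"
	define J' where "J' = mat 2 2 (%(i, j). if i = (0::nat) & j = (1::nat) then 1 else if i = 1 & j = 0 then inverse r else 0)"
	have d: "tdim (S k) = 2" by (simp add: Psi Vt_def)
	have "J' * J = idm 2" "J * J' = idm 2" "J * SX k = SY k * J" "J * SY k = SX k * J"
		using r unfolding X Y J_def J'_def
		by (rule_tac eq_matI; auto simp: diagm_def flip_def scalar_prod_def eval_nat_numeral less_Suc_eq)+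
	moreover have "J : sqm 2" "J' : sqm 2" by (simp_all add: J_def J'_def)
	ultimately show thesis using that[of J J'] unfolding d by blast
qed

text \<open>\<open>X\<close> and \<open>Y\<close> are antidiagonal on a two-dimensional irreducible,
  so \<open>diag(1, -1)\<close> anticommutes with both.\<close>

lemma neg_exists:
	assumes "k = Psi u j"
	obtains J where "J : carrier_mat (tdim (S k)) (tdim (S k))" "J * J = idm (tdim (S k))"
		"J * SX k = - 1 \<cdot> (SX k * J)" "J * SY k = - 1 \<cdot> (SY k * J)"
proof -
	obtain c r where X: "SX k = c \<cdot> flip" and Y: "SY k = c \<cdot> (diagm 2 (%i. if i = 0 then r else inverse r) * flip)"
		by (rule SX_SY_Psi[OF assms])
	define J :: "'k mat" where "J = diagm 2 (%i. if i = 0 then 1 else - 1)"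
	have d: "tdim (S k) = 2" by (simp add: assms Vt_def)
	have "J * J = idm 2" "J * SX k = - 1 \<cdot> (SX k * J)" "J * SY k = - 1 \<cdot> (SY k * J)"
		unfolding X Y J_def
		by (rule_tac eq_matI; auto simp: diagm_def flip_def scalar_prod_def eval_nat_numeral less_Suc_eq)+
	moreover have "J : sqm 2" by (simp add: J_def)
	ultimately show thesis using that[of J] unfolding d by blast
qed

lemma SY_neg: "k = Chi u e True ==> even n ==> SY k = - 1 \<cdot> SX k"
	unfolding SY_def SX_def by (simp add: par_def diagm_mult diagm_pow diagm_smult ze_n)

text \<open>The constituents are compared with those of the group's tensor product
  \<open>ttens\<close>. If \<open>par k\<close> fails, the actions coincide. Otherwise
  \<open>X\<close> and \<open>Y\<close> are exchanged on the second factor;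
  \<open>swap_exists\<close> undoes this unless they differ by a sign there, and then
  \<open>neg_exists\<close> absorbs the sign on the first factor.\<close>

lemma tensor_irr:
	assumes k: "k : K" "l : K" and V: "V : fdm" "vt V = S k" and W: "W : fdm" "vt W = S l"
	shows "mu (vt (mten A V W)) = fus k l"
proof -
	let ?d = "tdim (S k)" and ?e = "tdim (S l)" and ?U = "mten A V W"
	have t: "fst V = ?d" "fst W = ?e" unfolding V(2)[symmetric] W(2)[symmetric] by (simp_all add: vt_def)
	note pos = S_relations(3)[of k] S_relations(3)[of l]
	note U = SA.tensor_fd[OF V(1) W(1)]
	have fU: "fst ?U = ?d * ?e" by (simp add: fst_module_tensor t)
	note C = S_dims[of k] S_dims[of l]
	\<comment> \<open>The coproduct of \<open>X\<close> is
	  \<open>x11 \<otimes> X + x12 \<otimes> Y\<close>, that of \<open>Y\<close> is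
	  \<open>x22 \<otimes> Y + x21 \<otimes> X\<close>; on \<open>S k\<close> one summand of each
	  survives, depending on \<open>par k\<close>.\<close>
	let ?X = "kro (SX k) (if par k then SY l else SX l)" and ?Y = "kro (SY k) (if par k then SX l else SY l)"
	have XYC: "?X : carrier_mat (?d * ?e) (?d * ?e)" "?Y : carrier_mat (?d * ?e) (?d * ?e)"
		"kro (SX k) (SX l) : carrier_mat (?d * ?e) (?d * ?e)" "kro (SY k) (SY l) : carrier_mat (?d * ?e) (?d * ?e)"
		using C by (auto intro!: kron_carrier)
	have g: "vr ?U (gen i j) = (if (par k ~= par l) = (i ~= j) then if i = I1 then ?X else ?Y else zm (?d * ?e) (?d * ?e))" for i j
		unfolding U(2) vr_S[OF V] vr_S[OF W] t
		using carrier_matD[OF C(1)] carrier_matD[OF C(2)] carrier_matD[OF C(3)] carrier_matD[OF C(4)] XYC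
		by (cases i; cases j; cases "par k"; cases "par l") (simp_all add: kron_zero_left kron_zero_right)
	have vtU: "vt ?U = trXY (?d * ?e) (par k ~= par l) ?X ?Y"
		using vt_trXY(1)[OF U(1), of "par k ~= par l" ?X ?Y] g XYC pos unfolding fU by simp
	have target: "ttens (S k) (S l) = trXY (?d * ?e) (par k ~= par l) (kro (SX k) (SX l)) (kro (SY k) (SY l))"
		by (subst (1) S_relations(2), subst (2) S_relations(2)) (rule trXY_ttens[OF C])
	have "tiso (vt ?U) (ttens (S k) (S l))"
		unfolding vtU target
	proof (cases "par k")
		case False
		thus "tiso (trXY (?d * ?e) (par k ~= par l) ?X ?Y) (trXY (?d * ?e) (par k ~= par l) (kro (SX k) (SX l)) (kro (SY k) (SY l)))"
			using tiso_refl[OF trXY_carrier[OF XYC(3,4)]] by simp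
	next
		case True
		show "tiso (trXY (?d * ?e) (par k ~= par l) ?X ?Y) (trXY (?d * ?e) (par k ~= par l) (kro (SX k) (SX l)) (kro (SY k) (SY l)))"
		proof (cases "\<exists>u e. l = Chi u e True & even n")
			case l: True
			then obtain u e where l: "l = Chi u e True" "even n" by blast
			\<comment> \<open>For even \<open>n\<close> the exponents 0 and \<open>n\<close> of the
			  characters are even, so \<open>par k\<close> rules them out.\<close>
			obtain u' j where "k = Psi u' j" using \<open>par k\<close> l(2) by (cases k) (auto simp: par_def split: if_splits)
			from neg_exists[OF this] obtain J where J: "J : carrier_mat ?d ?d" "J * J = idm ?d"
				"J * SX k = - 1 \<cdot> (SX k * J)" "J * SY k = - 1 \<cdot> (SY k * J)" by blast
			note D = carrier_matD[OF C(1)] carrier_matD[OF C(2)] carrier_matD[OF C(3)] carrier_matD[OF J(1)]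
			have s: "1 \<cdot> M = M" for M :: "'k mat" by (rule eq_matI) auto
			show ?thesis
				by (rule trXY_tiso[of "kro J (idm ?e)" _ "kro J (idm ?e)"])
					(use True XYC J C D SY_neg[OF l] in "simp_all add: kron_mult kron_one kron_smult_left kron_smult_right
						smult_smult s kron_carrier mmsm msm")
		next
			case l: False
			obtain J J' where J: "J : carrier_mat ?e ?e" "J' : carrier_mat ?e ?e" "J' * J = idm ?e" "J * J' = idm ?e"
				"J * SX l = SY l * J" "J * SY l = SX l * J"
				by (rule swap_exists[of l]) (use l in auto)
			note D = carrier_matD[OF C(1)] carrier_matD[OF C(2)] carrier_matD[OF C(3)] carrier_matD[OF C(4)] carrier_matD[OF J(1)] carrier_matD[OF J(2)]
			show ?thesis
				by (rule trXY_tiso[of "kro (idm ?d) J" _ "kro (idm ?d) J'"])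
					(use True XYC J C D in "simp_all add: kron_mult kron_one kron_carrier")
		qed
	qed
	thus ?thesis
		using mu_tiso[OF _ vt_carrier[OF U(1)] ttens_carrier[OF S_carrier S_carrier]] mu_ttens[OF k] by metis
qed

lemma transpose_pow:
	assumes "B : sqm d"
	shows "trm B ^m m = trm (B ^m m :: 'k mat)"
proof (induction m)
	case (Suc m)
	have "trm B ^m Suc m = trm (B ^m m) * trm B" by (simp add: Suc)
	also have "... = trm (B * B ^m m)" using assms by (intro transpose_mult[symmetric]) auto
	also have "B * B ^m m = B ^m m * B" by (rule pow_intw) (use assms in auto)
	finally show ?case by simp
qed (use assms in simp)

lemma transpose_smult: "trm (c \<cdot> M) = c \<cdot> trm (M :: 'k mat)"
	by (rule eq_matI) auto

lemma zero_mat_pow: "m > 0 ==> zm d d ^m m = (zm d d :: 'k mat)"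
	by (cases m) (auto simp: mat_mult_zero)

text \<open>The antipode transposes the indices, which exchanges the roles of \<open>X\<close> and
  \<open>Y\<close> when the generators with distinct indices survive. The transpose of the map from
  \<open>swap_exists\<close> undoes this.\<close>

lemma dual_irr:
	assumes k: "k : K" and V: "V : fdm" "vt V = S k"
	shows "mu (vt (dmod A V)) = {#dual_irr k#}"
proof -
	let ?d = "tdim (S k)" and ?U = "dmod A V" and ?m = "2 * N - 1"
	have t: "fst V = ?d" unfolding V(2)[symmetric] by (simp add: vt_def)
	note pos = S_relations(3)[of k]
	note U = SA.dual_fd[OF V(1)]
	have fU: "fst ?U = ?d" by (cases V) (use t in simp)
	note C = S_dims[of k]
	define X Y where "X = SX k ^m ?m" and "Y = SY k ^m ?m"
	have XY: "X : carrier_mat ?d ?d" "Y : carrier_mat ?d ?d" unfolding X_def Y_def by (intro pow_carrier_mat C)+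
	have m: "?m > 0" using N_pos by linarith
	let ?A = "trm (if par k then Y else X)" and ?B = "trm (if par k then X else Y)"
	have AB: "?A : carrier_mat ?d ?d" "?B : carrier_mat ?d ?d" using XY by simp_all
	have z: "trm (zm ?d ?d ^m ?m) = (zm ?d ?d :: 'k mat)" by (simp only: zero_mat_pow[OF m] zero_transpose_mat)
	have g: "vr ?U (gen i j) = (if par k = (i ~= j) then if i = I1 then ?A else ?B else zm ?d ?d)" for i j
		unfolding U(2) vr_S[OF V] t
		by (cases i; cases j; cases "par k") (simp_all only: z X_def Y_def if_True if_False simp_thms idx.distinct)
	have vtU: "vt ?U = trXY ?d (par k) ?A ?B"
		using vt_trXY(1)[OF U(1), of "par k" ?A ?B] g AB pos unfolding fU by simp
	have td: "tdual (S k) = trXY ?d (par k) (trm X) (trm Y)"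
	proof -
		have c: "X ^m ?m * Y : carrier_mat ?d ?d" using XY by (intro mult_carrier_mat[of _ ?d ?d] pow_carrier_mat)
		have "trm (q \<cdot> (X ^m ?m * Y)) = q \<cdot> (trm Y * trm (X ^m ?m))" for q
			using transpose_mult[OF pow_carrier_mat[OF XY(1)] XY(2), of ?m] by (simp only: transpose_smult)
		thus ?thesis
			using vt_trXY(2)[OF V(1) _ vr_S[OF V] C[unfolded t[symmetric]]] pos
			unfolding V(2) t X_def[symmetric] Y_def[symmetric] trXY_def transpose_pow[OF XY(1)] by simp
	qed
	have "tiso (vt ?U) (tdual (S k))"
	proof (cases "par k")
		case False
		thus ?thesis unfolding vtU td using tiso_refl[OF trXY_carrier[OF AB]] by simp
	next
		case True
		\<comment> \<open>A character with \<open>par k\<close> and \<open>d\<close> has odd exponent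
		  \<open>n\<close>, so the exceptional case of \<open>swap_exists\<close> does not arise.\<close>
		have "odd n \<or> \<not> d" if "k = Chi u e d" for u e d using True that by (auto simp: par_def split: if_splits)
		then obtain J J' where J: "J : carrier_mat ?d ?d" "J' : carrier_mat ?d ?d" "J' * J = idm ?d" "J * J' = idm ?d"
			"J * SX k = SY k * J" "J * SY k = SX k * J"
			by (rule swap_exists)
		have "J * X = Y * J" "J * Y = X * J"
			unfolding X_def Y_def by (rule pow_intw[OF _ _ _ J(1)]; use J C in blast)+
		hence "trm (J * X) = trm (Y * J)" "trm (J * Y) = trm (X * J)" by simp_all
		hence "trm X * trm J = trm J * trm Y"
			"trm Y * trm J = trm J * trm X"
			by (simp_all only: transpose_mult[OF J(1) XY(1)] transpose_mult[OF J(1) XY(2)] transpose_mult[OF XY(1) J(1)] transpose_mult[OF XY(2) J(1)])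
		moreover have "trm J' * trm J = idm ?d" "trm J * trm J' = idm ?d"
			by (simp_all only: transpose_mult[OF J(1,2), symmetric] transpose_mult[OF J(2,1), symmetric] J(3,4) transpose_one)
		ultimately have "tiso (trXY ?d (par k) (trm Y) (trm X)) (trXY ?d (par k) (trm X) (trm Y))"
			using J(1,2) XY by (intro trXY_tiso[of "trm J" _ "trm J'"]) simp_all
		thus ?thesis unfolding vtU td using True by simp
	qed
	moreover have "tdual (S k) : tcarrier" unfolding td by (rule trXY_carrier) (use XY in simp_all)
	ultimately show ?thesis
		using mu_tiso[OF _ vt_carrier[OF U(1)]] mu_tdual[OF k] by metis
qed

lemma trivial_trip: "(1, snd (tmod A) ez, snd (tmod A) et, snd (tmod A) ew) = S (Chi 0 True False)"
proof -
	note c = rhom_simps[OF SA.counit_rhom]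
	have g: "free_counit (gen i j) = (if i = j then 1 else 0 :: 'k)" for i j by (simp add: free_counit_def)
	have X: "free_counit gX = (1 :: 'k)" "free_counit gY = (1 :: 'k)" "free_counit (gP N) = (1 :: 'k)"
		using N_pos by (simp_all add: gX_def gY_def gP_def c g)
	have "snd (tmod A) (SA.cls p) = free_counit p \<cdot> idm 1" for p
		using SA.vr_trivial[of p] by (simp only: SA.vr_def)
	thus ?thesis by (auto simp: c X gW_def diagm_def intro!: eq_matI)
qed

lemma suzuki_hopf_dihedral: "hopf_dihedral N n om ze A ez et ew"
proof
	have vt: "(fst V, snd V ez, snd V et, snd V ew) = vt V" for V by (simp add: vt_def SA.vr_def)
	show "ez : carrier A" "et : carrier A" "ew : carrier A" by (rule SA.cls_closed)+
	show "antipode A a : carrier A" if "a : carrier A" for a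
		using SA.carrier_A[OF that] SA.antipode_A by auto
	show "(fst V, snd V ez, snd V et, snd V ew) : trips" if "V : fdm" for V
		unfolding vt by (rule vt_trips[OF that])
	show "mod_inter A V W P" if "V : fdm" "W : fdm" "P : carrier_mat (fst W) (fst V)"
		"!!g. g : {ez, et, ew} ==> P * snd V g = snd W g * P" for V W P
	proof (rule SA.module_intertwine[OF that(1-3)])
		fix i j
		have "intertw (vt V) (vt W) P" using that(3,4) by (simp add: intertw_def vt_def SA.vr_def)
		thus "P * SA.vr V (gen i j) = SA.vr W (gen i j) * P"
			unfolding vr_gen[OF that(1)] vr_gen[OF that(2)] by (rule xm_intertwine[OF _ vt_carrier[OF that(1)] vt_carrier[OF that(2)]])
	qed
	show "\<exists>V\<in>fdm. (fst V, snd V ez, snd V et, snd V ew) = S k" if "k : K" for k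
		unfolding vt using irr_module[of k] by blast
	show "tmod A : fdm" by (rule SA.trivial_fd)
	show "(1, snd (tmod A) ez, snd (tmod A) et, snd (tmod A) ew) = S (Chi 0 True False)"
		by (rule trivial_trip)
	show "kys (SOME s. s : comult A a) \<subseteq> carrier A \<times> carrier A" if a: "a : carrier A" for a
	proof -
		obtain p where "a = SA.cls p" using SA.carrier_A[OF a] by blast
		thus ?thesis using SA.comult_some[of p] by (simp add: tensor_class_def)
	qed
	show "mten A V W : fdm" if "V : fdm" "W : fdm" for V W using that by (rule SA.tensor_fd)
	show "dmod A V : fdm" if "V : fdm" for V using that by (rule SA.dual_fd)
	show "mu (fst U, snd U ez, snd U et, snd U ew) = fus k l"
		if "k : K" "l : K" "V : fdm" "W : fdm" "(fst V, snd V ez, snd V et, snd V ew) = S k"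
			"(fst W, snd W ez, snd W et, snd W ew) = S l" "U = mten A V W" for k l V W U
		unfolding vt that(7) by (rule tensor_irr[OF that(1,2,3) that(5)[unfolded vt] that(4) that(6)[unfolded vt]])
	show "mu (fst U, snd U ez, snd U et, snd U ew) = {#dual_irr k#}"
		if "k : K" "V : fdm" "(fst V, snd V ez, snd V et, snd V ew) = S k" "U = dmod A V" for k V U
		unfolding vt that(4) by (rule dual_irr[OF that(1,2) that(3)[unfolded vt]])
qed

end

section \<open>Assembly of the isomorphisms\<close>

lemma root_of_unity_divisor:
	assumes "primitive_root_of_unity (m * l) (z :: 'k::field)" "m > 0" "l > 0" "of_nat m ~= (0 :: 'k)"
	shows "root_of_unity (z ^ l) m"
proof
	show "primitive_root_of_unity m (z ^ l)"
		unfolding primitive_root_of_unity_def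
	proof (intro conjI allI impI)
		show "(z ^ l) ^ m = 1" using assms(1) by (simp add: primitive_root_of_unity_def power_mult[symmetric] mult.commute)
		fix k assume "0 < k & k < m"
		hence "0 < l * k" "l * k < m * l" using assms(3) by simp_all
		thus "(z ^ l) ^ k ~= 1" using assms(1) by (simp add: primitive_root_of_unity_def power_mult[symmetric])
	qed
qed (use assms in auto)

lemma (in dihedral) Rep_isos:
	fixes R :: "'r ring"
	assumes A: "hopf_dihedral N n om ze (A :: ('k, 'a) hopf_algebra) z t w"
		and B: "hopf_dihedral N n om ze (B :: ('k, 'b) hopf_algebra) z' t' w'"
		and R: "fusion_ring N n om ze R val"
	shows "Rep A \<simeq>\<^sub>* with_star R (fusion_ring.rstar N n R val)" "Rep B \<simeq>\<^sub>* with_star R (fusion_ring.rstar N n R val)"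
		"Rep A \<simeq>\<^sub>* Rep B"
proof -
	interpret A: fusion_rep N n om ze A z t w R val
		using A R by (simp add: fusion_rep_def)
	interpret B: fusion_rep N n om ze B z' t' w' R val
		using B R by (simp add: fusion_rep_def)
	show "Rep A \<simeq>\<^sub>* with_star R (fusion_ring.rstar N n R val)" by (rule A.Rep_iso)
	show "Rep B \<simeq>\<^sub>* with_star R (fusion_ring.rstar N n R val)" by (rule B.Rep_iso)
	show "Rep A \<simeq>\<^sub>* Rep B"
	proof (rule star_ring_iso_common_target[OF A.rep_map_iso B.rep_map_iso])
		show "A.gcl {#} {#} : carrier (Rep A)" unfolding A.carrier_Rep by (auto intro!: exI[of _ "{#}"])
	qed (intro conjI A.Rep_closed B.Rep_closed; assumption)+
qed

theorem proposition6p5: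
  fixes N n :: nat
  assumes "odd N" and "n \<ge> 2"
    and "\<not> CHAR('k::field) dvd 2 * n * N"
    and "\<exists>z::'k. primitive_root_of_unity (4 * n * N) z"
  shows
    "(even n \<longrightarrow>
        Rep (A_Nn N n :: ('k, _) hopf_algebra)
          \<simeq>\<^sub>* Rep (group_hopf_algebra (G_Nn N n) :: ('k, _) hopf_algebra) \<and>
        (\<exists>s. is_star_even N n s \<and>
          Rep (A_Nn N n :: ('k, _) hopf_algebra) \<simeq>\<^sub>* with_star (R_even N n) s \<and>
          Rep (group_hopf_algebra (G_Nn N n) :: ('k, _) hopf_algebra) \<simeq>\<^sub>* with_star (R_even N n) s)) \<and>
     (odd n \<longrightarrow>
        Rep (A_Nn N n :: ('k, _) hopf_algebra)
          \<simeq>\<^sub>* Rep (group_hopf_algebra (G_Nn N n) :: ('k, _) hopf_algebra) \<and>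
        (\<exists>s. is_star_odd N n s \<and>
          Rep (A_Nn N n :: ('k, _) hopf_algebra) \<simeq>\<^sub>* with_star (R_odd N n) s \<and>
          Rep (group_hopf_algebra (G_Nn N n) :: ('k, _) hopf_algebra) \<simeq>\<^sub>* with_star (R_odd N n) s))"
proof -
	from assms(4) obtain z :: 'k where z: "primitive_root_of_unity (4 * n * N) z" by blast
	have N0: "N > 0" using assms(1) by (cases N) auto
	have "of_nat (2 * n * N) ~= (0 :: 'k)" using assms(3) by (simp only: of_nat_eq_0_iff_char_dvd not_False_eq_True)
	hence nz: "(2 :: 'k) ~= 0" "of_nat n ~= (0 :: 'k)" "of_nat N ~= (0 :: 'k)" by auto
	\<comment> \<open>The given root has order \<open>4 * n * N\<close>, so its powers with exponents
	  \<open>4 * n\<close> and \<open>2 * N\<close> have the orders \<open>N\<close> and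
	  \<open>2 * n\<close>.\<close>
	have 1: "root_of_unity (z ^ (4 * n)) N" "root_of_unity (z ^ (2 * N)) (2 * n)"
		using root_of_unity_divisor[of N "4 * n" z] root_of_unity_divisor[of "2 * n" "2 * N" z] z nz N0 assms(2)
		by (simp_all add: mult_ac)
	interpret dihedral N n "z ^ (4 * n)" "z ^ (2 * N)"
		by (rule dihedral.intro) (use assms 1 nz in auto)
	let ?A = "A_Nn N n :: ('k, 'k free_alg set) hopf_algebra"
	have A: "?A = suzuki N n 1 (alt_sign n)" by (simp add: A_Nn_def)
	interpret S: suzuki_dihedral N n "z ^ (4 * n)" "z ^ (2 * N)" "alt_sign n" ?A
		by unfold_locales (use assms A in auto)
	note G = group_hopf_dihedral[folded G_Nn_eq]
	note iso = Rep_isos[OF S.suzuki_hopf_dihedral G]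
	have "fusion_ring N n (z ^ (4 * n)) (z ^ (2 * N)) (R_even N n)
			(paper_ring.pval N n (vars_even n) (rels_even N n) (pvar VB) (pvar VC))" if "even n"
	proof -
		interpret paper_ring N n "z ^ (4 * n)" "z ^ (2 * N)" "vars_even n" "rels_even N n" "pvar VB" "pvar VC"
			by (rule paper_ring_even[OF that])
		show ?thesis unfolding R_even_def by (rule fusion_ring_axioms)
	qed
	moreover have "fusion_ring N n (z ^ (4 * n)) (z ^ (2 * N)) (R_odd N n)
			(paper_ring.pval N n (vars_odd n) (rels_odd N n) (pvar VB ^ N) (pvar VB ^ 2))" if "odd n"
	proof -
		interpret paper_ring N n "z ^ (4 * n)" "z ^ (2 * N)" "vars_odd n" "rels_odd N n" "pvar VB ^ N" "pvar VB ^ 2"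
			by (rule paper_ring_odd[OF that])
		show ?thesis unfolding R_odd_def by (rule fusion_ring_axioms)
	qed
	ultimately show ?thesis
		using iso is_star_even_rstar is_star_odd_rstar by blast
qed

end
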